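(* Consider the family of cubic Kolmogorov systems $$\dot x=\frac{a_3\,x(y-1)(b_2^2\,x+a_3^2\,y-2b_2^2)}{(a_3-b_2)(a_3+b_2)\,b_2},\qquad \dot y=\frac{b_2\,y(x-1)(b_2^2\,x+a_3^2\,y-2a_3^2)}{(a_3-b_2)(a_3+b_2)\,a_3},$$ with real parameters $a_3,b_2$ satisfying $a_3b_2\neq0$, $a_3^2\ne b_2^2$, all of which have a center at $(1,1)$. There exist parameter values $(a_3,b_2)$ and perturbations within the class of cubic Kolmogorov systems for which at least six limit cycles of small amplitude bifurcate from $(1,1)$.
   Context: A planar polynomial Kolmogorov system of degree at most $n$ is a real system $\dot x = x\,X(x,y)$, $\dot y = y\,Y(x,y)$ with $X,Y\in\mathbb R[x,y]$ of degree at most $n-1$; "cubic" means $n=3$. A limit cycle is a periodic orbit isolated in the set of all periodic orbits. At least $k$ limit cycles of small amplitude bifurcate from an equilibrium $p$ of a given system, within Kolmogorov systems of degree $n$, if for every neighbourhood $U$ of $p$ and every $\varepsilon>0$ there is a Kolmogorov system of degree at most $n$ whose coefficients are $\varepsilon$-close to those of the given system and which has at least $k$ limit cycles contained in $U$, all surrounding one single equilibrium point. *)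

theory Defs
  imports "HOL-Analysis.Analysis" "HOL-Computational_Algebra.Polynomial"
begin

subsection \<open>Bivariate polynomials\<close>

text \<open>
  A polynomial in \<open>\<real>[x,y]\<close> is an element of \<open>real poly poly\<close>: the outer indeterminate is \<open>x\<close>,
  the inner one is \<open>y\<close>, and \<open>coeff (coeff P i) j\<close> is the coefficient of \<open>x^i y^j\<close>.
\<close>

definition eval2 :: "real poly poly \<Rightarrow> real \<Rightarrow> real \<Rightarrow> real" where
  "eval2 P x y = poly (poly P [:x:]) y"

text \<open>
  Total degree at most \<open>n - 1\<close>. The strict form avoids truncated subtraction: for \<open>n = 0\<close> only the
  zero polynomial qualifies.
\<close>

definition total_degree_less :: "nat \<Rightarrow> real poly poly \<Rightarrow> bool" where
  "total_degree_less n P \<longleftrightarrow> (\<forall>i j. coeff (coeff P i) j \<noteq> 0 \<longrightarrow> i + j < n)"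

definition coeffs_close :: "real \<Rightarrow> real poly poly \<Rightarrow> real poly poly \<Rightarrow> bool" where
  "coeffs_close \<epsilon> P Q \<longleftrightarrow> (\<forall>i j. \<bar>coeff (coeff P i) j - coeff (coeff Q i) j\<bar> < \<epsilon>)"


subsection \<open>Planar autonomous systems\<close>

definition equilibrium :: "(real \<times> real \<Rightarrow> real \<times> real) \<Rightarrow> real \<times> real \<Rightarrow> bool" where
  "equilibrium F p \<longleftrightarrow> F p = 0"

text \<open>Periodic orbits are sets of points, so time shifts of a solution give the same orbit.\<close>

definition periodic_orbit ::
  "(real \<times> real \<Rightarrow> real \<times> real) \<Rightarrow> (real \<times> real) set \<Rightarrow> bool" where
  "periodic_orbit F \<gamma> \<longleftrightarrow>
     (\<exists>\<phi> T. T > 0 \<and>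
        (\<forall>t. (\<phi> has_vector_derivative F (\<phi> t)) (at t)) \<and>
        (\<forall>t. \<phi> (t + T) = \<phi> t) \<and>
        (\<exists>t. \<phi> t \<noteq> \<phi> 0) \<and>
        \<gamma> = range \<phi>)"

definition limit_cycle ::
  "(real \<times> real \<Rightarrow> real \<times> real) \<Rightarrow> (real \<times> real) set \<Rightarrow> bool" where
  "limit_cycle F \<gamma> \<longleftrightarrow>
     periodic_orbit F \<gamma> \<and>
     (\<exists>V. open V \<and> \<gamma> \<subseteq> V \<and> (\<forall>\<gamma>'. periodic_orbit F \<gamma>' \<and> \<gamma>' \<subseteq> V \<longrightarrow> \<gamma>' = \<gamma>))"

text \<open>
  A periodic orbit surrounds a point if the point lies in the bounded component of its complement
  (the library's \<^const>\<open>inside\<close>).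
\<close>

definition center :: "(real \<times> real \<Rightarrow> real \<times> real) \<Rightarrow> real \<times> real \<Rightarrow> bool" where
  "center F p \<longleftrightarrow>
     equilibrium F p \<and>
     (\<exists>U. open U \<and> p \<in> U \<and>
        (\<forall>q \<in> U - {p}. \<exists>\<gamma>. periodic_orbit F \<gamma> \<and> q \<in> \<gamma> \<and> p \<in> inside \<gamma>))"


subsection \<open>Kolmogorov systems\<close>

text \<open>The pair \<open>(X, Y)\<close> stands for the system \<open>x' = x X(x,y)\<close>, \<open>y' = y Y(x,y)\<close>.\<close>

type_synonym kolmogorov = "real poly poly \<times> real poly poly"

definition kolmogorov_field :: "kolmogorov \<Rightarrow> real \<times> real \<Rightarrow> real \<times> real" where
  "kolmogorov_field S = (\<lambda>(x, y). (x * eval2 (fst S) x y, y * eval2 (snd S) x y))"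

definition kolmogorov_degree_le :: "nat \<Rightarrow> kolmogorov \<Rightarrow> bool" where
  "kolmogorov_degree_le n S \<longleftrightarrow> total_degree_less n (fst S) \<and> total_degree_less n (snd S)"

definition kolmogorov_close :: "real \<Rightarrow> kolmogorov \<Rightarrow> kolmogorov \<Rightarrow> bool" where
  "kolmogorov_close \<epsilon> S S' \<longleftrightarrow> coeffs_close \<epsilon> (fst S) (fst S') \<and> coeffs_close \<epsilon> (snd S) (snd S')"

text \<open>
  At least \<open>k\<close> limit cycles of small amplitude bifurcate from the equilibrium \<open>p\<close> of \<open>S\<close> within
  Kolmogorov systems of degree \<open>n\<close>. The surrounded equilibrium \<open>q\<close> belongs to the perturbed
  system and need not be \<open>p\<close>.
\<close>

definition small_limit_cycles_bifurcate ::
  "nat \<Rightarrow> nat \<Rightarrow> kolmogorov \<Rightarrow> real \<times> real \<Rightarrow> bool" where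
  "small_limit_cycles_bifurcate n k S p \<longleftrightarrow>
     kolmogorov_degree_le n S \<and>
     equilibrium (kolmogorov_field S) p \<and>
     (\<forall>U \<epsilon>. open U \<and> p \<in> U \<and> \<epsilon> > 0 \<longrightarrow>
        (\<exists>S'. kolmogorov_degree_le n S' \<and> kolmogorov_close \<epsilon> S' S \<and>
          (\<exists>q C. equilibrium (kolmogorov_field S') q \<and> finite C \<and> card C = k \<and>
             (\<forall>\<gamma> \<in> C. limit_cycle (kolmogorov_field S') \<gamma> \<and> \<gamma> \<subseteq> U \<and> q \<in> inside \<gamma>))))"


subsection \<open>The family of cubic systems\<close>

definition const2 :: "real \<Rightarrow> real poly poly" where
  "const2 c = [:[:c:]:]"

definition varx :: "real poly poly" where
  "varx = [:0, 1:]"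

definition vary :: "real poly poly" where
  "vary = [:[:0, 1:]:]"

definition cubic_family :: "real \<Rightarrow> real \<Rightarrow> kolmogorov" where
  "cubic_family a3 b2 =
    (const2 (a3 / ((a3 - b2) * (a3 + b2) * b2)) * (vary - 1) *
       (const2 (b2\<^sup>2) * varx + const2 (a3\<^sup>2) * vary - const2 (2 * b2\<^sup>2)),
     const2 (b2 / ((a3 - b2) * (a3 + b2) * a3)) * (varx - 1) *
       (const2 (b2\<^sup>2) * varx + const2 (a3\<^sup>2) * vary - const2 (2 * a3\<^sup>2)))"

lemma kolmogorov_field_cubic_family:
  "kolmogorov_field (cubic_family a3 b2) (x, y) =
    (a3 * x * (y - 1) * (b2\<^sup>2 * x + a3\<^sup>2 * y - 2 * b2\<^sup>2) / ((a3 - b2) * (a3 + b2) * b2),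
     b2 * y * (x - 1) * (b2\<^sup>2 * x + a3\<^sup>2 * y - 2 * a3\<^sup>2) / ((a3 - b2) * (a3 + b2) * a3))"
proof -
  have hom: "eval2 (P * Q) x y = eval2 P x y * eval2 Q x y"
    "eval2 (P + Q) x y = eval2 P x y + eval2 Q x y"
    "eval2 (P - Q) x y = eval2 P x y - eval2 Q x y"
    "eval2 1 x y = 1" "eval2 (const2 c) x y = c" "eval2 varx x y = x" "eval2 vary x y = y"
    for P Q c
    by (simp_all add: eval2_def const2_def varx_def vary_def)
  show ?thesis
    by (simp add: kolmogorov_field_def cubic_family_def hom mult_ac)
qed

lemma kolmogorov_degree_le_cubic_family: "kolmogorov_degree_le 3 (cubic_family a3 b2)"
  by (auto simp: kolmogorov_degree_le_def total_degree_less_def cubic_family_def const2_def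
      varx_def vary_def one_pCons coeff_pCons split: nat.splits)

end

theory Submission
  imports Defs "HOL-Complex_Analysis.Complex_Analysis"
begin

text \<open>
  Up to a constant factor and a shift of the equilibrium to the origin, the family depends only on
  \<open>d = (a\<^sup>2 + b\<^sup>2) / (a\<^sup>2 - b\<^sup>2)\<close>, and the system has the first integral \<open>H\<close> obtained from the invariant
  lines and an invariant hyperbola \<open>f = 0\<close>. As \<open>H\<close> is monotone along a ray, the return map is
  the identity, which gives the center.

  For a perturbation of size \<open>e\<close>, polynomial certificates \<open>G\<close> are found such that \<open>H - 2 e G / f\<close>
  changes along orbits by \<open>e\<close> times a polynomial remainder \<open>R\<close>, up to order \<open>e\<^sup>2\<close>. Where \<open>R\<close> has a
  definite sign on an annulus, the return map moves points in a known direction. Five perturbations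
  have definite remainders of orders 2, 4, 6, 8, 10. The remainder of a sixth one has order 12 with a
  coefficient vanishing at \<open>d = \<delta>0\<close>, where the coefficient of order 14 is negative; so for \<open>d\<close> slightly
  below \<open>\<delta>0\<close> it changes sign once. Adding the other perturbations with successively smaller weights yields
  seven nested annuli with alternating signs, hence six fixed points of the return map between them.
  The return map extends holomorphically, so its fixed points, and with them the cycles, are isolated.
\<close>

section \<open>Averages and parametric integrals\<close>

text \<open>To first order the displacement of the return map is classically an integral over an
  oval of H. Subtracting 2 e G / f trades it for a pointwise sign: by the mean value theorem over
  one turn, only the sign of R on an annulus matters. So a certificate need only be right up to a
  finite degree in (x, y), with coefficients polynomial in \<open>d\<close>. The annulus of a test
  radius z reaches from z / \<open>spread\<close> to z * \<open>spread\<close>, the a priori range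
  of a solution during one turn.

  At a fixed generic d the orders 2 to 12 would yield six annuli and five cycles. The sixth cycle is
  paid for by d: the given system sits at \<open>\<delta>0\<close>, and passing to a smaller d
  nearby is itself a perturbation. The choices are nested: outermost radius, then d, then the other
  radii and the weights, last of all e, so that the error of order e^2 is absorbed on finitely many
  compact annuli.

  A limit cycle must be isolated among all periodic orbits in a neighbourhood, which are not given
  as fixed points of the return map; hence arbitrary orbits are lifted to polar coordinates.\<close>

lemma left_sum_approximates_integral:
  fixes g :: "real \<Rightarrow> 'a::banach"
  assumes cont: "continuous_on {0..real n * h} g" and h: "0 \<le> h"
    and close: "\<And>s t. \<lbrakk>s \<in> {0..real n * h}; t \<in> {0..real n * h}; \<bar>s - t\<bar> \<le> h\<rbrakk> \<Longrightarrow> norm (g s - g t) \<le> e"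
  shows "norm (integral {0..real n * h} g - (\<Sum>i<n. h *\<^sub>R g (real i * h))) \<le> real n * h * e"
proof -
  have "norm (integral {0..real k * h} g - (\<Sum>i<k. h *\<^sub>R g (real i * h))) \<le> real k * h * e"
    if "k \<le> n" for k
    using that
  proof (induction k)
    case 0
    then show ?case by simp
  next
    case (Suc k)
    define a b where "a = real k * h" and "b = real (Suc k) * h"
    have ab: "0 \<le> a" "a \<le> b" "b - a = h" using h by (auto simp: a_def b_def algebra_simps)
    have bn: "b \<le> real n * h" unfolding b_def using Suc.prems h by (intro mult_right_mono) auto
    have int: "g integrable_on {0..b}"
      using ab bn by (intro integrable_continuous_real continuous_on_subset[OF cont]) auto
    have int2: "g integrable_on {a..b}"
      using ab bn by (intro integrable_continuous_real continuous_on_subset[OF cont]) auto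
    have split: "integral {0..b} g = integral {0..a} g + integral {a..b} g"
      using Henstock_Kurzweil_Integration.integral_combine[OF ab(1) ab(2) int] by simp
    have "integral {a..b} (\<lambda>s. g s - g a) = integral {a..b} g - h *\<^sub>R g a"
      using ab int2 by (subst Henstock_Kurzweil_Integration.integral_diff) auto
    moreover have "norm (integral {a..b} (\<lambda>s. g s - g a)) \<le> e * (b - a)"
    proof (rule integral_bound)
      show "continuous_on {a..b} (\<lambda>s. g s - g a)"
        using ab bn by (intro continuous_intros continuous_on_subset[OF cont]) auto
    qed (use ab bn in \<open>auto intro!: close\<close>)
    ultimately have "norm (integral {a..b} g - h *\<^sub>R g a) \<le> h * e" using ab by (simp add: mult.commute)
    moreover have "norm (integral {0..a} g - (\<Sum>i<k. h *\<^sub>R g (real i * h))) \<le> real k * h * e"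
      using Suc by (simp add: a_def)
    moreover have "integral {0..b} g - (\<Sum>i<Suc k. h *\<^sub>R g (real i * h))
        = (integral {0..a} g - (\<Sum>i<k. h *\<^sub>R g (real i * h))) + (integral {a..b} g - h *\<^sub>R g a)"
      by (simp add: split a_def)
    moreover have "real (Suc k) * h * e = real k * h * e + h * e" by (simp add: algebra_simps)
    ultimately show ?case
      unfolding b_def[symmetric] using norm_triangle_mono by metis
  qed
  then show ?thesis by blast
qed

text \<open>Left Riemann sums are finite sums of functions holomorphic in z. Joint continuity is
  uniform on a compact product of a closed disc and the interval, so the sums converge uniformly on
  closed discs, and Weierstrass' theorem passes holomorphy to the integral.\<close>

lemma holomorphic_on_parametric_integral:
  fixes g :: "complex \<Rightarrow> real \<Rightarrow> complex"
  assumes S: "open S" and T: "0 \<le> T"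
    and cont: "continuous_on (S \<times> {0..T}) (\<lambda>(z, s). g z s)"
    and holo: "\<And>s. s \<in> {0..T} \<Longrightarrow> (\<lambda>z. g z s) holomorphic_on S"
  shows "(\<lambda>z. integral {0..T} (g z)) holomorphic_on S"
proof -
  define f where "f n z = (\<Sum>i<Suc n. (T / real (Suc n)) *\<^sub>R g z (real i * (T / real (Suc n))))" for n z
  have "f n holomorphic_on S" for n
  proof -
    have "real i * (T / real (Suc n)) \<in> {0..T}" if "i < Suc n" for i
    proof -
      have "real i * (T / real (Suc n)) \<le> real (Suc n) * (T / real (Suc n))"
        using that T by (intro mult_right_mono) auto
      then show ?thesis using T by auto
    qed
    then show ?thesis
      unfolding f_def scaleR_conv_of_real
      by (intro holomorphic_on_sum holomorphic_on_mult holomorphic_on_const holo) (metis lessThan_iff)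
  qed
  moreover have "\<exists>d. 0 < d \<and> cball z d \<subseteq> S \<and>
      uniform_limit (cball z d) f (\<lambda>z. integral {0..T} (g z)) sequentially" if "z \<in> S" for z
  proof -
    obtain d where d: "0 < d" "cball z d \<subseteq> S" using S \<open>z \<in> S\<close> by (meson open_contains_cball)
    have "compact (cball z d \<times> {0..T})" by (intro compact_Times) auto
    moreover have contd: "continuous_on (cball z d \<times> {0..T}) (\<lambda>(z, s). g z s)"
      using d by (intro continuous_on_subset[OF cont]) auto
    ultimately have uc: "uniformly_continuous_on (cball z d \<times> {0..T}) (\<lambda>(z, s). g z s)"
      using compact_uniformly_continuous by blast
    have "uniform_limit (cball z d) f (\<lambda>z. integral {0..T} (g z)) sequentially"
      unfolding uniform_limit_iff
    proof (intro allI impI)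
      fix e :: real assume "e > 0"
      \<comment> \<open>The denominator T + 1 in place of T gives T * e' < e also when T =
        0.\<close>
      define e' where "e' = e / (T + 1)"
      have e': "e' > 0" "T * e' < e" using T \<open>e > 0\<close> by (auto simp: e'_def divide_simps algebra_simps)
      obtain \<eta> where \<eta>: "\<eta> > 0"
        and \<eta>': "\<And>p q. \<lbrakk>p \<in> cball z d \<times> {0..T}; q \<in> cball z d \<times> {0..T}; dist q p < \<eta>\<rbrakk>
            \<Longrightarrow> dist (case q of (z, s) \<Rightarrow> g z s) (case p of (z, s) \<Rightarrow> g z s) < e'"
        using uc e' unfolding uniformly_continuous_on_def by metis
      have "(\<lambda>n. T / real (Suc n)) \<longlonglongrightarrow> 0"
        using LIMSEQ_Suc[OF lim_const_over_n[of T]] by simp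
      then have "\<forall>\<^sub>F n in sequentially. T / real (Suc n) < \<eta>"
        using \<eta> by (rule order_tendstoD)
      then show "\<forall>\<^sub>F n in sequentially. \<forall>w\<in>cball z d. dist (f n w) (integral {0..T} (g w)) < e"
      proof eventually_elim
        case (elim n)
        show ?case
        proof
          fix w assume w: "w \<in> cball z d"
          define h where "h = T / real (Suc n)"
          have hT: "real (Suc n) * h = T" "0 \<le> h" using T by (auto simp: h_def)
          have "norm (integral {0..real (Suc n) * h} (g w) - (\<Sum>i<Suc n. h *\<^sub>R g w (real i * h))) \<le> real (Suc n) * h * e'"
          proof (rule left_sum_approximates_integral)
            have "continuous_on {0..T} (\<lambda>s. (\<lambda>(z, s). g z s) (w, s))"
              by (rule continuous_on_compose2[OF contd]) (use w in \<open>auto intro!: continuous_intros\<close>)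
            then show "continuous_on {0..real (Suc n) * h} (g w)" using hT by simp
          next
            fix s t assume "s \<in> {0..real (Suc n) * h}" "t \<in> {0..real (Suc n) * h}" "\<bar>s - t\<bar> \<le> h"
            then have "dist (w, s) (w, t) < \<eta>" "s \<in> {0..T}" "t \<in> {0..T}"
              using elim hT by (auto simp: dist_Pair_Pair dist_real_def h_def)
            then show "norm (g w s - g w t) \<le> e'"
              using \<eta>'[of "(w, t)" "(w, s)"] w by (auto simp: dist_norm)
          qed (use hT in auto)
          then have "dist (f n w) (integral {0..T} (g w)) \<le> T * e'"
            using hT by (simp add: f_def h_def dist_norm norm_minus_commute)
          then show "dist (f n w) (integral {0..T} (g w)) < e" using e' by simp
        qed
      qed
    qed
    then show ?thesis using d by blast
  qed
  ultimately show ?thesis by (rule holomorphic_uniform_sequence[OF S])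
qed

section \<open>Radial differential equations\<close>

text \<open>Telescoping against the geometric series. The explicit rate, rather than bare
  convergence, is what later makes the Picard limits uniform in the initial value.\<close>

lemma geometric_increments_converge:
  fixes a :: "nat \<Rightarrow> 'a::banach"
  assumes inc: "\<And>n. norm (a (Suc n) - a n) \<le> c * (1/2) ^ n"
  obtains l where "\<And>n. norm (a n - l) \<le> 2 * c * (1/2) ^ n"
proof -
  have sm: "summable (\<lambda>n. c * (1/2::real) ^ n)"
    by (intro summable_mult summable_geometric) auto
  have sa: "summable (\<lambda>n. norm (a (Suc n) - a n))"
    by (rule summable_comparison_test'[OF sm]) (use inc in auto)
  define l where "l = a 0 + (\<Sum>n. a (Suc n) - a n)"
  have "norm (a n - l) \<le> 2 * c * (1/2) ^ n" for n
  proof -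
    have 1: "(\<Sum>k<n. a (Suc k) - a k) = a n - a 0"
      by (rule sum_lessThan_telescope)
    have 2: "summable (\<lambda>k. a (Suc k) - a k)" using sa by (rule summable_norm_cancel)
    have "l - a n = (\<Sum>k. a (Suc (k + n)) - a (k + n))"
      using suminf_split_initial_segment[OF 2, of n] 1 by (simp add: l_def algebra_simps)
    also have "norm \<dots> \<le> (\<Sum>k. norm (a (Suc (k + n)) - a (k + n)))"
      using summable_ignore_initial_segment[OF sa, of n] by (intro summable_norm) simp
    also have "\<dots> \<le> (\<Sum>k. c * (1/2) ^ n * (1/2) ^ k)"
    proof (rule suminf_le)
      show "norm (a (Suc (k + n)) - a (k + n)) \<le> c * (1/2) ^ n * (1/2) ^ k" for k
        using inc[of "k + n"] by (simp add: power_add mult.commute mult.left_commute)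
      show "summable (\<lambda>k. norm (a (Suc (k + n)) - a (k + n)))"
        using summable_ignore_initial_segment[OF sa, of n] by simp
      show "summable (\<lambda>k. c * (1/2) ^ n * (1/2::real) ^ k)"
        by (intro summable_mult summable_geometric) auto
    qed
    also have "\<dots> = c * (1/2) ^ n * 2"
      by (subst suminf_mult) (auto simp: suminf_geometric summable_geometric)
    finally show ?thesis by (simp add: norm_minus_commute mult_ac)
  qed
  then show thesis by (rule that)
qed

lemma has_integral_exp_weight:
  fixes c l :: real
  assumes "0 \<le> t" "l \<noteq> 0"
  shows "((\<lambda>s. c * exp (l * s)) has_integral (c / l * (exp (l * t) - 1))) {0..t}"
proof -
  have "((\<lambda>s. c * exp (l * s)) has_integral (c / l * exp (l * t) - c / l * exp (l * 0))) {0..t}"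
    using assms
    by (intro fundamental_theorem_of_calculus)
      (auto intro!: derivative_eq_intros simp flip: has_real_derivative_iff_has_vector_derivative)
  then show ?thesis by (simp add: algebra_simps)
qed

text \<open>The equation of the radius as a function of the angle, with real angle and complex
  radius. Holomorphy in the radius serves the isolation of fixed points, \<open>real_valued\<close>
  leads back to the plane, and \<open>zero\<close> says that the equilibrium is the zero
  solution.\<close>

locale radial_ode =
  fixes R :: "real \<Rightarrow> complex \<Rightarrow> complex" and r L :: real
  assumes r: "0 < r" and L: "0 < L"
    and cont: "continuous_on (UNIV \<times> cball 0 r) (\<lambda>(t, z). R t z)"
    and holo: "\<And>t. R t holomorphic_on ball 0 r"
    and lip: "\<And>t z w. \<lbrakk>norm z \<le> r; norm w \<le> r\<rbrakk> \<Longrightarrow> norm (R t z - R t w) \<le> L * norm (z - w)"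
    and zero: "\<And>t. R t 0 = 0"
    and real_valued: "\<And>t x. \<bar>x\<bar> \<le> r \<Longrightarrow> R t (complex_of_real x) \<in> \<real>"
    and periodic: "\<And>t z. R (t + 2 * pi) z = R t z"
begin

text \<open>A solution grows at most by the factor exp (2 pi L) during one turn, so that initial
  values below \<open>r1\<close> never leave the disc of radius \<open>r\<close>.\<close>

definition r1 :: real where "r1 = r * exp (- (L * (2 * pi)))"

lemma r1: "0 < r1" "r1 * exp (L * (2 * pi)) = r" "r1 \<le> r"
proof -
  show "0 < r1" using r by (simp add: r1_def)
  show "r1 * exp (L * (2 * pi)) = r" by (simp add: r1_def exp_minus)
  then show "r1 \<le> r" using r L by (simp add: r1_def)
qed

lemma growth_bound:
  assumes "x < r1" "0 \<le> x" "t \<le> 2 * pi"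
  shows "x * exp (L * t) < r"
proof -
  have "x * exp (L * t) \<le> x * exp (L * (2 * pi))"
    using assms L by (intro mult_left_mono) auto
  also have "\<dots> < r1 * exp (L * (2 * pi))" using assms by simp
  finally show ?thesis using r1 by simp
qed

lemma norm_R: "norm z \<le> r \<Longrightarrow> norm (R t z) \<le> L * norm z"
  using lip[of z 0 t] r zero by simp

lemma continuous_on_R_compose:
  assumes "continuous_on S g" "continuous_on S h" "\<And>s. s \<in> S \<Longrightarrow> norm (h s) \<le> r"
  shows "continuous_on S (\<lambda>s. R (g s) (h s))"
proof -
  have "continuous_on S (\<lambda>s. (\<lambda>(t, z). R t z) (g s, h s))"
    by (rule continuous_on_compose2[OF cont]) (use assms in \<open>auto intro!: continuous_intros\<close>)
  then show ?thesis by simp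
qed

section \<open>Picard iteration with estimates uniform in the initial value\<close>

primrec picard :: "nat \<Rightarrow> complex \<Rightarrow> real \<Rightarrow> complex" where
  "picard 0 z t = z"
| "picard (Suc n) z t = z + integral {0..t} (\<lambda>s. R s (picard n z s))"

text \<open>Invariant of the Picard iterates, preserved by the iteration and closed under pointwise
  limits. The first clause keeps the values in the disc where \<open>R\<close> is controlled; the
  other two together give the joint continuity in (z, t) that holomorphy of the integrals
  requires.\<close>

definition picard_regular :: "(complex \<Rightarrow> real \<Rightarrow> complex) \<Rightarrow> bool" where
  "picard_regular u \<longleftrightarrow>
    (\<forall>z t. norm z < r1 \<longrightarrow> t \<in> {0..2*pi} \<longrightarrow> norm (u z t) \<le> norm z * exp (L * t)) \<and>
    (\<forall>z w t. norm z < r1 \<longrightarrow> norm w < r1 \<longrightarrow> t \<in> {0..2*pi} \<longrightarrow>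
        norm (u z t - u w t) \<le> norm (z - w) * exp (L * t)) \<and>
    (\<forall>z s t. norm z < r1 \<longrightarrow> s \<in> {0..2*pi} \<longrightarrow> t \<in> {0..2*pi} \<longrightarrow>
        norm (u z t - u z s) \<le> L * r * \<bar>t - s\<bar>)"

lemma picard_regular_lt:
  assumes "picard_regular u" "norm z < r1" "t \<in> {0..2*pi}"
  shows "norm (u z t) < r"
proof -
  have "norm (u z t) \<le> norm z * exp (L * t)"
    using assms unfolding picard_regular_def by blast
  also have "\<dots> < r" using growth_bound[of "norm z" t] assms by auto
  finally show ?thesis .
qed

lemma picard_regular_continuous:
  assumes "picard_regular u"
  shows "continuous_on (ball 0 r1 \<times> {0..2*pi}) (\<lambda>(z, t). u z t)"
proof -
  define K where "K = exp (L * (2 * pi)) + L * r"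
  have K: "0 < K" using L r unfolding K_def by (intro add_pos_pos) auto
  have "dist (u z t) (u w s) \<le> K * dist (z, t) (w, s)"
    if "norm z < r1" "norm w < r1" "t \<in> {0..2*pi}" "s \<in> {0..2*pi}" for z w t s
  proof -
    have "norm (u z t - u w t) \<le> norm (z - w) * exp (L * t)"
      using assms that unfolding picard_regular_def by blast
    also have "\<dots> \<le> norm (z - w) * exp (L * (2 * pi))"
      using that L by (intro mult_left_mono) auto
    finally have 1: "norm (u z t - u w t) \<le> norm (z - w) * exp (L * (2 * pi))" .
    have 2: "norm (u w t - u w s) \<le> L * r * \<bar>t - s\<bar>"
      using assms that unfolding picard_regular_def by blast
    have 3: "norm (z - w) \<le> dist (z, t) (w, s)" "\<bar>t - s\<bar> \<le> dist (z, t) (w, s)"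
      using dist_fst_le[of "(z, t)" "(w, s)"] dist_snd_le[of "(z, t)" "(w, s)"]
      by (auto simp: dist_norm)
    have "dist (u z t) (u w s) \<le> norm (u z t - u w t) + norm (u w t - u w s)"
      by (metis dist_norm dist_triangle)
    also have "\<dots> \<le> dist (z, t) (w, s) * exp (L * (2 * pi)) + L * r * dist (z, t) (w, s)"
      using 1 2 3 L r mult_right_mono[OF 3(1), of "exp (L * (2 * pi))"] mult_left_mono[OF 3(2), of "L * r"]
      by (smt (verit) exp_gt_zero mult_nonneg_nonneg)
    also have "\<dots> = K * dist (z, t) (w, s)" by (simp add: K_def algebra_simps)
    finally show ?thesis .
  qed
  then have "K-lipschitz_on (ball 0 r1 \<times> {0..2*pi}) (\<lambda>(z, t). u z t)"
    using K by (intro lipschitz_onI) auto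
  then show ?thesis by (rule lipschitz_on_continuous_on)
qed

lemma picard_regular_continuous_t:
  assumes "picard_regular u" "norm z < r1"
  shows "continuous_on {0..2*pi} (u z)"
proof -
  have "continuous_on {0..2*pi} (\<lambda>t. (\<lambda>(z, t). u z t) (z, t))"
    by (rule continuous_on_compose2[OF picard_regular_continuous[OF assms(1)]])
      (use assms in \<open>auto intro!: continuous_intros\<close>)
  then show ?thesis by simp
qed

lemma picard_regular_continuous_R:
  assumes "picard_regular u" "norm z < r1"
  shows "continuous_on {0..2*pi} (\<lambda>s. R s (u z s))"
  using assms picard_regular_lt
  by (intro continuous_on_R_compose picard_regular_continuous_t continuous_intros) (auto intro: less_imp_le)

lemma integral_norm_le_exp:
  assumes g: "continuous_on {0..2*pi} g" and t: "t \<in> {0..2*pi}" and "l > 0"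
    and le: "\<And>s. s \<in> {0..t} \<Longrightarrow> norm (g s) \<le> c * exp (l * s)"
  shows "norm (integral {0..t} g :: complex) \<le> c / l * (exp (l * t) - 1)"
proof -
  have "g integrable_on {0..t}"
    using t by (intro integrable_continuous_real continuous_on_subset[OF g]) auto
  then have "norm (integral {0..t} g) \<le> integral {0..t} (\<lambda>s. c * exp (l * s))"
    using has_integral_exp_weight[of t l c] assms
    by (intro integral_norm_bound_integral) (auto simp: has_integral_integrable)
  also have "\<dots> = c / l * (exp (l * t) - 1)"
    by (rule integral_unique[OF has_integral_exp_weight]) (use assms in auto)
  finally show ?thesis .
qed

text \<open>The factor exp (L t) reproduces itself: integrating L a exp (L s) from 0 to t gives a
  (exp (L t) - 1), and the free term a compensates the -1. Hence no constant deteriorates during the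
  iteration.\<close>

lemma picard_regular_step:
  assumes u: "picard_regular u"
  shows "picard_regular (\<lambda>z t. z + integral {0..t} (\<lambda>s. R s (u z s)))"
  unfolding picard_regular_def
proof (intro conjI allI impI)
  fix z :: complex and t assume z: "norm z < r1" and t: "t \<in> {0..2*pi}"
  have "norm (integral {0..t} (\<lambda>s. R s (u z s))) \<le> (L * norm z) / L * (exp (L * t) - 1)"
  proof (rule integral_norm_le_exp[OF picard_regular_continuous_R[OF u z] t L])
    fix s assume s: "s \<in> {0..t}"
    then have "norm (R s (u z s)) \<le> L * norm (u z s)"
      using picard_regular_lt[OF u z, of s] t by (intro norm_R) auto
    also have "\<dots> \<le> L * (norm z * exp (L * s))"
      using u z s t L unfolding picard_regular_def by (intro mult_left_mono) auto
    finally show "norm (R s (u z s)) \<le> L * norm z * exp (L * s)" by simp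
  qed
  then show "norm (z + integral {0..t} (\<lambda>s. R s (u z s))) \<le> norm z * exp (L * t)"
    using L norm_triangle_ineq[of z "integral {0..t} (\<lambda>s. R s (u z s))"] by (simp add: algebra_simps)
next
  fix z w :: complex and t assume z: "norm z < r1" and w: "norm w < r1" and t: "t \<in> {0..2*pi}"
  have c: "continuous_on {0..2*pi} (\<lambda>s. R s (u z s))" "continuous_on {0..2*pi} (\<lambda>s. R s (u w s))"
    using picard_regular_continuous_R[OF u] z w by auto
  have "norm (integral {0..t} (\<lambda>s. R s (u z s) - R s (u w s))) \<le> (L * norm (z - w)) / L * (exp (L * t) - 1)"
  proof (rule integral_norm_le_exp[OF continuous_on_diff[OF c] t L])
    fix s assume s: "s \<in> {0..t}"
    then have "norm (R s (u z s) - R s (u w s)) \<le> L * norm (u z s - u w s)"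
      using picard_regular_lt[OF u z, of s] picard_regular_lt[OF u w, of s] t by (intro lip) auto
    also have "\<dots> \<le> L * (norm (z - w) * exp (L * s))"
      using u z w s t L unfolding picard_regular_def by (intro mult_left_mono) auto
    finally show "norm (R s (u z s) - R s (u w s)) \<le> L * norm (z - w) * exp (L * s)" by simp
  qed
  moreover have "integral {0..t} (\<lambda>s. R s (u z s) - R s (u w s))
      = integral {0..t} (\<lambda>s. R s (u z s)) - integral {0..t} (\<lambda>s. R s (u w s))"
    using t by (intro Henstock_Kurzweil_Integration.integral_diff integrable_continuous_real continuous_on_subset[OF c(1)] continuous_on_subset[OF c(2)]) auto
  ultimately show "norm (z + integral {0..t} (\<lambda>s. R s (u z s)) - (w + integral {0..t} (\<lambda>s. R s (u w s))))
      \<le> norm (z - w) * exp (L * t)"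
    using L norm_triangle_ineq[of "z - w" "integral {0..t} (\<lambda>s. R s (u z s)) - integral {0..t} (\<lambda>s. R s (u w s))"]
    by (simp add: algebra_simps)
next
  fix z :: complex and s t assume z: "norm z < r1" and s: "s \<in> {0..2*pi}" and t: "t \<in> {0..2*pi}"
  let ?g = "\<lambda>s. R s (u z s)"
  have *: "norm (integral {0..b} ?g - integral {0..a} ?g) \<le> L * r * (b - a)"
    if "a \<le> b" "a \<in> {0..2*pi}" "b \<in> {0..2*pi}" for a b
  proof -
    have c: "continuous_on {0..2*pi} ?g" using picard_regular_continuous_R[OF u z] .
    have "integral {0..a} ?g + integral {a..b} ?g = integral {0..b} ?g"
      using that by (intro Henstock_Kurzweil_Integration.integral_combine integrable_continuous_real continuous_on_subset[OF c]) auto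
    moreover have "norm (integral {a..b} ?g) \<le> L * r * (b - a)"
    proof (rule integral_bound)
      show "continuous_on {a..b} ?g" using that by (intro continuous_on_subset[OF c]) auto
      fix s assume "s \<in> {a..b}"
      then have "norm (u z s) < r" using picard_regular_lt[OF u z, of s] that by auto
      then show "norm (?g s) \<le> L * r" using norm_R[of "u z s" s] L by (smt (verit) mult_left_mono)
    qed (use that in auto)
    ultimately show ?thesis by (metis add_diff_cancel_left')
  qed
  show "norm (z + integral {0..t} ?g - (z + integral {0..s} ?g)) \<le> L * r * \<bar>t - s\<bar>"
    using *[of s t] *[of t s] s t by (cases "s \<le> t") (auto simp: norm_minus_commute)
qed

lemma picard_regular_picard: "picard_regular (picard n)"
proof (induction n)
  case 0
  have "1 \<le> exp (L * t)" if "t \<in> {0..2*pi}" for t using that L by simp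
  then have "a \<le> a * exp (L * t)" if "t \<in> {0..2*pi}" "0 \<le> a" for t a :: real
    using that mult_left_mono[of 1 "exp (L * t)" a] by auto
  then show ?case using L r unfolding picard_regular_def by (auto simp: mult_ac)
next
  case (Suc n)
  then show ?case using picard_regular_step by simp
qed

lemma holomorphic_picard: "t \<in> {0..2*pi} \<Longrightarrow> (\<lambda>z. picard n z t) holomorphic_on ball 0 r1"
proof (induction n arbitrary: t)
  case 0
  then show ?case by simp
next
  case (Suc n)
  have "continuous_on (ball 0 r1 \<times> {0..t}) (\<lambda>p. R (snd p) (case p of (z, s) \<Rightarrow> picard n z s))"
    using Suc.prems picard_regular_lt[OF picard_regular_picard[of n]]
    by (intro continuous_on_R_compose continuous_intros
        continuous_on_subset[OF picard_regular_continuous[OF picard_regular_picard[of n]]])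
      (auto intro: less_imp_le)
  then have "(\<lambda>z. integral {0..t} (\<lambda>s. R s (picard n z s))) holomorphic_on ball 0 r1"
  proof (intro holomorphic_on_parametric_integral)
    fix s assume "s \<in> {0..t}"
    then have s: "s \<in> {0..2*pi}" using Suc.prems by auto
    have "(R s \<circ> (\<lambda>z. picard n z s)) holomorphic_on ball 0 r1"
      using s picard_regular_lt[OF picard_regular_picard[of n], of _ s]
      by (intro holomorphic_on_compose_gen[OF Suc.IH[OF s] holo]) auto
    then show "(\<lambda>z. R s (picard n z s)) holomorphic_on ball 0 r1" by (simp add: o_def)
  qed (use Suc.prems in \<open>auto simp: case_prod_unfold\<close>)
  then show ?case by (auto intro!: holomorphic_intros)
qed

text \<open>In the norm weighted by exp (-2 L t) the iteration contracts by 1/2, because integrating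
  L exp (2 L s) costs the factor L / (2 L). This covers a full turn at once, however large L
  is.\<close>

lemma picard_increment:
  assumes z: "norm z < r1"
  shows "t \<in> {0..2*pi} \<Longrightarrow> norm (picard (Suc n) z t - picard n z t) \<le> r * (1/2) ^ n * exp (2 * L * t)"
proof (induction n arbitrary: t)
  case 0
  have u: "picard_regular (picard (Suc 0))" by (rule picard_regular_picard)
  have "norm (picard (Suc 0) z t - picard (Suc 0) z 0) \<le> L * r * \<bar>t - 0\<bar>"
    using u z 0 unfolding picard_regular_def by (metis atLeastAtMost_iff order_refl pi_ge_zero zero_le_mult_iff zero_le_numeral)
  also have "\<dots> \<le> r * exp (2 * L * t)"
  proof -
    have "L * t \<le> 2 * L * t" using L 0 by auto
    also have "\<dots> \<le> exp (2 * L * t)" using exp_ge_add_one_self[of "2 * L * t"] by linarith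
    finally show ?thesis using r 0 by (simp add: mult_ac mult_left_mono)
  qed
  finally show ?case by simp
next
  case (Suc n)
  have c: "continuous_on {0..2*pi} (\<lambda>s. R s (picard k z s))" for k
    using picard_regular_continuous_R[OF picard_regular_picard z] .
  have "norm (integral {0..t} (\<lambda>s. R s (picard (Suc n) z s) - R s (picard n z s)))
      \<le> (L * (r * (1/2) ^ n)) / (2 * L) * (exp (2 * L * t) - 1)"
  proof (rule integral_norm_le_exp[OF continuous_on_diff[OF c c] Suc.prems])
    fix s assume s: "s \<in> {0..t}"
    then have "norm (R s (picard (Suc n) z s) - R s (picard n z s)) \<le> L * norm (picard (Suc n) z s - picard n z s)"
      using picard_regular_lt[OF picard_regular_picard z, of s] Suc.prems
      by (intro lip less_imp_le) (auto simp del: picard.simps)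
    also have "\<dots> \<le> L * (r * (1/2) ^ n * exp (2 * L * s))"
      using s Suc L by (intro mult_left_mono) auto
    finally show "norm (R s (picard (Suc n) z s) - R s (picard n z s)) \<le> L * (r * (1/2) ^ n) * exp (2 * L * s)"
      by (simp add: mult_ac)
  qed (use L in auto)
  also have "\<dots> \<le> r * (1/2) ^ Suc n * exp (2 * L * t)"
    using L r by (simp add: field_simps)
  also have "integral {0..t} (\<lambda>s. R s (picard (Suc n) z s) - R s (picard n z s))
      = integral {0..t} (\<lambda>s. R s (picard (Suc n) z s)) - integral {0..t} (\<lambda>s. R s (picard n z s))"
    using Suc.prems by (intro Henstock_Kurzweil_Integration.integral_diff integrable_continuous_real continuous_on_subset[OF c]) auto
  finally show ?case by simp
qed

definition rate :: real where "rate = 2 * (r * exp (2 * L * (2 * pi)))"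

text \<open>The rate depends neither on z nor on t: the limits form a single function, to which
  \<open>SOME\<close> in the definition of \<open>sol\<close> applies, and the convergence is
  uniform.\<close>

lemma picard_converges:
  "\<exists>sol. \<forall>z t n. norm z < r1 \<longrightarrow> t \<in> {0..2*pi} \<longrightarrow> norm (picard n z t - sol z t) \<le> rate * (1/2) ^ n"
proof -
  have "\<exists>l. \<forall>n. norm (picard n z t - l) \<le> rate * (1/2) ^ n" if z: "norm z < r1" and t: "t \<in> {0..2*pi}" for z t
  proof -
    have "norm (picard (Suc n) z t - picard n z t) \<le> (r * exp (2 * L * (2 * pi))) * (1/2) ^ n" for n
    proof -
      have "exp (2 * L * t) \<le> exp (2 * L * (2 * pi))" using t L by auto
      then have "r * (1/2) ^ n * exp (2 * L * t) \<le> r * (1/2) ^ n * exp (2 * L * (2 * pi))"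
        using r by (intro mult_left_mono) auto
      then show ?thesis using picard_increment[OF z t, of n] by (simp only: mult_ac)
    qed
    then show ?thesis
      using geometric_increments_converge[of "\<lambda>n. picard n z t" "r * exp (2 * L * (2 * pi))"]
      unfolding rate_def by metis
  qed
  then show ?thesis by metis
qed

definition sol :: "complex \<Rightarrow> real \<Rightarrow> complex" where
  "sol = (SOME sol. \<forall>z t n. norm z < r1 \<longrightarrow> t \<in> {0..2*pi} \<longrightarrow> norm (picard n z t - sol z t) \<le> rate * (1/2) ^ n)"

lemma picard_sol:
  assumes "norm z < r1" "t \<in> {0..2*pi}"
  shows "norm (picard n z t - sol z t) \<le> rate * (1/2) ^ n"
  using someI_ex[OF picard_converges] assms unfolding sol_def by blast

lemma rate_tendsto: "(\<lambda>n. c * (1/2::real) ^ n) \<longlonglongrightarrow> 0"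
  by (intro tendsto_mult_right_zero LIMSEQ_realpow_zero) auto

lemma picard_tendsto:
  assumes "norm z < r1" "t \<in> {0..2*pi}"
  shows "(\<lambda>n. picard n z t) \<longlonglongrightarrow> sol z t"
proof -
  have "(\<lambda>n. picard n z t - sol z t) \<longlonglongrightarrow> 0"
    by (rule Lim_null_comparison[OF _ rate_tendsto[of rate]]) (use picard_sol[OF assms] in auto)
  then show ?thesis by (simp add: LIM_zero_iff)
qed

lemma picard_regular_sol: "picard_regular sol"
  unfolding picard_regular_def
proof (intro conjI allI impI)
  fix z :: complex and t assume "norm z < r1" "t \<in> {0..2*pi}"
  then show "norm (sol z t) \<le> norm z * exp (L * t)"
    using picard_regular_picard unfolding picard_regular_def
    by (intro LIMSEQ_le_const2[OF tendsto_norm[OF picard_tendsto]]) auto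
next
  fix z w :: complex and t assume "norm z < r1" "norm w < r1" "t \<in> {0..2*pi}"
  then show "norm (sol z t - sol w t) \<le> norm (z - w) * exp (L * t)"
    using picard_regular_picard unfolding picard_regular_def
    by (intro LIMSEQ_le_const2[OF tendsto_norm[OF tendsto_diff[OF picard_tendsto picard_tendsto]]]) auto
next
  fix z :: complex and s t assume "norm z < r1" "s \<in> {0..2*pi}" "t \<in> {0..2*pi}"
  then show "norm (sol z t - sol z s) \<le> L * r * \<bar>t - s\<bar>"
    using picard_regular_picard unfolding picard_regular_def
    by (intro LIMSEQ_le_const2[OF tendsto_norm[OF tendsto_diff[OF picard_tendsto picard_tendsto]]]) auto
qed

lemma sol_integral_equation:
  assumes z: "norm z < r1" and t: "t \<in> {0..2*pi}"
  shows "sol z t = z + integral {0..t} (\<lambda>s. R s (sol z s))"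
proof -
  have c: "continuous_on {0..2*pi} (\<lambda>s. R s (picard n z s))" for n
    using picard_regular_continuous_R[OF picard_regular_picard z] .
  have c': "continuous_on {0..2*pi} (\<lambda>s. R s (sol z s))"
    using picard_regular_continuous_R[OF picard_regular_sol z] .
  have "norm (integral {0..t} (\<lambda>s. R s (picard n z s)) - integral {0..t} (\<lambda>s. R s (sol z s)))
      \<le> (L * rate * t) * (1/2) ^ n" for n
  proof -
    have "integral {0..t} (\<lambda>s. R s (picard n z s)) - integral {0..t} (\<lambda>s. R s (sol z s))
      = integral {0..t} (\<lambda>s. R s (picard n z s) - R s (sol z s))"
      using t by (intro Henstock_Kurzweil_Integration.integral_diff[symmetric] integrable_continuous_real continuous_on_subset[OF c] continuous_on_subset[OF c']) auto
    also have "norm \<dots> \<le> (L * rate * (1/2) ^ n) * (t - 0)"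
    proof (rule integral_bound)
      show "continuous_on {0..t} (\<lambda>s. R s (picard n z s) - R s (sol z s))"
        using t by (intro continuous_on_diff continuous_on_subset[OF c] continuous_on_subset[OF c']) auto
      fix s assume "s \<in> {0..t}"
      then have s: "s \<in> {0..2*pi}" using t by auto
      have "norm (R s (picard n z s) - R s (sol z s)) \<le> L * norm (picard n z s - sol z s)"
        using picard_regular_lt[OF picard_regular_picard z s] picard_regular_lt[OF picard_regular_sol z s]
        by (intro lip less_imp_le)
      also have "\<dots> \<le> L * (rate * (1/2) ^ n)" using picard_sol[OF z s] L by (intro mult_left_mono) auto
      finally show "norm (R s (picard n z s) - R s (sol z s)) \<le> L * rate * (1/2) ^ n" by simp
    qed (use t in auto)
    finally show ?thesis by (simp add: mult_ac)
  qed
  then have "(\<lambda>n. integral {0..t} (\<lambda>s. R s (picard n z s)) - integral {0..t} (\<lambda>s. R s (sol z s))) \<longlonglongrightarrow> 0"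
    by (intro Lim_null_comparison[OF _ rate_tendsto[of "L * rate * t"]]) auto
  then have "(\<lambda>n. z + integral {0..t} (\<lambda>s. R s (picard n z s))) \<longlonglongrightarrow> z + integral {0..t} (\<lambda>s. R s (sol z s))"
    by (intro tendsto_intros) (simp add: LIM_zero_iff)
  moreover have "(\<lambda>n. picard (Suc n) z t) \<longlonglongrightarrow> sol z t"
    using picard_tendsto[OF z t] by (rule LIMSEQ_Suc)
  ultimately show ?thesis using LIMSEQ_unique by simp
qed

lemma sol_0: "norm z < r1 \<Longrightarrow> sol z 0 = z"
  using sol_integral_equation[of z 0] by simp

lemma sol_has_vector_derivative:
  assumes z: "norm z < r1" and t: "t \<in> {0..2*pi}"
  shows "(sol z has_vector_derivative R t (sol z t)) (at t within {0..2*pi})"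
proof (rule has_vector_derivative_transform[OF t])
  have "((\<lambda>t. integral {0..t} (\<lambda>s. R s (sol z s))) has_vector_derivative R t (sol z t)) (at t within {0..2*pi})"
    using picard_regular_continuous_R[OF picard_regular_sol z] t by (rule integral_has_vector_derivative)
  then show "((\<lambda>t. z + integral {0..t} (\<lambda>s. R s (sol z s))) has_vector_derivative R t (sol z t)) (at t within {0..2*pi})"
    using has_vector_derivative_add[OF has_vector_derivative_const] by fastforce
qed (use sol_integral_equation[OF z] in auto)

lemma holomorphic_sol:
  assumes t: "t \<in> {0..2*pi}"
  shows "(\<lambda>z. sol z t) holomorphic_on ball 0 r1"
proof (rule holomorphic_uniform_sequence[where f = "\<lambda>n z. picard n z t"])
  fix x :: complex assume "x \<in> ball 0 r1"
  then obtain d where d: "d > 0" "cball x d \<subseteq> ball 0 r1"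
    by (metis open_ball open_contains_cball)
  have "uniform_limit (cball x d) (\<lambda>n z. picard n z t) (\<lambda>z. sol z t) sequentially"
    unfolding uniform_limit_iff
  proof (intro allI impI)
    fix e :: real assume "e > 0"
    then have "\<forall>\<^sub>F n in sequentially. rate * (1/2) ^ n < e"
      using rate_tendsto[of rate] by (intro order_tendstoD(2))
    then show "\<forall>\<^sub>F n in sequentially. \<forall>z\<in>cball x d. dist (picard n z t) (sol z t) < e"
    proof eventually_elim
      case (elim n)
      show ?case
      proof
        fix z assume "z \<in> cball x d"
        then have "norm z < r1" using d by auto
        then show "dist (picard n z t) (sol z t) < e"
          using picard_sol[OF _ t, of z n] elim unfolding dist_norm by linarith
      qed
    qed
  qed
  then show "\<exists>d>0. cball x d \<subseteq> ball 0 r1 \<and> uniform_limit (cball x d) (\<lambda>n z. picard n z t) (\<lambda>z. sol z t) sequentially"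
    using d by blast
qed (use holomorphic_picard[OF t] in auto)

lemma picard_real:
  assumes x: "\<bar>x\<bar> < r1"
  shows "t \<in> {0..2*pi} \<Longrightarrow> picard n (complex_of_real x) t \<in> \<real>"
proof (induction n arbitrary: t)
  case 0
  then show ?case by simp
next
  case (Suc n)
  have z: "norm (complex_of_real x) < r1" using x by simp
  have R: "R s (picard n (complex_of_real x) s) \<in> \<real>" if "s \<in> {0..t}" for s
  proof -
    have s: "s \<in> {0..2*pi}" using that Suc.prems by auto
    then obtain y where y: "picard n (complex_of_real x) s = complex_of_real y"
      using Suc.IH by (auto elim: Reals_cases)
    then show ?thesis using picard_regular_lt[OF picard_regular_picard z s, of n] by (auto intro: real_valued)
  qed
  have int: "(\<lambda>s. R s (picard n (complex_of_real x) s)) integrable_on {0..t}"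
    using Suc.prems
    by (intro integrable_continuous_real continuous_on_subset[OF picard_regular_continuous_R[OF picard_regular_picard z]]) auto
  have "Im (integral {0..t} (\<lambda>s. R s (picard n (complex_of_real x) s)))
      = integral {0..t} (\<lambda>s. Im (R s (picard n (complex_of_real x) s)))"
    using integral_linear[OF int bounded_linear_Im] by (simp add: o_def)
  also have "\<dots> = integral {0..t} (\<lambda>s. 0)"
    using R by (intro integral_cong) (auto simp: complex_is_Real_iff)
  finally show ?case by (simp add: complex_is_Real_iff)
qed

lemma sol_real:
  assumes "\<bar>x\<bar> < r1" "t \<in> {0..2*pi}"
  shows "sol (complex_of_real x) t \<in> \<real>"
proof (rule Lim_in_closed_set[OF closed_complex_Reals _ _ picard_tendsto])
  show "\<forall>\<^sub>F n in sequentially. picard n (complex_of_real x) t \<in> \<real>"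
    using picard_real[OF assms(1) assms(2)] by auto
qed (use assms in auto)

end

section \<open>Periodic orbits\<close>

text \<open>The squares of D exp (-l (t - a)) and D exp (l (t - a)) are differentiable where |D| is
  not, and the bound on D' makes them monotone. The lower estimate matters as much as the upper one:
  a difference that is nonzero at the start never vanishes.\<close>

lemma gronwall_two_sided:
  fixes D D' :: "real \<Rightarrow> real"
  assumes der: "\<And>t. t \<in> {a..b} \<Longrightarrow> (D has_real_derivative D' t) (at t within {a..b})"
    and le: "\<And>t. t \<in> {a..b} \<Longrightarrow> \<bar>D' t\<bar> \<le> l * \<bar>D t\<bar>" and t: "t \<in> {a..b}"
  shows "\<bar>D t\<bar> \<le> \<bar>D a\<bar> * exp (l * (t - a))" "\<bar>D a\<bar> * exp (- (l * (t - a))) \<le> \<bar>D t\<bar>"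
proof -
  have main: "(D t * exp (- (l * (t - a))))\<^sup>2 \<le> (D a)\<^sup>2 \<and> (D a)\<^sup>2 \<le> (D t * exp (l * (t - a)))\<^sup>2"
  proof
    have cD: "continuous_on {a..t} D"
      using t DERIV_continuous_on[of "{a..b}" D D'] der by (metis atLeastatMost_subset_iff atLeastAtMost_iff continuous_on_subset order_refl)
    have D: "DERIV D x :> D' x" if "a < x" "x < t" for x
      using der[of x] that t by (simp add: at_within_Icc_at)
    have pr: "2 * (D x * D' x) \<le> 2 * l * (D x)\<^sup>2" "- (2 * l * (D x)\<^sup>2) \<le> 2 * (D x * D' x)" if "a < x" "x < t" for x
    proof -
      have "\<bar>D x * D' x\<bar> \<le> \<bar>D x\<bar> * (l * \<bar>D x\<bar>)"
        using le[of x] that t by (auto simp: abs_mult intro!: mult_left_mono)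
      then have "\<bar>D x * D' x\<bar> \<le> l * (D x)\<^sup>2" by (simp add: power2_eq_square mult_ac)
      then show "2 * (D x * D' x) \<le> 2 * l * (D x)\<^sup>2" "- (2 * l * (D x)\<^sup>2) \<le> 2 * (D x * D' x)" by linarith+
    qed
    have "(D t * exp (- (l * (t - a))))\<^sup>2 \<le> (D a * exp (- (l * (a - a))))\<^sup>2"
    proof (rule DERIV_nonpos_imp_decreasing_open[where f = "\<lambda>x. (D x * exp (- (l * (x - a))))\<^sup>2"])
      fix x assume x: "a < x" "x < t"
      let ?y = "(2 * (D x * D' x) - 2 * l * (D x)\<^sup>2) * (exp (- (l * (x - a))))\<^sup>2"
      have "DERIV (\<lambda>x. (D x * exp (- (l * (x - a))))\<^sup>2) x :> ?y"
        by (rule derivative_eq_intros D[OF x] refl)+ (simp add: algebra_simps power2_eq_square)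
      moreover have "?y \<le> 0" using pr[OF x] by (intro mult_nonpos_nonneg) auto
      ultimately show "\<exists>y. DERIV (\<lambda>x. (D x * exp (- (l * (x - a))))\<^sup>2) x :> y \<and> y \<le> 0" by blast
    qed (use t in \<open>auto intro!: continuous_intros cD\<close>)
    then show "(D t * exp (- (l * (t - a))))\<^sup>2 \<le> (D a)\<^sup>2" by simp
    have "(D a * exp (l * (a - a)))\<^sup>2 \<le> (D t * exp (l * (t - a)))\<^sup>2"
    proof (rule DERIV_nonneg_imp_increasing_open[where f = "\<lambda>x. (D x * exp (l * (x - a)))\<^sup>2"])
      fix x assume x: "a < x" "x < t"
      let ?y = "(2 * (D x * D' x) + 2 * l * (D x)\<^sup>2) * (exp (l * (x - a)))\<^sup>2"
      have "DERIV (\<lambda>x. (D x * exp (l * (x - a)))\<^sup>2) x :> ?y"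
        by (rule derivative_eq_intros D[OF x] refl)+ (simp add: algebra_simps power2_eq_square)
      moreover have "?y \<ge> 0" using pr[OF x] by (intro mult_nonneg_nonneg) auto
      ultimately show "\<exists>y. DERIV (\<lambda>x. (D x * exp (l * (x - a)))\<^sup>2) x :> y \<and> y \<ge> 0" by blast
    qed (use t in \<open>auto intro!: continuous_intros cD\<close>)
    then show "(D a)\<^sup>2 \<le> (D t * exp (l * (t - a)))\<^sup>2" by simp
  qed
  have "\<bar>D t\<bar> * exp (- (l * (t - a))) \<le> \<bar>D a\<bar>" "\<bar>D a\<bar> \<le> \<bar>D t\<bar> * exp (l * (t - a))"
    using main by (simp_all add: abs_le_square_iff[symmetric] abs_mult)
  moreover have "x * exp (- w) \<le> y \<longleftrightarrow> x \<le> y * exp w" for x y w :: real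
    by (simp add: exp_minus divide_inverse[symmetric] pos_divide_le_eq)
  ultimately show "\<bar>D t\<bar> \<le> \<bar>D a\<bar> * exp (l * (t - a))" "\<bar>D a\<bar> * exp (- (l * (t - a))) \<le> \<bar>D t\<bar>"
    by blast+
qed

text \<open>Neighbouring translates of the interval share one point. There both one-sided
  derivatives equal \<open>D 0\<close>, since f and D each agree at the two ends; elsewhere a single
  translate suffices.\<close>

lemma periodic_extension_has_derivative:
  fixes f D :: "real \<Rightarrow> real"
  assumes P: "0 < P" and der: "\<And>t. t \<in> {0..P} \<Longrightarrow> (f has_real_derivative D t) (at t within {0..P})"
    and f: "f P = f 0" and D: "D P = D 0"
  shows "((\<lambda>t. f (t - P * \<lfloor>t / P\<rfloor>)) has_real_derivative D (t - P * \<lfloor>t / P\<rfloor>)) (at t)"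
proof -
  let ?h = "\<lambda>t. f (t - P * \<lfloor>t / P\<rfloor>)"
  \<comment> \<open>The right end s = P k + P is included: there the floor jumps to k + 1, and
    \<open>f P = f 0\<close> is used.\<close>
  have fl: "?h s = f (s - P * k)" if "s \<in> {P * k..P * k + P}" for s and k :: int
  proof (cases "s = P * k + P")
    case True
    then have "\<lfloor>s / P\<rfloor> = k + 1" using P by (auto simp: divide_simps algebra_simps intro!: floor_unique)
    then show ?thesis using f True by (simp add: algebra_simps)
  next
    case False
    then have "\<lfloor>s / P\<rfloor> = k" using P that by (auto simp: field_simps intro!: floor_unique)
    then show ?thesis by simp
  qed
  have seg: "(?h has_real_derivative D (s - P * k)) (at s within {P * k..P * k + P})"
    if s: "s \<in> {P * k..P * k + P}" for s and k :: int
  proof -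
    have "((\<lambda>s. f (s - P * k)) has_real_derivative D (s - P * k) * 1) (at s within {P * k..P * k + P})"
    proof (rule DERIV_image_chain[where f = f and g = "\<lambda>s. s - P * k", unfolded o_def])
      show "(f has_real_derivative D (s - P * k)) (at (s - P * k) within (\<lambda>s. s - P * k) ` {P * k..P * k + P})"
        using s by (intro DERIV_subset[OF der]) auto
    qed (auto intro!: derivative_eq_intros)
    then have "((\<lambda>s. f (s - P * k)) has_real_derivative D (s - P * k)) (at s within {P * k..P * k + P})"
      by simp
    then show ?thesis
      by (rule has_field_derivative_transform_within[OF _ zero_less_one s]) (rule fl[symmetric])
  qed
  define k where "k = \<lfloor>t / P\<rfloor>"
  have k: "P * k \<le> t" "t < P * k + P"
  proof -
    have "real_of_int k \<le> t / P" "t / P < k + 1" unfolding k_def by linarith+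
    then show "P * k \<le> t" "t < P * k + P" using P by (auto simp: field_simps)
  qed
  show ?thesis
  proof (cases "t = P * k")
    case False
    then have "(?h has_real_derivative D (t - P * k)) (at t)"
      using seg[of t k] k by (simp add: at_within_Icc_at)
    then show ?thesis unfolding k_def .
  next
    case True
    let ?S = "{P * (k - 1)..P * (k - 1) + P}" and ?T = "{P * k..P * k + P}"
    have "(?h has_real_derivative D 0) (at t within ?T)"
      using seg[of t k] True P by simp
    moreover have "(?h has_real_derivative D 0) (at t within ?S)"
      using seg[of t "k - 1"] True P D by (simp add: algebra_simps)
    ultimately have "(?h has_real_derivative D 0) (at t within ?S \<union> ?T)"
      unfolding has_field_derivative_iff Lim_within_Un by simp
    moreover have "at t within ?S \<union> ?T = at t"
    proof -
      have "P * (k - 1) = P * k - P" by (simp add: right_diff_distrib)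
      then have sub: "{P * k - P<..<P * k + P} \<subseteq> ?S \<union> ?T" by auto
      have mem: "t \<in> {P * k - P<..<P * k + P}" using k P by simp
      have "t \<in> interior (?S \<union> ?T)" by (rule interiorI[OF open_greaterThanLessThan mem sub])
      then show ?thesis by (rule at_within_interior)
    qed
    ultimately have h0: "(?h has_real_derivative D 0) (at t)" by simp
    have "t - P * k = 0" using True by linarith
    then have z: "t - P * \<lfloor>t / P\<rfloor> = 0" unfolding k_def .
    show ?thesis using h0 unfolding z .
  qed
qed

lemma continuous_antiderivative_exists:
  fixes h :: "real \<Rightarrow> real"
  assumes "continuous_on UNIV h"
  obtains G where "\<And>t. (G has_real_derivative h t) (at t)"
proof -
  have "\<exists>G. \<forall>x. -\<infinity> < ereal x \<longrightarrow> ereal x < \<infinity> \<longrightarrow> (G has_vector_derivative h x) (at x)"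
    using assms by (intro einterval_antiderivative) (auto simp: continuous_on_eq_continuous_at)
  then show thesis using that by (auto simp: has_real_derivative_iff_has_vector_derivative)
qed

lemma derivative_ge_imp_increment_ge:
  fixes f f' :: "real \<Rightarrow> real"
  assumes "\<And>t. (f has_real_derivative f' t) (at t)" "\<And>t. c \<le> f' t" "x \<le> y"
  shows "c * (y - x) \<le> f y - f x"
proof -
  have "f x - c * x \<le> f y - c * y"
  proof (rule DERIV_nonneg_imp_nondecreasing[OF assms(3)])
    show "\<exists>y. ((\<lambda>x. f x - c * x) has_real_derivative y) (at t) \<and> 0 \<le> y" for t
      using assms(1,2)[of t] by (intro exI[of _ "f' t - c"]) (auto intro!: derivative_eq_intros)
  qed
  then show ?thesis by (simp add: algebra_simps)
qed

lemma derivative_ge_imp_surj: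
  fixes f f' :: "real \<Rightarrow> real"
  assumes der: "\<And>t. (f has_real_derivative f' t) (at t)" and c: "\<And>t. c \<le> f' t" "0 < c"
  shows "\<exists>t. f t = y"
proof -
  define M where "M = \<bar>y - f 0\<bar> / c"
  have M: "0 \<le> M" "c * M = \<bar>y - f 0\<bar>" using c by (auto simp: M_def)
  have "f (- M) \<le> y" "y \<le> f M"
    using derivative_ge_imp_increment_ge[OF der c(1), of "-M" 0] derivative_ge_imp_increment_ge[OF der c(1), of 0 M] M
    by (auto simp: algebra_simps)
  moreover have "continuous_on {-M..M} f"
    by (intro continuous_at_imp_continuous_on ballI DERIV_isCont[OF der])
  ultimately show ?thesis using IVT'[of f "-M" y M] M by auto
qed

text \<open>The new time is an antiderivative G of h. As h \<ge> c > 0, G is a bijection of the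
  reals, and \<psi> composed with its inverse solves the equation of F. Since h has period P, G
  gains a fixed amount per period, and this gain is the new period.\<close>

lemma periodic_orbit_time_change:
  fixes \<psi> :: "real \<Rightarrow> real \<times> real"
  assumes \<psi>: "\<And>s. (\<psi> has_vector_derivative h s *\<^sub>R F (\<psi> s)) (at s)"
    and h: "continuous_on UNIV h" "\<And>s. c \<le> h s" "0 < c" "\<And>s. h (s + P) = h s"
    and P: "0 < P" "\<And>s. \<psi> (s + P) = \<psi> s" and nc: "\<exists>s. \<psi> s \<noteq> \<psi> 0"
  shows "periodic_orbit F (range \<psi>)"
proof -
  obtain G where G: "\<And>t. (G has_real_derivative h t) (at t)"
    using continuous_antiderivative_exists[OF h(1)] by blast
  note inc = derivative_ge_imp_increment_ge[OF G h(2)]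
  have less: "x < y \<Longrightarrow> G x < G y" for x y using inc[of x y] h(3) by (smt (verit) mult_pos_pos)
  then have inj: "inj G" by (metis injI linorder_neq_iff)
  have surj: "surj G" using derivative_ge_imp_surj[OF G h(2) h(3)] by (metis surjI)
  define \<tau> where "\<tau> = inv G"
  have \<tau>: "G (\<tau> t) = t" "\<tau> (G s) = s" for t s
    using surj inj by (auto simp: \<tau>_def surj_f_inv_f)
  have ct: "isCont \<tau> t" for t
    using isCont_inverse_function[of 1 "\<tau> t" \<tau> G] \<tau> DERIV_isCont[OF G] by auto
  have der_\<tau>: "(\<tau> has_real_derivative inverse (h (\<tau> t))) (at t)" for t
    using h(2,3)
    by (intro DERIV_inverse_function[where f = G and g = \<tau> and a = "t - 1" and b = "t + 1"] G ct)
      (auto simp: \<tau>(1), metis less_le_not_le)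
  define T where "T = G P - G 0"
  have "((\<lambda>s. G (s + P) - G s) has_real_derivative 0) (at s)" for s
    using h(4)[of s] by (auto intro!: derivative_eq_intros DERIV_chain2[OF G] G)
  then have shift: "G (s + P) = G s + T" for s
    using DERIV_isconst_all[of "\<lambda>s. G (s + P) - G s" s 0] by (auto simp: T_def)
  have \<tau>shift: "\<tau> (t + T) = \<tau> t + P" for t using shift[of "\<tau> t"] \<tau> by metis
  define \<phi> where "\<phi> = \<psi> \<circ> \<tau>"
  have "(\<phi> has_vector_derivative inverse (h (\<tau> t)) *\<^sub>R (h (\<tau> t) *\<^sub>R F (\<psi> (\<tau> t)))) (at t)" for t
    unfolding \<phi>_def using der_\<tau> \<psi>
    by (intro vector_diff_chain_at) (auto simp: has_real_derivative_iff_has_vector_derivative)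
  moreover have "h s \<noteq> 0" for s using h(2)[of s] h(3) by auto
  ultimately have "(\<phi> has_vector_derivative F (\<phi> t)) (at t)" for t
    by (simp add: \<phi>_def)
  moreover have "\<phi> (t + T) = \<phi> t" for t using \<tau>shift P by (simp add: \<phi>_def)
  moreover have "T > 0" using less[of 0 P] P by (simp add: T_def)
  moreover have rng: "range \<phi> = range \<psi>"
    using \<tau>(2) unfolding \<phi>_def by (auto simp: image_iff) metis
  moreover have "\<exists>t. \<phi> t \<noteq> \<phi> 0"
  proof (rule ccontr)
    assume "\<not> ?thesis"
    moreover have "\<psi> s \<in> range \<phi>" for s unfolding rng by simp
    ultimately have "\<psi> s = \<phi> 0" for s by (metis imageE)
    then show False using nc by metis
  qed
  ultimately show ?thesis unfolding periodic_orbit_def by (intro exI[of _ \<phi>] exI[of _ T]) auto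
qed

lemma periodic_orbit_scaleR_pos:
  assumes "periodic_orbit F \<gamma>" "0 < c"
  shows "periodic_orbit (\<lambda>q. c *\<^sub>R F q) \<gamma>"
proof -
  obtain \<phi> T where \<phi>: "T > 0" "\<And>t. (\<phi> has_vector_derivative F (\<phi> t)) (at t)"
    "\<And>t. \<phi> (t + T) = \<phi> t" "\<exists>t. \<phi> t \<noteq> \<phi> 0" "\<gamma> = range \<phi>"
    using assms(1) unfolding periodic_orbit_def by blast
  show ?thesis unfolding \<phi>(5)
    by (rule periodic_orbit_time_change[where h = "\<lambda>_. inverse c" and c = "inverse c" and P = T])
      (use \<phi> assms(2) in auto)
qed

lemma periodic_orbit_uminus:
  assumes "periodic_orbit F \<gamma>"
  shows "periodic_orbit (\<lambda>q. - F q) \<gamma>"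
proof -
  obtain \<phi> T where \<phi>: "T > 0" "\<And>t. (\<phi> has_vector_derivative F (\<phi> t)) (at t)"
    "\<And>t. \<phi> (t + T) = \<phi> t" "\<exists>t. \<phi> t \<noteq> \<phi> 0" "\<gamma> = range \<phi>"
    using assms unfolding periodic_orbit_def by blast
  have "((\<lambda>t. \<phi> (- t)) has_vector_derivative (-1) *\<^sub>R F (\<phi> (- t))) (at t)" for t
    by (rule vector_diff_chain_at[where f = uminus and g = \<phi>, unfolded o_def])
      (use \<phi> in \<open>auto intro!: derivative_eq_intros\<close>)
  moreover have "\<phi> (- (t + T)) = \<phi> (- t)" for t using \<phi>(3)[of "- t - T"] by simp
  moreover have "\<exists>t. \<phi> (- t) \<noteq> \<phi> (- 0)"
  proof -
    obtain t where "\<phi> t \<noteq> \<phi> 0" using \<phi>(4) ..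
    then show ?thesis by (intro exI[of _ "- t"]) simp
  qed
  moreover have "range \<phi> = range (\<lambda>t. \<phi> (- t))"
  proof -
    have "range (uminus :: real \<Rightarrow> real) = UNIV" by (rule surjI[of _ uminus]) simp
    then show ?thesis by (metis (no_types) image_image)
  qed
  ultimately show ?thesis unfolding periodic_orbit_def using \<phi>(1,5)
    by (intro exI[of _ "\<lambda>t. \<phi> (- t)"] exI[of _ T]) auto
qed

lemma periodic_orbit_scaleR_iff:
  assumes "c \<noteq> 0"
  shows "periodic_orbit (\<lambda>q. c *\<^sub>R F q) \<gamma> \<longleftrightarrow> periodic_orbit F \<gamma>"
proof -
  have *: "periodic_orbit (\<lambda>q. d *\<^sub>R G q) \<gamma>" if "periodic_orbit G \<gamma>" "d \<noteq> 0" for G d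
  proof (cases "d > 0")
    case True
    then show ?thesis using periodic_orbit_scaleR_pos that by blast
  next
    case False
    then have "periodic_orbit (\<lambda>q. (- d) *\<^sub>R G q) \<gamma>" using that by (intro periodic_orbit_scaleR_pos) auto
    from periodic_orbit_uminus[OF this] show ?thesis by simp
  qed
  from *[of F c] *[of "\<lambda>q. c *\<^sub>R F q" "inverse c"] assms show ?thesis by auto
qed

section \<open>Polar coordinates and curves around a point\<close>

definition polar :: "real \<times> real \<Rightarrow> real \<Rightarrow> real \<Rightarrow> real \<times> real" where
  "polar p \<rho> t = p + (\<rho> * cos t, \<rho> * sin t)"

lemma dist_polar: "dist (polar p \<rho> t) p = \<bar>\<rho>\<bar>"
proof -
  have "dist (polar p \<rho> t) p = norm (\<rho> * cos t, \<rho> * sin t)" by (simp add: dist_norm polar_def)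
  also have "\<dots> = sqrt (\<rho>\<^sup>2 * ((cos t)\<^sup>2 + (sin t)\<^sup>2))"
    unfolding norm_Pair distrib_left by (simp add: power_mult_distrib)
  finally show ?thesis by simp
qed

lemma polar_surj:
  obtains t where "0 \<le> t" "t < 2 * pi" "polar p (dist q p) t = q"
proof (cases "q = p")
  case True
  then show thesis using that[of 0] by (simp add: polar_def zero_prod_def)
next
  case False
  then have d: "dist q p > 0" by simp
  have "dist q p = sqrt ((fst q - fst p)\<^sup>2 + (snd q - snd p)\<^sup>2)"
    by (cases q; cases p) (simp add: dist_Pair_Pair dist_real_def)
  then have e: "(dist q p)\<^sup>2 = (fst q - fst p)\<^sup>2 + (snd q - snd p)\<^sup>2" by simp
  have "((fst q - fst p) / dist q p)\<^sup>2 + ((snd q - snd p) / dist q p)\<^sup>2 = ((fst q - fst p)\<^sup>2 + (snd q - snd p)\<^sup>2) / (dist q p)\<^sup>2"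
    by (simp add: power_divide add_divide_distrib)
  also have "\<dots> = 1" unfolding e[symmetric] using d by simp
  finally obtain t where t: "0 \<le> t" "t < 2 * pi"
    and cs: "(fst q - fst p) / dist q p = cos t" "(snd q - snd p) / dist q p = sin t"
    by (rule sincos_total_2pi)
  have "dist q p * cos t = fst q - fst p" "dist q p * sin t = snd q - snd p"
    unfolding cs[symmetric] using d by simp_all
  then have "polar p (dist q p) t = q" unfolding polar_def by (intro prod_eqI) simp_all
  with t show thesis by (rule that)
qed

lemma polar_eq_iff:
  assumes "polar p \<rho> s = polar p \<sigma> t" "0 < \<rho>" "0 \<le> \<sigma>"
  shows "\<rho> = \<sigma>" "cos s = cos t" "sin s = sin t"
proof -
  have "\<bar>\<rho>\<bar> = \<bar>\<sigma>\<bar>" using assms(1) dist_polar by metis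
  then show eq: "\<rho> = \<sigma>" using assms(2,3) by linarith
  have "polar p \<rho> s = polar p \<rho> t" using assms(1) unfolding eq .
  then have "\<rho> * cos s = \<rho> * cos t \<and> \<rho> * sin s = \<rho> * sin t" unfolding polar_def by simp
  then show "cos s = cos t" "sin s = sin t" using assms(2) by simp_all
qed

lemma equal_angle_cases:
  fixes s t :: real
  assumes st: "s \<in> {0..2*pi}" "t \<in> {0..2*pi}" and eq: "sin t = sin s" "cos t = cos s"
  shows "s = t \<or> s = 0 \<and> t = 2 * pi \<or> s = 2 * pi \<and> t = 0"
proof -
  obtain n :: int where n: "t = s + 2 * pi * n" using sin_cos_eq_iff[of t s] eq by blast
  consider "n = 0" | "1 \<le> n" | "n \<le> -1" by linarith
  then show ?thesis
  proof cases
    case 1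
    then show ?thesis using n by simp
  next
    case 2
    then have "2 * pi * 1 \<le> 2 * pi * n" by (intro mult_left_mono) auto
    then have "s = 0 \<and> t = 2 * pi" using n st unfolding atLeastAtMost_iff by linarith
    then show ?thesis by blast
  next
    case 3
    then have "2 * pi * n \<le> 2 * pi * (-1)" by (intro mult_left_mono) auto
    then have "s = 2 * pi \<and> t = 0" using n st unfolding atLeastAtMost_iff by linarith
    then show ?thesis by blast
  qed
qed

text \<open>The connected component of p outside \<Gamma> cannot be divided between the closed sets
  A and B, which meet only in \<Gamma>; so it stays in the bounded set A. The inside of a polar
  curve is recognised in this way without the Jordan curve theorem.\<close>

lemma in_inside_of_closed_cover:
  fixes A B \<Gamma> :: "'a::real_normed_vector set"
  assumes "closed A" "closed B" "A \<union> B = UNIV" "A \<inter> B \<subseteq> \<Gamma>" "p \<in> A" "p \<notin> \<Gamma>" "bounded A"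
  shows "p \<in> inside \<Gamma>"
proof -
  define C where "C = connected_component_set (- \<Gamma>) p"
  have C: "connected C" "C \<subseteq> - \<Gamma>" "p \<in> C"
    using assms(6) connected_component_subset[of "- \<Gamma>" p] by (auto simp: C_def connected_component_refl_eq)
  have "A \<inter> C = {} \<or> B \<inter> C = {}"
    using assms C(2) by (intro connected_closedD[OF C(1)]) auto
  then have "C \<subseteq> A" using assms(3,5) C(3) by blast
  then have "bounded C" using assms(7) bounded_subset by blast
  then show ?thesis using assms(6) unfolding inside_def C_def by blast
qed

text \<open>The two closed sets consist of the points on or below the curve and of those on or above
  it. Angles are quantified existentially, because every angle fits p and the positive ray has both
  angles 0 and 2 pi; periodicity of v reconciles the latter two on the intersection.\<close>

lemma center_in_inside_polar_curve:
  fixes v :: "real \<Rightarrow> real"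
  assumes cont: "continuous_on {0..2*pi} v" and pos: "\<And>t. t \<in> {0..2*pi} \<Longrightarrow> 0 < v t"
    and per: "v (2*pi) = v 0"
  shows "p \<in> inside ((\<lambda>t. polar p (v t) t) ` {0..2*pi})"
proof -
  let ?\<gamma> = "(\<lambda>t. polar p (v t) t) ` {0..2*pi}"
  let ?A = "{q. \<exists>t\<in>{0..2*pi}. polar p (dist q p) t = q \<and> dist q p \<le> v t}"
  let ?B = "{q. \<exists>t\<in>{0..2*pi}. polar p (dist q p) t = q \<and> v t \<le> dist q p}"
  \<comment> \<open>One argument for both sets, with \<epsilon> = -1 and \<epsilon> = 1. Angles
    attached to a convergent sequence of points have a convergent subsequence in the compact
    interval, and its limit is an admissible angle of the limit point.\<close>
  have closed: "closed {q. \<exists>t\<in>{0..2*pi}. polar p (dist q p) t = q \<and> \<epsilon> * v t \<le> \<epsilon> * dist q p}" for \<epsilon>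
    unfolding closed_sequential_limits
  proof (intro allI impI, elim conjE)
    fix x l assume x: "\<forall>n. x n \<in> {q. \<exists>t\<in>{0..2*pi}. polar p (dist q p) t = q \<and> \<epsilon> * v t \<le> \<epsilon> * dist q p}"
      and l: "x \<longlonglongrightarrow> l"
    from x have "\<forall>n. \<exists>t. t \<in> {0..2*pi} \<and> polar p (dist (x n) p) t = x n \<and> \<epsilon> * v t \<le> \<epsilon> * dist (x n) p"
      unfolding mem_Collect_eq Bex_def .
    from choice[OF this] obtain t where
      t': "\<forall>n. t n \<in> {0..2*pi} \<and> polar p (dist (x n) p) (t n) = x n \<and> \<epsilon> * v (t n) \<le> \<epsilon> * dist (x n) p" ..
    from t' have t: "t n \<in> {0..2*pi}" "polar p (dist (x n) p) (t n) = x n" "\<epsilon> * v (t n) \<le> \<epsilon> * dist (x n) p" for n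
      by blast+
    obtain s and k :: "nat \<Rightarrow> nat" where k: "s \<in> {0..2*pi}" "strict_mono k" "(t \<circ> k) \<longlonglongrightarrow> s"
      using t(1) compact_Icc[of 0 "2*pi"] unfolding compact_def by blast
    have xk: "(\<lambda>n. x (k n)) \<longlonglongrightarrow> l" using LIMSEQ_subseq_LIMSEQ[OF l k(2)] by (simp add: o_def)
    have tk: "(\<lambda>n. t (k n)) \<longlonglongrightarrow> s" using k(3) by (simp add: o_def)
    have "(\<lambda>n. polar p (dist (x (k n)) p) (t (k n))) \<longlonglongrightarrow> polar p (dist l p) s"
      unfolding polar_def by (intro tendsto_intros xk tk)
    then have "(\<lambda>n. x (k n)) \<longlonglongrightarrow> polar p (dist l p) s" by (simp only: t(2))
    then have pl: "polar p (dist l p) s = l" by (rule LIMSEQ_unique[OF _ xk])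
    have "(\<lambda>n. v (t (k n))) \<longlonglongrightarrow> v s"
      by (intro continuous_on_tendsto_compose[OF cont tk k(1)] always_eventually allI t(1))
    then have vk: "(\<lambda>n. \<epsilon> * v (t (k n))) \<longlonglongrightarrow> \<epsilon> * v s" by (intro tendsto_intros)
    have dk: "(\<lambda>n. \<epsilon> * dist (x (k n)) p) \<longlonglongrightarrow> \<epsilon> * dist l p" by (intro tendsto_intros xk)
    have ev: "\<epsilon> * v s \<le> \<epsilon> * dist l p" by (rule LIMSEQ_le[OF vk dk]) (intro exI allI impI t(3))
    show "l \<in> {q. \<exists>t\<in>{0..2*pi}. polar p (dist q p) t = q \<and> \<epsilon> * v t \<le> \<epsilon> * dist q p}"
      unfolding mem_Collect_eq by (intro bexI[of _ s] conjI pl ev k(1))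
  qed
  have cA: "closed ?A" using closed[of "-1"] by simp
  have cB: "closed ?B" using closed[of 1] by simp
  have cover: "?A \<union> ?B = UNIV"
  proof -
    have "q \<in> ?A \<union> ?B" for q
    proof -
      obtain t where t: "0 \<le> t" "t < 2 * pi" and q: "polar p (dist q p) t = q" by (rule polar_surj)
      have t': "t \<in> {0..2*pi}" using t by simp
      show ?thesis
      proof (cases "dist q p \<le> v t")
        case True
        then have "q \<in> ?A" unfolding mem_Collect_eq by (intro bexI[OF _ t'] conjI q)
        then show ?thesis by (rule UnI1)
      next
        case False
        then have "v t \<le> dist q p" by simp
        then have "q \<in> ?B" unfolding mem_Collect_eq by (intro bexI[OF _ t'] conjI q)
        then show ?thesis by (rule UnI2)
      qed
    qed
    then show ?thesis by (intro equalityI subsetI UNIV_I)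
  qed
  have inter: "q \<in> ?\<gamma>" if inA: "q \<in> ?A" and inB: "q \<in> ?B" for q
  proof -
    obtain s where s: "s \<in> {0..2*pi}" "polar p (dist q p) s = q" "dist q p \<le> v s"
      using inA unfolding mem_Collect_eq by (elim bexE conjE)
    obtain t where t: "t \<in> {0..2*pi}" "polar p (dist q p) t = q" "v t \<le> dist q p"
      using inB unfolding mem_Collect_eq by (elim bexE conjE)
    have pq: "0 < dist q p" "0 \<le> dist q p" using pos[OF t(1)] t(3) by linarith+
    have eq: "polar p (dist q p) t = polar p (dist q p) s" unfolding s(2) t(2) ..
    have "v t = v s"
      using equal_angle_cases[OF s(1) t(1) polar_eq_iff(3)[OF eq pq] polar_eq_iff(2)[OF eq pq]] per by auto
    then have "dist q p = v s" using s(3) t(3) by linarith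
    then have "q = polar p (v s) s" using s(2) by metis
    then show "q \<in> ?\<gamma>" using s(1) by (rule image_eqI)
  qed
  have p\<gamma>: "p \<notin> ?\<gamma>"
  proof
    assume "p \<in> ?\<gamma>"
    then obtain t where t: "t \<in> {0..2*pi}" "p = polar p (v t) t" by (elim imageE)
    then have "dist p p = \<bar>v t\<bar>" using dist_polar by metis
    then show False using pos[OF t(1)] by simp
  qed
  have "0 \<le> v 0" using pos[of 0] by simp
  then have pA: "p \<in> ?A" unfolding mem_Collect_eq by (intro bexI[of _ 0]) (simp_all add: polar_def zero_prod_def[symmetric])
  have "bounded (v ` {0..2*pi})"
    by (rule compact_imp_bounded[OF compact_continuous_image[OF cont compact_Icc]])
  then obtain M where "\<forall>x\<in>v ` {0..2*pi}. norm x \<le> M" unfolding bounded_iff ..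
  then have M: "norm (v t) \<le> M" if "t \<in> {0..2*pi}" for t using that by (metis imageI)
  have "?A \<subseteq> cball p M"
  proof
    fix q assume "q \<in> ?A"
    then obtain t where t: "t \<in> {0..2*pi}" "dist q p \<le> v t" unfolding mem_Collect_eq by (elim bexE conjE)
    have "dist q p \<le> M" using M[OF t(1)] t(2) unfolding real_norm_def by linarith
    then show "q \<in> cball p M" by (simp only: mem_cball dist_commute)
  qed
  then have bA: "bounded ?A" by (rule bounded_subset[OF bounded_cball])
  show ?thesis
    by (rule in_inside_of_closed_cover[OF cA cB cover _ pA p\<gamma> bA]) (intro subsetI, elim IntE, rule inter)
qed

section \<open>Planar fields in polar coordinates\<close>

lemma nonvanishing_stays_positive:
  fixes f :: "real \<Rightarrow> real"
  assumes cont: "continuous_on {a..b} f" and nz: "\<And>t. t \<in> {a..b} \<Longrightarrow> f t \<noteq> 0"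
    and pos: "0 < f a" and t: "t \<in> {a..b}"
  shows "0 < f t"
proof (rule ccontr)
  assume "\<not> 0 < f t"
  moreover have "continuous_on {a..t} f" using t by (intro continuous_on_subset[OF cont]) auto
  ultimately obtain s where "a \<le> s" "s \<le> t" "f s = 0"
    using IVT2'[of f t 0 a] pos t by auto
  then show False using nz[of s] t by auto
qed

text \<open>\<open>N\<close> and \<open>Q\<close> are the rates of \<open>F\<close> around
  \<open>p\<close>: along an orbit the radius has derivative \<rho> N and the angle has derivative
  Q. As Q is positive, the angle can replace time, and \<rho> N / Q is the resulting radial
  equation, of which R is the complex extension.\<close>

locale polar_field = radial_ode R r L for R r L +
  fixes F :: "real \<times> real \<Rightarrow> real \<times> real" and p :: "real \<times> real"
    and N Q :: "real \<Rightarrow> real \<Rightarrow> real" and m K :: real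
  assumes F_polar: "\<And>t \<rho>. \<lbrakk>0 \<le> \<rho>; \<rho> \<le> r\<rbrakk> \<Longrightarrow> F (polar p \<rho> t)
        = (\<rho> * (N t \<rho> * cos t - Q t \<rho> * sin t), \<rho> * (N t \<rho> * sin t + Q t \<rho> * cos t))"
    and m: "0 < m" and Q_ge: "\<And>t \<rho>. \<lbrakk>0 \<le> \<rho>; \<rho> \<le> r\<rbrakk> \<Longrightarrow> m \<le> Q t \<rho>"
    and Q_le: "\<And>t \<rho>. \<lbrakk>0 \<le> \<rho>; \<rho> \<le> r\<rbrakk> \<Longrightarrow> Q t \<rho> \<le> K"
    and Q_cont: "continuous_on (UNIV \<times> {0..r}) (\<lambda>(t, \<rho>). Q t \<rho>)"
    and Q_periodic: "\<And>t \<rho>. Q (t + 2 * pi) \<rho> = Q t \<rho>"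
    and R_eq: "\<And>t \<rho>. \<lbrakk>0 \<le> \<rho>; \<rho> \<le> r\<rbrakk> \<Longrightarrow> R t (complex_of_real \<rho>) = complex_of_real (\<rho> * N t \<rho> / Q t \<rho>)"
    and F_cont: "continuous_on UNIV F"
begin

definition slope :: "real \<Rightarrow> real \<Rightarrow> real" where "slope t x = Re (R t (complex_of_real x))"

definition v :: "real \<Rightarrow> real \<Rightarrow> real" where "v x t = Re (sol (complex_of_real x) t)"

definition curve :: "real \<Rightarrow> (real \<times> real) set" where
  "curve x = (\<lambda>t. polar p (v x t) t) ` {0..2*pi}"

lemma Q_pos: "\<lbrakk>0 \<le> \<rho>; \<rho> \<le> r\<rbrakk> \<Longrightarrow> 0 < Q t \<rho>"
  using Q_ge[of \<rho> t] m by linarith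

lemma slope_lipschitz:
  assumes "\<bar>x\<bar> \<le> r" "\<bar>y\<bar> \<le> r"
  shows "\<bar>slope t x - slope t y\<bar> \<le> L * \<bar>x - y\<bar>"
proof -
  have "\<bar>slope t x - slope t y\<bar> \<le> norm (R t (complex_of_real x) - R t (complex_of_real y))"
    unfolding slope_def using abs_Re_le_cmod by (metis minus_complex.simps(1))
  also have "\<dots> \<le> L * norm (complex_of_real x - complex_of_real y)"
    using assms by (intro lip) auto
  also have "norm (complex_of_real x - complex_of_real y) = \<bar>x - y\<bar>"
    by (metis norm_of_real of_real_diff)
  finally show ?thesis .
qed

lemma slope_0: "slope t 0 = 0"
  unfolding slope_def using zero by simp

lemma slope_eq: "\<lbrakk>0 \<le> \<rho>; \<rho> \<le> r\<rbrakk> \<Longrightarrow> slope t \<rho> * Q t \<rho> = \<rho> * N t \<rho>"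
  unfolding slope_def using R_eq[of \<rho> t] Q_pos[of \<rho> t] by simp

lemma norm_less_r1: "\<lbrakk>0 \<le> x; x < r1\<rbrakk> \<Longrightarrow> norm (complex_of_real x) < r1"
  by simp

lemma v_complex:
  assumes "0 \<le> x" "x < r1" "t \<in> {0..2*pi}"
  shows "sol (complex_of_real x) t = complex_of_real (v x t)"
  using sol_real[of x t] assms unfolding v_def by (simp add: complex_is_Real_iff complex_eq_iff)

lemma v_0: "\<lbrakk>0 \<le> x; x < r1\<rbrakk> \<Longrightarrow> v x 0 = x"
  unfolding v_def by (simp add: sol_0)

lemma v_derivative:
  assumes x: "0 \<le> x" "x < r1" and t: "t \<in> {0..2*pi}"
  shows "(v x has_real_derivative slope t (v x t)) (at t within {0..2*pi})"
proof -
  have "((\<lambda>t. Re (sol (complex_of_real x) t)) has_vector_derivative Re (R t (sol (complex_of_real x) t)))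
      (at t within {0..2*pi})"
    by (intro bounded_linear.has_vector_derivative[OF bounded_linear_Re] sol_has_vector_derivative t norm_less_r1 x)
  then show ?thesis
    unfolding has_real_derivative_iff_has_vector_derivative slope_def v_complex[OF x t, symmetric]
    by (simp add: v_def[abs_def])
qed

lemma v_continuous: "\<lbrakk>0 \<le> x; x < r1\<rbrakk> \<Longrightarrow> continuous_on {0..2*pi} (v x)"
  using v_derivative by (intro DERIV_continuous_on)

lemma abs_v_less:
  assumes x: "0 \<le> x" "x < r1" and t: "t \<in> {0..2*pi}"
  shows "\<bar>v x t\<bar> < r"
proof -
  have "\<bar>v x t\<bar> \<le> norm (sol (complex_of_real x) t)" unfolding v_def by (rule abs_Re_le_cmod)
  also have "\<dots> < r" by (rule picard_regular_lt[OF picard_regular_sol norm_less_r1[OF x] t])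
  finally show ?thesis .
qed

text \<open>Gronwall's inequality against the zero solution. The lower bound keeps the orbit off the
  equilibrium, so that the radius never changes sign; over one turn both bounds confine the orbit to
  an annulus.\<close>

lemma v_bounds:
  assumes x: "0 < x" "x < r1" and t: "t \<in> {0..2*pi}"
  shows "x * exp (- (L * t)) \<le> v x t" "v x t \<le> x * exp (L * t)" "0 < v x t" "v x t < r"
proof -
  have x0: "0 \<le> x" using x by simp
  have le: "\<bar>slope s (v x s)\<bar> \<le> L * \<bar>v x s\<bar>" if "s \<in> {0..2*pi}" for s
    using slope_lipschitz[of "v x s" 0 s] abs_v_less[OF x0 x(2) that] r slope_0 by simp
  have g: "\<bar>v x s\<bar> \<le> \<bar>v x 0\<bar> * exp (L * (s - 0))" "\<bar>v x 0\<bar> * exp (- (L * (s - 0))) \<le> \<bar>v x s\<bar>"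
    if "s \<in> {0..2*pi}" for s
    using gronwall_two_sided[OF v_derivative[OF x0 x(2)] le that] by blast+
  have v0: "v x 0 = x" using v_0[OF x0 x(2)] .
  have nz: "v x s \<noteq> 0" if "s \<in> {0..2*pi}" for s
  proof
    assume "v x s = 0"
    then have "x * exp (- (L * s)) \<le> 0" using g(2)[OF that] v0 x by simp
    moreover have "0 < x * exp (- (L * s))" using x by simp
    ultimately show False by linarith
  qed
  show pos: "0 < v x t"
    using nonvanishing_stays_positive[OF v_continuous[OF x0 x(2)] nz _ t] v0 x by simp
  show "x * exp (- (L * t)) \<le> v x t" "v x t \<le> x * exp (L * t)"
    using g[OF t] v0 pos x by simp_all
  show "v x t < r" using abs_v_less[OF x0 x(2) t] by simp
qed

text \<open>By the lower Gronwall bound for their difference, solutions with different initial radii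
  never meet. Monotonicity of the return map will exclude periodic orbits that close only after
  several turns.\<close>

lemma v_strict_mono:
  assumes x: "0 \<le> x" "x < y" "y < r1" and t: "t \<in> {0..2*pi}"
  shows "v x t < v y t"
proof -
  have y0: "0 \<le> y" and x1: "x < r1" using x by simp_all
  let ?D = "\<lambda>t. v y t - v x t" and ?D' = "\<lambda>t. slope t (v y t) - slope t (v x t)"
  have der: "(?D has_real_derivative ?D' s) (at s within {0..2*pi})" if "s \<in> {0..2*pi}" for s
    by (intro DERIV_diff v_derivative x x1 y0 that)
  have le: "\<bar>?D' s\<bar> \<le> L * \<bar>?D s\<bar>" if "s \<in> {0..2*pi}" for s
    using abs_v_less[OF y0 x(3) that] abs_v_less[OF x(1) x1 that] by (intro slope_lipschitz) auto
  have D0: "?D 0 = y - x" using v_0[OF y0 x(3)] v_0[OF x(1) x1] by simp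
  have nz: "?D s \<noteq> 0" if "s \<in> {0..2*pi}" for s
  proof
    assume "?D s = 0"
    then have "\<bar>?D 0\<bar> * exp (- (L * (s - 0))) \<le> 0"
      using gronwall_two_sided(2)[OF der le that] by simp
    then show False using D0 x by (simp add: mult_le_0_iff)
  qed
  have "0 < ?D t"
  proof (rule nonvanishing_stays_positive[where f = ?D, OF _ nz _ t])
    show "continuous_on {0..2*pi} ?D"
      by (rule continuous_on_diff[OF v_continuous[OF y0 x(3)] v_continuous[OF x(1) x1]])
    show "0 < ?D 0" unfolding D0 using x by simp
  qed
  then show ?thesis by simp
qed

lemma v_lipschitz:
  assumes "0 \<le> x" "x < r1" "0 \<le> y" "y < r1" and t: "t \<in> {0..2*pi}"
  shows "\<bar>v x t - v y t\<bar> \<le> exp (L * t) * \<bar>x - y\<bar>"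
proof -
  have "norm (sol (complex_of_real x) t - sol (complex_of_real y) t) \<le> norm (complex_of_real x - complex_of_real y) * exp (L * t)"
    using picard_regular_sol norm_less_r1 assms unfolding picard_regular_def by blast
  moreover have "norm (complex_of_real x - complex_of_real y) = \<bar>x - y\<bar>"
    by (metis norm_of_real of_real_diff)
  moreover have "\<bar>v x t - v y t\<bar> \<le> norm (sol (complex_of_real x) t - sol (complex_of_real y) t)"
    unfolding v_def using abs_Re_le_cmod by (metis minus_complex.simps(1))
  ultimately show ?thesis by (simp add: mult.commute)
qed

lemma R_periodic_int: "R (t + 2 * pi * of_int k) z = R t z"
proof (induction k rule: int_induct[where k = 0])
  case base
  then show ?case by simp
next
  case (step1 i)
  then show ?case using periodic[of "t + 2 * pi * of_int i" z] by (simp add: algebra_simps)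
next
  case (step2 i)
  then show ?case using periodic[of "t + 2 * pi * of_int (i - 1)" z] by (simp add: algebra_simps)
qed

lemma slope_mod: "slope (t - 2 * pi * of_int k) x = slope t x"
  unfolding slope_def using R_periodic_int[of t "- k"] by simp

lemma polar_mod: "polar p \<rho> (t - 2 * pi * of_int k) = polar p \<rho> t"
proof -
  have "sin (t - 2 * pi * of_int k) = sin t \<and> cos (t - 2 * pi * of_int k) = cos t"
    using sin_cos_eq_iff[of "t - 2 * pi * of_int k" t] by (metis diff_conv_add_uminus mult_minus_right of_int_minus)
  then show ?thesis unfolding polar_def by simp
qed

lemma mod_angle:
  fixes t :: real
  shows "t - 2 * pi * of_int \<lfloor>t / (2 * pi)\<rfloor> \<in> {0..2*pi}"
proof -
  have c: "0 < 2 * pi" by simp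
  have "of_int \<lfloor>t / (2 * pi)\<rfloor> \<le> t / (2 * pi)" "t / (2 * pi) \<le> of_int \<lfloor>t / (2 * pi)\<rfloor> + 1" by linarith+
  then have "of_int \<lfloor>t / (2 * pi)\<rfloor> * (2 * pi) \<le> t" "t \<le> (of_int \<lfloor>t / (2 * pi)\<rfloor> + 1) * (2 * pi)"
    unfolding pos_le_divide_eq[OF c] pos_divide_le_eq[OF c] .
  then show ?thesis unfolding atLeastAtMost_iff distrib_right by (simp add: mult.commute)
qed

text \<open>Extended periodically in the angle, the solution traces a closed curve with velocity F /
  Q; the time change with h = 1 / Q turns the angle back into time.\<close>

lemma fixed_point_periodic_orbit:
  assumes x: "0 < x" "x < r1" and fp: "v x (2*pi) = x"
  shows "periodic_orbit F (curve x)"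
proof -
  have x0: "0 \<le> x" using x by simp
  define w where "w t = v x (t - 2 * pi * of_int \<lfloor>t / (2 * pi)\<rfloor>)" for t
  have w_bounds: "0 < w t" "w t < r" for t
    unfolding w_def using v_bounds[OF x mod_angle] by blast+
  have w_der: "(w has_real_derivative slope t (w t)) (at t)" for t
  proof -
    have s: "slope (2 * pi) (v x (2 * pi)) = slope 0 (v x 0)"
      using slope_mod[of "2*pi" 1] fp v_0[OF x0 x(2)] by simp
    have "(w has_real_derivative slope (t - 2 * pi * of_int \<lfloor>t / (2 * pi)\<rfloor>) (w t)) (at t)"
      unfolding w_def
      by (rule periodic_extension_has_derivative[where D = "\<lambda>t. slope t (v x t)"])
        (use v_derivative[OF x0 x(2)] fp s v_0[OF x0 x(2)] in auto)
    then show ?thesis by (simp only: slope_mod)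
  qed
  have w_per: "w (t + 2 * pi) = w t" for t
  proof -
    have "(t + 2 * pi) / (2 * pi) = t / (2 * pi) + 1" by (simp add: field_simps)
    then show ?thesis unfolding w_def by (simp add: algebra_simps)
  qed
  define \<psi> where "\<psi> t = polar p (w t) t" for t
  define h where "h t = 1 / Q t (w t)" for t
  have Qw: "0 < Q t (w t)" "Q t (w t) \<le> K" for t using w_bounds[of t] Q_pos Q_le by auto
  have \<psi>_eq: "(\<psi> has_vector_derivative h t *\<^sub>R F (\<psi> t)) (at t)" for t
  proof -
    have "(\<psi> has_vector_derivative (0 + (slope t (w t) * cos t + w t * - sin t, slope t (w t) * sin t + w t * cos t))) (at t)"
      unfolding \<psi>_def polar_def
      by (intro has_vector_derivative_add has_vector_derivative_const has_vector_derivative_Pair)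
        (auto intro!: derivative_eq_intros w_der simp flip: has_real_derivative_iff_has_vector_derivative)
    moreover have "h t *\<^sub>R F (\<psi> t) = (slope t (w t) * cos t + w t * - sin t, slope t (w t) * sin t + w t * cos t)"
    proof -
      have s: "w t * N t (w t) = slope t (w t) * Q t (w t)" using slope_eq[of "w t" t] w_bounds[of t] by simp
      have "w t * (N t (w t) * cos t - Q t (w t) * sin t) = Q t (w t) * (slope t (w t) * cos t + w t * - sin t)"
        "w t * (N t (w t) * sin t + Q t (w t) * cos t) = Q t (w t) * (slope t (w t) * sin t + w t * cos t)"
        using s by algebra+
      then show ?thesis
        using F_polar[of "w t" t] w_bounds[of t] Qw(1)[of t] unfolding \<psi>_def h_def by simp
    qed
    ultimately show ?thesis by simp
  qed
  have w_cont: "continuous_on UNIV w"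
    by (intro continuous_at_imp_continuous_on ballI DERIV_isCont[OF w_der])
  have "continuous_on UNIV (\<lambda>t. (\<lambda>(t, \<rho>). Q t \<rho>) (t, w t))"
  proof (rule continuous_on_compose2[OF Q_cont])
    show "continuous_on UNIV (\<lambda>t. (t, w t))" by (intro continuous_on_Pair continuous_on_id w_cont)
    show "(\<lambda>t. (t, w t)) ` UNIV \<subseteq> UNIV \<times> {0..r}"
    proof (rule image_subsetI)
      fix t show "(t, w t) \<in> UNIV \<times> {0..r}" using w_bounds[of t] by simp
    qed
  qed
  then have "continuous_on UNIV (\<lambda>t. Q t (w t))" by simp
  moreover have "Q t (w t) \<noteq> 0" for t using Qw(1)[of t] by simp
  ultimately have h_cont: "continuous_on UNIV h"
    unfolding h_def[abs_def] by (intro continuous_on_divide continuous_on_const) auto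
  have K: "0 < K" using Qw[of 0] by linarith
  have "periodic_orbit F (range \<psi>)"
  proof (rule periodic_orbit_time_change[OF \<psi>_eq h_cont])
    show "1 / K \<le> h t" for t unfolding h_def using Qw[of t] K by (simp add: frac_le)
    show "h (t + 2 * pi) = h t" for t unfolding h_def by (simp add: w_per Q_periodic)
    show "\<psi> (t + 2 * pi) = \<psi> t" for t unfolding \<psi>_def w_per by (simp add: polar_def)
    have "\<psi> pi \<noteq> \<psi> 0"
    proof
      assume "\<psi> pi = \<psi> 0"
      then have "cos pi = cos (0::real)" unfolding \<psi>_def using w_bounds by (metis less_imp_le polar_eq_iff(2))
      then show False by simp
    qed
    then show "\<exists>s. \<psi> s \<noteq> \<psi> 0" by blast
  qed (use K in auto)
  moreover have "range \<psi> = curve x"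
  proof (intro equalityI subsetI)
    fix q assume "q \<in> range \<psi>"
    then obtain t where "q = \<psi> t" by blast
    then have "q = polar p (v x (t - 2 * pi * of_int \<lfloor>t / (2 * pi)\<rfloor>)) (t - 2 * pi * of_int \<lfloor>t / (2 * pi)\<rfloor>)"
      unfolding \<psi>_def w_def polar_mod .
    then show "q \<in> curve x" unfolding curve_def using mod_angle[of t] by (rule image_eqI)
  next
    fix q assume "q \<in> curve x"
    then obtain t where t: "t \<in> {0..2*pi}" "q = polar p (v x t) t" unfolding curve_def by (elim imageE)
    have wv: "w t = v x t"
    proof (cases "t = 2 * pi")
      case True
      then show ?thesis unfolding w_def using fp v_0[OF x0 x(2)] by simp
    next
      case False
      then have "\<lfloor>t / (2 * pi)\<rfloor> = 0" using t(1) by (simp add: floor_eq_iff)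
      then show ?thesis unfolding w_def by simp
    qed
    have "q = \<psi> t" unfolding \<psi>_def t(2) wv ..
    then show "q \<in> range \<psi>" by (rule range_eqI)
  qed
  ultimately show ?thesis by simp
qed

lemma center_inside_curve:
  assumes x: "0 < x" "x < r1" and fp: "v x (2*pi) = x"
  shows "p \<in> inside (curve x)"
  unfolding curve_def using x fp
  by (intro center_in_inside_polar_curve v_continuous v_bounds(3)) (auto simp: v_0)

lemma curve_subset_cball:
  assumes x: "0 < x" "x < r1"
  shows "curve x \<subseteq> cball p (x * exp (L * (2 * pi)))"
proof
  fix q assume "q \<in> curve x"
  then obtain t where t: "t \<in> {0..2*pi}" "q = polar p (v x t) t" unfolding curve_def by (elim imageE)
  have "v x t \<le> x * exp (L * t)" by (rule v_bounds(2)[OF x t(1)])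
  also have "\<dots> \<le> x * exp (L * (2 * pi))" using t(1) x L by (intro mult_left_mono) auto
  finally have "\<bar>v x t\<bar> \<le> x * exp (L * (2 * pi))" using v_bounds(3)[OF x t(1)] by simp
  then have "dist q p \<le> x * exp (L * (2 * pi))" unfolding t(2) dist_polar .
  then show "q \<in> cball p (x * exp (L * (2 * pi)))" by (simp add: dist_commute)
qed

end

section \<open>Lifting arbitrary orbits to polar coordinates\<close>

context polar_field
begin

definition polar_lift :: "(real \<Rightarrow> real \<times> real) \<Rightarrow> (real \<Rightarrow> real) \<Rightarrow> (real \<Rightarrow> real) \<Rightarrow> bool" where
  "polar_lift \<phi> \<rho> \<theta> \<longleftrightarrow> (\<forall>t. \<phi> t = polar p (\<rho> t) (\<theta> t) \<and> 0 < \<rho> t \<and> \<rho> t < r \<and>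
     (\<theta> has_real_derivative Q (\<theta> t) (\<rho> t)) (at t) \<and>
     (\<rho> has_real_derivative slope (\<theta> t) (\<rho> t) * Q (\<theta> t) (\<rho> t)) (at t))"

text \<open>A continuous angle is found by integrating the angular speed (a b' - b a') / \<rho>^2
  along the orbit, not by choosing branches of an argument function. That this angle is correct at
  all times is then a matter of two conserved quantities.\<close>

lemma polar_lift_exists:
  assumes \<phi>: "\<And>t. (\<phi> has_vector_derivative F (\<phi> t)) (at t)"
    and ne: "\<And>t. \<phi> t \<noteq> p" and lt: "\<And>t. dist (\<phi> t) p < r"
  obtains \<rho> \<theta> where "polar_lift \<phi> \<rho> \<theta>"
proof -
  define a b a' b' where "a t = fst (\<phi> t) - fst p" and "b t = snd (\<phi> t) - snd p"
    and "a' t = fst (F (\<phi> t))" and "b' t = snd (F (\<phi> t))" for t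
  define \<rho> where "\<rho> t = sqrt ((a t)\<^sup>2 + (b t)\<^sup>2)" for t
  have \<rho>_dist: "\<rho> t = dist (\<phi> t) p" for t
    unfolding \<rho>_def a_def b_def dist_prod_def dist_real_def by simp
  have \<rho>: "0 < \<rho> t" "\<rho> t < r" for t unfolding \<rho>_dist using ne lt by auto
  have \<rho>2: "(\<rho> t)\<^sup>2 = (a t)\<^sup>2 + (b t)\<^sup>2" for t unfolding \<rho>_def by simp
  have da: "(a has_real_derivative a' t) (at t)" for t
  proof -
    have "((\<lambda>t. fst (\<phi> t)) has_vector_derivative fst (F (\<phi> t))) (at t)"
      by (rule bounded_linear.has_vector_derivative[OF bounded_linear_fst \<phi>])
    then show ?thesis
      unfolding a_def a'_def has_real_derivative_iff_has_vector_derivative[symmetric]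
      by (auto intro!: derivative_eq_intros)
  qed
  have db: "(b has_real_derivative b' t) (at t)" for t
  proof -
    have "((\<lambda>t. snd (\<phi> t)) has_vector_derivative snd (F (\<phi> t))) (at t)"
      by (rule bounded_linear.has_vector_derivative[OF bounded_linear_snd \<phi>])
    then show ?thesis
      unfolding b_def b'_def has_real_derivative_iff_has_vector_derivative[symmetric]
      by (auto intro!: derivative_eq_intros)
  qed
  have d\<rho>: "(\<rho> has_real_derivative (a t * a' t + b t * b' t) / \<rho> t) (at t)" for t
  proof -
    have "0 < (\<rho> t)\<^sup>2" using \<rho>(1)[of t] by simp
    then have pos: "0 < (a t)\<^sup>2 + (b t)\<^sup>2" unfolding \<rho>2 .
    have "((\<lambda>t. (a t)\<^sup>2 + (b t)\<^sup>2) has_real_derivative 2 * (a t * a' t + b t * b' t)) (at t)"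
      by (rule DERIV_cong[OF DERIV_add[OF DERIV_power[OF da, where n = 2] DERIV_power[OF db, where n = 2]]]) (simp add: algebra_simps)
    note chain = DERIV_chain2[where f = sqrt and g = "\<lambda>t. (a t)\<^sup>2 + (b t)\<^sup>2" and x = t, OF DERIV_real_sqrt[OF pos] this]
    have eq: "inverse (sqrt X) / 2 * (2 * Y) = Y / sqrt X" for X Y :: real by (simp add: field_simps)
    show ?thesis using chain unfolding \<rho>_def eq .
  qed
  define \<Omega> where "\<Omega> t = (a t * b' t - b t * a' t) / (\<rho> t)\<^sup>2" for t
  have c\<phi>: "continuous_on UNIV \<phi>"
    by (intro continuous_at_imp_continuous_on ballI has_vector_derivative_continuous[OF \<phi>])
  have cF: "continuous_on UNIV (\<lambda>t. F (\<phi> t))"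
    by (rule continuous_on_compose2[OF F_cont c\<phi>]) simp
  have nz: "(\<rho> t)\<^sup>2 \<noteq> 0" for t using \<rho>(1)[of t] by simp
  have c\<rho>: "continuous_on UNIV \<rho>"
    by (intro continuous_at_imp_continuous_on ballI DERIV_isCont[OF d\<rho>])
  have "continuous_on UNIV (\<lambda>t. a t * b' t - b t * a' t)"
    unfolding a_def b_def a'_def b'_def by (intro continuous_intros c\<phi> cF)
  then have "continuous_on UNIV \<Omega>"
    unfolding \<Omega>_def[abs_def] using nz by (intro continuous_on_divide continuous_on_power c\<rho>) auto
  then obtain G where G: "\<And>t. (G has_real_derivative \<Omega> t) (at t)"
    using continuous_antiderivative_exists by blast
  obtain \<alpha> where \<alpha>: "polar p (dist (\<phi> 0) p) \<alpha> = \<phi> 0" by (rule polar_surj)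
  define \<theta> where "\<theta> t = G t - G 0 + \<alpha>" for t
  have d\<theta>: "(\<theta> has_real_derivative \<Omega> t) (at t)" for t
    unfolding \<theta>_def by (rule DERIV_cong[OF DERIV_add[OF DERIV_diff[OF G DERIV_const] DERIV_const]]) simp
  have dcos: "((\<lambda>t. cos (\<theta> t)) has_real_derivative - sin (\<theta> t) * \<Omega> t) (at t)" for t
    by (rule DERIV_chain2[where f = cos and g = \<theta>, OF DERIV_cos d\<theta>])
  have dsin: "((\<lambda>t. sin (\<theta> t)) has_real_derivative cos (\<theta> t) * \<Omega> t) (at t)" for t
    by (rule DERIV_chain2[where f = sin and g = \<theta>, OF DERIV_sin d\<theta>])
  have \<rho>nz: "\<rho> t \<noteq> 0" for t using \<rho>(1)[of t] by simp
  have init: "a 0 = \<rho> 0 * cos (\<theta> 0)" "b 0 = \<rho> 0 * sin (\<theta> 0)"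
    unfolding a_def b_def \<rho>_dist \<theta>_def by (subst \<alpha>[symmetric], simp add: polar_def)+
  \<comment> \<open>Scalar and cross product of the unit vector (a, b) / \<rho> with (cos \<theta>,
    sin \<theta>). Both turn out constant, and their initial values 1 and 0 force the two vectors to
    agree.\<close>
  define E1 E2 where "E1 t = (a t * cos (\<theta> t) + b t * sin (\<theta> t)) / \<rho> t"
    and "E2 t = (b t * cos (\<theta> t) - a t * sin (\<theta> t)) / \<rho> t" for t
  have cs: "cos x * cos x + sin x * sin x = 1" for x :: real
    using sin_cos_squared_add2[of x] by (simp add: power2_eq_square)
  have \<Omega>2: "\<rho> t * \<rho> t * \<Omega> t = a t * b' t - b t * a' t" for t
    unfolding \<Omega>_def using \<rho>(1)[of t] by (simp add: power2_eq_square)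
  have \<rho>sq: "\<rho> t * \<rho> t = a t * a t + b t * b t" for t using \<rho>2[of t] by (simp add: power2_eq_square)
  have "(E1 has_real_derivative 0) (at t)" for t
  proof -
    define D where "D = a' t * cos (\<theta> t) + - sin (\<theta> t) * \<Omega> t * a t + (b' t * sin (\<theta> t) + cos (\<theta> t) * \<Omega> t * b t)"
    have "(E1 has_real_derivative (D * \<rho> t - (a t * cos (\<theta> t) + b t * sin (\<theta> t)) * ((a t * a' t + b t * b' t) / \<rho> t)) / (\<rho> t * \<rho> t)) (at t)"
      unfolding E1_def[abs_def] D_def
      by (rule DERIV_divide[OF DERIV_add[OF DERIV_mult[OF da dcos] DERIV_mult[OF db dsin]] d\<rho> \<rho>nz])
    moreover have "\<rho> t * \<rho> t * D = (a t * cos (\<theta> t) + b t * sin (\<theta> t)) * (a t * a' t + b t * b' t)"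
      unfolding D_def using \<Omega>2[of t] \<rho>sq[of t] by algebra
    then have "D * \<rho> t - (a t * cos (\<theta> t) + b t * sin (\<theta> t)) * ((a t * a' t + b t * b' t) / \<rho> t) = 0"
      using \<rho>nz[of t] by (simp add: eq_divide_eq mult_ac)
    ultimately show ?thesis by simp
  qed
  then have E1: "E1 t = E1 0" for t using DERIV_isconst_all[of E1 t 0] by blast
  have "(E2 has_real_derivative 0) (at t)" for t
  proof -
    define D where "D = b' t * cos (\<theta> t) + - sin (\<theta> t) * \<Omega> t * b t - (a' t * sin (\<theta> t) + cos (\<theta> t) * \<Omega> t * a t)"
    have "(E2 has_real_derivative (D * \<rho> t - (b t * cos (\<theta> t) - a t * sin (\<theta> t)) * ((a t * a' t + b t * b' t) / \<rho> t)) / (\<rho> t * \<rho> t)) (at t)"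
      unfolding E2_def[abs_def] D_def
      by (rule DERIV_divide[OF DERIV_diff[OF DERIV_mult[OF db dcos] DERIV_mult[OF da dsin]] d\<rho> \<rho>nz])
    moreover have "\<rho> t * \<rho> t * D = (b t * cos (\<theta> t) - a t * sin (\<theta> t)) * (a t * a' t + b t * b' t)"
      unfolding D_def using \<Omega>2[of t] \<rho>sq[of t] by algebra
    then have "D * \<rho> t - (b t * cos (\<theta> t) - a t * sin (\<theta> t)) * ((a t * a' t + b t * b' t) / \<rho> t) = 0"
      using \<rho>nz[of t] by (simp add: eq_divide_eq mult_ac)
    ultimately show ?thesis by simp
  qed
  then have E2: "E2 t = E2 0" for t using DERIV_isconst_all[of E2 t 0] by blast
  have "a 0 * cos (\<theta> 0) + b 0 * sin (\<theta> 0) = \<rho> 0" unfolding init using cs[of "\<theta> 0"] by algebra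
  then have "E1 0 = 1" unfolding E1_def using \<rho>(1)[of 0] by simp
  then have E1': "a t * cos (\<theta> t) + b t * sin (\<theta> t) = \<rho> t" for t
    using E1[of t] \<rho>(1)[of t] unfolding E1_def by (simp add: field_simps)
  have "E2 0 = 0" unfolding E2_def init by simp
  then have E2': "b t * cos (\<theta> t) - a t * sin (\<theta> t) = 0" for t
    using E2[of t] \<rho>(1)[of t] unfolding E2_def by (simp add: field_simps)
  have rot: "x = (x * c + y * s) * c - (y * c - x * s) * s" "y = (x * c + y * s) * s + (y * c - x * s) * c"
    if "c * c + s * s = 1" for x y c s :: real
  proof -
    have "x * (c * c + s * s) = (x * c + y * s) * c - (y * c - x * s) * s" by algebra
    then show "x = (x * c + y * s) * c - (y * c - x * s) * s" unfolding that by simp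
    have "y * (c * c + s * s) = (x * c + y * s) * s + (y * c - x * s) * c" by algebra
    then show "y = (x * c + y * s) * s + (y * c - x * s) * c" unfolding that by simp
  qed
  have ab: "a t = \<rho> t * cos (\<theta> t)" "b t = \<rho> t * sin (\<theta> t)" for t
    using rot[OF cs[of "\<theta> t"], where x = "a t" and y = "b t"] unfolding E1' E2' by simp_all
  have \<phi>_polar: "\<phi> t = polar p (\<rho> t) (\<theta> t)" for t
  proof (rule prod_eqI)
    show "fst (\<phi> t) = fst (polar p (\<rho> t) (\<theta> t))" using ab(1)[of t] unfolding polar_def a_def by simp
    show "snd (\<phi> t) = snd (polar p (\<rho> t) (\<theta> t))" using ab(2)[of t] unfolding polar_def b_def by simp
  qed
  have F\<phi>: "F (\<phi> t) = (\<rho> t * (N (\<theta> t) (\<rho> t) * cos (\<theta> t) - Q (\<theta> t) (\<rho> t) * sin (\<theta> t)),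
      \<rho> t * (N (\<theta> t) (\<rho> t) * sin (\<theta> t) + Q (\<theta> t) (\<rho> t) * cos (\<theta> t)))" for t
    unfolding \<phi>_polar[of t] using \<rho>[of t] by (intro F_polar) auto
  have a'b': "a' t = \<rho> t * (N (\<theta> t) (\<rho> t) * cos (\<theta> t) - Q (\<theta> t) (\<rho> t) * sin (\<theta> t))"
    "b' t = \<rho> t * (N (\<theta> t) (\<rho> t) * sin (\<theta> t) + Q (\<theta> t) (\<rho> t) * cos (\<theta> t))" for t
    unfolding a'_def b'_def F\<phi> by simp_all
  have "polar_lift \<phi> \<rho> \<theta>"
    unfolding polar_lift_def
  proof (intro allI conjI)
    fix t
    have "a t * b' t - b t * a' t = (\<rho> t * \<rho> t) * Q (\<theta> t) (\<rho> t)"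
      unfolding ab a'b' using cs[of "\<theta> t"] by algebra
    then have "\<Omega> t = Q (\<theta> t) (\<rho> t)" unfolding \<Omega>_def using \<rho>(1)[of t] by (simp add: power2_eq_square)
    then show "(\<theta> has_real_derivative Q (\<theta> t) (\<rho> t)) (at t)" using d\<theta>[of t] by simp
    have "a t * a' t + b t * b' t = \<rho> t * (\<rho> t * N (\<theta> t) (\<rho> t))"
      unfolding ab a'b' using cs[of "\<theta> t"] by algebra
    then have "(a t * a' t + b t * b' t) / \<rho> t = \<rho> t * N (\<theta> t) (\<rho> t)" using \<rho>(1)[of t] by simp
    then show "(\<rho> has_real_derivative slope (\<theta> t) (\<rho> t) * Q (\<theta> t) (\<rho> t)) (at t)"
      using d\<rho>[of t] slope_eq[of "\<rho> t" "\<theta> t"] \<rho>[of t] by simp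
  qed (rule \<phi>_polar \<rho>)+
  then show thesis by (rule that)
qed

context
  fixes \<phi> \<rho> \<theta>
  assumes lift: "polar_lift \<phi> \<rho> \<theta>"
begin

lemma lift_polar: "\<phi> t = polar p (\<rho> t) (\<theta> t)" and lift_pos: "0 < \<rho> t" and lift_less: "\<rho> t < r"
  and lift_\<theta>: "(\<theta> has_real_derivative Q (\<theta> t) (\<rho> t)) (at t)"
  and lift_\<rho>: "(\<rho> has_real_derivative slope (\<theta> t) (\<rho> t) * Q (\<theta> t) (\<rho> t)) (at t)"
  using lift unfolding polar_lift_def by auto

lemma lift_Q: "m \<le> Q (\<theta> t) (\<rho> t)" "Q (\<theta> t) (\<rho> t) \<le> K"
  using lift_pos[of t] lift_less[of t] Q_ge Q_le by auto

lemma lift_angle_increasing: "s \<le> t \<Longrightarrow> \<theta> s + m * (t - s) \<le> \<theta> t"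
  using derivative_ge_imp_increment_ge[OF lift_\<theta> lift_Q(1), of s t] by simp

lemma lift_angle_surj: "\<exists>t. \<theta> t = y"
  using derivative_ge_imp_surj[OF lift_\<theta> lift_Q(1) m] .

lemma lift_angle_less_iff: "\<theta> s < \<theta> t \<longleftrightarrow> s < t"
proof -
  have "\<theta> a < \<theta> b" if "a < b" for a b
    using lift_angle_increasing[of a b] that m mult_pos_pos[of m "b - a"] by linarith
  then show ?thesis by (metis linorder_neqE_linordered_idom order_less_asym)
qed

text \<open>Between consecutive passages of the positive ray, the radius and the solution
  \<open>v\<close> read at the current angle obey the same equation in time with the same initial
  value, so Gronwall's inequality identifies them. Thus an orbit not constructed from
  \<open>v\<close> follows the return map, too.\<close>

lemma lift_follows_solution:
  fixes j :: int
  assumes t0: "\<theta> t0 = 2 * pi * j" and t1: "\<theta> t1 = 2 * pi * j + 2 * pi" and small: "\<rho> t0 < r1"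
    and t: "t \<in> {t0..t1}"
  shows "\<theta> t - 2 * pi * j \<in> {0..2*pi}" "\<rho> t = v (\<rho> t0) (\<theta> t - 2 * pi * j)"
proof -
  define x where "x = \<rho> t0"
  have x: "0 \<le> x" "0 < x" "x < r1" using lift_pos[of t0] small by (simp_all add: x_def)
  have rng: "\<theta> s - 2 * pi * j \<in> {0..2*pi}" if "s \<in> {t0..t1}" for s
  proof -
    have "\<theta> t0 \<le> \<theta> s" "\<theta> s \<le> \<theta> t1"
      using that lift_angle_less_iff[of s t0] lift_angle_less_iff[of t1 s] by auto
    then show ?thesis using t0 t1 by simp
  qed
  then show "\<theta> t - 2 * pi * j \<in> {0..2*pi}" using t by blast
  let ?w = "\<lambda>s. v x (\<theta> s - 2 * pi * j)"
  let ?q = "\<lambda>s. Q (\<theta> s) (\<rho> s)"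
  let ?D = "\<lambda>s. \<rho> s - ?w s"
  let ?D' = "\<lambda>s. slope (\<theta> s) (\<rho> s) * ?q s - slope (\<theta> s) (?w s) * ?q s"
  have dw: "(?w has_real_derivative slope (\<theta> s) (?w s) * ?q s) (at s within {t0..t1})" if s: "s \<in> {t0..t1}" for s
  proof -
    have "((v x \<circ> (\<lambda>s. \<theta> s - 2 * pi * j)) has_real_derivative slope (\<theta> s - 2 * pi * j) (?w s) * ?q s) (at s within {t0..t1})"
    proof (rule DERIV_image_chain)
      show "(v x has_real_derivative slope (\<theta> s - 2 * pi * j) (?w s)) (at (\<theta> s - 2 * pi * j) within (\<lambda>s. \<theta> s - 2 * pi * j) ` {t0..t1})"
        by (rule DERIV_subset[OF v_derivative[OF x(1,3) rng[OF s]]]) (intro image_subsetI rng)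
      have "((\<lambda>s. \<theta> s - 2 * pi * j) has_real_derivative ?q s - 0) (at s)"
        by (intro DERIV_diff lift_\<theta> DERIV_const)
      then have "((\<lambda>s. \<theta> s - 2 * pi * j) has_real_derivative ?q s) (at s)" by (simp only: diff_zero)
      then show "((\<lambda>s. \<theta> s - 2 * pi * j) has_real_derivative ?q s) (at s within {t0..t1})"
        by (rule DERIV_subset[OF _ subset_UNIV])
    qed
    then show ?thesis unfolding slope_mod o_def .
  qed
  have der: "(?D has_real_derivative ?D' s) (at s within {t0..t1})" if "s \<in> {t0..t1}" for s
    by (intro DERIV_diff dw that DERIV_subset[OF lift_\<rho> subset_UNIV])
  \<comment> \<open>The factor K appears because time is the independent variable here: the slope is
    multiplied by the angular speed, which is at most K.\<close>
  have le: "\<bar>?D' s\<bar> \<le> (L * K) * \<bar>?D s\<bar>" if "s \<in> {t0..t1}" for s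
  proof -
    have w: "\<bar>?w s\<bar> \<le> r" using abs_v_less[OF x(1,3) rng[OF that]] by simp
    have "\<bar>?D' s\<bar> = \<bar>slope (\<theta> s) (\<rho> s) - slope (\<theta> s) (?w s)\<bar> * ?q s"
      using lift_Q(1)[of s] m by (simp add: left_diff_distrib[symmetric] abs_mult)
    also have "\<dots> \<le> (L * \<bar>?D s\<bar>) * K"
      using lift_Q[of s] m L w lift_pos[of s] lift_less[of s]
      by (intro mult_mono slope_lipschitz) auto
    finally show ?thesis by (simp add: mult_ac)
  qed
  have "?D t0 = 0" unfolding t0 using v_0[OF x(1,3)] by (simp add: x_def)
  then have "\<bar>?D t\<bar> \<le> 0" using gronwall_two_sided(1)[OF der le t] by simp
  then show "\<rho> t = v (\<rho> t0) (\<theta> t - 2 * pi * j)" by (simp add: x_def)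
qed

end

end

section \<open>Fixed points of the return map\<close>

context polar_field
begin

text \<open>A periodic orbit close to the curve crosses the positive ray only near x. Its successive
  crossings are iterates of an increasing map and come back to the start, so they are constant. The
  crossing radius is then a fixed point near x, hence x itself, and the orbit is the curve.\<close>

lemma fixed_point_limit_cycle:
  assumes x: "0 < x" "x < r1" and fp: "v x (2*pi) = x" and \<eta>: "0 < \<eta>"
    and iso: "\<And>z. \<lbrakk>0 < z; z < r1; \<bar>z - x\<bar> < \<eta>; v z (2*pi) = z\<rbrakk> \<Longrightarrow> z = x"
  shows "limit_cycle F (curve x)"
proof -
  have x0: "0 \<le> x" using x by simp
  \<comment> \<open>The bounds by x and r1 - x put every crossing radius within e of x into the
    interval from 0 to r1, where the return map is defined.\<close>
  define e where "e = min \<eta> (min x (r1 - x))"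
  have e: "0 < e" "e \<le> \<eta>" "e \<le> x" "e \<le> r1 - x" using \<eta> x unfolding e_def by auto
  let ?ray = "{q. snd q = snd p \<and> fst p \<le> fst q \<and> e \<le> \<bar>fst q - fst p - x\<bar>}"
  \<comment> \<open>What a competing orbit must avoid: the exterior of the disc, the equilibrium,
    and the points of the positive ray whose radius differs from x by at least e. The compact curve
    is disjoint from this closed set and therefore has a neighbourhood disjoint from it.\<close>
  let ?T = "- ball p r \<union> {p} \<union> ?ray"
  have "closed ?ray"
    by (intro closed_Collect_conj closed_Collect_eq closed_Collect_le continuous_intros)
  then have cT: "closed ?T" by (intro closed_Un closed_Compl open_ball closed_singleton)
  have cont: "continuous_on {0..2*pi} (\<lambda>t. polar p (v x t) t)"
    unfolding polar_def by (intro continuous_intros v_continuous x0 x)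
  have cC: "compact (curve x)"
    unfolding curve_def by (rule compact_continuous_image[OF cont compact_Icc])
  have disj: "curve x \<inter> ?T = {}"
  proof (rule equals0I)
    fix q assume q: "q \<in> curve x \<inter> ?T"
    then obtain t where t: "t \<in> {0..2*pi}" "q = polar p (v x t) t" unfolding curve_def by (auto elim: imageE)
    note vb = v_bounds[OF x t(1)]
    have d: "dist q p = v x t" unfolding t(2) dist_polar using vb by simp
    then have "q \<in> ball p r" "q \<noteq> p" using vb by (auto simp: dist_commute)
    then have r1: "snd q = snd p" "fst p \<le> fst q" "e \<le> \<bar>fst q - fst p - x\<bar>" using q by auto
    have "v x t * sin t = 0" "0 \<le> v x t * cos t" using r1(1,2) unfolding t(2) polar_def by simp_all
    then have st: "sin t = 0" "0 \<le> cos t" using vb by (simp_all add: zero_le_mult_iff)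
    then have "(cos t)\<^sup>2 = 1" using sin_cos_squared_add2[of t] by simp
    then have ct: "cos t = 1" using st(2) unfolding power2_eq_1_iff by linarith
    then have "t = 0 \<or> t = 2 * pi" using equal_angle_cases[of 0 t] t(1) st(1) ct by auto
    then have "v x t = x" using fp v_0[OF x0 x(2)] by auto
    then have "fst q - fst p - x = 0" unfolding t(2) polar_def using ct by simp
    then show False using r1(3) e(1) by simp
  qed
  obtain d where d: "0 < d" "\<And>a b. \<lbrakk>a \<in> curve x; b \<in> ?T\<rbrakk> \<Longrightarrow> d \<le> dist a b"
    using separate_compact_closed[OF cC cT disj] by blast
  define V where "V = (\<Union>q\<in>curve x. ball q d)"
  have V: "open V" "curve x \<subseteq> V" using d(1) unfolding V_def by auto
  have VT: "q \<notin> ?T" if qV: "q \<in> V" for q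
  proof
    assume qT: "q \<in> ?T"
    obtain a where a: "a \<in> curve x" "dist a q < d"
      using qV unfolding V_def UN_iff mem_ball by blast
    from d(2)[OF a(1) qT] a(2) show False by linarith
  qed
  have "\<gamma> = curve x" if orb: "periodic_orbit F \<gamma>" and sub: "\<gamma> \<subseteq> V" for \<gamma>
  proof -
    obtain \<phi> T where T: "T > 0" and \<phi>: "\<And>t. (\<phi> has_vector_derivative F (\<phi> t)) (at t)"
      and per: "\<And>t. \<phi> (t + T) = \<phi> t" and \<gamma>: "\<gamma> = range \<phi>"
      using orb unfolding periodic_orbit_def by blast
    have \<phi>T: "\<phi> t \<notin> ?T" for t using VT sub \<gamma> by blast
    have ne: "\<phi> t \<noteq> p" for t using \<phi>T[of t] by blast
    have lt: "dist (\<phi> t) p < r" for t using \<phi>T[of t] by (simp add: dist_commute)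
    obtain \<rho> \<theta> where lift: "polar_lift \<phi> \<rho> \<theta>" using polar_lift_exists[OF \<phi> ne lt] by blast
    note lp = lift_polar[OF lift] and lpos = lift_pos[OF lift]
    have near: "\<bar>\<rho> t - x\<bar> < e" if "\<theta> t = 2 * pi * real_of_int j" for t j
    proof -
      have "\<phi> t = polar p (\<rho> t) (0 - 2 * pi * real_of_int (- j))" using lp[of t] that by simp
      then have "\<phi> t = polar p (\<rho> t) 0" unfolding polar_mod .
      then have "snd (\<phi> t) = snd p" "fst (\<phi> t) - fst p = \<rho> t" unfolding polar_def by simp_all
      then show ?thesis using \<phi>T[of t] lpos[of t] by auto
    qed
    have "\<forall>j. \<exists>t. \<theta> t = 2 * pi * real_of_int j" using lift_angle_surj[OF lift] by blast
    from choice[OF this] obtain tt where tt: "\<And>j. \<theta> (tt j) = 2 * pi * real_of_int j" by blast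
    define z where "z j = \<rho> (tt j)" for j
    have z: "\<bar>z j - x\<bar> < e" "0 < z j" "z j < r1" for j
      using near[OF tt, of j] lpos[of "tt j"] e unfolding z_def by linarith+
    have tt_Suc: "\<theta> (tt (j + 1)) = 2 * pi * real_of_int j + 2 * pi" for j
      using tt[of "j + 1"] by (simp add: algebra_simps)
    have tt_le: "tt j \<le> tt (j + 1)" for j
      using lift_angle_less_iff[OF lift, of "tt (j + 1)" "tt j"] tt_Suc[of j] tt[of j] by auto
    have follow: "\<theta> t - 2 * pi * j \<in> {0..2*pi}" "\<rho> t = v (z j) (\<theta> t - 2 * pi * j)"
      if "t \<in> {tt j..tt (j + 1)}" for t j
      using lift_follows_solution[OF lift tt tt_Suc z(3)[unfolded z_def] that] unfolding z_def by blast+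
    have step: "z (j + 1) = v (z j) (2 * pi)" for j
      using follow(2)[of "tt (j + 1)" j] tt_le[of j] tt_Suc[of j] unfolding z_def by simp
    have "polar p (\<rho> (tt 0 + T)) (\<theta> (tt 0 + T)) = polar p (\<rho> (tt 0)) (\<theta> (tt 0))"
      using per[of "tt 0"] unfolding lp .
    note eq = polar_eq_iff[OF this lpos less_imp_le[OF lpos]]
    obtain n :: int where n: "\<theta> (tt 0 + T) = \<theta> (tt 0) + 2 * pi * n"
      using sin_cos_eq_iff[of "\<theta> (tt 0 + T)" "\<theta> (tt 0)"] eq(2,3) by blast
    have "\<theta> (tt 0) < \<theta> (tt 0 + T)" using lift_angle_less_iff[OF lift] T by simp
    then have "0 < 2 * pi * n" using n by linarith
    then have n1: "1 \<le> n" by (simp add: zero_less_mult_iff)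
    have "\<theta> (tt 0 + T) = \<theta> (tt n)" using n tt[of 0] tt[of n] by simp
    then have "tt 0 + T = tt n"
      using lift_angle_less_iff[OF lift, of "tt 0 + T" "tt n"] lift_angle_less_iff[OF lift, of "tt n" "tt 0 + T"] by linarith
    then have zn: "z n = z 0" using eq(1) unfolding z_def by simp
    define y where "y k = z (int k)" for k
    have ystep: "y (Suc k) = v (y k) (2 * pi)" for k
      unfolding y_def using step[of "int k"] by (simp add: add.commute)
    have ypos: "0 \<le> y k" "y k < r1" for k using z[of "int k"] unfolding y_def by simp_all
    have pi2: "2 * pi \<in> {0..2*pi}" by simp
    have yn: "y (nat n) = y 0" "0 < nat n" using zn n1 unfolding y_def by simp_all
    \<comment> \<open>An increasing map propagates a first increase to every later step, so the
      crossings could not return to their start after \<open>nat n\<close> turns. The decreasing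
      case is symmetric.\<close>
    have "\<not> y 0 < y (Suc 0)"
    proof
      assume a: "y 0 < y (Suc 0)"
      have "y k < y (Suc k)" for k
      proof (induction k)
        case (Suc k)
        then show ?case using v_strict_mono[OF ypos(1) Suc ypos(2) pi2] ystep by simp
      qed (rule a)
      then have "y 0 < y (nat n)" using yn(2) by (rule lift_Suc_mono_less)
      then show False using yn by simp
    qed
    moreover have "\<not> y (Suc 0) < y 0"
    proof
      assume a: "y (Suc 0) < y 0"
      have "- y k < - y (Suc k)" for k
      proof (induction k)
        case (Suc k)
        then have "y (Suc k) < y k" by simp
        then show ?case using v_strict_mono[OF ypos(1) _ ypos(2) pi2, of "Suc k" k] ystep by simp
      qed (use a in simp)
      then have "- y 0 < - y (nat n)" using yn(2) by (rule lift_Suc_mono_less)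
      then show False using yn by simp
    qed
    ultimately have "v (y 0) (2 * pi) = y 0" using ystep[of 0] by simp
    moreover have "\<bar>y 0 - x\<bar> < \<eta>" "0 < y 0" using z(1,2)[of 0] e unfolding y_def by simp_all
    ultimately have y0: "y 0 = x" using iso[of "y 0"] ypos[of 0] by blast
    have yx: "y k = x" for k
      by (induction k) (use y0 ystep fp in auto)
    have zx: "z j = x" if "0 \<le> j" for j
      using yx[of "nat j"] that unfolding y_def by simp
    have perk: "\<phi> (t + real k * T) = \<phi> t" for t k
    proof (induction k)
      case (Suc k)
      have "\<phi> (t + real (Suc k) * T) = \<phi> ((t + real k * T) + T)" by (simp add: algebra_simps)
      then show ?case unfolding per Suc .
    qed simp
    show ?thesis
    proof (intro equalityI subsetI)
      fix q assume "q \<in> \<gamma>"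
      then obtain t where t: "q = \<phi> t" unfolding \<gamma> by blast
      \<comment> \<open>The point is moved by whole periods to a time after the crossing
        \<open>tt 0\<close>, because the crossing radii are known to be x only for nonnegative
        indices.\<close>
      obtain k :: nat where "(tt 0 - t) / T < real k" using reals_Archimedean2 by blast
      then have k: "tt 0 < t + real k * T" using T by (simp add: field_simps)
      define s where "s = t + real k * T"
      have qs: "q = \<phi> s" unfolding s_def t perk ..
      define j where "j = \<lfloor>\<theta> s / (2 * pi)\<rfloor>"
      have "\<theta> (tt 0) < \<theta> s" using lift_angle_less_iff[OF lift] k unfolding s_def by blast
      then have "0 < \<theta> s" using tt[of 0] by simp
      then have j0: "0 \<le> j" unfolding j_def by simp
      have "\<theta> s - 2 * pi * j \<in> {0..2*pi}" unfolding j_def by (rule mod_angle)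
      then have "\<theta> (tt j) \<le> \<theta> s" "\<theta> s \<le> \<theta> (tt (j + 1))" using tt[of j] tt_Suc[of j] by simp_all
      then have sj: "s \<in> {tt j..tt (j + 1)}"
        using lift_angle_less_iff[OF lift, of s "tt j"] lift_angle_less_iff[OF lift, of "tt (j + 1)" s]
        unfolding atLeastAtMost_iff by linarith
      have "q = polar p (\<rho> s) (\<theta> s - 2 * pi * j)" unfolding qs lp polar_mod ..
      also have "\<rho> s = v x (\<theta> s - 2 * pi * j)" using follow(2)[OF sj] zx[OF j0] by simp
      finally show "q \<in> curve x" unfolding curve_def using follow(1)[OF sj] by (rule image_eqI)
    next
      fix q assume "q \<in> curve x"
      then obtain a where a: "a \<in> {0..2*pi}" "q = polar p (v x a) a" unfolding curve_def by (elim imageE)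
      obtain s where s: "\<theta> s = a" using lift_angle_surj[OF lift] by blast
      have "\<theta> (tt 0) \<le> \<theta> s" "\<theta> s \<le> \<theta> (tt (0 + 1))" using a(1) s tt[of 0] tt_Suc[of 0] by simp_all
      then have "s \<in> {tt 0..tt (0 + 1)}"
        using lift_angle_less_iff[OF lift, of s "tt 0"] lift_angle_less_iff[OF lift, of "tt (0 + 1)" s]
        unfolding atLeastAtMost_iff by linarith
      from follow(2)[OF this] have "\<rho> s = v x a" using zx[of 0] s by simp
      then have "q = \<phi> s" unfolding lp s a(2) by simp
      then show "q \<in> \<gamma>" unfolding \<gamma> by (rule range_eqI)
    qed
  qed
  then show ?thesis
    unfolding limit_cycle_def using fixed_point_periodic_orbit[OF x fp] V by blast
qed

text \<open>The displacement extends holomorphically to a disc. One radius y with nonzero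
  displacement shows that it is not identically zero, so its zeros are isolated, in particular along
  the real axis.\<close>

lemma displacement_zero_isolated:
  assumes x: "0 < x" "x < r1" and fp: "v x (2*pi) = x"
    and y: "0 < y" "y < r1" "v y (2*pi) \<noteq> y"
  obtains \<eta> where "0 < \<eta>" "\<And>z. \<lbrakk>0 < z; z < r1; \<bar>z - x\<bar> < \<eta>; v z (2*pi) = z\<rbrakk> \<Longrightarrow> z = x"
proof -
  define d where "d z = sol z (2*pi) - z" for z
  have pi2: "2 * pi \<in> {0..2*pi}" by simp
  have hol: "d holomorphic_on ball 0 r1"
    unfolding d_def by (intro holomorphic_on_diff holomorphic_sol pi2 holomorphic_on_ident)
  have dv: "d (complex_of_real z) = complex_of_real (v z (2*pi) - z)" if "0 < z" "z < r1" for z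
    unfolding d_def using v_complex[OF _ that(2) pi2] that by simp
  have "d (complex_of_real x) = 0" using dv[OF x] fp by simp
  moreover have "d (complex_of_real y) \<noteq> 0" unfolding dv[OF y(1,2)] of_real_eq_0_iff using y(3) by simp
  ultimately obtain \<eta> where \<eta>: "0 < \<eta>" "\<And>w. w \<in> ball (complex_of_real x) \<eta> - {complex_of_real x} \<Longrightarrow> d w \<noteq> 0"
    using isolated_zeros[OF hol open_ball connected_ball, of "complex_of_real x" "complex_of_real y"] x y
    by (metis dist_0_norm less_imp_le mem_ball norm_of_real abs_of_nonneg)
  have "z = x" if z: "0 < z" "z < r1" "\<bar>z - x\<bar> < \<eta>" "v z (2*pi) = z" for z
  proof (rule ccontr)
    assume "z \<noteq> x"
    moreover have "dist (complex_of_real x) (complex_of_real z) < \<eta>"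
      using z(3) by (metis abs_minus_commute dist_of_real dist_real_def)
    ultimately have "d (complex_of_real z) \<noteq> 0" using \<eta>(2)[of "complex_of_real z"] by simp
    then show False using dv[OF z(1,2)] z(4) by simp
  qed
  with \<eta>(1) show thesis by (rule that)
qed

lemma curve_inj:
  assumes "0 < x" "x < r1" "v x (2*pi) = x" "0 < y" "y < r1" "v y (2*pi) = y" "curve x = curve y"
  shows "x = y"
proof -
  have vx0: "v x 0 = x" and vy0: "v y 0 = y" using assms by (simp_all add: v_0)
  have "polar p (v x 0) 0 \<in> curve x" unfolding curve_def by (rule imageI) simp
  then have "polar p (v x 0) 0 \<in> curve y" unfolding assms(7) .
  then obtain t where t: "t \<in> {0..2*pi}" "polar p (v x 0) 0 = polar p (v y t) t"
    unfolding curve_def by (elim imageE)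
  have vt: "0 \<le> v y t" using v_bounds(3)[OF assms(4,5) t(1)] by simp
  have x0: "0 < v x 0" using vx0 assms by simp
  note e = polar_eq_iff[OF t(2) x0 vt]
  have "t = 0 \<or> t = 2 * pi" using equal_angle_cases[of 0 t] t(1) e(2,3) by auto
  then show ?thesis using e(1) vx0 vy0 assms(6) by auto
qed

text \<open>Between consecutive test radii the intermediate value theorem gives a fixed point, n of
  them for n + 1 radii. Different fixed points give different curves, since each curve meets the
  positive ray only at its initial radius.\<close>

lemma limit_cycles_from_sign_changes:
  fixes z :: "nat \<Rightarrow> real"
  assumes z: "\<And>i. i \<le> n \<Longrightarrow> 0 < z i" "\<And>i. i \<le> n \<Longrightarrow> z i < r1" "\<And>i. i < n \<Longrightarrow> z (Suc i) < z i"
    and sgn: "\<And>i. i \<le> n \<Longrightarrow> 0 < (-1) ^ i * (v (z i) (2*pi) - z i)"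
    and bd: "\<And>i. i \<le> n \<Longrightarrow> cball p (z i * exp (L * (2*pi))) \<subseteq> U"
  shows "\<exists>C. finite C \<and> card C = n \<and> (\<forall>\<gamma>\<in>C. limit_cycle F \<gamma> \<and> \<gamma> \<subseteq> U \<and> p \<in> inside \<gamma>)"
proof -
  let ?d = "\<lambda>y. v y (2*pi) - y"
  have pi2: "2 * pi \<in> {0..2*pi}" by simp
  have cont: "continuous_on {a..b} ?d" if "0 < a" "b < r1" for a b
  proof -
    have "(exp (L * (2*pi)))-lipschitz_on {a..b} (\<lambda>y. v y (2*pi))"
      using that by (intro lipschitz_onI) (auto simp: dist_real_def intro!: v_lipschitz)
    then show ?thesis by (intro continuous_on_diff lipschitz_on_continuous_on continuous_on_id)
  qed
  have "\<exists>y. z (Suc i) < y \<and> y < z i \<and> ?d y = 0" if i: "i < n" for i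
  proof -
    have i': "i \<le> n" "Suc i \<le> n" using i by simp_all
    note c = cont[OF z(1)[OF i'(2)] z(2)[OF i'(1)]]
    have s: "0 < (-1) ^ i * ?d (z i)" "(-1) ^ i * ?d (z (Suc i)) < 0" using sgn[OF i'(1)] sgn[OF i'(2)] by auto
    have "continuous_on {z (Suc i)..z i} (\<lambda>y. (-1) ^ i * ?d y)" by (intro continuous_on_mult continuous_on_const c)
    then obtain y where y: "z (Suc i) \<le> y" "y \<le> z i" "(-1) ^ i * ?d y = 0"
      using IVT'[of "\<lambda>y. (-1) ^ i * ?d y" "z (Suc i)" 0 "z i"] s z(3)[OF i] by auto
    then have "y \<noteq> z i" "y \<noteq> z (Suc i)" using s by auto
    then have "z (Suc i) < y" "y < z i" using y(1,2) by linarith+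
    moreover have "?d y = 0" using y(3) by simp
    ultimately show ?thesis by blast
  qed
  then have "\<forall>i. \<exists>y. i < n \<longrightarrow> z (Suc i) < y \<and> y < z i \<and> ?d y = 0" by blast
  from choice[OF this] obtain y where y: "\<And>i. i < n \<Longrightarrow> z (Suc i) < y i \<and> y i < z i \<and> ?d (y i) = 0" by blast
  have ypos: "0 < y i" "y i < r1" "v (y i) (2*pi) = y i" if "i < n" for i
    using y[OF that] z(1)[of "Suc i"] z(2)[of i] that by auto
  have zmono: "z j \<le> z i" if "i \<le> j" "j \<le> n" for i j
    using that
  proof (induction j rule: dec_induct)
    case (step k)
    then show ?case using z(3)[of k] by simp
  qed simp
  have yless: "y j < y i" if "i < j" "j < n" for i j
    using y[of i] y[of j] zmono[of "Suc i" j] that by auto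
  let ?C = "(\<lambda>i. curve (y i)) ` {..<n}"
  have "inj_on (\<lambda>i. curve (y i)) {..<n}"
  proof (rule inj_onI)
    fix i j assume ij: "i \<in> {..<n}" "j \<in> {..<n}" "curve (y i) = curve (y j)"
    then have "y i = y j" using curve_inj ypos by (metis lessThan_iff)
    then show "i = j" using yless[of i j] yless[of j i] ij by (metis lessThan_iff linorder_neqE_nat order_less_irrefl)
  qed
  then have "card ?C = n" by (simp add: card_image)
  moreover have "limit_cycle F (curve (y i)) \<and> curve (y i) \<subseteq> U \<and> p \<in> inside (curve (y i))" if i: "i < n" for i
  proof (intro conjI)
    \<comment> \<open>The outermost test radius witnesses that the displacement is not identically
      zero.\<close>
    have "v (z 0) (2*pi) \<noteq> z 0" using sgn[of 0] by auto
    then obtain \<eta> where "0 < \<eta>" "\<And>w. \<lbrakk>0 < w; w < r1; \<bar>w - y i\<bar> < \<eta>; v w (2*pi) = w\<rbrakk> \<Longrightarrow> w = y i"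
      using displacement_zero_isolated[OF ypos[OF i] z(1)[of 0] z(2)[of 0]] by auto
    then show "limit_cycle F (curve (y i))" by (rule fixed_point_limit_cycle[OF ypos[OF i]])
    have "y i * exp (L * (2*pi)) \<le> z i * exp (L * (2*pi))" using y[OF i] by (intro mult_right_mono) auto
    then have "cball p (y i * exp (L * (2*pi))) \<subseteq> cball p (z i * exp (L * (2*pi)))" by (rule subset_cball)
    then show "curve (y i) \<subseteq> U" using curve_subset_cball[OF ypos(1,2)[OF i]] bd[of i] i by auto
    show "p \<in> inside (curve (y i))" by (rule center_inside_curve[OF ypos[OF i]])
  qed
  ultimately show ?thesis by (intro exI[of _ ?C]) auto
qed

text \<open>With all radii fixed, it remains to see that each point q near p lies on one of the
  curves: at the angle t of q the radius \<open>v x t\<close> depends continuously on x and takes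
  the value \<open>dist q p\<close>.\<close>

lemma center_from_return_identity:
  assumes fp: "\<And>x. \<lbrakk>0 < x; x < r1\<rbrakk> \<Longrightarrow> v x (2*pi) = x"
  shows "center F p"
proof -
  have Fp: "F p = 0"
    using F_polar[of 0 0] r by (simp add: polar_def zero_prod_def[symmetric])
  have "\<exists>\<gamma>. periodic_orbit F \<gamma> \<and> q \<in> \<gamma> \<and> p \<in> inside \<gamma>"
    if q: "q \<in> ball p (r1 / (2 * exp (L * (2*pi)))) - {p}" for q
  proof -
    define E where "E = exp (L * (2*pi))"
    have E: "1 \<le> E" unfolding E_def using L by simp
    \<comment> \<open>Radii change at most by the factor E in either direction. Hence the solution
      from \<open>dist q p * E\<close> is at angle t at least as far out as q, and the one from
      \<open>dist q p / (2 * E)\<close> at most as far. The ball around p is small enough for both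
      initial radii to lie below \<open>r1\<close>.\<close>
    define y where "y = dist q p * E"
    have d: "0 < dist q p" "dist q p < r1 / (2 * E)" using q unfolding E_def by (auto simp: dist_commute)
    then have y: "0 < y" "y < r1" using E r1 unfolding y_def by (auto simp: field_simps)
    obtain t where "0 \<le> t" "t < 2 * pi" and qt: "polar p (dist q p) t = q" by (rule polar_surj)
    then have t: "t \<in> {0..2*pi}" by simp
    have "exp (L * t) \<le> E" unfolding E_def using t L by auto
    then have "dist q p * exp (L * t) \<le> y" unfolding y_def using d(1) by (intro mult_left_mono) auto
    then have "dist q p * exp (L * t) * exp (- (L * t)) \<le> y * exp (- (L * t))" by (intro mult_right_mono) auto
    then have up: "dist q p \<le> v y t" using v_bounds(1)[OF y t] by (simp add: mult.assoc flip: exp_add)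
    define x1 where "x1 = dist q p / (2 * E)"
    have x1: "0 < x1" "x1 \<le> y" "x1 < r1"
    proof -
      show "0 < x1" unfolding x1_def using d E by simp
      have "x1 \<le> dist q p" unfolding x1_def using d E by (simp add: field_simps)
      also have "\<dots> \<le> y" unfolding y_def using d E by simp
      finally show "x1 \<le> y" .
      then show "x1 < r1" using y by simp
    qed
    have "v x1 t \<le> x1 * exp (L * t)" by (rule v_bounds(2)[OF x1(1,3) t])
    also have "\<dots> \<le> x1 * E" using \<open>exp (L * t) \<le> E\<close> x1 by (intro mult_left_mono) auto
    also have "\<dots> \<le> dist q p" unfolding x1_def using d E by (simp add: field_simps)
    finally have low: "v x1 t \<le> dist q p" .
    have "(exp (L * t))-lipschitz_on {x1..y} (\<lambda>x. v x t)"
      using x1 y t by (intro lipschitz_onI) (auto simp: dist_real_def intro!: v_lipschitz)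
    then have "continuous_on {x1..y} (\<lambda>x. v x t)" by (rule lipschitz_on_continuous_on)
    then obtain x where x: "x1 \<le> x" "x \<le> y" "v x t = dist q p"
      using IVT'[of "\<lambda>x. v x t" x1 "dist q p" y] low up x1(2) by auto
    then have xb: "0 < x" "x < r1" using x1 y by auto
    have "q \<in> curve x" unfolding curve_def using qt x(3) t by (intro image_eqI[of _ _ t]) auto
    then show ?thesis
      using fixed_point_periodic_orbit[OF xb fp[OF xb]] center_inside_curve[OF xb fp[OF xb]] by blast
  qed
  moreover have "0 < r1 / (2 * exp (L * (2*pi)))" using r1 by simp
  ultimately show ?thesis
    unfolding center_def equilibrium_def using Fp
    by (intro conjI exI[of _ "ball p (r1 / (2 * exp (L * (2*pi))))"]) auto
qed

end

section \<open>Quadratic Kolmogorov factors\<close>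

context polar_field
begin

lemma polar_solution_derivative:
  assumes x: "0 < x" "x < r1" and t: "t \<in> {0..2*pi}"
  shows "((\<lambda>t. polar p (v x t) t) has_vector_derivative (1 / Q t (v x t)) *\<^sub>R F (polar p (v x t) t)) (at t within {0..2*pi})"
proof -
  let ?w = "v x t"
  have x0: "0 \<le> x" using x by simp
  note b = v_bounds[OF x t]
  have Qw: "0 < Q t ?w" using b by (intro Q_pos) auto
  have d1: "((\<lambda>t. v x t * cos t) has_real_derivative slope t ?w * cos t + - sin t * ?w) (at t within {0..2*pi})"
    by (rule DERIV_mult[OF v_derivative[OF x0 x(2) t] has_field_derivative_at_within[OF DERIV_cos]])
  have d2: "((\<lambda>t. v x t * sin t) has_real_derivative slope t ?w * sin t + cos t * ?w) (at t within {0..2*pi})"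
    by (rule DERIV_mult[OF v_derivative[OF x0 x(2) t] has_field_derivative_at_within[OF DERIV_sin]])
  have "((\<lambda>t. polar p (v x t) t) has_vector_derivative (0 + (slope t ?w * cos t + - sin t * ?w, slope t ?w * sin t + cos t * ?w))) (at t within {0..2*pi})"
    unfolding polar_def
    by (intro has_vector_derivative_add has_vector_derivative_const has_vector_derivative_Pair
        d1[unfolded has_real_derivative_iff_has_vector_derivative] d2[unfolded has_real_derivative_iff_has_vector_derivative])
  moreover have "(1 / Q t ?w) *\<^sub>R F (polar p ?w t) = (slope t ?w * cos t + - sin t * ?w, slope t ?w * sin t + cos t * ?w)"
  proof -
    have s: "?w * N t ?w = slope t ?w * Q t ?w" using slope_eq[of ?w t] b by simp
    have e1: "?w * (N t ?w * cos t - Q t ?w * sin t) = Q t ?w * (slope t ?w * cos t + - sin t * ?w)"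
      using s by algebra
    have e2: "?w * (N t ?w * sin t + Q t ?w * cos t) = Q t ?w * (slope t ?w * sin t + cos t * ?w)"
      using s by algebra
    have Fp: "F (polar p ?w t) = (?w * (N t ?w * cos t - Q t ?w * sin t), ?w * (N t ?w * sin t + Q t ?w * cos t))"
      using b by (intro F_polar) auto
    show ?thesis unfolding Fp e1 e2 using Qw by simp
  qed
  ultimately show ?thesis by simp
qed

lemma v_in_annulus:
  assumes x: "0 < x" "x < r1" and t: "t \<in> {0..2*pi}"
  shows "x * exp (- (L * (2*pi))) \<le> v x t" "v x t \<le> x * exp (L * (2*pi))"
proof -
  have e: "exp (L * t) \<le> exp (L * (2*pi))" "exp (- (L * (2*pi))) \<le> exp (- (L * t))" using t L by auto
  show "v x t \<le> x * exp (L * (2*pi))"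
    using v_bounds(2)[OF x t] mult_left_mono[OF e(1), of x] x by linarith
  show "x * exp (- (L * (2*pi))) \<le> v x t"
    using v_bounds(1)[OF x t] mult_left_mono[OF e(2), of x] x by linarith
qed

lemma ray_in_annulus:
  assumes x: "0 < x"
  shows "x * exp (- (L * (2*pi))) \<le> x" "x \<le> x * exp (L * (2*pi))"
  using x L by simp_all

text \<open>Mean value theorem along the orbit with the angle as parameter. The change of V over a
  turn is 2 pi times its derivative at a single angle, so a pointwise sign of the derivative along F
  decides it and nothing has to be integrated.\<close>

lemma first_return_along_function:
  fixes V :: "real \<times> real \<Rightarrow> real"
  assumes x: "0 < x" "x < r1"
    and V: "\<And>q. \<lbrakk>x * exp (- (L * (2*pi))) \<le> dist q p; dist q p \<le> x * exp (L * (2*pi))\<rbrakk> \<Longrightarrow> (V has_derivative V' q) (at q)"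
  shows "\<exists>t\<in>{0<..<2*pi}. V (polar p (v x (2*pi)) 0) - V (polar p x 0)
      = 2 * pi * ((1 / Q t (v x t)) * V' (polar p (v x t) t) (F (polar p (v x t) t)))"
proof -
  let ?g = "\<lambda>t. polar p (v x t) t"
  let ?D = "\<lambda>t. (1 / Q t (v x t)) * V' (?g t) (F (?g t))"
  have der: "((V \<circ> ?g) has_vector_derivative ?D t) (at t within {0..2*pi})" if t: "t \<in> {0..2*pi}" for t
  proof -
    have "dist (?g t) p = v x t" using v_bounds(3)[OF x t] by (simp add: dist_polar)
    then have V': "(V has_derivative V' (?g t)) (at (?g t))" using v_in_annulus[OF x t] by (intro V) simp_all
    have "((V \<circ> ?g) has_vector_derivative V' (?g t) ((1 / Q t (v x t)) *\<^sub>R F (?g t))) (at t within {0..2*pi})"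
      by (rule vector_derivative_diff_chain_within[OF polar_solution_derivative[OF x t] has_derivative_at_withinI[OF V']])
    also have "V' (?g t) ((1 / Q t (v x t)) *\<^sub>R F (?g t)) = ?D t"
      using linear_scale[OF has_derivative_linear[OF V']] by simp
    finally show ?thesis .
  qed
  then have rder: "((V \<circ> ?g) has_real_derivative ?D t) (at t within {0..2*pi})" if "t \<in> {0..2*pi}" for t
    using that unfolding has_real_derivative_iff_has_vector_derivative by blast
  have "continuous_on {0..2*pi} (V \<circ> ?g)" by (rule DERIV_continuous_on[OF rder])
  moreover have "((V \<circ> ?g) has_real_derivative ?D t) (at t)" if "0 < t" "t < 2*pi" for t
    using rder[of t] that by (simp add: at_within_Icc_at)
  ultimately obtain l t where t: "0 < t" "t < 2*pi" "((V \<circ> ?g) has_real_derivative l) (at t)"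
    "(V \<circ> ?g) (2*pi) - (V \<circ> ?g) 0 = (2*pi - 0) * l"
    using MVT[of 0 "2*pi" "V \<circ> ?g"] by (auto simp: real_differentiable_def)
  have "l = ?D t" using DERIV_unique[OF t(3)] rder[of t] t(1,2) by (simp add: at_within_Icc_at)
  moreover have "(V \<circ> ?g) (2*pi) = V (polar p (v x (2*pi)) 0)" by (simp add: polar_def)
  moreover have "(V \<circ> ?g) 0 = V (polar p x 0)" using v_0[of x] x by simp
  ultimately show ?thesis using t by (intro bexI[of _ t]) auto
qed

lemma ray_increment:
  fixes V :: "real \<times> real \<Rightarrow> real"
  assumes ab: "a < b"
    and V: "\<And>\<rho>. \<lbrakk>a \<le> \<rho>; \<rho> \<le> b\<rbrakk> \<Longrightarrow> (V has_derivative V' (polar p \<rho> 0)) (at (polar p \<rho> 0))"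
    and neg: "\<And>\<rho>. \<lbrakk>a \<le> \<rho>; \<rho> \<le> b\<rbrakk> \<Longrightarrow> V' (polar p \<rho> 0) (1, 0) < 0"
  shows "V (polar p b 0) < V (polar p a 0)"
proof (rule DERIV_neg_imp_decreasing[OF ab])
  fix \<rho> assume \<rho>: "a \<le> \<rho>" "\<rho> \<le> b"
  have "((\<lambda>\<rho>. p + (\<rho>, 0)) has_vector_derivative (0 + (1, 0))) (at \<rho>)"
    by (intro has_vector_derivative_add has_vector_derivative_const has_vector_derivative_Pair has_vector_derivative_id)
  then have "((\<lambda>\<rho>. polar p \<rho> 0) has_vector_derivative (0 + (1, 0))) (at \<rho>)"
    unfolding polar_def by simp
  then have "((V \<circ> (\<lambda>\<rho>. polar p \<rho> 0)) has_vector_derivative V' (polar p \<rho> 0) (0 + (1, 0))) (at \<rho>)"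
    by (rule vector_derivative_diff_chain_within[where f = "\<lambda>\<rho>. polar p \<rho> 0" and g = V and x = \<rho>, OF _ has_derivative_at_withinI[OF V[OF \<rho>]]])
  then have "((\<lambda>\<rho>. V (polar p \<rho> 0)) has_real_derivative V' (polar p \<rho> 0) (1, 0)) (at \<rho>)"
    unfolding has_real_derivative_iff_has_vector_derivative o_def by simp
  then show "\<exists>y. ((\<lambda>\<rho>. V (polar p \<rho> 0)) has_real_derivative y) (at \<rho>) \<and> y < 0"
    using neg[OF \<rho>] by blast
qed

text \<open>V decreases with the radius on the positive ray, so comparing V at the two ends of a
  turn compares the two radii; this is the reason for the reversed sign in the first claim. The
  annulus of the hypotheses contains the whole turn and the segment of the ray between its
  ends.\<close>

lemma return_sign:
  fixes V :: "real \<times> real \<Rightarrow> real"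
  assumes x: "0 < x" "x < r1"
    and V: "\<And>q. \<lbrakk>x * exp (- (L * (2*pi))) \<le> dist q p; dist q p \<le> x * exp (L * (2*pi))\<rbrakk> \<Longrightarrow> (V has_derivative V' q) (at q)"
    and ray: "\<And>\<rho>. \<lbrakk>x * exp (- (L * (2*pi))) \<le> \<rho>; \<rho> \<le> x * exp (L * (2*pi))\<rbrakk> \<Longrightarrow> V' (polar p \<rho> 0) (1, 0) < 0"
  shows "(\<And>q. \<lbrakk>x * exp (- (L * (2*pi))) \<le> dist q p; dist q p \<le> x * exp (L * (2*pi))\<rbrakk> \<Longrightarrow> 0 < \<sigma> * V' q (F q))
      \<Longrightarrow> \<sigma> * (v x (2*pi) - x) < 0"
    and "(\<And>q. \<lbrakk>x * exp (- (L * (2*pi))) \<le> dist q p; dist q p \<le> x * exp (L * (2*pi))\<rbrakk> \<Longrightarrow> V' q (F q) = 0)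
      \<Longrightarrow> v x (2*pi) = x"
proof -
  have pi2: "2 * pi \<in> {0..2*pi}" by simp
  let ?y = "v x (2*pi)"
  note an = v_in_annulus[OF x] and rn = ray_in_annulus[OF x(1)]
  have pos: "0 < x * exp (- (L * (2*pi)))" using x by simp
  have Vray: "(V has_derivative V' (polar p \<rho> 0)) (at (polar p \<rho> 0))"
    if "x * exp (- (L * (2*pi))) \<le> \<rho>" "\<rho> \<le> x * exp (L * (2*pi))" for \<rho>
    using that pos by (intro V) (simp_all add: dist_polar)
  have lt: "V (polar p x 0) < V (polar p ?y 0)" if "?y < x"
    by (rule ray_increment[OF that]) (use an[OF pi2] rn in \<open>auto intro!: Vray ray\<close>)
  have gt: "V (polar p ?y 0) < V (polar p x 0)" if "x < ?y"
    by (rule ray_increment[OF that]) (use an[OF pi2] rn in \<open>auto intro!: Vray ray\<close>)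
  obtain t where t: "t \<in> {0<..<2*pi}" and eq: "V (polar p ?y 0) - V (polar p x 0)
      = 2 * pi * ((1 / Q t (v x t)) * V' (polar p (v x t) t) (F (polar p (v x t) t)))"
    using first_return_along_function[OF x V] by blast
  have t': "t \<in> {0..2*pi}" using t by simp
  let ?q = "polar p (v x t) t"
  have dq: "dist ?q p = v x t" using v_bounds(3)[OF x t'] by (simp add: dist_polar)
  have Qp: "0 < 1 / Q t (v x t)" using Q_pos[of "v x t" t] v_bounds[OF x t'] by simp
  show "\<sigma> * (?y - x) < 0"
    if H: "\<And>q. \<lbrakk>x * exp (- (L * (2*pi))) \<le> dist q p; dist q p \<le> x * exp (L * (2*pi))\<rbrakk> \<Longrightarrow> 0 < \<sigma> * V' q (F q)"
  proof -
    have a: "0 < \<sigma> * V' ?q (F ?q)" using an[OF t'] dq by (intro H) simp_all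
    have "0 < (2 * pi) * ((1 / Q t (v x t)) * (\<sigma> * V' ?q (F ?q)))"
      by (rule mult_pos_pos[OF _ mult_pos_pos[OF Qp a]]) simp
    then have s: "0 < \<sigma> * (V (polar p ?y 0) - V (polar p x 0))" unfolding eq by (simp only: mult_ac)
    consider "?y < x" | "?y = x" | "x < ?y" by linarith
    then show ?thesis
    proof cases
      case 1
      then show ?thesis using s lt by (auto simp: zero_less_mult_iff mult_less_0_iff)
    next
      case 2
      then show ?thesis using s by simp
    next
      case 3
      then show ?thesis using s gt by (auto simp: zero_less_mult_iff mult_less_0_iff)
    qed
  qed
  show "?y = x"
    if H: "\<And>q. \<lbrakk>x * exp (- (L * (2*pi))) \<le> dist q p; dist q p \<le> x * exp (L * (2*pi))\<rbrakk> \<Longrightarrow> V' q (F q) = 0"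
  proof -
    have "V' ?q (F ?q) = 0" using an[OF t'] dq by (intro H) simp_all
    then have "V (polar p ?y 0) = V (polar p x 0)" using eq by simp
    then show ?thesis using lt gt by (metis linorder_neqE_linordered_idom order_less_irrefl)
  qed
qed

end

section \<open>Quadratic factors at (1, 1) in polar coordinates\<close>

definition quad :: "(nat \<Rightarrow> real) \<Rightarrow> real \<Rightarrow> real \<Rightarrow> real" where
  "quad \<alpha> u v = \<alpha> 0 * u + \<alpha> 1 * v + \<alpha> 2 * u\<^sup>2 + \<alpha> 3 * (u * v) + \<alpha> 4 * v\<^sup>2"

definition coeff_bound :: "real \<Rightarrow> (nat \<Rightarrow> real) \<Rightarrow> bool" where
  "coeff_bound M \<alpha> \<longleftrightarrow> (\<forall>i<5. \<bar>\<alpha> i\<bar> \<le> M)"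

text \<open>The factors have no constant term in x - 1 and y - 1, so every perturbation of this
  shape keeps the equilibrium at (1, 1), and all cycles can surround that same point.\<close>

definition quad_field :: "(nat \<Rightarrow> real) \<Rightarrow> (nat \<Rightarrow> real) \<Rightarrow> real \<times> real \<Rightarrow> real \<times> real" where
  "quad_field \<alpha> \<beta> = (\<lambda>(x, y). (x * quad \<alpha> (x - 1) (y - 1), y * quad \<beta> (x - 1) (y - 1)))"

definition ang1 :: "(nat \<Rightarrow> real) \<Rightarrow> real \<Rightarrow> real" where
  "ang1 \<alpha> t = \<alpha> 0 * cos t + \<alpha> 1 * sin t"

definition ang2 :: "(nat \<Rightarrow> real) \<Rightarrow> real \<Rightarrow> real" where
  "ang2 \<alpha> t = \<alpha> 2 * (cos t)\<^sup>2 + \<alpha> 3 * (cos t * sin t) + \<alpha> 4 * (sin t)\<^sup>2"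

text \<open>One component of the field on the ray of angle t, divided by the radius z; c is cos t or
  sin t. The type is left general so that the same formula serves real radii and the complex
  extension of the radial equation.\<close>

definition scaled_component :: "real \<Rightarrow> (nat \<Rightarrow> real) \<Rightarrow> real \<Rightarrow> 'a \<Rightarrow> 'a::real_normed_field" where
  "scaled_component c \<alpha> t z = (1 + z * of_real c) * (of_real (ang1 \<alpha> t) + z * of_real (ang2 \<alpha> t))"

definition radial_part :: "(nat \<Rightarrow> real) \<Rightarrow> (nat \<Rightarrow> real) \<Rightarrow> real \<Rightarrow> 'a \<Rightarrow> 'a::real_normed_field" where
  "radial_part \<alpha> \<beta> t z = of_real (cos t) * scaled_component (cos t) \<alpha> t z + of_real (sin t) * scaled_component (sin t) \<beta> t z"

definition angular_part :: "(nat \<Rightarrow> real) \<Rightarrow> (nat \<Rightarrow> real) \<Rightarrow> real \<Rightarrow> 'a \<Rightarrow> 'a::real_normed_field" where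
  "angular_part \<alpha> \<beta> t z = of_real (cos t) * scaled_component (sin t) \<beta> t z - of_real (sin t) * scaled_component (cos t) \<alpha> t z"

lemma scaled_component_of_real: "scaled_component c \<alpha> t (of_real x) = of_real (scaled_component c \<alpha> t x)"
  unfolding scaled_component_def by simp

lemma radial_part_of_real: "radial_part \<alpha> \<beta> t (of_real x) = of_real (radial_part \<alpha> \<beta> t x)"
  unfolding radial_part_def scaled_component_of_real by simp

lemma angular_part_of_real: "angular_part \<alpha> \<beta> t (of_real x) = of_real (angular_part \<alpha> \<beta> t x)"
  unfolding angular_part_def scaled_component_of_real by simp

lemma abs_ang_le:
  assumes "coeff_bound M \<alpha>"
  shows "\<bar>ang1 \<alpha> t\<bar> \<le> 2 * M" "\<bar>ang2 \<alpha> t\<bar> \<le> 3 * M"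
proof -
  have M: "\<bar>\<alpha> 0\<bar> \<le> M" "\<bar>\<alpha> 1\<bar> \<le> M" "\<bar>\<alpha> 2\<bar> \<le> M" "\<bar>\<alpha> 3\<bar> \<le> M" "\<bar>\<alpha> 4\<bar> \<le> M" using assms unfolding coeff_bound_def by simp_all
  have *: "\<bar>a * b\<bar> \<le> M" if "\<bar>a\<bar> \<le> M" "\<bar>b\<bar> \<le> 1" for a b :: real
    using mult_mono[OF that] that by (simp add: abs_mult)
  have c: "\<bar>cos t\<bar> \<le> 1" "\<bar>sin t\<bar> \<le> 1" by simp_all
  have c2: "\<bar>(cos t)\<^sup>2\<bar> \<le> 1" "\<bar>(sin t)\<^sup>2\<bar> \<le> 1" using c by (simp_all add: abs_square_le_1)
  have c3: "\<bar>cos t * sin t\<bar> \<le> 1" using mult_mono[OF c] by (simp add: abs_mult)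
  show "\<bar>ang1 \<alpha> t\<bar> \<le> 2 * M" unfolding ang1_def using *[OF M(1) c(1)] *[OF M(2) c(2)] by linarith
  show "\<bar>ang2 \<alpha> t\<bar> \<le> 3 * M"
    unfolding ang2_def using *[OF M(3) c2(1)] *[OF M(4) c3] *[OF M(5) c2(2)] by linarith
qed

text \<open>The difference is divisible by z - w. In multiples of M the three terms of the other
  factor are at most 2, 3 and 6, which gives 11.\<close>

lemma scaled_component_lipschitz:
  fixes z w :: "'a::real_normed_field"
  assumes M: "coeff_bound M \<alpha>" and c: "\<bar>c\<bar> \<le> 1" and z: "norm z \<le> 1" "norm w \<le> 1"
  shows "norm (scaled_component c \<alpha> t z - scaled_component c \<alpha> t w) \<le> 11 * M * norm (z - w)"
proof -
  let ?a = "ang1 \<alpha> t" and ?b = "ang2 \<alpha> t"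
  note ab = abs_ang_le[where \<alpha> = \<alpha> and t = t, OF M]
  have M0: "0 \<le> M" using M abs_ge_zero[of "\<alpha> 0"] unfolding coeff_bound_def by fastforce
  have eq: "scaled_component c \<alpha> t z - scaled_component c \<alpha> t w = (z - w) * (of_real (c * ?a) + of_real ?b + (z + w) * of_real (c * ?b))"
    unfolding scaled_component_def by (simp add: algebra_simps)
  have "\<bar>c * ?a\<bar> \<le> 2 * M" using mult_mono[OF c ab(1)] by (simp add: abs_mult)
  moreover have cb: "\<bar>c * ?b\<bar> \<le> 3 * M" using mult_mono[OF c ab(2)] by (simp add: abs_mult)
  moreover have "norm ((z + w) * of_real (c * ?b)) \<le> 2 * (3 * M)"
    unfolding norm_mult norm_of_real using norm_triangle_ineq[of z w] z by (intro mult_mono cb) simp_all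
  ultimately have "norm (of_real (c * ?a) + of_real ?b + (z + w) * of_real (c * ?b) :: 'a) \<le> 11 * M"
    using norm_triangle_ineq[of "of_real (c * ?a) + of_real ?b :: 'a" "(z + w) * of_real (c * ?b)"]
      norm_triangle_ineq[of "of_real (c * ?a) :: 'a" "of_real ?b"] ab(2)
    unfolding norm_of_real by linarith
  then have "norm (z - w) * norm (of_real (c * ?a) + of_real ?b + (z + w) * of_real (c * ?b) :: 'a) \<le> norm (z - w) * (11 * M)"
    by (intro mult_left_mono) auto
  then show ?thesis unfolding eq norm_mult by (simp only: mult_ac)
qed

lemma parts_lipschitz:
  fixes z w :: "'a::real_normed_field"
  assumes M: "coeff_bound M \<alpha>" "coeff_bound M \<beta>" and z: "norm z \<le> 1" "norm w \<le> 1"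
  shows "norm (radial_part \<alpha> \<beta> t z - radial_part \<alpha> \<beta> t w) \<le> 22 * M * norm (z - w)"
    and "norm (angular_part \<alpha> \<beta> t z - angular_part \<alpha> \<beta> t w) \<le> 22 * M * norm (z - w)"
proof -
  let ?A = "scaled_component (cos t) \<alpha> t z - scaled_component (cos t) \<alpha> t w" and ?B = "scaled_component (sin t) \<beta> t z - scaled_component (sin t) \<beta> t w"
  have A: "norm ?A \<le> 11 * M * norm (z - w)" by (intro scaled_component_lipschitz M z) simp_all
  have B: "norm ?B \<le> 11 * M * norm (z - w)" by (intro scaled_component_lipschitz M z) simp_all
  have *: "norm (of_real c * X :: 'a) \<le> norm X" if "\<bar>c\<bar> \<le> 1" for c X
    using mult_right_mono[OF that norm_ge_zero[of X]] by (simp add: norm_mult)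
  have "radial_part \<alpha> \<beta> t z - radial_part \<alpha> \<beta> t w = of_real (cos t) * ?A + of_real (sin t) * ?B"
    unfolding radial_part_def by (simp add: algebra_simps)
  also have "norm \<dots> \<le> norm ?A + norm ?B"
    by (intro order_trans[OF norm_triangle_ineq] add_mono *) simp_all
  finally show "norm (radial_part \<alpha> \<beta> t z - radial_part \<alpha> \<beta> t w) \<le> 22 * M * norm (z - w)" using A B by linarith
  have "angular_part \<alpha> \<beta> t z - angular_part \<alpha> \<beta> t w = of_real (cos t) * ?B - of_real (sin t) * ?A"
    unfolding angular_part_def by (simp add: algebra_simps)
  also have "norm \<dots> \<le> norm ?B + norm ?A"
    by (intro order_trans[OF norm_triangle_ineq4] add_mono *) simp_all
  finally show "norm (angular_part \<alpha> \<beta> t z - angular_part \<alpha> \<beta> t w) \<le> 22 * M * norm (z - w)" using A B by linarith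
qed


text \<open>26 = 22 + 4: the Lipschitz constant 22 M over the unit disc, added to the bound 4 M at
  radius 0.\<close>

lemma norm_parts_le:
  fixes z :: "'a::real_normed_field"
  assumes M: "coeff_bound M \<alpha>" "coeff_bound M \<beta>" and z: "norm z \<le> 1"
  shows "norm (radial_part \<alpha> \<beta> t z) \<le> 26 * M" "norm (angular_part \<alpha> \<beta> t z) \<le> 26 * M"
proof -
  have M0: "0 \<le> M" using M(1) abs_ge_zero[of "\<alpha> 0"] unfolding coeff_bound_def by fastforce
  have *: "\<bar>c * a\<bar> \<le> 2 * M" if "\<bar>c\<bar> \<le> 1" "\<bar>a\<bar> \<le> 2 * M" for c a :: real
    using mult_mono[OF that] by (simp add: abs_mult)
  note a = abs_ang_le(1)[where \<alpha> = \<alpha> and t = t, OF M(1)] and b = abs_ang_le(1)[where \<alpha> = \<beta> and t = t, OF M(2)]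
  have c: "\<bar>cos t\<bar> \<le> 1" "\<bar>sin t\<bar> \<le> 1" by simp_all
  have "norm (radial_part \<alpha> \<beta> t (0::'a)) = \<bar>cos t * ang1 \<alpha> t + sin t * ang1 \<beta> t\<bar>"
    unfolding radial_part_def scaled_component_def by (simp flip: of_real_mult of_real_add)
  then have r0: "norm (radial_part \<alpha> \<beta> t (0::'a)) \<le> 4 * M"
    using *[OF c(1) a] *[OF c(2) b] by linarith
  have "norm (angular_part \<alpha> \<beta> t (0::'a)) = \<bar>cos t * ang1 \<beta> t - sin t * ang1 \<alpha> t\<bar>"
    unfolding angular_part_def scaled_component_def by (simp flip: of_real_mult of_real_diff)
  then have a0: "norm (angular_part \<alpha> \<beta> t (0::'a)) \<le> 4 * M"
    using *[OF c(1) b] *[OF c(2) a] by linarith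
  have z22: "22 * M * norm z \<le> 22 * M" using mult_left_mono[OF z, of "22 * M"] M0 by simp
  have l: "norm (radial_part \<alpha> \<beta> t z - radial_part \<alpha> \<beta> t 0) \<le> 22 * M * norm (z - 0)"
    "norm (angular_part \<alpha> \<beta> t z - angular_part \<alpha> \<beta> t 0) \<le> 22 * M * norm (z - 0)"
    by (intro parts_lipschitz[OF M]; use z in simp)+
  show "norm (radial_part \<alpha> \<beta> t z) \<le> 26 * M"
    using norm_triangle_sub[of "radial_part \<alpha> \<beta> t z" "radial_part \<alpha> \<beta> t 0"] r0 z22 l(1) unfolding diff_zero by linarith
  show "norm (angular_part \<alpha> \<beta> t z) \<le> 26 * M"
    using norm_triangle_sub[of "angular_part \<alpha> \<beta> t z" "angular_part \<alpha> \<beta> t 0"] a0 z22 l(2) unfolding diff_zero by linarith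
qed

text \<open>Within the radius m / (22 M) the Lipschitz constant 22 M changes the angular speed by at
  most m, half of its lower bound 2 m at radius 0.\<close>

lemma angular_part_lower_bound:
  fixes z :: "'a::real_normed_field"
  assumes M: "coeff_bound M \<alpha>" "coeff_bound M \<beta>"
    and m: "0 < m" "m \<le> M" "\<And>t. 2 * m \<le> cos t * ang1 \<beta> t - sin t * ang1 \<alpha> t"
    and z: "norm z \<le> m / (22 * M)"
  shows "norm (angular_part \<alpha> \<beta> t z - of_real (cos t * ang1 \<beta> t - sin t * ang1 \<alpha> t)) \<le> m"
    and "m \<le> norm (angular_part \<alpha> \<beta> t z)" and "norm z \<le> 1"
proof -
  have M0: "0 < 22 * M" using m by simp
  have "m / (22 * M) \<le> 1" using m M0 by (simp add: field_simps)
  then show z1: "norm z \<le> 1" using z by linarith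
  have e: "angular_part \<alpha> \<beta> t (0::'a) = of_real (cos t * ang1 \<beta> t - sin t * ang1 \<alpha> t)"
    unfolding angular_part_def scaled_component_def by simp
  have "norm (angular_part \<alpha> \<beta> t z - angular_part \<alpha> \<beta> t 0) \<le> 22 * M * norm (z - 0)"
    by (intro parts_lipschitz[OF M]) (use z1 in simp_all)
  also have "\<dots> \<le> 22 * M * (m / (22 * M))" unfolding diff_zero using M0 z by (intro mult_left_mono) auto
  also have "\<dots> = m" using M0 by simp
  finally show d: "norm (angular_part \<alpha> \<beta> t z - of_real (cos t * ang1 \<beta> t - sin t * ang1 \<alpha> t)) \<le> m"
    unfolding e .
  have "2 * m \<le> norm (of_real (cos t * ang1 \<beta> t - sin t * ang1 \<alpha> t) :: 'a)"
    unfolding norm_of_real using m(3)[of t] m(1) by linarith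
  moreover have "norm (of_real (cos t * ang1 \<beta> t - sin t * ang1 \<alpha> t) - angular_part \<alpha> \<beta> t z) \<le> m"
    by (subst norm_minus_commute) (rule d)
  ultimately show "m \<le> norm (angular_part \<alpha> \<beta> t z)"
    using norm_triangle_sub[of "of_real (cos t * ang1 \<beta> t - sin t * ang1 \<alpha> t) :: 'a" "angular_part \<alpha> \<beta> t z"]
    by linarith
qed

text \<open>A single k bounds the values and the Lipschitz constants involved. Over the common
  denominator the difference telescopes into three products, each at most k^2 times |z - w|.\<close>

lemma quotient_lipschitz:
  fixes z w n n' q q' :: "'a::real_normed_field"
  assumes bounds: "norm n \<le> k" "norm n' \<le> k" "norm q' \<le> k" "m \<le> norm q" "m \<le> norm q'" "0 < m"
    and lip: "norm (n - n') \<le> k * norm (z - w)" "norm (q - q') \<le> k * norm (z - w)" and w: "norm w \<le> 1"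
  shows "norm (z * n / q - w * n' / q') \<le> 3 * k\<^sup>2 / m\<^sup>2 * norm (z - w)"
proof -
  have k: "0 \<le> k" using bounds(1) norm_ge_zero order_trans by blast
  have nz: "q \<noteq> 0" "q' \<noteq> 0" using bounds by auto
  have eq: "z * n / q - w * n' / q' = ((z - w) * n * q' + w * (n - n') * q' + w * n' * (q' - q)) / (q * q')"
    using nz by (simp add: field_simps)
  let ?d = "norm (z - w)"
  have 1: "norm ((z - w) * n * q') \<le> ?d * k * k"
    unfolding norm_mult using bounds k by (intro mult_mono) auto
  have 2: "norm (w * (n - n') * q') \<le> 1 * (k * ?d) * k"
    unfolding norm_mult using bounds lip w k by (intro mult_mono) auto
  have 3: "norm (w * n' * (q' - q)) \<le> 1 * k * (k * ?d)"
    unfolding norm_mult using bounds lip w k by (intro mult_mono) (auto simp: norm_minus_commute)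
  have num: "norm ((z - w) * n * q' + w * (n - n') * q' + w * n' * (q' - q)) \<le> 3 * k\<^sup>2 * ?d"
  proof -
    have "norm ((z - w) * n * q' + w * (n - n') * q' + w * n' * (q' - q)) \<le> ?d * k * k + 1 * (k * ?d) * k + 1 * k * (k * ?d)"
      by (intro order_trans[OF norm_triangle_ineq] add_mono 1 2 3)
    also have "\<dots> = 3 * k\<^sup>2 * ?d" by (simp add: power2_eq_square)
    finally show ?thesis .
  qed
  have den: "m\<^sup>2 \<le> norm (q * q')" unfolding norm_mult power2_eq_square using bounds by (intro mult_mono) auto
  have "norm (z * n / q - w * n' / q') \<le> (3 * k\<^sup>2 * ?d) / m\<^sup>2"
    unfolding eq norm_divide using num den bounds(6) by (intro frac_le) auto
  then show ?thesis by simp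
qed

lemma ang_periodic: "ang1 \<alpha> (t + 2 * pi) = ang1 \<alpha> t" "ang2 \<alpha> (t + 2 * pi) = ang2 \<alpha> t"
  unfolding ang1_def ang2_def by simp_all

lemma quad_polar: "quad \<alpha> (\<rho> * cos t) (\<rho> * sin t) = \<rho> * (ang1 \<alpha> t + \<rho> * ang2 \<alpha> t)"
  unfolding quad_def ang1_def ang2_def by (simp add: power2_eq_square algebra_simps)

lemma continuous_on_parts:
  fixes f :: "'b::t2_space \<Rightarrow> 'a::real_normed_field"
  assumes "continuous_on S g" "continuous_on S f"
  shows "continuous_on S (\<lambda>x. radial_part \<alpha> \<beta> (g x) (f x))" "continuous_on S (\<lambda>x. angular_part \<alpha> \<beta> (g x) (f x))"
  unfolding radial_part_def angular_part_def scaled_component_def ang1_def ang2_def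
  by (intro continuous_on_add continuous_on_diff continuous_on_mult continuous_on_power continuous_on_const
      continuous_on_of_real continuous_on_cos continuous_on_sin assms)+

lemma holomorphic_on_parts:
  "radial_part \<alpha> \<beta> t holomorphic_on S" "angular_part \<alpha> \<beta> t holomorphic_on S"
  unfolding radial_part_def[abs_def] angular_part_def[abs_def] scaled_component_def
  by (auto intro!: holomorphic_on_add holomorphic_on_diff holomorphic_on_mult)

text \<open>The coefficients enter the radius and the Lipschitz constant only through M and m, so
  the same constants serve a base field and all its small perturbations.\<close>

lemma quad_field_polar_field:
  assumes M: "coeff_bound M \<alpha>" "coeff_bound M \<beta>"
    and m: "0 < m" "m \<le> M" "\<And>t. 2 * m \<le> cos t * ang1 \<beta> t - sin t * ang1 \<alpha> t"
  shows "polar_field (\<lambda>t z. z * radial_part \<alpha> \<beta> t z / angular_part \<alpha> \<beta> t z) (m / (22 * M)) (3 * (26 * M)\<^sup>2 / m\<^sup>2)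
    (quad_field \<alpha> \<beta>) (1, 1) (radial_part \<alpha> \<beta>) (angular_part \<alpha> \<beta>) m (26 * M)"
proof -
  let ?r = "m / (22 * M)"
  have M0: "0 < M" using m by simp
  note lb = angular_part_lower_bound[OF M m]
  have nz: "angular_part \<alpha> \<beta> t z \<noteq> 0" if "norm z \<le> ?r" for t and z :: complex
    using lb(2)[OF that, of t] m(1) by auto
  show ?thesis
  proof
    show "0 < ?r" using m M0 by simp
    show "0 < 3 * (26 * M)\<^sup>2 / m\<^sup>2" using m M0 by simp
    show "continuous_on (UNIV \<times> cball 0 ?r) (\<lambda>(t, z). z * radial_part \<alpha> \<beta> t z / angular_part \<alpha> \<beta> t (z::complex))"
      unfolding case_prod_unfold
      by (intro continuous_on_divide continuous_on_mult continuous_on_parts continuous_on_fst continuous_on_snd continuous_on_id ballI nz) auto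
    show "(\<lambda>z. z * radial_part \<alpha> \<beta> t z / angular_part \<alpha> \<beta> t (z::complex)) holomorphic_on ball 0 ?r" for t
      by (intro holomorphic_on_divide holomorphic_on_mult holomorphic_on_parts holomorphic_on_ident nz) auto
    show "norm (z * radial_part \<alpha> \<beta> t z / angular_part \<alpha> \<beta> t z - w * radial_part \<alpha> \<beta> t w / angular_part \<alpha> \<beta> t w)
        \<le> 3 * (26 * M)\<^sup>2 / m\<^sup>2 * norm (z - w)" if zw: "norm z \<le> ?r" "norm w \<le> ?r" for t and z w :: complex
    proof -
      note z1 = lb(3)[OF zw(1)] and w1 = lb(3)[OF zw(2)]
      have le: "22 * M * norm (z - w) \<le> 26 * M * norm (z - w)" using M0 by (intro mult_right_mono) auto
      show ?thesis
        by (rule quotient_lipschitz[OF norm_parts_le(1)[OF M z1] norm_parts_le(1)[OF M w1] norm_parts_le(2)[OF M w1]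
              lb(2)[OF zw(1)] lb(2)[OF zw(2)] m(1) order_trans[OF parts_lipschitz(1)[OF M z1 w1] le]
              order_trans[OF parts_lipschitz(2)[OF M z1 w1] le] w1])
    qed
    show "0 * radial_part \<alpha> \<beta> t 0 / angular_part \<alpha> \<beta> t 0 = (0::complex)" for t by simp
    show "complex_of_real x * radial_part \<alpha> \<beta> t (complex_of_real x) / angular_part \<alpha> \<beta> t (complex_of_real x) \<in> \<real>" for t x
      unfolding radial_part_of_real angular_part_of_real by simp
    show "z * radial_part \<alpha> \<beta> (t + 2 * pi) z / angular_part \<alpha> \<beta> (t + 2 * pi) z = z * radial_part \<alpha> \<beta> t z / angular_part \<alpha> \<beta> t z"
      for t and z :: complex
      unfolding radial_part_def angular_part_def scaled_component_def by (simp add: ang_periodic)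
    show "quad_field \<alpha> \<beta> (polar (1, 1) \<rho> t) = (\<rho> * (radial_part \<alpha> \<beta> t \<rho> * cos t - angular_part \<alpha> \<beta> t \<rho> * sin t),
        \<rho> * (radial_part \<alpha> \<beta> t \<rho> * sin t + angular_part \<alpha> \<beta> t \<rho> * cos t))" for t \<rho>
    proof -
      have cs: "cos t * cos t + sin t * sin t = 1"
        using sin_cos_squared_add2[of t] by (simp add: power2_eq_square)
      let ?a = "(1 + \<rho> * cos t) * (ang1 \<alpha> t + \<rho> * ang2 \<alpha> t)" and ?b = "(1 + \<rho> * sin t) * (ang1 \<beta> t + \<rho> * ang2 \<beta> t)"
      have NQ: "radial_part \<alpha> \<beta> t \<rho> = cos t * ?a + sin t * ?b" "angular_part \<alpha> \<beta> t \<rho> = cos t * ?b - sin t * ?a"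
        unfolding radial_part_def angular_part_def scaled_component_def by simp_all
      have rot: "(c * a + s * b) * c - (c * b - s * a) * s = a * (c * c + s * s)"
        "(c * a + s * b) * s + (c * b - s * a) * c = b * (c * c + s * s)" for a b c s :: real
        by (simp_all add: algebra_simps)
      have 1: "radial_part \<alpha> \<beta> t \<rho> * cos t - angular_part \<alpha> \<beta> t \<rho> * sin t = ?a"
        unfolding NQ rot cs by (rule mult_1_right)
      have 2: "radial_part \<alpha> \<beta> t \<rho> * sin t + angular_part \<alpha> \<beta> t \<rho> * cos t = ?b"
        unfolding NQ rot cs by (rule mult_1_right)
      show ?thesis unfolding 1 2 unfolding quad_field_def polar_def by (simp add: quad_polar mult_ac)
    qed
    show "0 < m" by (rule m)
    show "m \<le> angular_part \<alpha> \<beta> t \<rho>" if "0 \<le> \<rho>" "\<rho> \<le> ?r" for t \<rho>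
      using lb(1)[of \<rho> t] m(3)[of t] that by (simp add: abs_le_iff)
    show "angular_part \<alpha> \<beta> t \<rho> \<le> 26 * M" if "0 \<le> \<rho>" "\<rho> \<le> ?r" for t \<rho>
      using norm_parts_le(2)[OF M lb(3), of \<rho> t] that by simp
    show "continuous_on (UNIV \<times> {0..?r}) (\<lambda>(t, \<rho>). angular_part \<alpha> \<beta> t \<rho>)"
      unfolding case_prod_unfold by (intro continuous_on_parts continuous_on_fst continuous_on_snd continuous_on_id)
    show "angular_part \<alpha> \<beta> (t + 2 * pi) \<rho> = angular_part \<alpha> \<beta> t \<rho>" for t \<rho>
      unfolding angular_part_def scaled_component_def by (simp add: ang_periodic)
    show "complex_of_real \<rho> * radial_part \<alpha> \<beta> t (complex_of_real \<rho>) / angular_part \<alpha> \<beta> t (complex_of_real \<rho>)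
        = complex_of_real (\<rho> * radial_part \<alpha> \<beta> t \<rho> / angular_part \<alpha> \<beta> t \<rho>)" for t \<rho>
      unfolding radial_part_of_real angular_part_of_real by simp
    show "continuous_on UNIV (quad_field \<alpha> \<beta>)"
      unfolding quad_field_def quad_def case_prod_unfold
      by (intro continuous_on_Pair continuous_on_mult continuous_on_add continuous_on_diff continuous_on_power
          continuous_on_const continuous_on_fst continuous_on_snd continuous_on_id)
  qed
qed

section \<open>Certificates for the bifurcation functions\<close>

text \<open>Polynomials in \<open>x\<close>, \<open>y\<close>, \<open>d\<close> are nested coefficient lists, \<open>x\<close> outermost, so that the
  polynomial identities below are decided by rewriting. In this section \<open>x\<close> and \<open>y\<close> are half the
  displacements from the equilibrium, which keeps all coefficients integral.\<close>

fun list_add :: "('a \<Rightarrow> 'a \<Rightarrow> 'a) \<Rightarrow> 'a list \<Rightarrow> 'a list \<Rightarrow> 'a list" where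
  "list_add f [] ys = ys"
| "list_add f (x # xs) [] = x # xs"
| "list_add f (x # xs) (y # ys) = f x y # list_add f xs ys"

text \<open>The operations on coefficients are parameters, with z the zero coefficient, so that one
  definition is instantiated at each level of nesting. Above the innermost level the zero is the
  empty list.\<close>

fun list_mul :: "('a \<Rightarrow> 'a \<Rightarrow> 'a) \<Rightarrow> ('a \<Rightarrow> 'a \<Rightarrow> 'a) \<Rightarrow> 'a \<Rightarrow> 'a list \<Rightarrow> 'a list \<Rightarrow> 'a list" where
  "list_mul f g z [] ys = []"
| "list_mul f g z (x # xs) ys = list_add f (map (g x) ys) (z # list_mul f g z xs ys)"

fun list_deriv :: "('a \<Rightarrow> 'a \<Rightarrow> 'a) \<Rightarrow> 'a \<Rightarrow> 'a list \<Rightarrow> 'a list" where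
  "list_deriv f z [] = []"
| "list_deriv f z (x # xs) = list_add f xs (z # list_deriv f z xs)"

fun list_eval :: "('a \<Rightarrow> real) \<Rightarrow> real \<Rightarrow> 'a list \<Rightarrow> real" where
  "list_eval e z [] = 0"
| "list_eval e z (x # xs) = e x + z * list_eval e z xs"

text \<open>The five entries of c are polynomials in \<open>d\<close>, taken as coefficients in half
  displacements; \<open>quad_coeff\<close> converts them to coefficients in displacements.\<close>

definition quad_list :: "int list list \<Rightarrow> int list list list" where
  "quad_list c = [[[], c ! 1, c ! 4], [c ! 0, c ! 3], [c ! 2]]"

definition "add1 = list_add ((+) :: int \<Rightarrow> int \<Rightarrow> int)"
definition "add2 = list_add add1"
definition "add3 = list_add add2"
definition "mul1 = list_mul ((+) :: int \<Rightarrow> int \<Rightarrow> int) (*) 0"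
definition "mul2 = list_mul add1 mul1 []"
definition "mul3 = list_mul add2 mul2 []"
definition "deriv_x = list_deriv add2 []"
definition "deriv_y = map (list_deriv add1 [])"
definition scale3 :: "int \<Rightarrow> int list list list \<Rightarrow> int list list list" where
  "scale3 c = map (map (map ((*) c)))"

definition eval1 :: "real \<Rightarrow> int list \<Rightarrow> real" where "eval1 d = list_eval real_of_int d"
definition eval3 :: "real \<Rightarrow> real \<Rightarrow> real \<Rightarrow> int list list list \<Rightarrow> real" where
  "eval3 d x y = list_eval (list_eval (eval1 d) y) x"

fun vanishes2 :: "nat \<Rightarrow> int list list \<Rightarrow> bool" where
  "vanishes2 0 ps = True"
| "vanishes2 (Suc n) [] = True"
| "vanishes2 (Suc n) (p # ps) = (list_all (\<lambda>a. a = 0) p \<and> vanishes2 n ps)"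

text \<open>Vanishing, identically in \<open>d\<close>, of all coefficients of total degree below n
  in (x, y): each power of x lowers the degree that is left for y.\<close>

fun vanishes3 :: "nat \<Rightarrow> int list list list \<Rightarrow> bool" where
  "vanishes3 0 ps = True"
| "vanishes3 (Suc n) [] = True"
| "vanishes3 (Suc n) (p # ps) = (vanishes2 (Suc n) p \<and> vanishes3 n ps)"

definition "pX = [[], [[-1, 1::int]]]"
definition "pY = [[[], [1, 1::int]]]"
definition "pone = [[[1::int]]]"
definition "pS = add3 pX pY"
definition "field_x = mul3 (mul3 pY [[[-1::int]], [[-2]]]) (add3 pone pS)"
definition "field_y = mul3 (mul3 pX [[[1::int], [2]]]) (add3 pone (scale3 (-1) pS))"
definition "pXm = add3 pX (scale3 (-1) pone)"
definition "pYp = add3 pY pone"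
text \<open>Write the field as ((1 + 2 x) A, (1 + 2 y) B), X = (d - 1) x and Y = (d + 1) y. The
  weights are (X - Y - 1) B and -(X - Y - 1) A, that is, the pair of factors turned by a right angle
  and multiplied by the numerator of an integrating factor.\<close>

definition "weight_x = scale3 (-1) (mul3 pX (add3 (mul3 pXm pXm) (scale3 (-1) (mul3 pY pY))))"
definition "weight_y = mul3 pY (add3 (mul3 pX pX) (scale3 (-1) (mul3 pYp pYp)))"
definition "pQ = [[[], [], [1, 1]], [], [[-1, 1::int]]]"

fun pow3 :: "int list list list \<Rightarrow> nat \<Rightarrow> int list list list" where
  "pow3 P 0 = pone"
| "pow3 P (Suc n) = mul3 P (pow3 P n)"

text \<open>The hyperbola f has logarithmic derivative -4 X Y along the field, so the derivative of
  G / f is that of G plus 4 X Y G, all divided by f. The remainder is what this leaves of the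
  first-order change of the first integral, after multiplication by f.\<close>

definition remainder :: "int list list list \<Rightarrow> int list list list \<Rightarrow> int list list list \<Rightarrow> int list list list" where
  "remainder P Q G = add3 (add3 (mul3 weight_x P) (mul3 weight_y Q))
     (scale3 (-1) (add3 (add3 (mul3 field_x (deriv_x G)) (mul3 field_y (deriv_y G)))
        (scale3 4 (mul3 (mul3 pX pY) G))))"

text \<open>Each perturbation with its certificate solves, degree by degree in \<open>(x, y)\<close>, the linear system
  expressing that the remainder is a multiple of a power of the quadratic part \<open>pQ\<close> of the first
  integral. The certificates were computed externally and are only verified here.\<close>

definition pert_x0 :: "int list list" where
  "pert_x0 = [[-2, 2],
   [],
   [],
   [],
   []]"

definition pert_y0 :: "int list list" where
  "pert_y0 = [[],
   [],
   [],
   [],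
   []]"

definition cert0 :: "int list list list" where
  "cert0 = [[],
   [[], [1, -1]]]"

definition lead0 :: "int list" where
  "lead0 = [1, -1]"

definition pert_x1 :: "int list list" where
  "pert_x1 = [[],
   [12, 12],
   [],
   [],
   []]"

definition pert_y1 :: "int list list" where
  "pert_y1 = [[],
   [],
   [],
   [],
   []]"

definition cert1 :: "int list list list" where
  "cert1 = [[[], [], [], [4, 8, 4]],
   [[], [], [], [3, 3, -3, -3]],
   [[-6, 6], [], [0, 12, 0, -12]],
   [[-4, 16, -12], [3, -3, -3, 3]],
   [[0, -6, 0, 6]]]"

definition lead1 :: "int list" where
  "lead1 = [3, 0, -3]"

definition pert_x2 :: "int list list" where
  "pert_x2 = [[],
   [45, 90, 45],
   [],
   [],
   []]"

definition pert_y2 :: "int list list" where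
  "pert_y2 = [[45, 0, -45],
   [],
   [],
   [],
   []]"

definition cert2 :: "int list list list" where
  "cert2 = [[[], [], [], [30, 90, 90, 30], [], [-12, -60, -168, -264, -204, -60]],
   [[], [], [], [], [], [15, 45, 30, -30, -45, -15]],
   [[], [], [0, 90, 90, -90, -90], [60, 60, 0, 0, -60, -60], [-30, -60, 30, -120, -210, 180, 210]],
   [[-30, 30, 30, -30], [], [-60, -60, 0, 0, 60, 60], [0, -80, -80, 0, 0, 80, 80]],
   [[], [], [30, 270, -90, 60, -150, -330, 210]],
   [[12, -36, 72, -24, -84, 60], [-15, 15, 30, -30, -15, 15]],
   [[0, -90, 180, -280, 380, -190]]]"

definition lead2 :: "int list" where
  "lead2 = [15, 15, -15, -15]"

definition pert_x3 :: "int list list" where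
  "pert_x3 = [[],
   [-37800, -113400, -113400, -37800],
   [],
   [],
   [-52920, -196560, -257040, -120960, 7560, 15120]]"

definition pert_y3 :: "int list list" where
  "pert_y3 = [[],
   [],
   [22680, 15120, -45360, -30240, 22680, 15120],
   [],
   []]"

definition cert3 :: "int list list list" where
  "cert3 = [[[], [], [], [5040, 15120, 10080, -10080, -15120, -5040], [], [8064, 34272, 40320, -14112, -56448, -26208, 8064, 6048], [], [6336, 39840,
     31680, -181824, -371136, -89856, 305472, 249408, 27648, -17568]],
   [[], [], [], [], [], [], [], [0, -3465, -13860, -13860, 13860, 34650, 13860, -13860, -13860, -3465]],
   [[18900, 18900, -18900, -18900], [], [-26460, -56700, -15120, 37800, 34020, 18900, 7560], [-15120, -50400, -5040, 100800, 55440, -50400, -35280],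
     [-5040, 40320, 131040, -20160, -262080, -80640, 151200, 60480, -15120], [7056, -51744, -29568, 349440, 194208, -590016, -327936, 338688, 156240,
     -46368], [-29232, -28224, 300048, 180096, -1128288, -666624, 1581216, 905856, -831600, -391104, 107856]],
   [[20160, -20160, -65520, 15120, 45360, 5040], [], [15120, 75600, 80640, -50400, -105840, -25200, 10080], [16800, 47040, 26880, -73920, -114240,
     6720, 80640, 20160, -10080], [-20160, -33600, -13440, -53760, 26880, 228480, 67200, -161280, -60480, 20160], [7392, 609, 44002, 14014, -425222,
     -242816, 740614, 441154, -418530, -212961, 51744]],
   [[7560, -7560, 22680, 52920, -30240, -45360], [], [-21420, -144900, -180180, 240660, 258300, -197820, -41580, 102060, -15120], [-40320, -43680,
     3360, -43680, 225120, 198240, -299040, -90720, 110880, -20160], [55188, 165060, -493248, 232176, 1894200, -2254056, -2304624, 3151344, 623700,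
     -1294524, 224784]],
   [[2016, -37296, -23184, 8064, -20160, 35280, 41328, -6048], [], [63504, 163968, 188832, 73248, -591360, -350112, 604128, 66528, -265104, 46368],
     [39648, 126945, -33376, -161924, 222656, -365498, -452032, 708988, 171360, -308511, 51744]],
   [[5460, 43260, 76860, -68460, 24780, 13860, -107100, 11340], [], [-101472, -443856, 190288, -504224, -104832, 3407936, -2677024, -1504608,
     2585184, -955248, 107856]],
   [[-14976, -62976, -135648, -32928, 370848, -276768, -71328, 355104, -148896, 17568], [0, -3465, 6930, 6930, -20790, 0, 20790, -6930, -6930, 3465]],
   [[28056, 172872, 896, 417424, -580272, -820064, 2253440, -2119824, 724248, -76776]]]"

definition lead3 :: "int list" where
  "lead3 = [0, -3465, -3465, 6930, 6930, -3465, -3465]"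

definition pert_x4 :: "int list list" where
  "pert_x4 = [[],
   [-893025, -4762800, -9653175, -8845200, -2849175, 680400, 467775],
   [],
   [0, 935550, 2806650, 1871100, -1871100, -2806650, -935550],
   [-1020600, -6038550, -14883750, -19561500, -14458500, -5698350, -935550]]"

definition pert_y4 :: "int list list" where
  "pert_y4 = [[-382725, -1020600, -42525, 1701000, 893025, -680400, -467775],
   [],
   [],
   [],
   []]"

definition cert4 :: "int list list list" where
  "cert4 = [[[], [], [], [-85050, -595350, -1389150, -992250, 992250, 2182950, 1389150, 311850], [], [170100, 873180, 1995840, 3175200, 3969000,
     2381400, -1905120, -4354560, -2778300, -623700], [], [199260, 814860, -115020, -4260060, -5087880, -824040, -5738040, -16058520, -9255060,
     6152220, 8108100, 2286900], [], [302580, 2332620, 2507880, -10752840, -11570100, 46214420, 73450160, -17745520, -43820340, 72389300, 84488040,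
     -29506760, -61653900, -19226900]],
   [[], [], [], [], [], [], [], [], [], [68040, 476280, 1445850, 2500470, 2653560, 1428840, -714420, -2551500, -2857680, -1769040, -595350, -85050]],
   [[255150, 978075, 935550, -510300, -1190700, -467775], [], [-510300, -2764125, -5698350, -3444525, 4847850, 8037225, 2296350, -1828575, -935550],
     [-510300, -1587600, -737100, 1304100, 283500, -283500, 1871100, 1190700, -907200, -623700], [85050, 1190700, 2182950, -567000, -623700, 4989600,
     170100, -9412200, -3997350, 3798900, 2182950], [-272160, -623700, 4706100, 11718000, -3326400, -17153640, 7204680, 12791520, -16571520,
     -12553380, 8259300, 5821200], [-425250, 136080, 2086560, -11340000, -25085970, 19353600, 43197840, -34322400, -41827590, 44619120, 35879760,
     -18446400, -13825350], [59940, -4406400, 112860, 41216580, -16723800, -183968100, 1337400, 261443880, -94417740, -244113480, 193194540,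
     202523220, -83563200, -72695700], [-1421550, -2065500, 19052010, 4374000, -126191790, 38682900, 482109210, -29318400, -693532890, 224757900,
     633191310, -410569200, -472423050, 174138300, 159216750]],
   [[425250, 255150, -2296350, -2749950, 1389150, 2806650, 481950, -311850], [], [510300, 3175200, 6463800, 4139100, -3402000, -7654500, -5103000,
     -283500, 1530900, 623700], [226800, 1474200, 3099600, 1209600, -3024000, -2797200, -907200, -1512000, -226800, 1625400, 831600], [-170100,
     -963900, -3912300, -6142500, 1776600, 9563400, 491400, -3969000, 5348700, 3798900, -3534300, -2286900], [-226800, -476280, 1769040, 340200,
     -10770480, -4258800, 11864160, -7081200, -11385360, 20863080, 15679440, -9387000, -6930000], [-56700, 1077300, 7560, -11060280, 1266300,
     44655660, 8290800, -56463120, 13463100, 48153420, -42368760, -42509880, 19397700, 16146900], [-641520, -3599640, 5715900, 24322140, -24495840,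
     -8044920, 190614360, 19809240, -319409520, 81007320, 307026540, -212475540, -248807520, 98981400, 89997600]],
   [[255150, 255150, 935550, 2381400, 255150, -2636550, -1445850], [], [-595350, -5996025, -11623500, -2381400, 6775650, 6492150, 11595150, 3855600,
     -8334900, -1970325, 2182950], [-850500, -2664900, -4706100, -1379700, 9752400, 3024000, -9147600, 7408800, 8486100, -8675100, -3534300,
     2286900], [1786050, 2304855, -2154600, 28006965, 19355490, -91349370, 1028160, 122027850, -81763290, -86302125, 90334440, 25311825, -28586250],
     [-1508220, 3061800, 3723300, -27892620, 64343160, 102141900, -233415000, -46753560, 355137300, -178708320, -266324940, 220846500, 78044400,
     -72695700], [3353400, 6890265, -68116950, 18779040, 349997490, -588226455, -808964280, 1929168360, 282817980, -2728657125, 1266678810,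
     1866189240, -1532002950, -504143325, 506236500]],
   [[-34020, -1031940, -2460780, -2744280, 56700, 4581360, 2778300, -1428840, -340200, 623700], [], [1632960, 7813260, 18608940, 13305600, -20865600,
     -21402360, 5617080, -11324880, -8376480, 17429580, 3383100, -5821200], [861840, 4604040, 5549040, 2215080, -2081520, -16374960, -1804320,
     19630800, -17776080, -16211160, 22181040, 6136200, -6930000], [79380, -8414280, -14904540, 19402740, -38767680, -67577580, 203220360, 28413000,
     -304356780, 171450720, 216557460, -215970300, -61828200, 72695700], [-235872, 5134752, -7880544, -27808704, 63917280, -120470112, -250004832,
     565568640, 148640352, -887693856, 414706656, 651766080, -562998240, -186496800, 193855200]],
   [[226800, 1941975, 3978450, 3477600, 1332450, -7304850, -7796250, 4120200, 2258550, -2234925], [], [-3033450, -14662620, -25787160, -37762200,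
     39441150, 92274840, -86758560, 5544000, 121581810, -101653020, -31618440, 56259000, -13825350], [-1341900, -8221500, -9293760, 8646120,
     -26302500, 20590500, 96673920, -129109680, -10418100, 177147180, -119132160, -52905720, 69814500, -16146900], [1749600, 343845, 95510070,
     -83997540, -297138330, 1140245505, -656204640, -2393823360, 3712237740, 3733815, -4229766090, 3050298660, 867375150, -1716800925, 506236500]],
   [[-520020, -2810700, -9222660, -6443820, 7875360, 2250720, 8886240, 10566720, -15127020, -1276020, 8108100, -2286900], [], [4226580, 29872800,
     52164540, 2669220, 43111440, -112660380, -245628360, 380877480, -25986060, -445800600, 395547660, 72345780, -223435800, 72695700], [2663280,
     9762120, 21828420, 6002100, -54556560, 108058680, -55146120, -337357320, 494101920, 5579400, -623074620, 496684020, 124186080, -288729000,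
     89997600]],
   [[1031940, 6049890, 12772620, 20018880, -22293180, -20219220, 30354660, -57781080, 20822760, 41259330, -42688800, 10672200], [], [-9306090,
     -41317290, -143097570, 54120690, 129048570, -669760920, 1570646010, -305918820, -2869539630, 4205934270, -1493028390, -2131866030, 2656060350,
     -1111191900, 159216750]],
   [[-1760220, -12364020, -25397520, -13330440, -23602740, 113105180, -2128000, -172782640, 288471740, -155276540, -124957360, 221421560, -110625900,
     19226900], [-68040, 68040, 187110, -187110, -68040, 68040, -238140, 238140, 272160, -272160, -85050, 85050]],
   [[3838428, 19835766, 61977204, -1460106, -5496912, 108903564, -678799968, 914684052, -153424908, -1364227050, 2307907980, -1818542250, 720165600,
     -115361400]]]"

definition lead4 :: "int list" where
  "lead4 = [68040, 204120, 221130, 119070, -34020, -238140, -255150, -85050]"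

definition pert_x5 :: "int list list" where
  "pert_x5 = [[],
   [],
   [367783416000, 1471133664000, 1930862934000, 367783416000, -1838917080000, -3310050744000, -3126159036000, -367783416000, 2206700496000,
     1838917080000, 459729270000],
   [-275837562000, -3993898033125, -14688350176500, -19090257936750, 3068692877250, 29560592061000, 16952516831250, -16584733415250, -19664919524250,
     2752629004125, 13228709744250, 7355668320000, 1379187810000],
   [91945854000, 1166563022625, 6551142097500, 18975325619250, 27158506625250, 7976302834500, -32422406766750, -47294648651250, -17458219028250,
     16326135700875, 20584378064250, 8734856130000, 1379187810000]]"

definition pert_y5 :: "int list list" where
  "pert_y5 = [[],
   [],
   [275837562000, 1350454730625, 976924698750, -5401818922500, -10228976257500, 2815841778750, 19998223245000, 9769246987500, -13217216512500,
     -13131017274375, 816019454250, 4597292700000, 1379187810000],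
   [1011404394000, 2810095162875, -1712491530750, -11125448334000, -1884890007000, 24928819665750, 24158773138500, -11079475407000, -28825025229000,
     -11510471597625, 5873041424250, 5976480510000, 1379187810000],
   []]"

definition cert5 :: "int list list list" where
  "cert5 = [[[], [], [], [551675124000, 2693247306750, 3532253224500, -3356023671000, -11401285896000, -758553295500, 24779407653000, 31767292557000,
     9746260524000, -12263278277250, -14029404889500, -5823237420000, -919458540000], [], [465858993600, 2698610814900, 4867000538400, -501104904300,
     -11612761360200, -11643409978200, -5430935109600, -25950184860600, -65729026162800, -67186367948700, -17825236228800, 25813798510500,
     28303998723000, 11646474840000, 1838917080000], [], [963242280000, 7750816573500, 20723865762600, 10027789972200, -50311311850800,
     -82827379334700, 4447114471800, 88007360641200, 1804473871200, -93035120478300, 31467519883800, 210182530357800, 174498928203600,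
     10198327639500, -63120828771000, -36574017480000, -6742695960000], [], [1519782264000, 19108497107700, 75007287154800, 77568465674700,
     -190433966322600, -487636336687500, -25145920800000, 831918176189100, 389515605078600, -995662320552900, -821624205402000, 635581686039300,
     536250312397800, -980043892928100, -1296619308784800, -235618913029500, 428343382467000, 288286198200000, 56688591960000], [], [871818292800,
     40140265461660, 275857725812760, 558264657066480, -498503382577200, -2927452153036320, -1027400455383120, 6592855659914160, 5036163967532880,
     -9916528119792840, -10431199239945120, 11322491365195920, 16831322629758000, -3842128634198400, -9286795349198640, 9887784982966800,
     17432650020567600, 4371685858039500, -5454796950603000, -4032195247080000, -823252149720000], [], [-7493154287220, 27764177958720,
     861568934096430, 3351710277333810, 339150717127530, -18589195385553870, -17582075744911650, 51409490199231150, 65653496700152970,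
     -107189494286276430, -161116571818371750, 155192090162612370, 270886235716082070, -178971857241456090, -399593075170415910, 15804692489351850,
     211087113692122290, -164335516721469450, -362259766914259200, -106571389802377500, 110660367636819000, 86994708080280000, 18194051355480000]],
   [[], [], [], [], [], [], [], [], [], [], [], [99608008500, 996080085000, 4126070198250, 8390059177500, 5275393373250, -13745905173000,
     -36452700033750, -32280656908500, 5689149716250, 40624743159000, 37969806624750, 9539382352500, -10930063394250, -12182825655000,
     -5643176789250, -1340877037500, -134087703750], [-99608008500, -1095688093500, -5122150283250, -12516129375750, -13665452550750, 8470511799750,
     50198605206750, 68733356942250, 26591507192250, -46313892875250, -78594549783750, -47509188977250, 1390681041750, 23112889049250,
     17826002444250, 6984053826750, 1474964741250, 134087703750], [99608008500, 930951771750, 3310050744000, 5693436874125, 11099816602875,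
     55408414186125, 189719962306875, 329976247726125, 181118646583875, -411465997317375, -1031250195100125, -1028718400334625, -367110879510375,
     311034854505375, 509569487051625, 335411451750375, 125556533227125, 26239686598125, 2397615845625]],
   [[], [-367783416000, -1471133664000, -1930862934000, -367783416000, 1838917080000, 3310050744000, 3126159036000, 367783416000, -2206700496000,
     -1838917080000, -459729270000], [551675124000, 4103083734750, 8010782529750, -2459551594500, -20825735931000, -3792766477500, 41996268814500,
     38065583556000, -23032436427000, -51340266227250, -18653515130250, 12665541388500, 11952961020000, 2758375620000], [-612972360000,
     -3930685258500, -6589452870000, 5018711197500, 25974703755000, 21500005527000, -8642910276000, -16075200141000, 2911618710000, 1800606307500,
     -16887388518000, -14443161232500, 2007484479000, 6129723600000, 1838917080000], [-551675124000, 1291073033250, 13933627958250, 16998489758250,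
     -32062285505250, -74108358324000, -1831254925500, 80521581640500, 5509089085500, -92861481462750, -23810145108750, 84532719521250,
     62105593299750, -9937814386500, -23292949680000, -6436209780000], [-1422095875200, -14426304492600, -33740041935600, 15420341336400,
     130458907378800, 71154853169400, -175959845661600, -162172054044000, 118266887138400, 91284865471800, -179308717988400, -111244267134000,
     167163692295600, 166580346933000, -8295559272000, -56597781240000, -17163226080000], [-1949252104800, -1165413699450, 43530998360850,
     105796986094800, -59605943096700, -385267686353550, -130808046218850, 586744805146500, 389463226752600, -524881335928950, -364344385655250,
     553177927902600, 431850776256900, -371354746212450, -439109135214750, -3813198889500, 130971760920000, 40762661940000], [-73556683200,
     -35257659336900, -156734697319200, -35099308143900, 690415336611000, 581402069948700, -1427867447806800, -1514608315119900, 2060061891287400,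
     2427236445734100, -2037448903089600, -2303497174878900, 2291783151457800, 2486095024713300, -1499636586848400, -2255340704116500,
     -134835189489000, 649069621200000, 214336001880000], [-6765463504800, -30139960400550, 85068194661450, 538777419330150, 215276804993250,
     -2011010517365850, -1832959049471550, 3846318625299150, 4398303567908250, -5188566385752750, -6704991677434050, 4881895219451250,
     6475182574810950, -4865013984981150, -6298057181666250, 2867484882512250, 5064339753222750, 429689367607500, -1395397523520000,
     -469434665700000], [12608938742400, -51155031007080, -748901277043920, -1073890913135040, 3650126518518480, 6794337590520480,
     -10447902329744880, -20396014723244160, 21602467943456400, 40389915684278160, -33353382315773520, -61156553445187200, 30829121778414960,
     58598234736481440, -31929752575440720, -53725820926377600, 19802549721754800, 42274235194191000, 4641515754876000, -11653288166520000,
     -4058452157760000], [-17403939352800, -167840365943250, -74026806243390, 2440083214508940, 4171935710222280, -9645641405159760,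
     -20954760539272560, 23991118034443560, 56119558740565320, -45640393416317700, -102797638899375420, 67795051802718240, 146389041998199000,
     -61486412939471520, -138367740755724480, 61948973337090840, 121593305489455800, -36414758600069850, -90367424711313750, -11406518643019500,
     24305153712840000, 8586338981220000], [73906002850680, 260234323303500, -2781089512224660, -10874718070283340, 14495939112154500,
     76025948564180160, -51228857685734820, -283910040204303240, 162796705916442780, 721498578185887320, -372282430324453740, -1309195129644074400,
     623341314415621620, 1865180238739228320, -551233389929383980, -1748997551162654520, 613017539773913820, 1508864644600376700,
     -386740337621929200, -1122312916885660500, -159134294976657000, 303460711554000000, 109674994829400000], [-25250303988000, -661222031529150,
     -2345132632137750, 7749897366777930, 38047973395108950, -28727976266638740, -216139597590866040, 84612635052276240, 727486929957551400,
     -274660919729146860, -1731856542716276340, 657585050340303540, 3013780674250933860, -1140323550816766680, -4152176321172985560,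
     1004328942710839200, 3862623586221571080, -1138946348683828230, -3258800351586493350, 697247154591419250, 2343221339650941750,
     359732666106313500, -623817307473360000, -227936328640020000]],
   [[183891708000, 1597559213250, 2743051311000, -2750713465500, -9845868532500, -1455809355000, 13263189439500, 7838384053500, -7960978525500,
     -8294282246250, 697256059500, 3064861800000, 919458540000], [-367783416000, -1103350248000, -459729270000, 1563079518000, 2206700496000,
     1471133664000, -183891708000, -2758375620000, -2574483912000, 367783416000, 1379187810000, 459729270000], [-612972360000, -1953849397500,
     -781539759000, 3302388589500, 566999433000, -14512120623000, -26449757334000, -14971849893000, 14374201842000, 33629196100500, 25637568957000,
     2474875903500, -10895583699000, -7968640680000, -1838917080000], [-490377888000, -2778808032000, -4127347224000, 1409836428000, 5802805008000,
     -2635781148000, -11196961776000, -11646474840000, -15773822064000, -10747448712000, 18184846680000, 36226666476000, 16999766784000,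
     -7376100732000, -9398909520000, -2451889440000], [122594472000, 4497684691500, 15334525206000, 4760751996000, -39919824945000, -31197739072500,
     62017478523000, 77745327660000, -22588031466000, -39059109589500, 38596826268000, 17817063264000, -68177850741000, -57652604509500,
     7871586723000, 23088625560000, 6742695960000], [-686529043200, -6383085508800, -11111145645600, 9193223239200, 15506838547200, -44166701779200,
     -16772285930400, 146479961628000, 89777294006400, -171803893060800, -86871805020000, 231407963186400, 142743554553600, -191296414108800,
     -198650720268000, 6136534404000, 66064798800000, 20432412000000], [-612972360000, 7592173488900, 47291839194600, 43428580895700,
     -134968681247400, -188447965605900, 230578747799400, 348660891879300, -367778307897000, -527536442733300, 365700331596600, 467145384205500,
     -455036285503800, -486917488757700, 344777541708600, 482711476747500, 17655306669000, -146636610120000, -47607519960000], [-1298333836800,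
     -22919620323600, -54659329124400, 69360546855600, 173469913016400, -424092192123600, -576002505078000, 1377057098617200, 1649709085424400,
     -2383172027636400, -3122524045040400, 2169973040835600, 2991307678959600, -2382050255785200, -2975946332158800, 1674730682024400,
     2706314969358000, 186461651376000, -790371101520000, -265348923840000], [-3211975166400, 8634956229900, 154384386156000, 287771598714600,
     -458497536096600, -1233569269132200, 1118795675797800, 2985130522974600, -2658776222302200, -5657783693562000, 4494745878222600,
     8677142268795000, -4099089149555400, -8169388463035800, 4402634456820600, 7411577026253400, -2916475737575400, -5982543544477500,
     -612815143941000, 1673028597240000, 578305367640000], [65521556100, -72624889537200, -298829239819110, 341830449520560, 1975202107949070,
     -2264853152802240, -8680298201765190, 9132555670077840, 25951810417563030, -21112608782865600, -51439675881323730, 34545745917642960,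
     77897727094237050, -30888112754378880, -73612612664761170, 34053121831288560, 65990576359657950, -22702858612434000, -52361980244574000,
     -6178116296352000, 14578014731280000, 5145920619840000], [-11634945121800, -26702300324700, 440883502359300, 1651603058125020,
     -1149342787412820, -8965408008997440, 3295680688279980, 29449024744819680, -13558126514712780, -72483701792862360, 34518940966610100,
     130521072485763960, -60170951336916420, -185627129181093600, 53272960463382660, 173129084714826240, -60272541347638620, -148625399134512300,
     39096394782845400, 111180700586455500, 15407883135645000, -30203145172200000, -10870146607320000], [18670714990200, -148543123201200,
     -1625557909919580, -32857146831600, 15968680184915640, -2252678486090760, -98531352729722640, 19397257722570000, 364083124600464360,
     -107968196675826760, -917293270288125640, 318150124309421040, 1650106947286495880, -629215270614261240, -2368921138079459600,
     545970801164071920, 2218032312414726080, -663827879343265000, -1893945846968784700, 450252932164089600, 1418360795952100000, 210761715848684000,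
     -386253365177680000, -141087405819360000]],
   [[-183891708000, -1160816406750, -2057288483250, 390769879500, 4804170871500, 2620456839000, -5930507583000, -5677656484500, 5217927214500,
     7734944967750, -471222501750, -3907698795000, -1379187810000], [], [2574483912000, 6857628277500, -4007306803500, -15469889935500,
     16580902338000, 39590352301500, 3938347413000, 2804348547000, 31292238978000, -31499117149500, -99753589435500, -31345874059500, 55657890288000,
     35498761798500, -6282966690000, -6436209780000], [122594472000, 3424983061500, 4255049799000, -18537305787000, -18879548688000, 60763439236500,
     72540170703000, -55402485138000, -60561669168000, 79918825486500, 46069980957000, -109911052251000, -82465214832000, 41991160711500,
     45661332717000, -2247565320000, -6742695960000], [4119174259200, 10176873606900, -54667939926600, -101816752237200, 231835851947700,
     352042285795200, -567471932527500, -749089513071900, 754410623967000, 837003030563700, -902070557388000, -739631860367400, 920745271145700,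
     714579680014200, -470622299647500, -407547443803500, 83721808170000, 84283699500000], [-4290806520000, 5985164285100, 71875095692400,
     -80831132682300, -404844065425800, 423829351845900, 1215360730584000, -1116980539775100, -2286487362159000, 1650495676529700, 2628787133372400,
     -2096556343982100, -2458235406627000, 2039218228347300, 2106997136244000, -997746177928500, -1083498457041000, 172585773360000,
     214336001880000], [13592224245600, 100559976466950, -132629157911250, -1028338156795950, 770212650056850, 4453438996556550, -3010512496241250,
     -11103181638699150, 7488604839766050, 18457311762940050, -11569503718322550, -20861268661683450, 14166767726461350, 18624516611951250,
     -13312611758996550, -14464181988506250, 6903919183911750, 7313730794370000, -1317839492970000, -1492587696600000], [-26795648880000,
     -38075712194520, 683995307355360, 392571609590160, -5274992450407680, -173401376868720, 21439162253789280, -5506406050345200,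
     -52510619783381760, 21633359836888800, 87238254465442080, -38065176237488400, -99061787934869760, 50181904311018480, 87506297094696480,
     -49826064411723600, -65863189920528000, 26460512161083000, 32370725250864000, -5059224129960000, -6501048634080000], [19230013202400,
     536423443305750, 468152790495390, -7398512105804820, -4554566722726020, 44193519027517860, 9169688836247940, -154408677014051460,
     15152614922144700, 346779539137951920, -101631346029813600, -545297779427260860, 200336932074579300, 607970192501091420, -270350141699497860,
     -525573674563998060, 268589736243328500, 379040920744736250, -146004370452690750, -182506636159848000, 28804070024730000, 36664684416360000],
     [-117726548759820, -818313723847620, 3658508107704450, 13207159088233110, -44498638399425210, -76796762556223710, 275179542316849170,
     195387434943811110, -996456507873516690, -172341087126998790, 2279458003337464950, -278358831340379790, -3623717359200128190,
     892277175084244950, 4064182627588353270, -1414500645306258510, -3513475397018717130, 1534490648191751250, 2516467474372051200,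
     -864619791247212000, -1200296790128436000, 172073013992880000, 239616263446560000], [-88404837393600, 2046250214681400, 10075200646066920,
     -34516152218850120, -118213499095522740, 315447312750750180, 591876990379354680, -1709622259732066680, -1461229232649764760,
     5774232120275400600, 1603436801500748760, -12705373743455713320, 572748006029253600, 19668474079119662160, -3851635757080380360,
     -21812547535950454920, 6681200727503429400, 18627640489633484400, -7436879258877650400, -13029271041124993200, 4273775510933428500,
     6120369355680079500, -865067084451570000, -1216878875191980000]],
   [[465858993600, 1518639021900, 2847256612200, 1190698809300, -7941056923800, -8633715690600, 12988884308400, 20194374400200, -10769924365200,
     -29295481515300, -4532930602200, 17477374414500, 8780829057000, -2451889440000, -1838917080000], [], [-1422095875200, -11618891083800,
     -17073323467200, 31551730610400, 51673569948000, -93250463506200, -154084905374400, 60553496203200, 132426548654400, -50728570893000,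
     -19901169288000, 158763927722400, 61791700370400, -117542558133000, -70573551048000, 22271329080000, 17163226080000], [-686529043200,
     -1397576980800, -2733856725600, -791415424800, 28215798811200, 8508056356800, -136560706682400, -116062910964000, 157694631494400,
     131413101019200, -178586091684000, -85498746933600, 239743025121600, 142419360283200, -127382467212000, -99022279356000, 20296195920000,
     20432412000000], [4045617576000, 2164303241100, -48017189820600, 49115942775900, 289881099307800, -333053253432900, -857226521151000,
     1085602484666700, 1807473981713400, -1622733136724700, -2171494428503400, 1921703935050900, 1892500739929800, -2000567256187500,
     -1682120453013000, 1118164598050500, 979293155841000, -220397617440000, -214336001880000], [-1516902266880, 10838168621280, 10516153808160,
     -165817741209120, 92317179034080, 954556065983520, -800897244507360, -2894631202663200, 2460292428353760, 5564262409786080, -3779133064106400,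
     -6481722024217440, 4789238138324640, 5815083434640480, -4950144563364000, -4926799851573600, 2703305729124000, 2695793412312000,
     -523977854400000, -571562671680000], [13779618652800, 36013906688760, -324655147776960, -250672672570320, 2670408754453440, 84838896782640,
     -11162102251940640, 3446242558078320, 27813520813478400, -13229711963788320, -46860969324929760, 22999847605534800, 53471381918834880,
     -29772593650079280, -46857063426132960, 29988671232920400, 35708786950636800, -16634413122327000, -18286593280956000, 3331777208760000,
     3813505375680000], [-13971887649720, 45458886432960, 321698456139060, -1520343678573720, -2433508596218700, 12583247825388240, 5581401760754820,
     -52464126373659000, 2756833631812260, 129414866487706800, -39899580002542260, -217000085900237640, 82411650605023740, 248788081401940080,
     -115456149730221300, -218551818225260520, 121417263563696100, 164261624613886800, -68402430570474000, -82586820980664000, 13716792769680000,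
     17029915943040000], [42465455372340, 359968550301360, -1234137210456150, -5109146051659650, 16454485174957830, 29243866448987190,
     -103821683281906590, -72976406199646950, 377327950806837030, 57361409431476150, -863978209161197130, 129270487715719350, 1376399798049125850,
     -377845722743959470, -1547744069153211930, 578319436513889070, 1334905867260515550, -623089142627501550, -959215512845389800,
     357127187591674500, 465400336674273000, -72661938629280000, -94537291768920000], [-89573282859060, -64199962556730, 3719743821549756,
     -4702202716342131, -47079275130344457, 90389991225062529, 262659085770540459, -634465109450991819, -699600702932684553, 2417720014690065085,
     829279644494704403, -5658991005989001681, 212444139960457405, 9135564238747909963, -1806551133023019383, -10355192759603572881,
     3236497509377036905, 8958398967045793265, -3748799203059385475, -6419871641324741600, 2210810495657764000, 3098306414539336000,
     -453290731653760000, -627092707200960000]],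
   [[-1042053012000, -2836274190750, -1380464835750, -2197761315750, 1081640810250, 16746915685500, -2577037963500, -41357755939500, -3087848263500,
     60938391764250, 29324342297250, -36784726728750, -28908031902750, 5491210725000, 6589452870000], [], [2218959943200, 12311805255750,
     52908453848250, -20201866284600, -243544986184500, 139351178216250, 675288747683550, -205796445554700, -823278749693400, 355699091597850,
     620239402732950, -647608022661600, -562578029313300, 544107554540550, 368035841423250, -218625957049500, -89289640440000, 40762661940000],
     [2165835672000, 1856114360100, -17047442412000, 35732031835500, 47272995970200, -234513292513500, 82384620318000, 767003062725900,
     -229956467340600, -1055897730587700, 490136331484800, 997473064688100, -752793285043800, -914790131154900, 560745525740400, 519533521006500,
     -230515634349000, -116396640360000, 47607519960000], [-4413984775200, -84923416427850, 175649090566950, 726641358493050, -2036511699972750,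
     -1963707116020650, 8761835715182550, 545099831926650, -19897028509708350, 5262609011710050, 26742600018184050, -12481266722774850,
     -25355224729885050, 16715724542366850, 19240603033702050, -14184411754763250, -9885069108164250, 6956821962090000, 2257560174870000,
     -1492587696600000], [9333525801600, 20645463678840, -377248195724400, 275794167448800, 2933478348680880, -5017784474102400, -8476756442154000,
     23542505162336160, 8353956361710960, -54333509435084880, 4780806347837520, 74011376267468640, -24178989911796720, -71399119165133760,
     37041268755450960, 54152089869477600, -33436864303642800, -27452440304289000, 17164520889516000, 6200442448200000, -3813505375680000],
     [30891212352000, -548379759727800, -286482140544600, 10001704495582800, -8158045232937600, -60169448089951200, 92826356903280000,
     156174250898265600, -376620985627286400, -158310357042037200, 807217072540678800, -49052567372608800, -1071021490678339200, 337789567850935200,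
     1012186123932984000, -519745417705113600, -732944354334192000, 480171828701565000, 355696057321605000, -252646495010910000, -78925143897600000,
     56335313034000000], [36815839940880, 670909547468160, -3181726713405240, -7466284399654080, 52384738485479400, -5258422348779600,
     -309999142715141880, 323644053501568800, 832301982424272360, -1504119095182463760, -997329039792245160, 3362419803557374560, 220622293795863960,
     -4551700135588285680, 1009044094884385560, 4358721083506389600, -1882239543030526680, -3180596819237838000, 1863982325233828800,
     1546308514771020000, -1017915157110852000, -342623608126800000, 232292358698400000], [358309033336800, -2174192518311450, -16289179143556410,
     73270608004576710, 124220890514619990, -837055827528527880, 63746641208337360, 4220848119430935720, -3943469498607868320, -10488199708733417580,
     17395687248873710140, 12362328308476340740, -37637055339448130020, -3455774133684843880, 50169733645337786480, -10368378300337646680,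
     -47490527310740543120, 20079489126470196150, 33910113896017254350, -20132955220354917850, -16090782624643977250, 11071551445810856000,
     3514263321599030000, -2522950225035240000]],
   [[963242280000, 6981098424300, 7885159682400, -15206968576800, -8197921531800, 29442157044300, -4787751969000, -16177216255200, 42568595269200,
     -18068600850300, -110786581105200, -10189351972800, 106697033843400, 34456708786500, -41084472429000, -11237826600000, 6742695960000], [],
     [-8409980779200, -25293063896100, 6154096548600, -75193100482500, -14585580009000, 581925236993100, -479268834244200, -1884736836882900,
     1184476118225400, 2715216309105300, -1743015170496600, -2264385305882700, 2345855486574600, 1701708836127300, -2101877406228600,
     -1005328305481500, 1025007272289000, 256086230400000, -214336001880000], [-1298333836800, -11060648398800, 2387965179600, 93649430674800,
     -152165912698800, -291104433219600, 823856938304400, -101242179838800, -2442841286886000, 1007080019946000, 3482740528066800, -2056924916046000,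
     -3187166747965200, 2912307736338000, 2577572611614000, -2521773445791600, -1455840003618000, 1234417360176000, 352754241840000,
     -265348923840000], [-6788231049600, -18144653206680, 466179899225040, -374322838649760, -3691132994268720, 6681344393243520, 10236324524746320,
     -30932255489335200, -6423915973915440, 71428735738760400, -17072293031473680, -97240800121264800, 46102934396478960, 91778705220121920,
     -63502002104420880, -67634117209058400, 56876721123222000, 34253728097589000, -29487076242624000, -7942873138200000, 6501048634080000],
     [8258576606280, -34147094501520, -217389426394140, 1589258477766960, -151347917300580, -12377285214053760, 15975194396140980, 35556267740994000,
     -82315175000958900, -34299161558101440, 194543551528145820, -22778292709252080, -267959397984658380, 101481491244893760, 256497651346957020,
     -152750425124016720, -190096459749296100, 142354702304614800, 95731976538198000, -75772324011384000, -22016862307440000, 17029915943040000],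
     [-18249704993520, -558218179078560, 2491892335132200, 6310386937174320, -43715319237069480, 6179873457597840, 261273821981051880,
     -292046141477890800, -685998562757387880, 1344824869070002320, 743083360887187320, -2989078041786716880, 66139046129356200, 4026039304879191600,
     -1220270935280397000, -3818162512560636240, 1979748334076593080, 2749715531755592400, -1897922137636324800, -1330512619071636000,
     1027481107905252000, 297287566976400000, -232292358698400000], [67859317777680, 118289757540240, -4643525131883352, 10231202165915016,
     48635046390912696, -202796357796520488, -70548412529993112, 1239440793202322568, -1016976323332929960, -3355064495705527176,
     5429345226248881080, 4027767221143857048, -12530927650210346520, -865678295913435576, 17161650304625589048, -4065430590916784232,
     -16455280005515911560, 7575272110270464600, 11934239141784960000, -7628334916450248000, -5787732897522576000, 4237587903524976000,
     1292171235875520000, -973112863282560000]],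
   [[-2084106024000, -8875839772800, -22756598865000, 21551427097200, 70758123836400, -104385446965800, -94441332585600, 184511491164000,
     291502411200, -173512723784400, 177604995367800, 223276544290800, -212447365930800, -209311331229000, 114540696270000, 66745879200000,
     -31465914480000], [], [10574065101600, 88907444876250, -65330995479750, -284777411168250, 1283989103847450, -920543991617250, -3830089728014550,
     7903845589389750, 3801726110432250, -16101867548116350, 1146816989668350, 17382171897540450, -6550543918368450, -14657007128113350,
     9008543938744350, 8733055422341250, -7199955604091250, -1674349609432500, 2394270038160000, -469434665700000], [2345640897600, 4729641216300,
     83831316168600, -210817735128000, -499779619138800, 2305220235318000, -734591384326800, -6773438286014400, 9574850868382800, 7650708970905000,
     -20541936712096800, -1012826576361600, 23271410296134000, -6331487625262800, -20304192506598000, 10062545396904000, 12178656286196400,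
     -8729732608096500, -2452288817979000, 3035098586520000, -578305367640000], [-40402273111200, 322326549294750, -28891642189410,
     -7413796149980220, 16926796595889180, 27430631547178860, -134572387053964860, 57983058210217140, 355860277118646300, -465854643140566680,
     -345257600724036000, 936285053383019340, -6543148100989500, -1030875680213559180, 337282227950407740, 840188142989935740, -510246715730251500,
     -451365039947571750, 432291923682869250, 56635262355672000, -145672079823270000, 36664684416360000], [2229560473140, -300480808708080,
     1482458130243090, 1746567247214790, -27989613228466890, 43942494036471030, 111295456493711490, -386251532351955270, 72566906199297510,
     1059576917341092150, -1149564343957479450, -1124016921681744090, 2447211073491674490, 221230574914278930, -2760599897816891130,
     689585014386458190, 2292751107674977950, -1230173371840563150, -1255439823905467200, 1107464108266015500, 173747155589007000,
     -382803369508560000, 94537291768920000], [-332023092055200, 1414716788107350, 15779130897192390, -88363423973809530, -22324346782649730,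
     987149242217076120, -1591633388545713240, -3104133630837231720, 11049523194004309560, -2409544274644759980, -27405134072471029420,
     29360213287520451700, 27101055810264900100, -59868928697822662600, -3745657256830241480, 66077588742912688760, -18807999415948604680,
     -53243504345125344250, 31651014070371372950, 27478741112031268150, -27534020917664511250, -2667682504030544000, 9289729215797030000,
     -2522950225035240000]],
   [[4298590296000, 17054942404500, 14729093379000, 33151856037300, -112086887913000, -157742753067900, 569969403003000, 103235126494500,
     -1035574396857000, 283800097280700, 890068553173800, -784899915099300, -664554086796600, 995540628782700, 429693445981800, -709803546952500,
     -39855122307000, 219663564120000, -56688591960000], [], [-18513711216000, -75319037113320, -373598999373600, 756982367341200, 1720717816577760,
     -7620273904042800, 3665525559696000, 20249924111136720, -35553814286870880, -13675345624100160, 73060933347642240, -18009634243320720,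
     -77112362543055840, 44315831892412080, 60280212509637120, -54827018848602000, -31129070773600800, 42979431263769000, 1401518922804000,
     -14094577977480000, 4058452157760000], [-7344633195900, -11372458897800, 61788275238690, -455938125142500, 810700341100650, 2623331518287480,
     -10916563836127950, 3883494444729900, 31203150190422210, -45960278787663240, -26640088500155130, 96384654175429620, -14543472900566610,
     -104094414312808920, 50778113760363990, 83670871163339460, -67064628859177950, -44373246239322000, 54589030834338000, 3186978002208000,
     -18270684672240000, 5145920619840000], [2124920577780, 548915306759820, -2377398732058350, -3071077233514290, 46503677712762270,
     -79095141074419470, -172653457194568350, 680722451389570590, -244631194651533690, -1770670472907245910, 2315009047412811750,
     1546643822967453210, -4649769909660785910, 432088459250598150, 5009888888128594470, -2156629796538166950, -3949630253679880770,
     2990449460685536850, 1981337296143004800, -2457087106165692000, -94062556952364000, 816100484319120000, -239616263446560000], [-24363921041460,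
     -114364761581070, 2756229425605656, -8188713211143465, -18745782637757175, 155726094001885407, -197127562647270255, -610117271679820905,
     1912377655567347969, -342070962382170021, -5145701352066522247, 5865993280537603213, 4898219456922082291, -12306281436977210683,
     269040755839826971, 13514287831996660709, -5003401623707912425, -10832346047603665585, 7534803782067236675, 5544548337114186400,
     -6418287114435196000, -354344039833784000, 2166089919593600000, -627092707200960000]],
   [[-6802475359680, -40907498551920, -10541665134000, 41804053331040, -243781958379960, 740271874862520, -153218405700360, -2754925607233800,
     3027313980250560, 2347172459311680, -4766223757014720, 56794068611280, 4445220902882760, -1285535509057800, -4003899666366600, 2379627377127000,
     1371801493062000, -1484301218400000, 340131551760000], [], [52532353954080, 52633999528110, 219666637360170, 2790749020599540,
     -11751986254488480, 3144866425941240, 66070791281575080, -126925406314827120, -19901988087901920, 348927652437944580, -335548529221045140,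
     -239327607300261480, 546729649523497440, -22237152300122760, -485196973657676280, 151511890302012240, 388499899312324800, -297222973332134850,
     -81062703691719750, 170699008080100500, -68110358195880000, 8586338981220000], [7972075271160, 87611174550900, -301998501784980,
     -195043354686180, 5913428144403780, -17206891874892720, -1222229247859620, 101498670511678440, -171361896144899460, -58297310772060360,
     492337921937801940, -410587141953948960, -368120473677896940, 706438084317485520, 25483710945993300, -643741700981619240, 155727509962244220,
     528440548690154100, -372729672743828400, -119188811263021500, 223395580643235000, -87248014493640000, 10870146607320000], [123321611125440,
     -565039819333080, -9875177518601304, 63076373160792264, -57270680692456140, -590027743403715708, 1967266057707346032, -507339663297975144,
     -8370993703090138848, 15198128700654408600, 2670506195031122448, -37194406314391957176, 33151349972046067944, 23932842474558252144,
     -52665666746697574752, 2547636707468197800, 45964857848558201280, -16343207147541456000, -35096643367736004600, 30585164944996006800,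
     4650339517486162500, -16474424417191240500, 7796006763294750000, -1216878875191980000]],
   [[13098573633600, 56172854441340, 143765507733120, -298631165643720, -207929318851800, 2081650957069320, -4122398177908920, 886837863464280,
     12491301190160520, -18499921872082560, -4261211260127640, 26124011635536360, -9864827248578120, -19789693671613320, 14439163988634840,
     14957090381305800, -18950371917258600, -550627174597500, 9496156512843000, -4966889807880000, 823252149720000], [99608008500, 0, -854330226750,
     0, 3168300885750, 0, -6646919028750, 0, 8639079198750, 0, -7129634762250, 0, 3651016619250, 0, -1061208398250, 0, 134087703750],
     [-63508778653320, -549653732655300, 887041854234900, 667292930200260, -21886180351488180, 73010163340885680, -20796840384907860,
     -386527138638928560, 793717679022215220, -14373870319830840, -1959517474153244460, 2265821478590113080, 854917256269805820,
     -3303952913337782160, 903429195800285700, 2628718939913124240, -1574434440403117020, -1910301254919684900, 2255851843766812200,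
     26506974152158500, -1122429577812543000, 620979982022400000, -109674994829400000], [-13933965918600, -22161300688800, -624315406691340,
     2564390897326440, 1602512872637040, -40621580250516720, 109142637861140520, 876035091608040, -585511707112332000, 1066784830108910640,
     124911374536945360, -2746810282267538760, 2881112514540165360, 1383834285671910800, -4348448768239499560, 939987205168535160,
     3540378000179977320, -1889944601543216400, -2639134734931340100, 2910180277095145600, 110666697136996000, -1485740992852116000,
     805919722527920000, -141087405819360000]],
   [[-26746766766720, -96937404684120, -142416822988440, -455275038778560, 3202192143750600, -4289487024382560, -9362107461306600, 40821392477305440,
     -51650593353198840, -22720642329905520, 141971261568176040, -130603973621721600, -28396768883082600, 103625367783057120, 11934373706815560,
     -113362279485655200, 34611624526479000, 87658281035325000, -96103636226598000, 39423553609440000, -6037182431280000], [-99608008500,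
     99608008500, 854330226750, -854330226750, -3168300885750, 3168300885750, 6646919028750, -6646919028750, -8639079198750, 8639079198750,
     7129634762250, -7129634762250, -3651016619250, 3651016619250, 1061208398250, -1061208398250, -134087703750, 134087703750], [105551084227680,
     630512137963890, 4241066532870258, -26299535266520334, 45339379329320622, 170841297942377244, -1001077387240663824, 1583196053551026096,
     1575413365969012752, -9570383148157204828, 12286955715578457732, 3479107835857085796, -26908690315104801476, 25699477545773884216,
     3043586933967836256, -18222932202652632000, -1064072679544929600, 20422399416554578170, -9146206386359374150, -13447168365674611750,
     18721748159408043750, -9860933081425926500, 2442656596380000000, -227936328640020000]],
   [[44506828307340, 255003416256960, 14378673527190, -69165565177590, 3700785419976330, -21065086587457710, 36293207714545950, 41252378864334750,
     -265025092724729190, 400873669318019730, -4196783485336470, -824747097668151630, 1064199068465143590, -202151777213417850, -603907377511568550,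
     204364385445660090, 623857189954496610, -491873671702166250, -353505536662063800, 745005489067339500, -483280295316819000, 148155872624760000,
     -18194051355480000], [99608008500, 65128313250, -1019066548500, -2207156576625, 6229787689125, 14505461845875, -24320681760375, -43962979685625,
     59248977913125, 74924468994375, -90693182955375, -76574021398875, 87354672780375, 46749814736625, -51462039754125, -15764244370875,
     16959540472875, 2263528141875, -2397615845625]],
   [[-85550594463360, -386986561949520, -1096930395502344, 4985262425842920, -10572480446816808, -16860293209635408, 195270166698656712,
     -547309503690847872, 402936846130655304, 1464238449339714256, -4642163575260056456, 5266200660325012304, 184092632318487672,
     -7995185248394857968, 10042189423773154648, -5840025619917885760, 3870017722803221080, -8096429946772148800, 12153073566050908400,
     -10272455313187067000, 5044651919645338000, -1362766979493920000, 157681778414160000]]]"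

definition lead5 :: "int list" where
  "lead5 = [99608008500, 498040042500, 639789900750, -785370836250, -2674091920500, -1509444436500, 1992160170000, 2880970092000, 612972360000,
     -950107158000, -670438518750, -134087703750]"

definition lead6 :: "int list" where
  "lead6 = [0, -264344330250, -1321721651250, -49347923625, 10327033591875, 19391088717000, -464107644000, -36779253761250, -37028821079250,
     -823681608750, 20088892073250, 12658517746875, 2531703549375]"


section \<open>Verification of the certificates by evaluation\<close>

lemma certificate0_check:
  "vanishes3 3 (add3 (remainder (quad_list pert_x0) (quad_list pert_y0) cert0) (scale3 (-1) (mul3 [[lead0]] (pow3 pQ 1))))"
  by code_simp

lemma certificate1_check:
  "vanishes3 5 (add3 (remainder (quad_list pert_x1) (quad_list pert_y1) cert1) (scale3 (-1) (mul3 [[lead1]] (pow3 pQ 2))))"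
  by code_simp

lemma certificate2_check:
  "vanishes3 7 (add3 (remainder (quad_list pert_x2) (quad_list pert_y2) cert2) (scale3 (-1) (mul3 [[lead2]] (pow3 pQ 3))))"
  by code_simp

lemma certificate3_check:
  "vanishes3 9 (add3 (remainder (quad_list pert_x3) (quad_list pert_y3) cert3) (scale3 (-1) (mul3 [[lead3]] (pow3 pQ 4))))"
  by code_simp

lemma certificate4_check:
  "vanishes3 11 (add3 (remainder (quad_list pert_x4) (quad_list pert_y4) cert4) (scale3 (-1) (mul3 [[lead4]] (pow3 pQ 5))))"
  by code_simp

text \<open>Here the check extends to degree 14: the coefficient of order 12 will be made small, so
  the term of order 14 must be known exactly, and neither degree 13 nor another term of degree 14
  may interfere with it.\<close>

lemma certificate5_check:
  "vanishes3 15 (add3 (remainder (quad_list pert_x5) (quad_list pert_y5) cert5)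
     (scale3 (-1) (add3 (mul3 [[lead5]] (pow3 pQ 6)) (mul3 [[lead6]] (pow3 pQ 7)))))"
  by code_simp

section \<open>Evaluation and differentiation of coefficient lists\<close>

lemma list_eval_add:
  assumes "\<And>x y. e (f x y) = e x + e y"
  shows "list_eval e z (list_add f xs ys) = list_eval e z xs + list_eval e z ys"
proof (induction xs arbitrary: ys)
  case (Cons x xs)
  then show ?case by (cases ys) (simp_all add: assms algebra_simps)
qed simp

lemma list_eval_map_mul:
  assumes "\<And>y. e (g x y) = c * e y"
  shows "list_eval e z (map (g x) ys) = c * list_eval e z ys"
  by (induction ys) (simp_all add: assms algebra_simps)

lemma list_eval_mul:
  assumes f: "\<And>x y. e (f x y) = e x + e y" and g: "\<And>x y. e (g x y) = e x * e y" and z0: "e z0 = 0"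
  shows "list_eval e z (list_mul f g z0 xs ys) = list_eval e z xs * list_eval e z ys"
proof (induction xs)
  case (Cons x xs)
  have "list_eval e z (map (g x) ys) = e x * list_eval e z ys" by (rule list_eval_map_mul) (rule g)
  then show ?case using Cons by (simp add: list_eval_add[OF f] z0 algebra_simps)
qed simp

lemma list_eval_deriv:
  assumes f: "\<And>x y. e (f x y) = e x + e y" and z0: "e z0 = 0"
  shows "((\<lambda>z. list_eval e z xs) has_real_derivative list_eval e z (list_deriv f z0 xs)) (at z)"
proof (induction xs)
  case (Cons x xs)
  have "((\<lambda>z. e x + z * list_eval e z xs) has_real_derivative
      0 + (1 * list_eval e z xs + list_eval e z (list_deriv f z0 xs) * z)) (at z)"
    by (intro DERIV_add DERIV_const DERIV_mult DERIV_ident Cons)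
  then show ?case by (simp add: list_eval_add[OF f] z0 mult.commute)
qed simp

lemma eval1_add: "eval1 d (add1 xs ys) = eval1 d xs + eval1 d ys"
  unfolding eval1_def add1_def by (rule list_eval_add) simp

lemma eval1_mul: "eval1 d (mul1 xs ys) = eval1 d xs * eval1 d ys"
  unfolding eval1_def mul1_def by (rule list_eval_mul) simp_all

lemma eval1_Nil: "eval1 d [] = 0" unfolding eval1_def by simp

abbreviation "eval2l d y \<equiv> list_eval (eval1 d) y"

lemma eval2l_add: "eval2l d y (add2 xs ys) = eval2l d y xs + eval2l d y ys"
  unfolding add2_def by (rule list_eval_add) (rule eval1_add)

lemma eval2l_mul: "eval2l d y (mul2 xs ys) = eval2l d y xs * eval2l d y ys"
  unfolding mul2_def by (rule list_eval_mul) (rule eval1_add eval1_mul eval1_Nil)+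

lemma eval3_add: "eval3 d x y (add3 P Q) = eval3 d x y P + eval3 d x y Q"
  unfolding eval3_def add3_def by (rule list_eval_add) (rule eval2l_add)

lemma eval3_mul: "eval3 d x y (mul3 P Q) = eval3 d x y P * eval3 d x y Q"
  unfolding eval3_def mul3_def by (rule list_eval_mul) (simp_all add: eval2l_add eval2l_mul)

lemma eval3_scale: "eval3 d x y (scale3 c P) = of_int c * eval3 d x y P"
proof -
  have 1: "eval1 d (map ((*) c) xs) = of_int c * eval1 d xs" for xs
    unfolding eval1_def by (rule list_eval_map_mul) simp
  have 2: "eval2l d y (map (map ((*) c)) xs) = of_int c * eval2l d y xs" for xs
    by (induction xs) (simp_all add: 1 distrib_left mult.left_commute)
  show ?thesis unfolding eval3_def scale3_def by (induction P) (simp_all add: 2 distrib_left mult.left_commute)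
qed

lemma eval3_pow: "eval3 d x y (pow3 P n) = eval3 d x y P ^ n"
  by (induction n) (simp_all add: eval3_mul, simp add: eval3_def pone_def eval1_def)

lemma eval3_has_derivative:
  "((\<lambda>p. eval3 d (fst p) (snd p) P) has_derivative
     (\<lambda>h. eval3 d (fst p) (snd p) (deriv_x P) * fst h + eval3 d (fst p) (snd p) (deriv_y P) * snd h)) (at p)"
proof (induction P)
  case Nil
  then show ?case unfolding eval3_def deriv_x_def deriv_y_def by simp
next
  case (Cons q P)
  have q: "((\<lambda>p. eval2l d (snd p) q) has_derivative (\<lambda>h. eval2l d (snd p) (list_deriv add1 [] q) * snd h)) (at p)"
  proof -
    have "((\<lambda>y. eval2l d y q) has_real_derivative eval2l d (snd p) (list_deriv add1 [] q)) (at (snd p))"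
      by (rule list_eval_deriv) (rule eval1_add eval1_Nil)+
    then have "((\<lambda>y. eval2l d y q) has_derivative (*) (eval2l d (snd p) (list_deriv add1 [] q))) (at (snd p))"
      unfolding has_field_derivative_def .
    from has_derivative_compose[OF has_derivative_snd[OF has_derivative_ident] this] show ?thesis by simp
  qed
  have "((\<lambda>p. eval2l d (snd p) q + fst p * eval3 d (fst p) (snd p) P) has_derivative
     (\<lambda>h. eval2l d (snd p) (list_deriv add1 [] q) * snd h +
        (fst p * (eval3 d (fst p) (snd p) (deriv_x P) * fst h + eval3 d (fst p) (snd p) (deriv_y P) * snd h) + fst h * eval3 d (fst p) (snd p) P))) (at p)"
    by (intro has_derivative_add q has_derivative_mult has_derivative_fst has_derivative_ident Cons)
  moreover have "eval3 d x y (deriv_x (q # P)) = eval3 d x y P + x * eval3 d x y (deriv_x P)" for x y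
    unfolding deriv_x_def eval3_def by (simp add: list_eval_add[OF eval2l_add])
  moreover have "eval3 d x y (deriv_y (q # P)) = eval2l d y (list_deriv add1 [] q) + x * eval3 d x y (deriv_y P)" for x y
    unfolding deriv_y_def eval3_def by simp
  moreover have "eval3 d x y (q # P) = eval2l d y q + x * eval3 d x y P" for x y
    unfolding eval3_def by simp
  ultimately show ?case by (simp add: algebra_simps)
qed

lemma continuous_on_list_eval:
  assumes "\<And>a. continuous_on S (\<lambda>p. e p a)" "continuous_on S z"
  shows "continuous_on S (\<lambda>p. list_eval (e p) (z p) xs)"
  by (induction xs) (simp_all add: continuous_on_const continuous_on_add continuous_on_mult assms)

lemma continuous_on_eval3:
  assumes "continuous_on S d" "continuous_on S x" "continuous_on S y"
  shows "continuous_on S (\<lambda>p. eval3 (d p) (x p) (y p) P)"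
  unfolding eval3_def eval1_def
  by (intro continuous_on_list_eval assms continuous_on_const)

lemma continuous_on_eval1: "continuous_on S d \<Longrightarrow> continuous_on S (\<lambda>p. eval1 (d p) P)"
  unfolding eval1_def by (intro continuous_on_list_eval continuous_on_const)

section \<open>Bounds that are uniform in the parameter\<close>

lemma eval1_bound: "\<exists>C\<ge>0. \<forall>d. \<bar>d\<bar> \<le> D \<longrightarrow> \<bar>eval1 d c\<bar> \<le> C"
proof (induction c)
  case Nil
  then show ?case by (auto simp: eval1_def intro: exI[of _ 0])
next
  case (Cons a c)
  then obtain C where C: "0 \<le> C" "\<And>d. \<bar>d\<bar> \<le> D \<Longrightarrow> \<bar>eval1 d c\<bar> \<le> C" by blast
  have "\<bar>eval1 d (a # c)\<bar> \<le> \<bar>real_of_int a\<bar> + \<bar>D\<bar> * C" if "\<bar>d\<bar> \<le> D" for d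
  proof -
    have "\<bar>d * eval1 d c\<bar> \<le> \<bar>D\<bar> * C" unfolding abs_mult using that C(2)[OF that] by (intro mult_mono) auto
    then show ?thesis by (simp add: eval1_def)
  qed
  then show ?case using C(1) by (intro exI[of _ "\<bar>real_of_int a\<bar> + \<bar>D\<bar> * C"]) auto
qed

lemma eval2l_bound: "\<exists>C\<ge>0. \<forall>d y. \<bar>d\<bar> \<le> D \<longrightarrow> \<bar>y\<bar> \<le> 1 \<longrightarrow> \<bar>eval2l d y c\<bar> \<le> C"
proof (induction c)
  case Nil
  then show ?case by (auto intro: exI[of _ 0])
next
  case (Cons a c)
  then obtain C where C: "0 \<le> C" "\<And>d y. \<bar>d\<bar> \<le> D \<Longrightarrow> \<bar>y\<bar> \<le> 1 \<Longrightarrow> \<bar>eval2l d y c\<bar> \<le> C" by blast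
  obtain B where B: "0 \<le> B" "\<And>d. \<bar>d\<bar> \<le> D \<Longrightarrow> \<bar>eval1 d a\<bar> \<le> B" using eval1_bound by blast
  have "\<bar>eval2l d y (a # c)\<bar> \<le> B + C" if "\<bar>d\<bar> \<le> D" "\<bar>y\<bar> \<le> 1" for d y
  proof -
    have "\<bar>y * eval2l d y c\<bar> \<le> 1 * C" unfolding abs_mult using that C(2)[OF that] by (intro mult_mono) auto
    then show ?thesis using B(2)[OF that(1)] by simp
  qed
  then show ?case using C(1) B(1) by (intro exI[of _ "B + C"]) auto
qed

lemma eval3_bound: "\<exists>C\<ge>0. \<forall>d x y. \<bar>d\<bar> \<le> D \<longrightarrow> \<bar>x\<bar> \<le> 1 \<longrightarrow> \<bar>y\<bar> \<le> 1 \<longrightarrow> \<bar>eval3 d x y c\<bar> \<le> C"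
proof (induction c)
  case Nil
  then show ?case by (auto simp: eval3_def intro: exI[of _ 0])
next
  case (Cons a c)
  then obtain C where C: "0 \<le> C" "\<And>d x y. \<bar>d\<bar> \<le> D \<Longrightarrow> \<bar>x\<bar> \<le> 1 \<Longrightarrow> \<bar>y\<bar> \<le> 1 \<Longrightarrow> \<bar>eval3 d x y c\<bar> \<le> C" by blast
  obtain B where B: "0 \<le> B" "\<And>d y. \<bar>d\<bar> \<le> D \<Longrightarrow> \<bar>y\<bar> \<le> 1 \<Longrightarrow> \<bar>eval2l d y a\<bar> \<le> B" using eval2l_bound by blast
  have "\<bar>eval3 d x y (a # c)\<bar> \<le> B + C" if "\<bar>d\<bar> \<le> D" "\<bar>x\<bar> \<le> 1" "\<bar>y\<bar> \<le> 1" for d x y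
  proof -
    have "\<bar>x * eval3 d x y c\<bar> \<le> 1 * C" unfolding abs_mult using that C(2)[OF that] by (intro mult_mono) auto
    then show ?thesis using B(2)[OF that(1,3)] by (simp add: eval3_def)
  qed
  then show ?case using C(1) B(1) by (intro exI[of _ "B + C"]) auto
qed

lemma eval1_zero: "list_all (\<lambda>a. a = 0) c \<Longrightarrow> eval1 d c = 0"
  unfolding eval1_def by (induction c) auto

text \<open>Every vanishing initial coefficient lets a factor y be split off, and the rest is
  bounded on the unit interval. The constant is uniform for |d| \<le> D; this matters because
  \<open>d\<close> is moved towards \<open>\<delta>0\<close> after the constant has been
  fixed.\<close>

lemma vanishes2_bound:
  "vanishes2 n c \<Longrightarrow> \<exists>C\<ge>0. \<forall>d y \<rho>. \<bar>d\<bar> \<le> D \<longrightarrow> \<bar>y\<bar> \<le> \<rho> \<longrightarrow> \<rho> \<le> 1 \<longrightarrow> \<bar>eval2l d y c\<bar> \<le> C * \<rho> ^ n"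
proof (induction n c rule: vanishes2.induct)
  case (1 ps)
  obtain C where "0 \<le> C" "\<And>d y. \<bar>d\<bar> \<le> D \<Longrightarrow> \<bar>y\<bar> \<le> 1 \<Longrightarrow> \<bar>eval2l d y ps\<bar> \<le> C" using eval2l_bound by blast
  then show ?case by (intro exI[of _ C]) auto
next
  case (2 n)
  then show ?case by (intro exI[of _ 0]) simp
next
  case (3 n p ps)
  then obtain C where C: "0 \<le> C" "\<And>d y \<rho>. \<bar>d\<bar> \<le> D \<Longrightarrow> \<bar>y\<bar> \<le> \<rho> \<Longrightarrow> \<rho> \<le> 1 \<Longrightarrow> \<bar>eval2l d y ps\<bar> \<le> C * \<rho> ^ n" by auto
  have "\<bar>eval2l d y (p # ps)\<bar> \<le> C * \<rho> ^ Suc n" if "\<bar>d\<bar> \<le> D" "\<bar>y\<bar> \<le> \<rho>" "\<rho> \<le> 1" for d y \<rho>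
  proof -
    have "eval1 d p = 0" using 3(2) by (intro eval1_zero) simp
    then have "\<bar>eval2l d y (p # ps)\<bar> = \<bar>y\<bar> * \<bar>eval2l d y ps\<bar>" by (simp add: abs_mult)
    also have "\<dots> \<le> \<rho> * (C * \<rho> ^ n)" using C(2)[OF that] that by (intro mult_mono) auto
    finally show ?thesis by (simp add: mult_ac)
  qed
  then show ?case using C(1) by blast
qed

lemma vanishes3_bound:
  "vanishes3 n c \<Longrightarrow> \<exists>C\<ge>0. \<forall>d x y \<rho>. \<bar>d\<bar> \<le> D \<longrightarrow> \<bar>x\<bar> \<le> \<rho> \<longrightarrow> \<bar>y\<bar> \<le> \<rho> \<longrightarrow> \<rho> \<le> 1 \<longrightarrow> \<bar>eval3 d x y c\<bar> \<le> C * \<rho> ^ n"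
proof (induction n c rule: vanishes3.induct)
  case (1 ps)
  obtain C where "0 \<le> C" "\<And>d x y. \<bar>d\<bar> \<le> D \<Longrightarrow> \<bar>x\<bar> \<le> 1 \<Longrightarrow> \<bar>y\<bar> \<le> 1 \<Longrightarrow> \<bar>eval3 d x y ps\<bar> \<le> C" using eval3_bound by blast
  then show ?case by (intro exI[of _ C]) auto
next
  case (2 n)
  then show ?case by (intro exI[of _ 0]) (simp add: eval3_def)
next
  case (3 n p ps)
  have "vanishes3 n ps" "vanishes2 (Suc n) p" using 3(2) by simp_all
  then obtain C B where C: "0 \<le> C" "\<And>d x y \<rho>. \<bar>d\<bar> \<le> D \<Longrightarrow> \<bar>x\<bar> \<le> \<rho> \<Longrightarrow> \<bar>y\<bar> \<le> \<rho> \<Longrightarrow> \<rho> \<le> 1 \<Longrightarrow> \<bar>eval3 d x y ps\<bar> \<le> C * \<rho> ^ n"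
    and B: "0 \<le> B" "\<And>d y \<rho>. \<bar>d\<bar> \<le> D \<Longrightarrow> \<bar>y\<bar> \<le> \<rho> \<Longrightarrow> \<rho> \<le> 1 \<Longrightarrow> \<bar>eval2l d y p\<bar> \<le> B * \<rho> ^ Suc n"
    using 3(1) vanishes2_bound[of "Suc n" p D] by blast
  have "\<bar>eval3 d x y (p # ps)\<bar> \<le> (B + C) * \<rho> ^ Suc n" if "\<bar>d\<bar> \<le> D" "\<bar>x\<bar> \<le> \<rho>" "\<bar>y\<bar> \<le> \<rho>" "\<rho> \<le> 1" for d x y \<rho>
  proof -
    have "\<bar>x * eval3 d x y ps\<bar> \<le> \<rho> * (C * \<rho> ^ n)"
      unfolding abs_mult using C(2)[OF that] that by (intro mult_mono) auto
    then have "\<bar>eval2l d y p\<bar> + \<bar>x * eval3 d x y ps\<bar> \<le> B * \<rho> ^ Suc n + \<rho> * (C * \<rho> ^ n)"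
      using B(2)[OF that(1,3,4)] by linarith
    moreover have "eval3 d x y (p # ps) = eval2l d y p + x * eval3 d x y ps" by (simp add: eval3_def)
    moreover have "\<rho> * (C * \<rho> ^ n) = C * \<rho> ^ Suc n" by simp
    ultimately show ?thesis unfolding distrib_right by linarith
  qed
  then show ?case using B(1) C(1) by (intro exI[of _ "B + C"]) auto
qed

section \<open>The certificate data as real functions\<close>

definition wX :: "real \<Rightarrow> real \<Rightarrow> real \<Rightarrow> real" where
  "wX d x y = - ((d - 1) * x) * (((d - 1) * x - 1)\<^sup>2 - ((d + 1) * y)\<^sup>2)"

definition wY :: "real \<Rightarrow> real \<Rightarrow> real \<Rightarrow> real" where
  "wY d x y = ((d + 1) * y) * (((d - 1) * x)\<^sup>2 - ((d + 1) * y + 1)\<^sup>2)"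

definition fX :: "real \<Rightarrow> real \<Rightarrow> real \<Rightarrow> real" where
  "fX d x y = - ((d + 1) * y) * (1 + 2 * x) * (1 + ((d - 1) * x + (d + 1) * y))"

definition fY :: "real \<Rightarrow> real \<Rightarrow> real \<Rightarrow> real" where
  "fY d x y = ((d - 1) * x) * (1 + 2 * y) * (1 - ((d - 1) * x + (d + 1) * y))"

lemma eval3_basic:
  "eval3 d x y pX = (d - 1) * x" "eval3 d x y pY = (d + 1) * y" "eval3 d x y pone = 1"
  "eval3 d x y [[[-1]], [[-2]]] = - (1 + 2 * x)" "eval3 d x y [[[1], [2]]] = 1 + 2 * y"
  "eval3 d x y pQ = (d - 1) * x\<^sup>2 + (d + 1) * y\<^sup>2" "eval3 d x y [[c]] = eval1 d c"
  by (simp_all add: eval3_def eval1_def pX_def pY_def pone_def pQ_def power2_eq_square algebra_simps)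

lemma eval3_structure:
  "eval3 d x y weight_x = wX d x y" "eval3 d x y weight_y = wY d x y"
  "eval3 d x y field_x = fX d x y" "eval3 d x y field_y = fY d x y"
  unfolding weight_x_def weight_y_def field_x_def field_y_def pXm_def pYp_def pS_def
    eval3_mul eval3_add eval3_scale eval3_basic wX_def wY_def fX_def fY_def
  by (simp_all add: power2_eq_square algebra_simps)

lemma eval3_remainder:
  "eval3 d x y (remainder P Q G) = wX d x y * eval3 d x y P + wY d x y * eval3 d x y Q
    - (fX d x y * eval3 d x y (deriv_x G) + fY d x y * eval3 d x y (deriv_y G)
       + 4 * ((d - 1) * x * ((d + 1) * y)) * eval3 d x y G)"
  unfolding remainder_def eval3_mul eval3_add eval3_scale eval3_basic eval3_structure by simp

text \<open>The divisors 2 and 4 undo the passage to half displacements in the linear and in the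
  quadratic terms.\<close>

definition quad_coeff :: "real \<Rightarrow> int list list \<Rightarrow> nat \<Rightarrow> real" where
  "quad_coeff d c i = eval1 d (c ! i) / (if i < 2 then 2 else 4)"

lemma eval3_quad_list: "eval3 d (u / 2) (v / 2) (quad_list c) = quad (quad_coeff d c) u v"
  unfolding quad_list_def eval3_def quad_def quad_coeff_def
  by (simp add: eval1_Nil power2_eq_square field_simps)

section \<open>The integrable base field\<close>

lemma has_derivative_half:
  fixes f :: "'a::real_normed_vector \<Rightarrow> real"
  assumes "(f has_derivative f') F"
  shows "((\<lambda>x. f x / 2) has_derivative (\<lambda>h. f' h / 2)) F"
  by (rule bounded_linear.has_derivative[OF bounded_linear_divide assms])

text \<open>The time-reversed base field, so that the polar angle increases for \<open>d > 1\<close>.\<close>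

definition base_x :: "real \<Rightarrow> nat \<Rightarrow> real" where
  "base_x d i = [0, - (d + 1), 0, - (d\<^sup>2 - 1) / 2, - (d + 1)\<^sup>2 / 2] ! i"

definition base_y :: "real \<Rightarrow> nat \<Rightarrow> real" where
  "base_y d i = [d - 1, 0, - (d - 1)\<^sup>2 / 2, - (d\<^sup>2 - 1) / 2, 0] ! i"

definition hX :: "real \<Rightarrow> real \<Rightarrow> real" where "hX d u = (d - 1) * u / 2"
definition hY :: "real \<Rightarrow> real \<Rightarrow> real" where "hY d v = (d + 1) * v / 2"

text \<open>With u and v the displacements, \<open>weight1\<close> and \<open>weight2\<close> are
  half the components of the gradient of \<open>integral_fun\<close>, multiplied by the hyperbola
  and by 1 + u and 1 + v, respectively.\<close>

definition weight1 :: "real \<Rightarrow> real \<times> real \<Rightarrow> real" where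
  "weight1 d q = - hX d (fst q) * ((hX d (fst q) - 1)\<^sup>2 - (hY d (snd q))\<^sup>2)"

definition weight2 :: "real \<Rightarrow> real \<times> real \<Rightarrow> real" where
  "weight2 d q = hY d (snd q) * ((hX d (fst q))\<^sup>2 - (hY d (snd q) + 1)\<^sup>2)"

definition hyperbola :: "real \<Rightarrow> real \<times> real \<Rightarrow> real" where
  "hyperbola d q = (hX d (fst q))\<^sup>2 - (hY d (snd q))\<^sup>2 + d"

abbreviation quadp :: "(nat \<Rightarrow> real) \<Rightarrow> real \<times> real \<Rightarrow> real" where
  "quadp \<alpha> q \<equiv> quad \<alpha> (fst q) (snd q)"

definition vel1 :: "real \<Rightarrow> real \<times> real \<Rightarrow> real" where
  "vel1 d q = (1 + fst q) * quadp (base_x d) q"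

definition vel2 :: "real \<Rightarrow> real \<times> real \<Rightarrow> real" where
  "vel2 d q = (1 + snd q) * quadp (base_y d) q"

lemma quad_base:
  "quad (base_x d) u v = - 2 * hY d v * (1 + hX d u + hY d v)"
  "quad (base_y d) u v = 2 * hX d u * (1 - hX d u - hY d v)"
  unfolding quad_def base_x_def base_y_def hX_def hY_def
  by (simp_all add: power2_eq_square field_simps)

text \<open>Constancy of \<open>integral_fun\<close> along the base field, with denominators
  cleared. Each product contains the same factors X Y (X - Y - 1) (X + Y - 1) (X + Y + 1), with
  opposite signs.\<close>

lemma weights_orthogonal: "weight1 d q * quadp (base_x d) q + weight2 d q * quadp (base_y d) q = 0"
  unfolding quad_base weight1_def weight2_def by algebra

text \<open>The left side is the derivative of \<open>hyperbola d\<close> along the base field, so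
  the hyperbola is invariant with cofactor -4 X Y.\<close>

lemma hyperbola_invariant:
  "(d - 1) * hX d (fst q) * vel1 d q - (d + 1) * hY d (snd q) * vel2 d q = - 4 * hX d (fst q) * hY d (snd q) * hyperbola d q"
proof -
  have x: "(d - 1) * (1 + fst q) = d - 1 + 2 * hX d (fst q)" and y: "(d + 1) * (1 + snd q) = d + 1 + 2 * hY d (snd q)"
    unfolding hX_def hY_def by (simp_all add: field_simps)
  have "(d - 1) * hX d (fst q) * vel1 d q - (d + 1) * hY d (snd q) * vel2 d q
      = hX d (fst q) * ((d - 1) * (1 + fst q)) * quadp (base_x d) q - hY d (snd q) * ((d + 1) * (1 + snd q)) * quadp (base_y d) q"
    unfolding vel1_def vel2_def by (simp add: algebra_simps)
  also have "\<dots> = - 4 * hX d (fst q) * hY d (snd q) * hyperbola d q"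
    unfolding x y quad_base hyperbola_def by algebra
  finally show ?thesis .
qed

text \<open>Divided by the hyperbola f, the equation splits half the first-order change of
  \<open>integral_fun\<close> into the derivative of G / f along the base field and R / f. It is
  linear in the perturbation, so perturbations can be superposed. Continuity of the partial
  derivatives serves to bound the error of second order.\<close>

definition certificate :: "real \<Rightarrow> (nat \<Rightarrow> real) \<Rightarrow> (nat \<Rightarrow> real) \<Rightarrow> (real \<times> real \<Rightarrow> real) \<Rightarrow> bool" where
  "certificate d \<alpha> \<beta> R \<longleftrightarrow> (\<exists>G G1 G2 :: real \<times> real \<Rightarrow> real.
     (\<forall>q. (G has_derivative (\<lambda>h. G1 q * fst h + G2 q * snd h)) (at q)) \<and>
     continuous_on UNIV G1 \<and> continuous_on UNIV G2 \<and>
     (\<forall>q. weight1 d q * quadp \<alpha> q + weight2 d q * quadp \<beta> q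
        = vel1 d q * G1 q + vel2 d q * G2 q + 4 * hX d (fst q) * hY d (snd q) * G q + R q))"

lemma quad_linear: "quad (\<lambda>i. a * \<alpha> i + b * \<beta> i) u v = a * quad \<alpha> u v + b * quad \<beta> u v"
  unfolding quad_def by (simp add: algebra_simps)

lemma certificate_linear:
  assumes "certificate d \<alpha> \<beta> R" "certificate d \<alpha>' \<beta>' R'"
  shows "certificate d (\<lambda>i. a * \<alpha> i + b * \<alpha>' i) (\<lambda>i. a * \<beta> i + b * \<beta>' i) (\<lambda>q. a * R q + b * R' q)"
proof -
  obtain G G1 G2 where G: "\<And>q. (G has_derivative (\<lambda>h. G1 q * fst h + G2 q * snd h)) (at q)"
    "continuous_on UNIV G1" "continuous_on UNIV G2"
    and Geq: "\<And>q. weight1 d q * quadp \<alpha> q + weight2 d q * quadp \<beta> q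
        = vel1 d q * G1 q + vel2 d q * G2 q + 4 * hX d (fst q) * hY d (snd q) * G q + R q"
    using assms(1) unfolding certificate_def by blast
  obtain G' G1' G2' where G': "\<And>q. (G' has_derivative (\<lambda>h. G1' q * fst h + G2' q * snd h)) (at q)"
    "continuous_on UNIV G1'" "continuous_on UNIV G2'"
    and Geq': "\<And>q. weight1 d q * quadp \<alpha>' q + weight2 d q * quadp \<beta>' q
        = vel1 d q * G1' q + vel2 d q * G2' q + 4 * hX d (fst q) * hY d (snd q) * G' q + R' q"
    using assms(2) unfolding certificate_def by blast
  have "((\<lambda>q. a * G q + b * G' q) has_derivative (\<lambda>h. (a * G1 q + b * G1' q) * fst h + (a * G2 q + b * G2' q) * snd h)) (at q)" for q
  proof -
    have "((\<lambda>q. a * G q + b * G' q) has_derivative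
        (\<lambda>h. a * (G1 q * fst h + G2 q * snd h) + b * (G1' q * fst h + G2' q * snd h))) (at q)"
      by (intro has_derivative_add has_derivative_mult_right G(1) G'(1))
    moreover have "(\<lambda>h. a * (G1 q * fst h + G2 q * snd h) + b * (G1' q * fst h + G2' q * snd h))
        = (\<lambda>h. (a * G1 q + b * G1' q) * fst h + (a * G2 q + b * G2' q) * snd h)"
      by (simp add: fun_eq_iff algebra_simps)
    ultimately show ?thesis by simp
  qed
  moreover have "continuous_on UNIV (\<lambda>q. a * G1 q + b * G1' q)" "continuous_on UNIV (\<lambda>q. a * G2 q + b * G2' q)"
    by (intro continuous_on_add continuous_on_mult continuous_on_const G G')+
  moreover have "weight1 d q * quadp (\<lambda>i. a * \<alpha> i + b * \<alpha>' i) q + weight2 d q * quadp (\<lambda>i. a * \<beta> i + b * \<beta>' i) q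
      = vel1 d q * (a * G1 q + b * G1' q) + vel2 d q * (a * G2 q + b * G2' q)
        + 4 * hX d (fst q) * hY d (snd q) * (a * G q + b * G' q) + (a * R q + b * R' q)" for q
  proof -
    have "weight1 d q * quadp (\<lambda>i. a * \<alpha> i + b * \<alpha>' i) q + weight2 d q * quadp (\<lambda>i. a * \<beta> i + b * \<beta>' i) q
        = a * (weight1 d q * quadp \<alpha> q + weight2 d q * quadp \<beta> q) + b * (weight1 d q * quadp \<alpha>' q + weight2 d q * quadp \<beta>' q)"
      unfolding quad_linear by (simp add: algebra_simps)
    then show ?thesis unfolding Geq Geq' by (simp add: algebra_simps)
  qed
  ultimately show ?thesis unfolding certificate_def
    by (intro exI[of _ "\<lambda>q. a * G q + b * G' q"] exI[of _ "\<lambda>q. a * G1 q + b * G1' q"] exI[of _ "\<lambda>q. a * G2 q + b * G2' q"]) blast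
qed

definition evalp :: "real \<Rightarrow> int list list list \<Rightarrow> real \<times> real \<Rightarrow> real" where
  "evalp d P q = eval3 d (fst q / 2) (snd q / 2) P"

lemma halves: "(d - 1) * (u / 2) = hX d u" "(d + 1) * (v / 2) = hY d v"
  unfolding hX_def hY_def by simp_all

text \<open>True for every list G, since \<open>remainder\<close> is by construction what the
  equation leaves over; the checks of the concrete data only show how small it is near the
  equilibrium. The divisions by 2 come from the chain rule for half displacements.\<close>

lemma certificate_of_list:
  "certificate d (quad_coeff d c) (quad_coeff d c') (evalp d (remainder (quad_list c) (quad_list c') G))"
proof -
  have der: "(evalp d G has_derivative (\<lambda>h. evalp d (deriv_x G) q / 2 * fst h + evalp d (deriv_y G) q / 2 * snd h)) (at q)" for q
  proof -
    have "((\<lambda>q. (fst q / 2, snd q / 2)) has_derivative (\<lambda>h. (fst h / 2, snd h / 2))) (at q)" for q :: "real \<times> real"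
      by (intro has_derivative_Pair has_derivative_half has_derivative_fst has_derivative_snd has_derivative_ident)
    from has_derivative_compose[OF this eval3_has_derivative[of d G]] show ?thesis
      unfolding evalp_def by simp
  qed
  have cont: "continuous_on UNIV (\<lambda>q. evalp d P q / 2)" for P
    unfolding evalp_def
    by (intro continuous_on_divide continuous_on_eval3 continuous_on_const continuous_on_fst continuous_on_snd continuous_on_id) simp_all
  have f: "fX d (u / 2) (v / 2) = - hY d v * (1 + u) * (1 + (hX d u + hY d v))"
    "fY d (u / 2) (v / 2) = hX d u * (1 + v) * (1 - (hX d u + hY d v))" for u v
    unfolding fX_def fY_def halves by simp_all
  have eq: "weight1 d q * quadp (quad_coeff d c) q + weight2 d q * quadp (quad_coeff d c') q
        = vel1 d q * (evalp d (deriv_x G) q / 2) + vel2 d q * (evalp d (deriv_y G) q / 2)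
          + 4 * hX d (fst q) * hY d (snd q) * evalp d G q + evalp d (remainder (quad_list c) (quad_list c') G) q" for q
    unfolding evalp_def eval3_remainder eval3_quad_list halves f vel1_def vel2_def quad_base
      wX_def wY_def weight1_def weight2_def
    by (simp add: algebra_simps)
  show ?thesis unfolding certificate_def
    by (intro exI[of _ "evalp d G"] exI[of _ "\<lambda>q. evalp d (deriv_x G) q / 2"] exI[of _ "\<lambda>q. evalp d (deriv_y G) q / 2"] conjI allI der cont eq)
qed

text \<open>Logarithm of a Darboux first integral composed of the coordinate axes, the exponential
  of a linear form and the hyperbola. The square under the last logarithm admits both signs of the
  hyperbola, whose sign near the equilibrium is that of d.\<close>

definition integral_fun :: "real \<Rightarrow> real \<times> real \<Rightarrow> real" where
  "integral_fun d q = (d - 1) * (ln (1 + fst q) - fst q) - (d + 1) * (ln (1 + snd q) - snd q) + ln ((hyperbola d q)\<^sup>2)"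

lemma hyperbola_has_derivative:
  "(hyperbola d has_derivative (\<lambda>h. (d - 1) * hX d (fst q) * fst h - (d + 1) * hY d (snd q) * snd h)) (at q)"
proof -
  have X: "((\<lambda>q. hX d (fst q)) has_derivative (\<lambda>h. (d - 1) * fst h / 2)) (at q)"
    unfolding hX_def
    by (intro has_derivative_half has_derivative_mult_right has_derivative_fst has_derivative_ident)
  have Y: "((\<lambda>q. hY d (snd q)) has_derivative (\<lambda>h. (d + 1) * snd h / 2)) (at q)"
    unfolding hY_def
    by (intro has_derivative_half has_derivative_mult_right has_derivative_snd has_derivative_ident)
  have "((\<lambda>q. hX d (fst q) * hX d (fst q) - hY d (snd q) * hY d (snd q) + d) has_derivative
      (\<lambda>h. hX d (fst q) * ((d - 1) * fst h / 2) + (d - 1) * fst h / 2 * hX d (fst q)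
        - (hY d (snd q) * ((d + 1) * snd h / 2) + (d + 1) * snd h / 2 * hY d (snd q)) + 0)) (at q)"
    by (intro has_derivative_add has_derivative_diff has_derivative_mult X Y has_derivative_const)
  moreover have "(\<lambda>h. hX d (fst q) * ((d - 1) * fst h / 2) + (d - 1) * fst h / 2 * hX d (fst q)
        - (hY d (snd q) * ((d + 1) * snd h / 2) + (d + 1) * snd h / 2 * hY d (snd q)) + 0)
      = (\<lambda>h. (d - 1) * hX d (fst q) * fst h - (d + 1) * hY d (snd q) * snd h)"
    by (simp add: fun_eq_iff)
  moreover have "hyperbola d = (\<lambda>q. hX d (fst q) * hX d (fst q) - hY d (snd q) * hY d (snd q) + d)"
    unfolding hyperbola_def power2_eq_square by (rule ext) (rule refl)
  ultimately show ?thesis by simp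
qed

lemma integral_fun_has_derivative:
  assumes "0 < 1 + fst q" "0 < 1 + snd q" "hyperbola d q \<noteq> 0"
  shows "(integral_fun d has_derivative
     (\<lambda>h. 2 * weight1 d q / ((1 + fst q) * hyperbola d q) * fst h + 2 * weight2 d q / ((1 + snd q) * hyperbola d q) * snd h)) (at q)"
proof -
  have l1: "((\<lambda>q. ln (1 + fst q)) has_derivative (\<lambda>h. fst h * inverse (1 + fst q))) (at q)"
  proof -
    have "((\<lambda>q. 1 + fst q) has_derivative (\<lambda>h. 0 + fst h)) (at q)"
      by (intro has_derivative_add has_derivative_const has_derivative_fst has_derivative_ident)
    from has_derivative_ln[OF assms(1) this] show ?thesis by simp
  qed
  have l2: "((\<lambda>q. ln (1 + snd q)) has_derivative (\<lambda>h. snd h * inverse (1 + snd q))) (at q)"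
  proof -
    have "((\<lambda>q. 1 + snd q) has_derivative (\<lambda>h. 0 + snd h)) (at q)"
      by (intro has_derivative_add has_derivative_const has_derivative_snd has_derivative_ident)
    from has_derivative_ln[OF assms(2) this] show ?thesis by simp
  qed
  let ?c = "\<lambda>h. (d - 1) * hX d (fst q) * fst h - (d + 1) * hY d (snd q) * snd h"
  have l3: "((\<lambda>q. ln ((hyperbola d q)\<^sup>2)) has_derivative (\<lambda>h. (hyperbola d q * ?c h + ?c h * hyperbola d q) * inverse (hyperbola d q * hyperbola d q))) (at q)"
    unfolding power2_eq_square
    by (intro has_derivative_ln has_derivative_mult hyperbola_has_derivative) (use assms(3) in \<open>auto simp: zero_less_mult_iff linorder_neq_iff\<close>)
  have H: "(integral_fun d has_derivative (\<lambda>h. (d - 1) * (fst h * inverse (1 + fst q) - fst h)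
      - (d + 1) * (snd h * inverse (1 + snd q) - snd h)
      + (hyperbola d q * ?c h + ?c h * hyperbola d q) * inverse (hyperbola d q * hyperbola d q))) (at q)"
    unfolding integral_fun_def[abs_def]
    by (intro has_derivative_add has_derivative_diff has_derivative_mult_right l1 l2 l3 has_derivative_fst has_derivative_snd has_derivative_ident)
  let ?x = "1 + fst q" and ?y = "1 + snd q" and ?f = "hyperbola d q" and ?X = "hX d (fst q)" and ?Y = "hY d (snd q)"
  have nz: "?x \<noteq> 0" "?y \<noteq> 0" "?f \<noteq> 0" using assms by auto
  have w1: "2 * weight1 d q = (d - 1) * (1 - ?x) * ?f + 2 * (d - 1) * ?X * ?x"
  proof -
    have a: "(d - 1) * (1 - ?x) = - 2 * ?X" "(d - 1) * ?x = d - 1 + 2 * ?X" unfolding hX_def by (simp_all add: field_simps)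
    have "(d - 1) * (1 - ?x) * ?f + 2 * (d - 1) * ?X * ?x = (d - 1) * (1 - ?x) * ?f + 2 * ?X * ((d - 1) * ?x)" by (simp add: algebra_simps)
    also have "\<dots> = 2 * weight1 d q" unfolding a weight1_def hyperbola_def by algebra
    finally show ?thesis by simp
  qed
  have w2: "2 * weight2 d q = - (d + 1) * (1 - ?y) * ?f - 2 * (d + 1) * ?Y * ?y"
  proof -
    have a: "(d + 1) * (1 - ?y) = - 2 * ?Y" "(d + 1) * ?y = d + 1 + 2 * ?Y" unfolding hY_def by (simp_all add: field_simps)
    have "- (d + 1) * (1 - ?y) * ?f - 2 * (d + 1) * ?Y * ?y = - ((d + 1) * (1 - ?y)) * ?f - 2 * ?Y * ((d + 1) * ?y)" by (simp add: algebra_simps)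
    also have "\<dots> = 2 * weight2 d q" unfolding a weight2_def hyperbola_def by algebra
    finally show ?thesis by simp
  qed
  have e1: "2 * weight1 d q / (?x * ?f) = (d - 1) * (inverse ?x - 1) + 2 * (d - 1) * ?X / ?f"
    unfolding w1 using nz by (simp add: field_simps)
  have e2: "2 * weight2 d q / (?y * ?f) = - (d + 1) * (inverse ?y - 1) - 2 * (d + 1) * ?Y / ?f"
    unfolding w2 using nz by (simp add: field_simps)
  have e3: "(?f * c + c * ?f) * inverse (?f * ?f) = 2 * c / ?f" for c using nz(3) by (simp add: field_simps)
  have "(\<lambda>h. (d - 1) * (fst h * inverse ?x - fst h) - (d + 1) * (snd h * inverse ?y - snd h)
      + (?f * ?c h + ?c h * ?f) * inverse (?f * ?f))
    = (\<lambda>h. 2 * weight1 d q / (?x * ?f) * fst h + 2 * weight2 d q / (?y * ?f) * snd h)"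
    unfolding e1 e2 e3 by (rule ext) (simp add: algebra_simps diff_divide_distrib add_divide_distrib)
  then show ?thesis using H by simp
qed

section \<open>Cycles of the perturbed field\<close>

text \<open>The radius m / (22 M) and the Lipschitz constant 3 (26 M)^2 / m^2 for m = 1/40 and M =
  3, which are valid for 11/10 < d < 6/5 and perturbations of the coefficients by at most 1/100.
  \<open>spread\<close> is the resulting bound on the change of the radius during one turn.\<close>

definition radius0 :: real where "radius0 = (1/40) / (22 * 3)"
definition lip0 :: real where "lip0 = 3 * (26 * 3)\<^sup>2 / (1/40)\<^sup>2"
definition spread :: real where "spread = exp (lip0 * (2 * pi))"
definition ret_radius :: real where "ret_radius = radius0 * exp (- (lip0 * (2 * pi)))"

lemma constants_pos: "0 < radius0" "0 < lip0" "1 \<le> spread" "0 < ret_radius"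
  unfolding radius0_def lip0_def spread_def ret_radius_def by simp_all

lemma inverse_spread: "x * exp (- (lip0 * (2 * pi))) = x / spread"
  unfolding spread_def exp_minus by (simp add: field_simps)

lemma base_coeff_bound:
  assumes d: "11/10 < d" "d < 6/5" and small: "\<And>i. i < 5 \<Longrightarrow> \<bar>e * \<alpha> i\<bar> \<le> 1/100"
  shows "coeff_bound 3 (\<lambda>i. base_x d i + e * \<alpha> i)" "coeff_bound 3 (\<lambda>i. base_y d i + e * \<alpha> i)"
proof -
  have dd: "(d + 1)\<^sup>2 \<le> (22/10)\<^sup>2" "(d - 1)\<^sup>2 \<le> (2/10)\<^sup>2" "d\<^sup>2 \<le> (12/10)\<^sup>2" "1\<^sup>2 \<le> d\<^sup>2"
    using d by (intro power_mono; simp)+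
  have "\<bar>base_x d i\<bar> \<le> 29/10 \<and> \<bar>base_y d i\<bar> \<le> 29/10" if "i < 5" for i
  proof -
    have "i = 0 \<or> i = 1 \<or> i = 2 \<or> i = 3 \<or> i = 4" using that by linarith
    then show ?thesis unfolding base_x_def base_y_def using dd d
      by (elim disjE) (simp_all add: power2_eq_square)
  qed
  note b = this
  have "\<bar>base_x d i + e * \<alpha> i\<bar> \<le> 3 \<and> \<bar>base_y d i + e * \<alpha> i\<bar> \<le> 3" if "i < 5" for i
    using abs_triangle_ineq[of "base_x d i" "e * \<alpha> i"] abs_triangle_ineq[of "base_y d i" "e * \<alpha> i"]
      b[OF that] small[OF that] by linarith
  then show "coeff_bound 3 (\<lambda>i. base_x d i + e * \<alpha> i)" "coeff_bound 3 (\<lambda>i. base_y d i + e * \<alpha> i)"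
    unfolding coeff_bound_def by blast+
qed

lemma base_angular_speed:
  "cos t * ang1 (base_y d) t - sin t * ang1 (base_x d) t = (d - 1) * (cos t)\<^sup>2 + (d + 1) * (sin t)\<^sup>2"
  unfolding ang1_def base_x_def base_y_def by (simp add: power2_eq_square algebra_simps)

text \<open>The base field contributes at least d - 1 > 1/10, and the perturbation takes away at
  most 4/100, which leaves more than 1/20.\<close>

lemma perturbed_angular_speed:
  assumes d: "11/10 < d"
    and small: "\<And>i. i < 5 \<Longrightarrow> \<bar>e * \<alpha> i\<bar> \<le> 1/100" "\<And>i. i < 5 \<Longrightarrow> \<bar>e * \<beta> i\<bar> \<le> 1/100"
  shows "2 * (1/40) \<le> cos t * ang1 (\<lambda>i. base_y d i + e * \<beta> i) t - sin t * ang1 (\<lambda>i. base_x d i + e * \<alpha> i) t"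
proof -
  have split: "cos t * ang1 (\<lambda>i. base_y d i + e * \<beta> i) t - sin t * ang1 (\<lambda>i. base_x d i + e * \<alpha> i) t
      = (d - 1) * (cos t)\<^sup>2 + (d + 1) * (sin t)\<^sup>2
        + (cos t * ang1 (\<lambda>i. e * \<beta> i) t - sin t * ang1 (\<lambda>i. e * \<alpha> i) t)"
    unfolding base_angular_speed[symmetric] ang1_def by (simp add: algebra_simps)
  have "(d - 1) * 1 \<le> (d - 1) * (cos t)\<^sup>2 + (d + 1) * (sin t)\<^sup>2"
  proof -
    have "(d - 1) * 1 = (d - 1) * (cos t)\<^sup>2 + (d - 1) * (sin t)\<^sup>2"
      unfolding distrib_left[symmetric] by simp
    also have "\<dots> \<le> (d - 1) * (cos t)\<^sup>2 + (d + 1) * (sin t)\<^sup>2"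
      by (intro add_left_mono mult_right_mono) simp_all
    finally show ?thesis .
  qed
  moreover have b: "\<bar>c * ang1 (\<lambda>i. e * \<gamma> i) t\<bar> \<le> 2 * (1/100)"
    if "\<bar>c\<bar> \<le> 1" "\<And>i. i < 5 \<Longrightarrow> \<bar>e * \<gamma> i\<bar> \<le> 1/100" for c \<gamma>
  proof -
    have "coeff_bound (1/100) (\<lambda>i. e * \<gamma> i)" using that(2) unfolding coeff_bound_def by blast
    from mult_mono[OF that(1) abs_ang_le(1)[OF this, of t]] show ?thesis by (simp add: abs_mult)
  qed
  ultimately show ?thesis
    unfolding split using d b[of "cos t" \<beta>, OF _ small(2)] b[of "sin t" \<alpha>, OF _ small(1)]
    by (simp add: abs_le_iff)
qed

lemma region_bounds:
  assumes d: "11/10 < d" "d < 6/5" and q: "norm q \<le> 1/4"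
  shows "\<bar>fst q\<bar> \<le> 1/4" "\<bar>snd q\<bar> \<le> 1/4" "1/2 \<le> hyperbola d q" "hyperbola d q \<le> 2"
proof -
  show a: "\<bar>fst q\<bar> \<le> 1/4" "\<bar>snd q\<bar> \<le> 1/4"
    using q norm_fst_le[of "fst q" "snd q"] norm_snd_le[of "snd q" "fst q"] by simp_all
  have "\<bar>hX d (fst q)\<bar> \<le> (1/5) * (1/4)"
  proof -
    have "\<bar>(d - 1) * fst q\<bar> \<le> (1/5) * (1/4)" unfolding abs_mult using d a by (intro mult_mono) auto
    then show ?thesis unfolding hX_def by simp
  qed
  from power_mono[OF this abs_ge_zero, of 2] have X: "(hX d (fst q))\<^sup>2 \<le> ((1/5) * (1/4))\<^sup>2" unfolding power2_abs .
  have "\<bar>hY d (snd q)\<bar> \<le> (11/5) * (1/4) / 2"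
  proof -
    have "\<bar>(d + 1) * snd q\<bar> \<le> (11/5) * (1/4)" unfolding abs_mult using d a by (intro mult_mono) auto
    then show ?thesis unfolding hY_def by simp
  qed
  from power_mono[OF this abs_ge_zero, of 2] have Y: "(hY d (snd q))\<^sup>2 \<le> ((11/5) * (1/4) / 2)\<^sup>2" unfolding power2_abs .
  have p: "0 \<le> (hX d (fst q))\<^sup>2" "0 \<le> (hY d (snd q))\<^sup>2" by simp_all
  have c: "((1/5) * (1/4))\<^sup>2 = (1/400 :: real)" "((11/5) * (1/4) / 2)\<^sup>2 = (121/1600 :: real)"
    by (simp_all add: power2_eq_square)
  show "1/2 \<le> hyperbola d q" using Y p d unfolding hyperbola_def c by linarith
  show "hyperbola d q \<le> 2" using X p d unfolding hyperbola_def c by linarith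
qed

text \<open>On the positive ray Y vanishes and the weight reduces to -X (1 - X)^2 with X \<ge>
  \<rho> / 20. The bound is linear in \<rho>, and the perturbation of the gradient has to stay below
  it for monotonicity along the ray to survive.\<close>

lemma weight_on_ray:
  assumes d: "11/10 < d" "d < 6/5" and \<rho>: "0 < \<rho>" "\<rho> \<le> 1/4"
  shows "2 * weight1 d (\<rho>, 0) / ((1 + fst (\<rho>, 0::real)) * hyperbola d (\<rho>, 0)) \<le> - (\<rho> / 50)"
proof -
  have n: "norm (\<rho>, 0::real) \<le> 1/4" using \<rho> by (simp add: norm_Pair)
  note rb = region_bounds[OF d n]
  define X where "X = hX d \<rho>"
  have X: "\<rho> / 20 \<le> X" "X \<le> 1/40" "0 < X"
  proof -
    have "(1/10) * \<rho> \<le> (d - 1) * \<rho>" using d \<rho> by (intro mult_right_mono) auto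
    then show 1: "\<rho> / 20 \<le> X" unfolding X_def hX_def by linarith
    have "(d - 1) * \<rho> \<le> (1/5) * (1/4)" using d \<rho> by (intro mult_mono) auto
    then show "X \<le> 1/40" unfolding X_def hX_def by linarith
    show "0 < X" using 1 \<rho> by simp
  qed
  have "(1/2)\<^sup>2 * 2 \<le> (1 - X)\<^sup>2"
  proof -
    have "(39/40)\<^sup>2 \<le> (1 - X)\<^sup>2" using X by (intro power_mono) auto
    then show ?thesis by (simp add: power2_eq_square)
  qed
  then have "(\<rho> / 20) * (1/2) \<le> X * (1 - X)\<^sup>2" using X \<rho> by (intro mult_mono) (auto simp: power2_eq_square)
  moreover have w: "weight1 d (\<rho>, 0) = - (X * (1 - X)\<^sup>2)"
    unfolding weight1_def X_def hY_def by (simp add: power2_commute)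
  ultimately have nw: "\<rho> / 20 \<le> 2 * (X * (1 - X)\<^sup>2)" by simp
  have den: "0 < (1 + \<rho>) * hyperbola d (\<rho>, 0)" using rb \<rho> by (intro mult_pos_pos) auto
  have den2: "(1 + \<rho>) * hyperbola d (\<rho>, 0) \<le> (5/4) * 2" using rb \<rho> by (intro mult_mono) auto
  have "\<rho> / 50 * ((1 + \<rho>) * hyperbola d (\<rho>, 0)) \<le> \<rho> / 50 * ((5/4) * 2)" using den2 \<rho> by (intro mult_left_mono) auto
  also have "\<dots> \<le> 2 * (X * (1 - X)\<^sup>2)" using nw by simp
  finally have "\<rho> / 50 \<le> 2 * (X * (1 - X)\<^sup>2) / ((1 + \<rho>) * hyperbola d (\<rho>, 0))" unfolding pos_le_divide_eq[OF den] .
  then show ?thesis unfolding w by simp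
qed

text \<open>The derivative of \<open>integral_fun\<close> - 2 e G / f along the perturbed field, as
  pure algebra. The terms free of e cancel by \<open>orth\<close>. At order e, \<open>con\<close>
  and \<open>cert\<close> turn the derivative of G / f into (w1 P + w2 Q - R) / f, so that only R /
  f survives. What remains is exactly of order e^2.\<close>

lemma lyapunov_derivative_identity:
  fixes f x y w1 w2 A B P Q G G1 G2 X Y R e d :: real
  assumes nz: "f \<noteq> 0" "x \<noteq> 0" "y \<noteq> 0"
    and orth: "w1 * A + w2 * B = 0"
    and con: "(d - 1) * X * (x * A) - (d + 1) * Y * (y * B) = - 4 * X * Y * f"
    and cert: "w1 * P + w2 * Q = x * A * G1 + y * B * G2 + 4 * X * Y * G + R"
  shows "(2 * w1 / (x * f) - 2 * e * ((G1 * f - G * ((d - 1) * X)) / f\<^sup>2)) * (x * (A + e * P))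
      + (2 * w2 / (y * f) - 2 * e * ((G2 * f + G * ((d + 1) * Y)) / f\<^sup>2)) * (y * (B + e * Q))
    = 2 * e * (R / f) - 2 * e\<^sup>2 * ((G1 * f - G * ((d - 1) * X)) / f\<^sup>2 * (x * P) + (G2 * f + G * ((d + 1) * Y)) / f\<^sup>2 * (y * Q))"
proof -
  define E1 E2 where "E1 = (G1 * f - G * ((d - 1) * X)) / f\<^sup>2" and "E2 = (G2 * f + G * ((d + 1) * Y)) / f\<^sup>2"
  have "(G1 * f - G * ((d - 1) * X)) * (x * A) + (G2 * f + G * ((d + 1) * Y)) * (y * B)
      = f * (x * A * G1 + y * B * G2) - G * ((d - 1) * X * (x * A) - (d + 1) * Y * (y * B))"
    by algebra
  also have "\<dots> = f * (w1 * P + w2 * Q - R)" unfolding con cert by algebra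
  finally have "E1 * (x * A) + E2 * (y * B) = f * (w1 * P + w2 * Q - R) / f\<^sup>2"
    unfolding E1_def E2_def by (metis add_divide_distrib times_divide_eq_left)
  then have E: "E1 * (x * A) + E2 * (y * B) = (w1 * P + w2 * Q - R) / f"
    using nz by (simp add: power2_eq_square)
  have h: "2 * w1 / (x * f) * (x * (A + e * P)) = 2 / f * (w1 * A) + 2 * e / f * (w1 * P)"
    "2 * w2 / (y * f) * (y * (B + e * Q)) = 2 / f * (w2 * B) + 2 * e / f * (w2 * Q)"
    using nz by (simp_all add: field_simps)
  have "2 * w1 / (x * f) * (x * (A + e * P)) + 2 * w2 / (y * f) * (y * (B + e * Q))
      = 2 / f * (w1 * A + w2 * B) + 2 * e * ((w1 * P + w2 * Q) / f)"
    unfolding h by (simp add: algebra_simps add_divide_distrib)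
  then have h': "2 * w1 / (x * f) * (x * (A + e * P)) + 2 * w2 / (y * f) * (y * (B + e * Q)) = 2 * e * ((w1 * P + w2 * Q) / f)"
    unfolding orth by simp
  have "(2 * w1 / (x * f) - 2 * e * E1) * (x * (A + e * P)) + (2 * w2 / (y * f) - 2 * e * E2) * (y * (B + e * Q))
      = (2 * w1 / (x * f) * (x * (A + e * P)) + 2 * w2 / (y * f) * (y * (B + e * Q)))
        - 2 * e * (E1 * (x * A) + E2 * (y * B)) - 2 * e\<^sup>2 * (E1 * (x * P) + E2 * (y * Q))"
    by (simp add: power2_eq_square algebra_simps)
  also have "\<dots> = 2 * e * (R / f) - 2 * e\<^sup>2 * (E1 * (x * P) + E2 * (y * Q))"
    unfolding h' E by (simp add: diff_divide_distrib algebra_simps)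
  finally show ?thesis unfolding E1_def E2_def .
qed


text \<open>For fixed R the strict signs on finitely many compact annuli have a common margin \<mu>,
  while the factor of the e^2 term has a bound independent of e. A small e therefore preserves every
  sign, and the alternating displacements yield the cycles.\<close>

lemma perturbed_cycles:
  fixes z :: "nat \<Rightarrow> real"
  assumes d: "11/10 < d" "d < 6/5" and cert: "certificate d \<alpha> \<beta> R" and R: "continuous_on UNIV R"
    and z: "\<And>i. i \<le> n \<Longrightarrow> 0 < z i" "\<And>i. i \<le> n \<Longrightarrow> z i < ret_radius"
      "\<And>i. i \<le> n \<Longrightarrow> z i * spread < 1/4" "\<And>i. i < n \<Longrightarrow> z (Suc i) < z i"
    and sgn: "\<And>i q. \<lbrakk>i \<le> n; z i / spread \<le> norm q; norm q \<le> z i * spread\<rbrakk> \<Longrightarrow> (-1) ^ i * R q < 0"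
  obtains e0 where "0 < e0"
    "\<And>e. \<lbrakk>0 < e; e < e0\<rbrakk> \<Longrightarrow> \<exists>C. finite C \<and> card C = n \<and>
      (\<forall>\<gamma>\<in>C. limit_cycle (quad_field (\<lambda>i. base_x d i + e * \<alpha> i) (\<lambda>i. base_y d i + e * \<beta> i)) \<gamma>
         \<and> \<gamma> \<subseteq> cball (1, 1) (z 0 * spread) \<and> (1, 1) \<in> inside \<gamma>)"
proof -
  have s: "0 < spread" "1 \<le> spread" using constants_pos by simp_all
  obtain G G1 G2 where G: "\<And>q. (G has_derivative (\<lambda>h. G1 q * fst h + G2 q * snd h)) (at q)"
    and G12: "continuous_on UNIV G1" "continuous_on UNIV G2"
    and Geq: "\<And>q. weight1 d q * quadp \<alpha> q + weight2 d q * quadp \<beta> q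
        = vel1 d q * G1 q + vel2 d q * G2 q + 4 * hX d (fst q) * hY d (snd q) * G q + R q"
    using cert unfolding certificate_def by blast
  have cG: "continuous_on UNIV G"
    by (intro continuous_at_imp_continuous_on ballI has_derivative_continuous[OF G])
  define E1 where "E1 q = (G1 q * hyperbola d q - G q * ((d - 1) * hX d (fst q))) / (hyperbola d q)\<^sup>2" for q
  define E2 where "E2 q = (G2 q * hyperbola d q + G q * ((d + 1) * hY d (snd q))) / (hyperbola d q)\<^sup>2" for q
  \<comment> \<open>The factor of -2 e^2 in the derivative along the perturbed field.\<close>
  define Er where "Er q = E1 q * ((1 + fst q) * quadp \<alpha> q) + E2 q * ((1 + snd q) * quadp \<beta> q)" for q
  let ?K = "cball 0 (1/4) :: (real \<times> real) set"
  note rb = region_bounds[OF d]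
  have hnz: "hyperbola d q \<noteq> 0" if "norm q \<le> 1/4" for q using rb(3)[OF that] by auto
  have chX: "continuous_on ?K (\<lambda>q. hX d (fst q))" "continuous_on ?K (\<lambda>q. hY d (snd q))"
    unfolding hX_def hY_def
    by (intro continuous_on_divide continuous_on_mult continuous_on_const continuous_on_fst continuous_on_snd continuous_on_id; simp)+
  have chyp: "continuous_on ?K (hyperbola d)"
    unfolding hyperbola_def[abs_def] by (intro continuous_on_add continuous_on_diff continuous_on_power continuous_on_const chX)
  have cquad: "continuous_on ?K (\<lambda>q. quadp \<gamma> q)" for \<gamma>
    unfolding quad_def
    by (intro continuous_on_add continuous_on_mult continuous_on_power continuous_on_const continuous_on_fst continuous_on_snd continuous_on_id)
  have cGK: "continuous_on ?K G" "continuous_on ?K G1" "continuous_on ?K G2"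
    by (intro continuous_on_subset[OF cG] continuous_on_subset[OF G12(1)] continuous_on_subset[OF G12(2)] subset_UNIV)+
  have cE1: "continuous_on ?K E1" unfolding E1_def[abs_def]
    by (intro continuous_on_divide continuous_on_diff continuous_on_mult continuous_on_power continuous_on_const chX chyp cGK) (use hnz in auto)
  have cE2: "continuous_on ?K E2" unfolding E2_def[abs_def]
    by (intro continuous_on_divide continuous_on_add continuous_on_mult continuous_on_power continuous_on_const chX chyp cGK) (use hnz in auto)
  have cEr: "continuous_on ?K Er" unfolding Er_def[abs_def]
    by (intro continuous_on_add continuous_on_mult continuous_on_const continuous_on_fst continuous_on_snd continuous_on_id cE1 cE2 cquad)
  have bounded: "\<exists>B>0. \<forall>q. norm q \<le> 1/4 \<longrightarrow> \<bar>f q\<bar> \<le> B" if c: "continuous_on ?K f" for f :: "real \<times> real \<Rightarrow> real"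
  proof -
    have "bounded (f ` ?K)" by (intro compact_imp_bounded compact_continuous_image c compact_cball)
    then obtain B where "B > 0" "\<forall>y\<in>f ` ?K. norm y \<le> B" unfolding bounded_pos by blast
    then show ?thesis by (intro exI[of _ B]) auto
  qed
  obtain B1 where B1: "0 < B1" "\<And>q. norm q \<le> 1/4 \<Longrightarrow> \<bar>E1 q\<bar> \<le> B1" using bounded[OF cE1] by blast
  obtain Br where Br: "0 < Br" "\<And>q. norm q \<le> 1/4 \<Longrightarrow> \<bar>Er q\<bar> \<le> Br" using bounded[OF cEr] by blast
  define A where "A i = {q :: real \<times> real. z i / spread \<le> norm q \<and> norm q \<le> z i * spread}" for i
  have A: "q \<in> A i \<longleftrightarrow> z i / spread \<le> norm q \<and> norm q \<le> z i * spread" for q i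
    unfolding A_def by simp
  have cA: "compact (A i)" for i
  proof -
    have "A i = cball 0 (z i * spread) \<inter> {q. z i / spread \<le> norm q}" unfolding A_def by auto
    moreover have "closed {q :: real \<times> real. z i / spread \<le> norm q}"
      by (intro closed_Collect_le continuous_on_const continuous_on_norm continuous_on_id)
    ultimately show ?thesis by (simp add: compact_Int_closed)
  qed
  let ?K1 = "\<Union>i\<in>{..n}. A i"
  have K1: "compact ?K1" by (intro compact_UN cA) simp
  have "z 0 / spread \<le> z 0" "z 0 \<le> z 0 * spread" using z(1)[of 0] s by (simp_all add: field_simps)
  then have z0A: "(z 0, 0) \<in> A 0" using z(1)[of 0] by (simp add: A norm_Pair)
  have mem: "(z 0, 0) \<in> ?K1" by (rule UN_I[where B = A and a = 0, OF _ z0A]) simp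
  have ne: "?K1 \<noteq> {}"
  proof
    assume "?K1 = {}"
    with mem show False by (simp only: empty_iff)
  qed
  have cR: "continuous_on ?K1 (\<lambda>q. \<bar>R q\<bar>)"
    by (intro continuous_on_rabs continuous_on_subset[OF R subset_UNIV])
  obtain q0 where q0: "q0 \<in> ?K1" "\<forall>q\<in>?K1. \<bar>R q0\<bar> \<le> \<bar>R q\<bar>"
    using continuous_attains_inf[OF K1 ne cR] by (elim bexE)
  define \<mu> where "\<mu> = \<bar>R q0\<bar>"
  obtain i0 where "i0 \<in> {..n}" "q0 \<in> A i0" using q0(1) by (elim UN_E)
  then have "R q0 \<noteq> 0" using sgn[of i0 q0] by (auto simp: A)
  then have \<mu>: "0 < \<mu>" unfolding \<mu>_def by simp
  have \<mu>_le: "\<mu> \<le> \<bar>R q\<bar>" if "i \<le> n" "q \<in> A i" for i q unfolding \<mu>_def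
    by (rule bspec[OF q0(2) UN_I[where B = A and a = i, OF _ that(2)]]) (use that(1) in simp)
  define \<Sigma> where "\<Sigma> = 1 + (\<Sum>i<5. \<bar>\<alpha> i\<bar>) + (\<Sum>i<5. \<bar>\<beta> i\<bar>)"
  have \<Sigma>: "\<bar>\<alpha> i\<bar> \<le> \<Sigma>" "\<bar>\<beta> i\<bar> \<le> \<Sigma>" if "i < 5" for i
  proof -
    have "\<bar>\<alpha> i\<bar> \<le> (\<Sum>i<5. \<bar>\<alpha> i\<bar>)" "\<bar>\<beta> i\<bar> \<le> (\<Sum>i<5. \<bar>\<beta> i\<bar>)"
      by (rule member_le_sum; use that in simp)+
    moreover have "0 \<le> (\<Sum>i<5. \<bar>\<alpha> i\<bar>)" "0 \<le> (\<Sum>i<5. \<bar>\<beta> i\<bar>)" by (simp_all add: sum_nonneg)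
    ultimately show "\<bar>\<alpha> i\<bar> \<le> \<Sigma>" "\<bar>\<beta> i\<bar> \<le> \<Sigma>" unfolding \<Sigma>_def by linarith+
  qed
  have \<Sigma>1: "1 \<le> \<Sigma>" unfolding \<Sigma>_def by (simp add: sum_nonneg)
  \<comment> \<open>In this order the bounds keep the perturbed coefficients within 1/100 of the
    base coefficients, make the e^2 term smaller than the margin of R, and preserve the decrease
    along the positive ray; for the last one the innermost annulus is critical.\<close>
  define e0 where "e0 = min (1 / (100 * \<Sigma>)) (min (\<mu> / (2 * Br)) (z n / spread / (100 * B1)))"
  have e0: "0 < e0" unfolding e0_def using \<Sigma>1 \<mu> Br B1 z(1)[of n] s by simp
  have main: "\<exists>C. finite C \<and> card C = n \<and>
      (\<forall>\<gamma>\<in>C. limit_cycle (quad_field (\<lambda>i. base_x d i + e * \<alpha> i) (\<lambda>i. base_y d i + e * \<beta> i)) \<gamma>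
         \<and> \<gamma> \<subseteq> cball (1, 1) (z 0 * spread) \<and> (1, 1) \<in> inside \<gamma>)" if e: "0 < e" "e < e0" for e
  proof -
    let ?\<alpha> = "\<lambda>i. base_x d i + e * \<alpha> i" and ?\<beta> = "\<lambda>i. base_y d i + e * \<beta> i"
    have e1: "e * \<Sigma> \<le> 1/100" "e * Br < \<mu> / 2" "e * B1 < z n / spread / 100"
    proof -
      have g: "a * b < x / k" if "a < x / (k * b)" "0 < k" "0 < b" for a b x k :: real
        using that by (simp add: field_simps)
      have b: "e < 1 / (100 * \<Sigma>)" "e < \<mu> / (2 * Br)" "e < z n / spread / (100 * B1)" using e unfolding e0_def by simp_all
      show "e * \<Sigma> \<le> 1/100" by (rule less_imp_le[OF g[OF b(1)]]) (use \<Sigma>1 in simp_all)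
      show "e * Br < \<mu> / 2" by (rule g[OF b(2)]) (use Br(1) in simp_all)
      show "e * B1 < z n / spread / 100" by (rule g[OF b(3)]) (use B1(1) in simp_all)
    qed
    have small: "\<bar>e * \<alpha> i\<bar> \<le> 1/100" "\<bar>e * \<beta> i\<bar> \<le> 1/100" if "i < 5" for i
    proof -
      have "e * \<bar>\<alpha> i\<bar> \<le> e * \<Sigma>" "e * \<bar>\<beta> i\<bar> \<le> e * \<Sigma>"
        using \<Sigma>[OF that] e by (simp_all add: mult_left_mono)
      moreover have "\<bar>e * \<alpha> i\<bar> = e * \<bar>\<alpha> i\<bar>" "\<bar>e * \<beta> i\<bar> = e * \<bar>\<beta> i\<bar>"
        using e by (simp_all add: abs_mult)
      ultimately show "\<bar>e * \<alpha> i\<bar> \<le> 1/100" "\<bar>e * \<beta> i\<bar> \<le> 1/100" using e1(1) by linarith+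
    qed
    interpret pf: polar_field "\<lambda>t z. z * radial_part ?\<alpha> ?\<beta> t z / angular_part ?\<alpha> ?\<beta> t z"
      radius0 lip0 "quad_field ?\<alpha> ?\<beta>" "(1, 1)" "radial_part ?\<alpha> ?\<beta>" "angular_part ?\<alpha> ?\<beta>" "1/40" "26 * 3"
      unfolding radius0_def lip0_def
      by (rule quad_field_polar_field[OF base_coeff_bound(1)[OF d small(1)] base_coeff_bound(2)[OF d small(2)] _ _
            perturbed_angular_speed[OF d(1) small]]) simp_all
    have r1: "pf.r1 = ret_radius" unfolding pf.r1_def ret_radius_def ..
    let ?V = "\<lambda>q. integral_fun d (q - (1, 1)) - 2 * e * (G (q - (1, 1)) / hyperbola d (q - (1, 1)))"
    define W1 where "W1 w = 2 * weight1 d w / ((1 + fst w) * hyperbola d w) - 2 * e * E1 w" for w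
    define W2 where "W2 w = 2 * weight2 d w / ((1 + snd w) * hyperbola d w) - 2 * e * E2 w" for w
    let ?V' = "\<lambda>q h. W1 (q - (1, 1)) * fst h + W2 (q - (1, 1)) * snd h"
    have V': "(?V has_derivative ?V' q) (at q)" if q: "norm (q - (1, 1)) \<le> 1/4" for q
    proof -
      let ?w = "q - (1, 1)"
      note b = rb[OF q]
      have pos: "0 < 1 + fst ?w" "0 < 1 + snd ?w" using b(1,2) unfolding abs_le_iff by linarith+
      note nz = hnz[OF q]
      have sh: "((\<lambda>q. q - (1, 1)) has_derivative (\<lambda>h. h)) (at q)"
        using has_derivative_diff[OF has_derivative_ident has_derivative_const] by fastforce
      have quo: "((\<lambda>w. G w / hyperbola d w) has_derivative (\<lambda>h. E1 ?w * fst h + E2 ?w * snd h)) (at ?w)"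
      proof -
        let ?c = "\<lambda>h. (d - 1) * hX d (fst ?w) * fst h - (d + 1) * hY d (snd ?w) * snd h"
        have "((\<lambda>w. G w / hyperbola d w) has_derivative
          (\<lambda>h. ((G1 ?w * fst h + G2 ?w * snd h) * hyperbola d ?w - G ?w * ?c h) / (hyperbola d ?w * hyperbola d ?w))) (at ?w)"
          by (rule has_derivative_divide'[OF G hyperbola_has_derivative nz])
        moreover have "(\<lambda>h. ((G1 ?w * fst h + G2 ?w * snd h) * hyperbola d ?w - G ?w * ?c h) / (hyperbola d ?w * hyperbola d ?w))
            = (\<lambda>h. E1 ?w * fst h + E2 ?w * snd h)"
          unfolding E1_def E2_def power2_eq_square times_divide_eq_left add_divide_distrib[symmetric]
          by (rule ext, rule arg_cong[where f = "\<lambda>x. x / _"]) (simp add: algebra_simps)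
        ultimately show ?thesis by simp
      qed
      have "((\<lambda>w. integral_fun d w - 2 * e * (G w / hyperbola d w)) has_derivative
          (\<lambda>h. 2 * weight1 d ?w / ((1 + fst ?w) * hyperbola d ?w) * fst h + 2 * weight2 d ?w / ((1 + snd ?w) * hyperbola d ?w) * snd h
            - 2 * e * (E1 ?w * fst h + E2 ?w * snd h))) (at ?w)"
        by (intro has_derivative_diff has_derivative_mult_right integral_fun_has_derivative[OF pos nz] quo)
      from has_derivative_compose[OF sh this] show ?thesis
        unfolding W1_def W2_def by (simp add: algebra_simps)
    qed
    have annulus: "norm (q - (1, 1)) \<le> 1/4 \<and> q - (1, 1) \<in> A i"
      if "i \<le> n" "z i * exp (- (lip0 * (2 * pi))) \<le> dist q (1, 1)" "dist q (1, 1) \<le> z i * exp (lip0 * (2 * pi))" for i q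
      using that z(3)[of i] unfolding inverse_spread spread_def[symmetric] by (auto simp: A dist_norm)
    have zn: "z n \<le> z i" if "i \<le> n" for i
      using that
    proof (induction rule: inc_induct)
      case (step k)
      then show ?case using z(4)[of k] by simp
    qed simp
    have ret: "0 < (-1) ^ i * (pf.v (z i) (2 * pi) - z i)" if i: "i \<le> n" for i
    proof -
      have zi: "0 < z i" "z i < pf.r1" using z(1,2)[OF i] unfolding r1 by simp_all
      have "(- ((-1) ^ i)) * (pf.v (z i) (2 * pi) - z i) < 0"
      proof (rule pf.return_sign(1)[OF zi, where V = ?V and V' = ?V'])
        fix q :: "real \<times> real" assume q: "z i * exp (- (lip0 * (2 * pi))) \<le> dist q (1, 1)" "dist q (1, 1) \<le> z i * exp (lip0 * (2 * pi))"
        note an = annulus[OF i q]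
        show "(?V has_derivative ?V' q) (at q)" using an by (intro V') simp
        let ?w = "q - (1, 1)"
        have w4: "norm ?w \<le> 1/4" using an by simp
        note b = rb[OF w4]
        have nz: "hyperbola d ?w \<noteq> 0" "1 + fst ?w \<noteq> 0" "1 + snd ?w \<noteq> 0" using b unfolding abs_le_iff by linarith+
        have cert': "weight1 d ?w * quadp \<alpha> ?w + weight2 d ?w * quadp \<beta> ?w
            = (1 + fst ?w) * quadp (base_x d) ?w * G1 ?w + (1 + snd ?w) * quadp (base_y d) ?w * G2 ?w
              + 4 * hX d (fst ?w) * hY d (snd ?w) * G ?w + R ?w"
          using Geq[of ?w] unfolding vel1_def vel2_def .
        have lin: "quadp (\<lambda>i. b i + e * c i) ?w = quadp b ?w + e * quadp c ?w" for b c
          using quad_linear[of 1 b e c] by simp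
        have F: "quad_field ?\<alpha> ?\<beta> q = ((1 + fst ?w) * (quadp (base_x d) ?w + e * quadp \<alpha> ?w),
            (1 + snd ?w) * (quadp (base_y d) ?w + e * quadp \<beta> ?w))"
          unfolding lin[symmetric] quad_field_def by (simp add: case_prod_unfold)
        have val: "?V' q (quad_field ?\<alpha> ?\<beta> q) = 2 * e * (R ?w / hyperbola d ?w) - 2 * e\<^sup>2 * Er ?w"
          using lyapunov_derivative_identity[OF nz weights_orthogonal
              hyperbola_invariant[of d ?w, unfolded vel1_def vel2_def] cert', of e]
          unfolding F W1_def W2_def E1_def E2_def Er_def by simp
        let ?\<sigma> = "- ((-1) ^ i) :: real"
        have sR: "\<mu> \<le> ?\<sigma> * R ?w"
        proof -
          have "0 < ?\<sigma> * R ?w" using sgn[OF i, of ?w] an by (simp add: A)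
          moreover have "\<bar>?\<sigma> * R ?w\<bar> = \<bar>R ?w\<bar>" by (simp add: abs_mult power_abs)
          ultimately show ?thesis using \<mu>_le[OF i, of ?w] an by simp
        qed
        \<comment> \<open>The divisor 2 is the upper bound of the hyperbola on the region.\<close>
        have "\<mu> / 2 \<le> ?\<sigma> * R ?w / hyperbola d ?w"
          using sR b(3,4) \<mu> by (intro frac_le) auto
        moreover have "?\<sigma> * (e * Er ?w) \<le> e * Br"
        proof -
          have "\<bar>?\<sigma> * (e * Er ?w)\<bar> = e * \<bar>Er ?w\<bar>" using e by (simp add: abs_mult power_abs)
          also have "\<dots> \<le> e * Br" using Br(2)[OF w4] e by (intro mult_left_mono) auto
          finally show ?thesis by linarith
        qed
        ultimately have "0 < ?\<sigma> * R ?w / hyperbola d ?w - ?\<sigma> * (e * Er ?w)" using e1(2) by linarith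
        then have "0 < (2 * e) * (?\<sigma> * R ?w / hyperbola d ?w - ?\<sigma> * (e * Er ?w))" using e by (intro mult_pos_pos) auto
        also have "\<dots> = ?\<sigma> * ?V' q (quad_field ?\<alpha> ?\<beta> q)"
          unfolding val by (simp add: power2_eq_square algebra_simps)
        finally show "0 < ?\<sigma> * ?V' q (quad_field ?\<alpha> ?\<beta> q)" .
      next
        fix \<rho> assume \<rho>: "z i * exp (- (lip0 * (2 * pi))) \<le> \<rho>" "\<rho> \<le> z i * exp (lip0 * (2 * pi))"
        have \<rho>': "z i / spread \<le> \<rho>" "\<rho> \<le> 1/4"
          using \<rho> z(3)[OF i] unfolding inverse_spread spread_def[symmetric] by simp_all
        have "z n / spread \<le> z i / spread" using zn[OF i] s by (intro divide_right_mono) auto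
        then have zr: "z n / spread \<le> \<rho>" using \<rho>' by linarith
        have "0 < z n / spread" using z(1)[of n] s by (intro divide_pos_pos) simp_all
        then have pos: "0 < \<rho>" using zr by linarith
        have w: "polar (1, 1) \<rho> 0 - (1, 1) = (\<rho>, 0)" by (simp add: polar_def)
        have "\<bar>E1 (\<rho>, 0)\<bar> \<le> B1" using \<rho>' pos by (intro B1) (simp add: norm_Pair)
        then have "\<bar>e * E1 (\<rho>, 0)\<bar> \<le> e * B1" using e by (simp add: abs_mult)
        then have "- (e * E1 (\<rho>, 0)) \<le> e * B1" by (rule abs_le_D2)
        moreover have "e * B1 < \<rho> / 100" by (rule less_le_trans[OF e1(3) divide_right_mono[OF zr]]) simp
        ultimately have "- (e * E1 (\<rho>, 0)) < \<rho> / 100" by linarith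
        then have "- (2 * e * E1 (\<rho>, 0)) < \<rho> / 50" unfolding mult.assoc by linarith
        then have "W1 (\<rho>, 0) < 0"
          using weight_on_ray[OF d pos \<rho>'(2)] unfolding W1_def by linarith
        then show "?V' (polar (1, 1) \<rho> 0) (1, 0) < 0" unfolding w by simp
      qed
      then show ?thesis by simp
    qed
    have bd: "cball (1, 1) (z i * exp (lip0 * (2 * pi))) \<subseteq> cball (1, 1) (z 0 * spread)" if i: "i \<le> n" for i
    proof -
      have "z i \<le> z 0" using i
      proof (induction i)
        case (Suc k)
        then show ?case using z(4)[of k] by simp
      qed simp
      then show ?thesis unfolding spread_def by (intro subset_cball mult_right_mono) auto
    qed
    show ?thesis
      by (rule pf.limit_cycles_from_sign_changes[OF z(1) z(2)[folded r1] z(4) ret bd])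
  qed
  show thesis by (rule that[OF e0 main])
qed

section \<open>Creating six sign changes\<close>

definition qform :: "real \<Rightarrow> real \<times> real \<Rightarrow> real" where
  "qform d q = (d - 1) * (fst q / 2)\<^sup>2 + (d + 1) * (snd q / 2)\<^sup>2"

text \<open>The constant 1/40 is a quarter of the lower bound 1/10 of d - 1.\<close>

lemma qform_bounds:
  assumes "11/10 < d" "d < 6/5"
  shows "(norm q)\<^sup>2 / 40 \<le> qform d q" "qform d q \<le> (norm q)\<^sup>2"
proof -
  have n: "(norm q)\<^sup>2 = (fst q)\<^sup>2 + (snd q)\<^sup>2" by (simp add: norm_prod_def)
  have q: "qform d q = (d - 1) / 4 * (fst q)\<^sup>2 + (d + 1) / 4 * (snd q)\<^sup>2" unfolding qform_def by (simp add: power_divide)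
  have "1/40 * (fst q)\<^sup>2 \<le> (d - 1) / 4 * (fst q)\<^sup>2" "1/40 * (snd q)\<^sup>2 \<le> (d + 1) / 4 * (snd q)\<^sup>2"
    "(d - 1) / 4 * (fst q)\<^sup>2 \<le> 1 * (fst q)\<^sup>2" "(d + 1) / 4 * (snd q)\<^sup>2 \<le> 1 * (snd q)\<^sup>2"
    using assms by (intro mult_right_mono; simp)+
  note b = this
  show "(norm q)\<^sup>2 / 40 \<le> qform d q" using add_mono[OF b(1,2)] unfolding n q by (simp add: add_divide_distrib)
  show "qform d q \<le> (norm q)\<^sup>2" using add_mono[OF b(3,4)] unfolding n q by simp
qed

lemma qform_power_bounds:
  assumes "11/10 < d" "d < 6/5"
  shows "norm q ^ (2 * k) / 40 ^ k \<le> qform d q ^ k" "qform d q ^ k \<le> norm q ^ (2 * k)" "0 \<le> qform d q ^ k"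
proof -
  note b = qform_bounds[OF assms, of q]
  have p: "0 \<le> qform d q" using b(1) by (smt (verit) divide_nonneg_nonneg zero_le_power2)
  show "norm q ^ (2 * k) / 40 ^ k \<le> qform d q ^ k"
    using power_mono[OF b(1), of k] by (simp add: power_divide power_mult)
  show "qform d q ^ k \<le> norm q ^ (2 * k)" using power_mono[OF b(2) p, of k] by (simp add: power_mult)
  show "0 \<le> qform d q ^ k" using p by simp
qed

lemma evalp_difference:
  assumes "vanishes3 m (add3 P (scale3 (-1) T))"
  obtains C where "0 \<le> C" "\<And>d q. \<lbrakk>\<bar>d\<bar> \<le> 2; norm q \<le> 1\<rbrakk> \<Longrightarrow> \<bar>evalp d P q - evalp d T q\<bar> \<le> C * norm q ^ m"
proof -
  obtain C where C: "0 \<le> C" "\<forall>d x y \<rho>. \<bar>d\<bar> \<le> 2 \<longrightarrow> \<bar>x\<bar> \<le> \<rho> \<longrightarrow> \<bar>y\<bar> \<le> \<rho> \<longrightarrow> \<rho> \<le> 1 \<longrightarrow>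
      \<bar>eval3 d x y (add3 P (scale3 (-1) T))\<bar> \<le> C * \<rho> ^ m"
    using vanishes3_bound[OF assms, of 2] by blast
  have "\<bar>evalp d P q - evalp d T q\<bar> \<le> C * norm q ^ m" if dq: "\<bar>d\<bar> \<le> 2" "norm q \<le> 1" for d q
  proof -
    have "\<bar>fst q\<bar> \<le> norm q" "\<bar>snd q\<bar> \<le> norm q"
      using norm_fst_le[of "fst q" "snd q"] norm_snd_le[of "snd q" "fst q"] by simp_all
    then have "\<bar>fst q / 2\<bar> \<le> norm q" "\<bar>snd q / 2\<bar> \<le> norm q" by simp_all
    with C(2) dq have "\<bar>eval3 d (fst q / 2) (snd q / 2) (add3 P (scale3 (-1) T))\<bar> \<le> C * norm q ^ m" by blast
    then show ?thesis unfolding evalp_def eval3_add eval3_scale by simp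
  qed
  with C(1) show thesis by (rule that)
qed

lemma evalp_leading: "evalp d (mul3 [[l]] (pow3 pQ k)) q = eval1 d l * qform d q ^ k"
  unfolding evalp_def eval3_mul eval3_pow eval3_basic qform_def ..

lemma continuous_on_evalp: "continuous_on S (evalp d P)"
  unfolding evalp_def[abs_def]
  by (intro continuous_on_eval3 continuous_on_divide continuous_on_const continuous_on_fst continuous_on_snd continuous_on_id) simp_all

section \<open>Orders of vanishing and annuli with alternating signs\<close>

definition order_bound :: "nat \<Rightarrow> (real \<times> real \<Rightarrow> real) \<Rightarrow> bool" where
  "order_bound k R \<longleftrightarrow> (\<exists>C\<ge>0. \<forall>q. norm q \<le> 1 \<longrightarrow> \<bar>R q\<bar> \<le> C * norm q ^ k)"

text \<open>A lower bound with the exponent of the upper bound in \<open>order_bound\<close>;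
  \<theta> stands for the sign of g near the origin.\<close>

definition definite :: "nat \<Rightarrow> real \<Rightarrow> (real \<times> real \<Rightarrow> real) \<Rightarrow> bool" where
  "definite k \<theta> g \<longleftrightarrow> (\<exists>c>0. \<exists>r>0. \<forall>q. norm q \<le> r \<longrightarrow> c * norm q ^ k \<le> \<theta> * g q)"

lemma order_bound_mono: "order_bound k R \<Longrightarrow> j \<le> k \<Longrightarrow> order_bound j R"
  unfolding order_bound_def by (meson mult_left_mono norm_ge_zero order_trans power_decreasing)

text \<open>The leading term has size at least |l| |q|^(2 k) / 40^k. Near the origin the error of
  order 2 k + 1 consumes at most half of it.\<close>

lemma leading_term:
  assumes d: "11/10 < d" "d < 6/5" and l: "l \<noteq> 0" and C: "0 \<le> C"
    and g: "\<And>q. norm q \<le> 1 \<Longrightarrow> \<bar>g q - l * qform d q ^ k\<bar> \<le> C * norm q ^ (2 * k + 1)"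
  shows "order_bound (2 * k) g" "definite (2 * k) (sgn l) g"
proof -
  note qb = qform_power_bounds[OF d]
  have up: "\<bar>g q\<bar> \<le> (\<bar>l\<bar> + C) * norm q ^ (2 * k)" if q: "norm q \<le> 1" for q
  proof -
    have "\<bar>l * qform d q ^ k\<bar> \<le> \<bar>l\<bar> * norm q ^ (2 * k)"
      unfolding abs_mult using qb(2,3)[of q k] by (intro mult_left_mono) simp_all
    moreover have "C * norm q ^ (2 * k + 1) \<le> C * norm q ^ (2 * k)"
      using q C by (intro mult_left_mono power_decreasing) simp_all
    ultimately show ?thesis using g[OF q] unfolding distrib_right by linarith
  qed
  then show "order_bound (2 * k) g" unfolding order_bound_def using C by (intro exI[of _ "\<bar>l\<bar> + C"]) auto
  define c where "c = \<bar>l\<bar> / 40 ^ k / 2"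
  have c: "0 < c" unfolding c_def using l by simp
  define r where "r = min 1 (c / (C + 1))"
  have r: "0 < r" unfolding r_def using c C by simp
  have "c * norm q ^ (2 * k) \<le> sgn l * g q" if q: "norm q \<le> r" for q
  proof -
    have q1: "norm q \<le> 1" "norm q * (C + 1) \<le> c" using q C unfolding r_def by (simp_all add: pos_le_divide_eq)
    have "2 * c * norm q ^ (2 * k) \<le> \<bar>l\<bar> * qform d q ^ k"
      using mult_left_mono[OF qb(1)[of q k], of "\<bar>l\<bar>"] unfolding c_def by simp
    moreover have "sgn l * (l * qform d q ^ k) = \<bar>l\<bar> * qform d q ^ k" by (simp add: sgn_if abs_if)
    moreover have "\<bar>sgn l * (g q - l * qform d q ^ k)\<bar> \<le> C * norm q ^ (2 * k + 1)"
      using g[OF q1(1)] l unfolding abs_mult by (simp add: abs_sgn_eq)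
    moreover have "C * norm q ^ (2 * k + 1) \<le> c * norm q ^ (2 * k)"
    proof -
      have "C * norm q + norm q \<le> c" using q1(2) by (simp add: algebra_simps)
      then have "C * norm q \<le> c" using norm_ge_zero[of q] by linarith
      then have "(C * norm q) * norm q ^ (2 * k) \<le> c * norm q ^ (2 * k)" by (intro mult_right_mono) simp_all
      then show ?thesis by (simp add: mult.assoc)
    qed
    ultimately show ?thesis unfolding right_diff_distrib by linarith
  qed
  with c r show "definite (2 * k) (sgn l) g" unfolding definite_def by blast
qed

text \<open>The annulus of index i contains the whole first turn of a solution that starts at radius
  \<open>z i\<close>; this is why a sign is required on it and not just on a circle.\<close>

definition annuli :: "nat \<Rightarrow> (real \<times> real \<Rightarrow> real) \<Rightarrow> real \<Rightarrow> (nat \<Rightarrow> real) \<Rightarrow> bool" where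
  "annuli n R b z \<longleftrightarrow> (\<forall>i\<le>n. 0 < z i \<and> z i < b) \<and> (\<forall>i<n. z (Suc i) < z i) \<and>
     (\<forall>i\<le>n. \<forall>q. z i / spread \<le> norm q \<longrightarrow> norm q \<le> z i * spread \<longrightarrow> (-1) ^ i * R q < 0)"

lemma negative_stable:
  fixes f g :: "real \<times> real \<Rightarrow> real"
  assumes A: "compact A" and f: "continuous_on A f" and g: "continuous_on A g" and neg: "\<And>q. q \<in> A \<Longrightarrow> f q < 0"
  shows "eventually (\<lambda>a. \<forall>q\<in>A. f q + a * g q < 0) (at_right 0)"
proof (cases "A = {}")
  case False
  obtain q0 where q0: "q0 \<in> A" "\<And>q. q \<in> A \<Longrightarrow> f q \<le> f q0"
    using continuous_attains_sup[OF A False f] by blast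
  obtain q1 where q1: "q1 \<in> A" "\<And>q. q \<in> A \<Longrightarrow> \<bar>g q\<bar> \<le> \<bar>g q1\<bar>"
    using continuous_attains_sup[OF A False continuous_on_rabs[OF g]] by blast
  define e where "e = - f q0 / (\<bar>g q1\<bar> + 1)"
  have e: "0 < e" unfolding e_def by (intro divide_pos_pos) (use neg[OF q0(1)] in simp_all)
  have "f q + a * g q < 0" if a: "0 < a" "a < e" and q: "q \<in> A" for a q
  proof -
    have "a * g q \<le> a * (\<bar>g q1\<bar> + 1)" using a q1(2)[OF q] by (intro mult_left_mono) auto
    also have "\<dots> < - f q0" using a(2) unfolding e_def by (subst (asm) pos_less_divide_eq) simp_all
    finally show ?thesis using q0(2)[OF q] by linarith
  qed
  then show ?thesis unfolding eventually_at_right_field using e by blast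
qed simp

lemma compact_annulus: "compact {q :: real \<times> real. a \<le> norm q \<and> norm q \<le> b}"
proof -
  have "{q :: real \<times> real. a \<le> norm q \<and> norm q \<le> b} = cball 0 b \<inter> {q. a \<le> norm q}" by auto
  moreover have "closed {q :: real \<times> real. a \<le> norm q}"
    by (intro closed_Collect_le continuous_on_const continuous_on_norm continuous_on_id)
  ultimately show ?thesis by (simp add: compact_Int_closed)
qed

text \<open>A small multiple of g does not disturb the strict signs on the old compact annuli. Close
  to the origin it nevertheless dominates R, which is of higher order, and a new innermost annulus
  there can be given the next sign.\<close>

lemma annuli_extend:
  assumes R: "continuous_on UNIV R" "order_bound (Suc k) R" and an: "annuli n R b z"
    and g: "continuous_on UNIV g" "definite k \<theta> g"
  obtains a z' where "annuli (Suc n) (\<lambda>q. R q + a * g q) b (z(Suc n := z'))"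
proof -
  have s: "0 < spread" "1 \<le> spread" using constants_pos by simp_all
  \<comment> \<open>Chosen such that (-1)^(n + 1) \<kappa> g = -\<theta> g, which is negative near
    the origin by definiteness.\<close>
  define \<kappa> where "\<kappa> = - ((-1) ^ Suc n) * \<theta>"
  let ?A = "\<lambda>i. {q :: real \<times> real. z i / spread \<le> norm q \<and> norm q \<le> z i * spread}"
  have "eventually (\<lambda>a. \<forall>q\<in>?A i. (-1) ^ i * R q + a * ((-1) ^ i * (\<kappa> * g q)) < 0) (at_right 0)" if "i \<le> n" for i
  proof (rule negative_stable[OF compact_annulus])
    show "continuous_on (?A i) (\<lambda>q. (-1) ^ i * R q)" "continuous_on (?A i) (\<lambda>q. (-1) ^ i * (\<kappa> * g q))"
      by (intro continuous_on_mult continuous_on_const continuous_on_subset[OF R(1) subset_UNIV] continuous_on_subset[OF g(1) subset_UNIV])+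
    show "(-1) ^ i * R q < 0" if "q \<in> ?A i" for q using an that \<open>i \<le> n\<close> unfolding annuli_def by blast
  qed
  then have "eventually (\<lambda>a. \<forall>i\<in>{..n}. \<forall>q\<in>?A i. (-1) ^ i * R q + a * ((-1) ^ i * (\<kappa> * g q)) < 0) (at_right 0)"
    by (intro eventually_ball_finite) simp_all
  then obtain e where e: "0 < e" "\<And>a. 0 < a \<Longrightarrow> a < e \<Longrightarrow> \<forall>i\<in>{..n}. \<forall>q\<in>?A i. (-1) ^ i * R q + a * ((-1) ^ i * (\<kappa> * g q)) < 0"
    unfolding eventually_at_right_field by blast
  define a where "a = e / 2"
  have a: "0 < a" "a < e" unfolding a_def using e by simp_all
  obtain C where C: "0 \<le> C" "\<And>q. norm q \<le> 1 \<Longrightarrow> \<bar>R q\<bar> \<le> C * norm q ^ Suc k"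
    using R(2) unfolding order_bound_def by blast
  obtain c r where c: "0 < c" "0 < r" "\<And>q. norm q \<le> r \<Longrightarrow> c * norm q ^ k \<le> \<theta> * g q"
    using g(2) unfolding definite_def by blast
  \<comment> \<open>For 0 < |q| \<le> \<rho> one has C |q| < a c, so the term of order k beats the
    remainder of order k + 1.\<close>
  define \<rho> where "\<rho> = min (min 1 r) (a * c / (C + 1))"
  have \<rho>: "0 < \<rho>" unfolding \<rho>_def using a c C by simp
  define z' where "z' = min (z n / 2) (\<rho> / (2 * spread))"
  have zn: "0 < z n" "z n < b" using an unfolding annuli_def by blast+
  have z': "0 < z'" "z' < z n" "z' < b" "z' * spread < \<rho>"
  proof -
    show "0 < z'" unfolding z'_def using zn \<rho> s by simp
    have "z' \<le> z n / 2" unfolding z'_def by (rule min.cobounded1)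
    then show "z' < z n" "z' < b" using zn by linarith+
    have "z' \<le> \<rho> / (2 * spread)" unfolding z'_def by (rule min.cobounded2)
    then have "z' * (2 * spread) \<le> \<rho>" using s by (simp add: pos_le_divide_eq)
    then show "z' * spread < \<rho>" using \<rho> by linarith
  qed
  have new: "(-1) ^ Suc n * (R q + a * \<kappa> * g q) < 0" if q: "z' / spread \<le> norm q" "norm q \<le> z' * spread" for q
  proof -
    have "0 < z' / spread" using z' s by simp
    then have q0: "0 < norm q" "norm q \<le> \<rho>" using q z' by linarith+
    then have q1: "norm q \<le> 1" "norm q \<le> r" "norm q * (C + 1) \<le> a * c"
      using C unfolding \<rho>_def by (simp_all add: pos_le_divide_eq)
    have "C * norm q + norm q \<le> a * c" using q1(3) by (simp add: algebra_simps)
    then have "C * norm q < a * c" using q0 by linarith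
    then have "(C * norm q) * norm q ^ k < (a * c) * norm q ^ k" using q0 by (intro mult_strict_right_mono) simp_all
    then have "C * norm q ^ Suc k < a * (c * norm q ^ k)" by (simp add: mult_ac)
    also have "\<dots> \<le> a * (\<theta> * g q)" using c(3)[OF q1(2)] a by (intro mult_left_mono) simp_all
    finally have lt: "C * norm q ^ Suc k < a * (\<theta> * g q)" .
    have "\<bar>(-1) ^ Suc n * R q\<bar> \<le> C * norm q ^ Suc k" using C(2)[OF q1(1)] by (simp add: abs_mult power_abs)
    then have "(-1) ^ Suc n * R q < a * (\<theta> * g q)" using lt by linarith
    moreover have "(-1) ^ Suc n * (a * \<kappa> * g q) = - (a * (\<theta> * g q))"
    proof -
      define s where "s = (-1 :: real) ^ Suc n"
      have "s * s = 1" unfolding s_def by (simp flip: power_add mult_2)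
      then show ?thesis unfolding \<kappa>_def s_def[symmetric] by algebra
    qed
    ultimately show ?thesis unfolding distrib_left by linarith
  qed
  have old: "(-1) ^ i * (R q + a * \<kappa> * g q) < 0" if "i \<le> n" "z i / spread \<le> norm q" "norm q \<le> z i * spread" for i q
  proof -
    have "(-1) ^ i * R q + a * ((-1) ^ i * (\<kappa> * g q)) < 0" using e(2)[OF a] that by blast
    then show ?thesis by (simp add: algebra_simps)
  qed
  have "annuli (Suc n) (\<lambda>q. R q + a * \<kappa> * g q) b (z(Suc n := z'))"
    unfolding annuli_def
  proof (intro conjI allI impI)
    fix i assume i: "i \<le> Suc n"
    show "0 < (z(Suc n := z')) i" "(z(Suc n := z')) i < b"
      using an i z' unfolding annuli_def by (auto simp: le_Suc_eq)
    fix q :: "real \<times> real" assume "(z(Suc n := z')) i / spread \<le> norm q" "norm q \<le> (z(Suc n := z')) i * spread"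
    then show "(-1) ^ i * (R q + a * \<kappa> * g q) < 0" using i new old by (cases "i = Suc n") simp_all
  next
    fix i assume "i < Suc n"
    then show "(z(Suc n := z')) (Suc i) < (z(Suc n := z')) i"
      using an z' unfolding annuli_def by (auto simp: less_Suc_eq)
  qed
  then show thesis by (rule that)
qed

text \<open>The state of the induction: with each perturbation added the order k drops, and n, the
  number of sign changes, rises by one. The bound b on the radii finally places the cycles in the
  given neighbourhood.\<close>

definition staged :: "real \<Rightarrow> nat \<Rightarrow> nat \<Rightarrow> real \<Rightarrow> bool" where
  "staged d k n b \<longleftrightarrow> (\<exists>\<alpha> \<beta> R z. certificate d \<alpha> \<beta> R \<and> continuous_on UNIV R \<and> order_bound k R \<and> annuli n R b z)"

definition graded :: "real \<Rightarrow> nat \<Rightarrow> bool" where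
  "graded d k \<longleftrightarrow> (\<exists>\<alpha> \<beta> g \<theta>. certificate d \<alpha> \<beta> g \<and> continuous_on UNIV g \<and> order_bound k g \<and> definite k \<theta> g)"

lemma staged_step:
  assumes st: "staged d m n b" and gr: "graded d k" and km: "k < m"
  shows "staged d k (Suc n) b"
proof -
  obtain \<alpha> \<beta> R z where R: "certificate d \<alpha> \<beta> R" "continuous_on UNIV R" "order_bound m R" "annuli n R b z"
    using st unfolding staged_def by blast
  obtain \<alpha>' \<beta>' g \<theta> where g: "certificate d \<alpha>' \<beta>' g" "continuous_on UNIV g" "order_bound k g" "definite k \<theta> g"
    using gr unfolding graded_def by blast
  have "order_bound (Suc k) R" by (rule order_bound_mono[OF R(3)]) (use km in simp)
  from annuli_extend[OF R(2) this R(4) g(2,4)]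
  obtain a z' where an: "annuli (Suc n) (\<lambda>q. R q + a * g q) b (z(Suc n := z'))" .
  have cont: "continuous_on UNIV (\<lambda>q. R q + a * g q)"
    by (intro continuous_on_add continuous_on_mult continuous_on_const R(2) g(2))
  have ob: "order_bound k (\<lambda>q. R q + a * g q)"
  proof -
    have "order_bound k R" by (rule order_bound_mono[OF R(3)]) (use km in simp)
    then obtain C where C: "0 \<le> C" "\<And>q. norm q \<le> 1 \<Longrightarrow> \<bar>R q\<bar> \<le> C * norm q ^ k" unfolding order_bound_def by blast
    obtain C' where C': "0 \<le> C'" "\<And>q. norm q \<le> 1 \<Longrightarrow> \<bar>g q\<bar> \<le> C' * norm q ^ k" using g(3) unfolding order_bound_def by blast
    have "\<bar>R q + a * g q\<bar> \<le> (C + \<bar>a\<bar> * C') * norm q ^ k" if "norm q \<le> 1" for q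
    proof -
      have "\<bar>a * g q\<bar> \<le> \<bar>a\<bar> * (C' * norm q ^ k)" unfolding abs_mult using C'(2)[OF that] by (intro mult_left_mono) simp_all
      then show ?thesis using C(2)[OF that] by (simp add: algebra_simps)
    qed
    then show ?thesis unfolding order_bound_def using C C' by (intro exI[of _ "C + \<bar>a\<bar> * C'"]) simp
  qed
  have "certificate d (\<lambda>i. \<alpha> i + a * \<alpha>' i) (\<lambda>i. \<beta> i + a * \<beta>' i) (\<lambda>q. R q + a * g q)"
    using certificate_linear[OF R(1) g(1), of 1 a] by simp
  then show ?thesis unfolding staged_def using cont ob an by blast
qed

lemma graded_of_check:
  assumes d: "11/10 < d" "d < 6/5" and l: "eval1 d l \<noteq> 0"
    and check: "vanishes3 (2 * k + 1) (add3 (remainder (quad_list c) (quad_list c') G) (scale3 (-1) (mul3 [[l]] (pow3 pQ k))))"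
  shows "graded d (2 * k)"
proof -
  let ?g = "evalp d (remainder (quad_list c) (quad_list c') G)"
  obtain C where C: "0 \<le> C" "\<And>d q. \<lbrakk>\<bar>d\<bar> \<le> 2; norm q \<le> 1\<rbrakk> \<Longrightarrow>
      \<bar>evalp d (remainder (quad_list c) (quad_list c') G) q - evalp d (mul3 [[l]] (pow3 pQ k)) q\<bar> \<le> C * norm q ^ (2 * k + 1)"
    using evalp_difference[OF check] by blast
  have "\<bar>d\<bar> \<le> 2" using d by simp
  from C(2)[OF this] have b: "\<bar>?g q - eval1 d l * qform d q ^ k\<bar> \<le> C * norm q ^ (2 * k + 1)" if "norm q \<le> 1" for q
    using that unfolding evalp_leading .
  note lt = leading_term[OF d l C(1) b]
  show ?thesis unfolding graded_def using certificate_of_list continuous_on_evalp lt by blast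
qed

section \<open>Signs of the leading coefficients\<close>

lemma leads_nonzero:
  assumes "11/10 < d" "d < 6/5"
  shows "eval1 d lead0 \<noteq> 0" "eval1 d lead1 \<noteq> 0" "eval1 d lead2 \<noteq> 0" "eval1 d lead3 \<noteq> 0" "eval1 d lead4 \<noteq> 0"
proof -
  \<comment> \<open>The factorisations show that -1, 0 and 1 are the only real zeros of these
    coefficients.\<close>
  have f: "eval1 d lead0 = - (d - 1)" "eval1 d lead1 = - 3 * (d - 1) * (d + 1)" "eval1 d lead2 = - 15 * (d - 1) * (d + 1)\<^sup>2"
    "eval1 d lead3 = - 3465 * d * (d - 1)\<^sup>2 * (d + 1) ^ 3"
    "eval1 d lead4 = - (d - 1) * (d + 1) ^ 4 * (68040 + 85050 * d\<^sup>2)"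
    unfolding eval1_def lead0_def lead1_def lead2_def lead3_def lead4_def list_eval.simps of_int_minus of_int_numeral of_int_0 of_int_1
    by algebra+
  have "0 < 68040 + 85050 * d\<^sup>2" by (intro add_pos_nonneg) simp_all
  then have nz: "68040 + 85050 * d\<^sup>2 \<noteq> 0" by linarith
  show "eval1 d lead0 \<noteq> 0" "eval1 d lead1 \<noteq> 0" "eval1 d lead2 \<noteq> 0" "eval1 d lead3 \<noteq> 0" "eval1 d lead4 \<noteq> 0"
    unfolding f mult_eq_0_iff de_Morgan_disj using assms nz by auto
qed

lemma lead_factors:
  "eval1 d lead5 = - 3831077250 * (35 * (d\<^sup>2)\<^sup>2 - 67 * d\<^sup>2 + 26) * ((d - 1) * (d + 1) ^ 6)"
  "eval1 d lead6 = d * (d + 1) ^ 5 * (- 264344330250 + 2594095378875 * d\<^sup>2 - 5228143420500 * (d\<^sup>2)\<^sup>2 + 2531703549375 * (d\<^sup>2) ^ 3)"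
  unfolding eval1_def lead5_def lead6_def list_eval.simps of_int_minus of_int_numeral of_int_0 of_int_1
  by algebra+

text \<open>Its square is the larger root of 35 s^2 - 67 s + 26, the factor of \<open>lead5\<close>
  in s = d^2. It is the only zero of \<open>lead5\<close> between 11/10 and 6/5.\<close>

definition \<delta>0 :: real where "\<delta>0 = sqrt ((67 + sqrt 849) / 70)"

lemma \<delta>0: "11/10 < \<delta>0" "\<delta>0 < 6/5" "35 * (\<delta>0\<^sup>2)\<^sup>2 = 67 * \<delta>0\<^sup>2 - 26" "13733/10000 < \<delta>0\<^sup>2" "\<delta>0\<^sup>2 < 13735/10000"
proof -
  have s: "29137/1000 < sqrt 849" by (rule real_less_rsqrt) (simp add: power2_eq_square)
  have s': "sqrt 849 < 29138/1000" by (rule real_less_lsqrt) (simp_all add: power2_eq_square)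
  note s = s s'
  have e: "\<delta>0\<^sup>2 = (67 + sqrt 849) / 70" unfolding \<delta>0_def using s by simp
  have "sqrt 849 * sqrt 849 = 849" by simp
  then show "35 * (\<delta>0\<^sup>2)\<^sup>2 = 67 * \<delta>0\<^sup>2 - 26" unfolding e by (simp add: power2_eq_square field_simps)
  have "13733/10000 < (67 + x) / 70" "(67 + x) / 70 < 13735/10000" if "29137/1000 < x" "x < 29138/1000" for x :: real
    using that by simp_all
  from this[OF s] show "13733/10000 < \<delta>0\<^sup>2" "\<delta>0\<^sup>2 < 13735/10000" unfolding e .
  show "11/10 < \<delta>0" unfolding \<delta>0_def by (rule real_less_rsqrt) (use s in \<open>simp add: power2_eq_square\<close>)
  show "\<delta>0 < 6/5" unfolding \<delta>0_def by (rule real_less_lsqrt) (use s in \<open>simp_all add: power2_eq_square\<close>)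
qed

lemma lead6_neg: "eval1 \<delta>0 lead6 < 0"
proof -
  let ?e = "\<delta>0\<^sup>2"
  \<comment> \<open>The quadratic relation for the square of \<delta>0 reduces its cube, and with it
    the cubic factor of \<open>lead6\<close>, to a linear expression, which rational bounds
    decide.\<close>
  have "1225 * ?e ^ 3 = 3579 * ?e - 1742" using \<delta>0(3) by algebra
  then have "- 264344330250 + 2594095378875 * ?e - 5228143420500 * ?e\<^sup>2 + 2531703549375 * ?e ^ 3 < 0"
    using \<delta>0(3,4) by linarith
  moreover have "0 < \<delta>0 * (\<delta>0 + 1) ^ 5" using \<delta>0(1) by simp
  ultimately show ?thesis unfolding lead_factors by (simp add: mult_pos_neg)
qed

lemma lead5_pos:
  assumes "11/10 < d" "d < \<delta>0"
  shows "0 < eval1 d lead5"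
proof -
  have "(11/10)\<^sup>2 \<le> d\<^sup>2" "d\<^sup>2 < \<delta>0\<^sup>2" using assms by (intro power_mono power_strict_mono; simp)+
  \<comment> \<open>This product is the value of the quadratic factor at d^2, since the factor
    vanishes at the square of \<delta>0. The lower bounds on both squares make the second
    parenthesis positive.\<close>
  then have "(d\<^sup>2 - \<delta>0\<^sup>2) * (35 * (d\<^sup>2 + \<delta>0\<^sup>2) - 67) < 0"
    using \<delta>0(4) by (intro mult_neg_pos) (simp_all add: power2_eq_square)
  moreover have "(d\<^sup>2 - \<delta>0\<^sup>2) * (35 * (d\<^sup>2 + \<delta>0\<^sup>2) - 67)
      = (35 * (d\<^sup>2)\<^sup>2 - 67 * d\<^sup>2 + 26) - (35 * (\<delta>0\<^sup>2)\<^sup>2 - 67 * \<delta>0\<^sup>2 + 26)" by algebra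
  ultimately have "35 * (d\<^sup>2)\<^sup>2 - 67 * d\<^sup>2 + 26 < 0" using \<delta>0(3) by linarith
  moreover have "0 < (d - 1) * (d + 1) ^ 6" using assms by simp
  ultimately show ?thesis unfolding lead_factors by (simp add: mult_less_0_iff zero_less_mult_iff)
qed

lemma lead5_zero: "eval1 \<delta>0 lead5 = 0"
  unfolding lead_factors using \<delta>0(3) by simp

lemma eval1_tendsto: "((\<lambda>d. eval1 d c) \<longlongrightarrow> eval1 a c) (at a within S)"
proof -
  have "continuous_on UNIV (\<lambda>d. eval1 d c)" by (intro continuous_on_eval1 continuous_on_id)
  then have "isCont (\<lambda>d. eval1 d c) a" by (simp add: continuous_on_eq_continuous_at)
  then show ?thesis unfolding isCont_def by (rule tendsto_within_subset) simp
qed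

text \<open>Two annuli come from the competition of the terms of order 12 and 14: the first has a small
  positive coefficient left of \<open>\<delta>0\<close>, the second a negative one.\<close>

lemma eventually_staged:
  assumes b: "0 < b"
  shows "eventually (\<lambda>d. staged d 2 6 b) (at_left \<delta>0)"
proof -
  have s: "0 < spread" "1 \<le> spread" using constants_pos by simp_all
  let ?T = "add3 (mul3 [[lead5]] (pow3 pQ 6)) (mul3 [[lead6]] (pow3 pQ 7))"
  let ?h = "\<lambda>d. evalp d (remainder (quad_list pert_x5) (quad_list pert_y5) cert5)"
  have T: "evalp d ?T q = eval1 d lead5 * qform d q ^ 6 + eval1 d lead6 * qform d q ^ 7" for d q
  proof -
    have "evalp d ?T q = evalp d (mul3 [[lead5]] (pow3 pQ 6)) q + evalp d (mul3 [[lead6]] (pow3 pQ 7)) q"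
      unfolding evalp_def eval3_add ..
    then show ?thesis unfolding evalp_leading .
  qed
  obtain C where C0: "0 \<le> C" and C: "\<And>d q. \<lbrakk>\<bar>d\<bar> \<le> 2; norm q \<le> 1\<rbrakk> \<Longrightarrow> \<bar>?h d q - evalp d ?T q\<bar> \<le> C * norm q ^ 15"
    using evalp_difference[OF certificate5_check] by blast
  define \<nu> where "\<nu> = - eval1 \<delta>0 lead6 / 2"
  have \<nu>: "0 < \<nu>" unfolding \<nu>_def using lead6_neg by simp
  \<comment> \<open>\<nu> bounds -\<open>lead6\<close> from below near \<delta>0, and 40^7 comes
    from the lower bound of the quadratic form, whose seventh power is the term of order 14.\<close>
  define \<kappa> where "\<kappa> = \<nu> / 40 ^ 7"
  have \<kappa>: "0 < \<kappa>" unfolding \<kappa>_def using \<nu> by simp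
  \<comment> \<open>This radius is fixed before d. It keeps the error C |q|^15 below \<kappa> / 2 *
    |q|^14 on its whole annulus; only afterwards is d moved so close to \<delta>0 that the
    coefficient of order 12 is less than \<kappa> / 2 times the square of the inner radius
    w.\<close>
  define z0 where "z0 = min (b / 2) (min 1 (\<kappa> / (2 * (C + 1))) / spread)"
  have z0: "0 < z0" "z0 < b" "z0 * spread \<le> 1" "z0 * spread * (2 * (C + 1)) \<le> \<kappa>"
  proof -
    show "0 < z0" unfolding z0_def using b \<kappa> C0 s by simp
    have "z0 \<le> b / 2" unfolding z0_def by (rule min.cobounded1)
    then show "z0 < b" using b by linarith
    have "z0 \<le> min 1 (\<kappa> / (2 * (C + 1))) / spread" unfolding z0_def by (rule min.cobounded2)
    then have "z0 * spread \<le> min 1 (\<kappa> / (2 * (C + 1)))" using s by (simp add: pos_le_divide_eq)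
    then show "z0 * spread \<le> 1" "z0 * spread * (2 * (C + 1)) \<le> \<kappa>" using C0 by (simp_all add: pos_le_divide_eq)
  qed
  define w where "w = z0 / spread"
  have w: "0 < w" unfolding w_def using z0 s by simp
  have "eventually (\<lambda>d. eval1 d lead6 < - \<nu>) (at_left \<delta>0)"
    by (rule order_tendstoD(2)[OF eval1_tendsto]) (use lead6_neg in \<open>simp add: \<nu>_def\<close>)
  moreover have "eventually (\<lambda>d. eval1 d lead5 < \<kappa> / 2 * w\<^sup>2) (at_left \<delta>0)"
    by (rule order_tendstoD(2)[OF eval1_tendsto]) (use \<kappa> w in \<open>simp add: lead5_zero\<close>)
  moreover have "eventually (\<lambda>d. d \<in> {11/10<..<\<delta>0}) (at_left \<delta>0)"
    by (rule eventually_at_leftI[OF _ \<delta>0(1)]) simp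
  ultimately show ?thesis
  proof eventually_elim
    case (elim d)
    then have d: "11/10 < d" "d < 6/5" "\<bar>d\<bar> \<le> 2" "d < \<delta>0" using \<delta>0(2) by auto
    note qb = qform_power_bounds[OF d(1,2)]
    have l5: "0 < eval1 d lead5" by (rule lead5_pos[OF d(1,4)])
    have err: "\<bar>?h d q - (eval1 d lead5 * qform d q ^ 6 + eval1 d lead6 * qform d q ^ 7)\<bar> \<le> C * norm q ^ 15" if "norm q \<le> 1" for q
      using C[OF d(3) that] unfolding T .
    have neg: "?h d q < 0" if q: "w \<le> norm q" "norm q \<le> z0 * spread" for q
    proof -
      let ?n = "norm q"
      have q1: "0 < ?n" "?n \<le> 1" using q w z0 by linarith+
      have "eval1 d lead5 * qform d q ^ 6 \<le> eval1 d lead5 * ?n ^ 12" using qb(2)[of q 6] l5 by simp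
      also have "\<dots> < (\<kappa> / 2 * w\<^sup>2) * ?n ^ 12" using elim(2) q1 by (intro mult_strict_right_mono) simp_all
      also have "\<dots> \<le> (\<kappa> / 2 * ?n\<^sup>2) * ?n ^ 12" using q w \<kappa> by (intro mult_right_mono mult_left_mono power_mono) simp_all
      also have "\<dots> = \<kappa> / 2 * ?n ^ 14" unfolding mult.assoc power_add[symmetric] by simp
      finally have a: "eval1 d lead5 * qform d q ^ 6 < \<kappa> / 2 * ?n ^ 14" .
      have "\<nu> * (?n ^ 14 / 40 ^ 7) \<le> (- eval1 d lead6) * qform d q ^ 7"
        using qb(1)[of q 7] elim(1) \<nu> by (intro mult_mono) simp_all
      then have b: "eval1 d lead6 * qform d q ^ 7 \<le> - (\<kappa> * ?n ^ 14)" unfolding \<kappa>_def by simp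
      have "?n * (2 * (C + 1)) \<le> z0 * spread * (2 * (C + 1))" using q C0 by (intro mult_right_mono) simp_all
      then have "?n * (2 * (C + 1)) \<le> \<kappa>" using z0(4) by (rule order_trans)
      then have "2 * (C * ?n) + 2 * ?n \<le> \<kappa>" by (simp add: algebra_simps)
      then have "C * ?n \<le> \<kappa> / 2" using q1 by linarith
      then have "(C * ?n) * ?n ^ 14 \<le> \<kappa> / 2 * ?n ^ 14" by (intro mult_right_mono) simp_all
      moreover have "(C * ?n) * ?n ^ 14 = C * ?n ^ 15" by (simp add: numeral_eq_Suc)
      ultimately show ?thesis using a b err[OF q1(2)] unfolding abs_le_iff by linarith
    qed
    define C' where "C' = \<bar>eval1 d lead6\<bar> + C"
    have near: "\<bar>?h d q - eval1 d lead5 * qform d q ^ 6\<bar> \<le> C' * norm q ^ (2 * 6 + 1)" if q: "norm q \<le> 1" for q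
    proof -
      have "\<bar>eval1 d lead6 * qform d q ^ 7\<bar> \<le> \<bar>eval1 d lead6\<bar> * norm q ^ 13"
      proof -
        have "qform d q ^ 7 \<le> norm q ^ 13"
          using order_trans[OF qb(2)[of q 7] power_decreasing[of 13 "2 * 7" "norm q"]] q by simp
        then show ?thesis unfolding abs_mult using qb(3)[of q 7] by (intro mult_left_mono) simp_all
      qed
      moreover have "C * norm q ^ 15 \<le> C * norm q ^ 13" using q C0 by (intro mult_left_mono power_decreasing) simp_all
      ultimately have "\<bar>?h d q - eval1 d lead5 * qform d q ^ 6\<bar> \<le> C' * norm q ^ 13"
        using err[OF q] unfolding C'_def distrib_right by linarith
      then show ?thesis by simp
    qed
    have C'0: "0 \<le> C'" unfolding C'_def using C0 by simp
    have l5': "eval1 d lead5 \<noteq> 0" using l5 by simp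
    note lt = leading_term[OF d(1,2) l5' C'0 near]
    define c0 where "c0 = (\<lambda>_::nat. z0)"
    have an0: "annuli 0 (?h d) b c0" unfolding annuli_def c0_def using z0 neg w_def by auto
    have dir: "definite 12 1 (?h d)" using lt(2) l5 by simp
    have cert: "certificate d (quad_coeff d pert_x5) (quad_coeff d pert_y5) (?h d)" by (rule certificate_of_list)
    have ob: "order_bound 12 (?h d)" using lt(1) by simp
    \<comment> \<open>Now d is fixed and \<open>lead5\<close> is positive, so the term of order 12
      prevails close enough to the origin; this second radius depends on d.\<close>
    obtain z1 where an1: "annuli 1 (?h d) b z1"
    proof -
      obtain c r where c: "0 < c" "0 < r" "\<And>q. norm q \<le> r \<Longrightarrow> c * norm q ^ 12 \<le> 1 * ?h d q"
        using dir unfolding definite_def by blast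
      define z' where "z' = min (z0 / 2) (r / spread)"
      have z': "0 < z'" "z' < z0" "z' * spread \<le> r"
      proof -
        show "0 < z'" "z' < z0" unfolding z'_def using z0 c s by simp_all
        have "z' \<le> r / spread" unfolding z'_def by (rule min.cobounded2)
        then show "z' * spread \<le> r" using s by (simp add: pos_le_divide_eq)
      qed
      have pos: "0 < ?h d q" if "z' / spread \<le> norm q" "norm q \<le> z' * spread" for q
      proof -
        have "0 < z' / spread" using z' s by simp
        then have "0 < c * norm q ^ 12" using that c by (intro mult_pos_pos zero_less_power) linarith+
        moreover have "norm q \<le> r" using that z' by linarith
        ultimately show ?thesis using c(3)[of q] by linarith
      qed
      have "annuli 1 (?h d) b (\<lambda>i. if i = 0 then z0 else z')"
        unfolding annuli_def using z0 z' neg pos w_def by (auto simp: le_Suc_eq)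
      then show thesis by (rule that)
    qed
    have st: "staged d 12 1 b" unfolding staged_def using cert continuous_on_evalp ob an1 by blast
    note nz = leads_nonzero[OF d(1,2)]
    note gr = graded_of_check[OF d(1,2)]
    have "graded d (2 * 1)"
      by (rule gr[OF nz(1), where c = pert_x0 and c' = pert_y0 and G = cert0]) (use certificate0_check in simp)
    moreover have "graded d (2 * 2)"
      by (rule gr[OF nz(2), where c = pert_x1 and c' = pert_y1 and G = cert1]) (use certificate1_check in simp)
    moreover have "graded d (2 * 3)"
      by (rule gr[OF nz(3), where c = pert_x2 and c' = pert_y2 and G = cert2]) (use certificate2_check in simp)
    moreover have "graded d (2 * 4)"
      by (rule gr[OF nz(4), where c = pert_x3 and c' = pert_y3 and G = cert3]) (use certificate3_check in simp)
    moreover have "graded d (2 * 5)"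
      by (rule gr[OF nz(5), where c = pert_x4 and c' = pert_y4 and G = cert4]) (use certificate4_check in simp)
    ultimately have g: "graded d 2" "graded d 4" "graded d 6" "graded d 8" "graded d 10" by simp_all
    \<comment> \<open>The orders 10, 8, 6, 4 and 2 have to be added in descending order: each new
      term must be of lower order than everything present in order to dominate near the
      origin.\<close>
    have "staged d 10 2 b" using staged_step[OF st g(5)] by (simp add: numeral_2_eq_2)
    then have "staged d 8 3 b" using staged_step[OF _ g(4)] by (fastforce simp: numeral_eq_Suc)
    then have "staged d 6 4 b" using staged_step[OF _ g(3)] by (fastforce simp: numeral_eq_Suc)
    then have "staged d 4 5 b" using staged_step[OF _ g(2)] by (fastforce simp: numeral_eq_Suc)
    then show "staged d 2 6 b" using staged_step[OF _ g(1)] by (fastforce simp: numeral_eq_Suc)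
  qed
qed

section \<open>The cubic family\<close>

text \<open>The expansion of the quadratic factor in powers of x and y in place of x - 1 and y - 1;
  closeness of systems is measured on these coefficients.\<close>

definition quad_poly :: "(nat \<Rightarrow> real) \<Rightarrow> real poly poly" where
  "quad_poly \<alpha> = [:[:- \<alpha> 0 - \<alpha> 1 + \<alpha> 2 + \<alpha> 3 + \<alpha> 4, \<alpha> 1 - \<alpha> 3 - 2 * \<alpha> 4, \<alpha> 4:],
      [:\<alpha> 0 - 2 * \<alpha> 2 - \<alpha> 3, \<alpha> 3:], [:\<alpha> 2:]:]"

lemma eval2_quad_poly: "eval2 (quad_poly \<alpha>) x y = quad \<alpha> (x - 1) (y - 1)"
  unfolding eval2_def quad_poly_def quad_def by (simp add: power2_eq_square algebra_simps)

lemma total_degree_quad_poly: "total_degree_less 3 (quad_poly \<alpha>)"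
  unfolding total_degree_less_def quad_poly_def by (auto simp: coeff_pCons split: nat.splits)

text \<open>Each coefficient of the expansion is a combination of the \<alpha> i whose integer
  factors have absolute sum at most 5, hence the margin \<epsilon> / 6.\<close>

lemma quad_poly_close:
  assumes e: "0 < \<epsilon>" and close: "\<And>i. i < 5 \<Longrightarrow> \<bar>\<alpha> i - \<beta> i\<bar> < \<epsilon> / 6"
  shows "coeffs_close \<epsilon> (quad_poly \<alpha>) (quad_poly \<beta>)"
proof -
  have "\<bar>\<alpha> 0 - \<beta> 0\<bar> < \<epsilon> / 6" "\<bar>\<alpha> 1 - \<beta> 1\<bar> < \<epsilon> / 6" "\<bar>\<alpha> 2 - \<beta> 2\<bar> < \<epsilon> / 6"
    "\<bar>\<alpha> 3 - \<beta> 3\<bar> < \<epsilon> / 6" "\<bar>\<alpha> 4 - \<beta> 4\<bar> < \<epsilon> / 6" by (rule close; simp)+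
  note b = this[unfolded abs_less_iff]
  have c: "\<bar>(- \<alpha> 0 - \<alpha> 1 + \<alpha> 2 + \<alpha> 3 + \<alpha> 4) - (- \<beta> 0 - \<beta> 1 + \<beta> 2 + \<beta> 3 + \<beta> 4)\<bar> < \<epsilon>"
    "\<bar>(\<alpha> 1 - \<alpha> 3 - 2 * \<alpha> 4) - (\<beta> 1 - \<beta> 3 - 2 * \<beta> 4)\<bar> < \<epsilon>" "\<bar>\<alpha> 4 - \<beta> 4\<bar> < \<epsilon>"
    "\<bar>(\<alpha> 0 - 2 * \<alpha> 2 - \<alpha> 3) - (\<beta> 0 - 2 * \<beta> 2 - \<beta> 3)\<bar> < \<epsilon>" "\<bar>\<alpha> 3 - \<beta> 3\<bar> < \<epsilon>" "\<bar>\<alpha> 2 - \<beta> 2\<bar> < \<epsilon>"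
    unfolding abs_less_iff using b e by linarith+
  show ?thesis unfolding coeffs_close_def
  proof (intro allI)
    fix i j
    show "\<bar>coeff (coeff (quad_poly \<alpha>) i) j - coeff (coeff (quad_poly \<beta>) i) j\<bar> < \<epsilon>"
      using c e by (simp add: quad_poly_def coeff_pCons split: nat.splits)
  qed
qed

lemma kolmogorov_field_quad_poly:
  "kolmogorov_field (quad_poly (\<lambda>i. c * \<alpha> i), quad_poly (\<lambda>i. c * \<beta> i)) = (\<lambda>q. c *\<^sub>R quad_field \<alpha> \<beta> q)"
proof -
  have "quad (\<lambda>i. c * \<alpha> i) u v = c * quad \<alpha> u v" for \<alpha> u v unfolding quad_def by (simp add: algebra_simps)
  then show ?thesis unfolding kolmogorov_field_def quad_field_def by (simp add: fun_eq_iff eval2_quad_poly)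
qed

text \<open>Here d + 1 and d - 1 are 2 a^2 and 2 b^2 divided by a^2 - b^2, so d retains only the
  ratio of the squares. The speed and the direction of time are absorbed into c.\<close>

lemma cubic_family_quad_poly:
  assumes nz: "a * b \<noteq> 0" and ne: "a\<^sup>2 \<noteq> b\<^sup>2"
  defines "d \<equiv> (a\<^sup>2 + b\<^sup>2) / (a\<^sup>2 - b\<^sup>2)" and "c \<equiv> - (a\<^sup>2 - b\<^sup>2) / (2 * (a * b))"
  shows "cubic_family a b = (quad_poly (\<lambda>i. c * base_x d i), quad_poly (\<lambda>i. c * base_y d i))"
proof -
  define D where "D = a\<^sup>2 - b\<^sup>2"
  have n: "a \<noteq> 0" "b \<noteq> 0" "D \<noteq> 0" using nz ne unfolding D_def by auto
  have D: "(a - b) * (a + b) = D" unfolding D_def by (simp add: power2_eq_square algebra_simps)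
  have dp: "d + 1 = 2 * a\<^sup>2 / D" and dm: "d - 1 = 2 * b\<^sup>2 / D"
    unfolding d_def D_def[symmetric] using n(3) by (simp_all add: field_simps) (simp_all add: D_def)
  have d2: "d\<^sup>2 - 1 = 4 * a\<^sup>2 * b\<^sup>2 / D\<^sup>2"
  proof -
    have "d\<^sup>2 - 1 = (d + 1) * (d - 1)" by (simp add: power2_eq_square algebra_simps)
    then show ?thesis unfolding dp dm by (simp add: power2_eq_square)
  qed
  define k l where "k = a / (D * b)" and "l = b / (D * a)"
  have x: "c * - (d + 1) = k * D" "c * (- (d\<^sup>2 - 1) / 2) = k * b\<^sup>2" "c * (- (d + 1)\<^sup>2 / 2) = k * a\<^sup>2"
    and y: "c * (d - 1) = - l * D" "c * (- (d - 1)\<^sup>2 / 2) = l * b\<^sup>2" "c * (- (d\<^sup>2 - 1) / 2) = l * a\<^sup>2"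
    unfolding c_def d2 dp dm D_def[symmetric] k_def l_def using n by (simp_all add: power2_eq_square power3_eq_cube field_simps)
  have bx: "c * base_x d 0 = 0" "c * base_x d 1 = k * D" "c * base_x d 2 = 0" "c * base_x d 3 = k * b\<^sup>2" "c * base_x d 4 = k * a\<^sup>2"
    unfolding x[symmetric] by (simp_all add: base_x_def)
  have by': "c * base_y d 0 = - l * D" "c * base_y d 1 = 0" "c * base_y d 2 = l * b\<^sup>2" "c * base_y d 3 = l * a\<^sup>2" "c * base_y d 4 = 0"
    unfolding y[symmetric] by (simp_all add: base_y_def)
  have px: "const2 k * (vary - 1) * (const2 (b\<^sup>2) * varx + const2 (a\<^sup>2) * vary - const2 (2 * b\<^sup>2)) = quad_poly (\<lambda>i. c * base_x d i)"
    unfolding quad_poly_def bx const2_def varx_def vary_def D_def by (simp add: one_pCons algebra_simps)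
  have py: "const2 l * (varx - 1) * (const2 (b\<^sup>2) * varx + const2 (a\<^sup>2) * vary - const2 (2 * a\<^sup>2)) = quad_poly (\<lambda>i. c * base_y d i)"
    unfolding quad_poly_def by' const2_def varx_def vary_def D_def by (simp add: one_pCons algebra_simps)
  show ?thesis unfolding cubic_family_def D k_def[symmetric] l_def[symmetric] px py ..
qed

lemma limit_cycle_scaleR_iff:
  "c \<noteq> 0 \<Longrightarrow> limit_cycle (\<lambda>q. c *\<^sub>R F q) \<gamma> \<longleftrightarrow> limit_cycle F \<gamma>"
  unfolding limit_cycle_def periodic_orbit_scaleR_iff ..

lemma center_scaleR_iff:
  "c \<noteq> 0 \<Longrightarrow> center (\<lambda>q. c *\<^sub>R F q) p \<longleftrightarrow> center F p"
  unfolding center_def equilibrium_def periodic_orbit_scaleR_iff by simp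

lemma quad_field_scale: "quad_field (\<lambda>i. c * \<alpha> i) (\<lambda>i. c * \<beta> i) = (\<lambda>q. c *\<^sub>R quad_field \<alpha> \<beta> q)"
proof -
  have "quad (\<lambda>i. c * \<alpha> i) u v = c * quad \<alpha> u v" for \<alpha> u v unfolding quad_def by (simp add: algebra_simps)
  then show ?thesis unfolding quad_field_def by (simp add: fun_eq_iff)
qed

text \<open>For d < -1 the base field rotates in the opposite direction and is multiplied by the
  sign s of d, which does not affect centers. In both cases \<open>integral_fun\<close> is constant
  along orbits and strictly decreasing on the positive ray near (1, 1), so every turn
  closes.\<close>

lemma center_base:
  assumes d: "1 < \<bar>d\<bar>"
  shows "center (quad_field (base_x d) (base_y d)) (1, 1)"
proof -
  define s where "s = sgn d"
  have s: "s * d = \<bar>d\<bar>" "\<bar>s\<bar> = 1" "s \<noteq> 0" unfolding s_def using d by (auto simp: sgn_if)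
  let ?\<alpha> = "\<lambda>i. s * base_x d i" and ?\<beta> = "\<lambda>i. s * base_y d i"
  \<comment> \<open>Up to sign and a factor 1/2, each coefficient is zero or a product of at most
    two factors d + 1 or d - 1, so M bounds them all. The angular speed at radius 0 is at least |d|
    - 1, which is 2 m.\<close>
  define M where "M = (\<bar>d\<bar> + 1)\<^sup>2"
  define m where "m = (\<bar>d\<bar> - 1) / 2"
  have M: "M = d\<^sup>2 + 2 * \<bar>d\<bar> + 1" unfolding M_def by (simp add: power2_eq_square algebra_simps)
  have "\<bar>base_x d i\<bar> \<le> M \<and> \<bar>base_y d i\<bar> \<le> M" if "i < 5" for i
  proof -
    have "\<bar>d + 1\<bar> \<le> x + 2 * \<bar>d\<bar> + 1 \<and> \<bar>d - 1\<bar> \<le> x + 2 * \<bar>d\<bar> + 1 \<and> \<bar>(x - 1) / 2\<bar> \<le> x + 2 * \<bar>d\<bar> + 1 \<and> 0 \<le> x + 2 * \<bar>d\<bar> + 1"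
      if "0 \<le> x" for x :: real using that by (auto simp: abs_if field_simps)
    from this[OF zero_le_power2[of d]] have b: "\<bar>d + 1\<bar> \<le> M" "\<bar>d - 1\<bar> \<le> M" "\<bar>(d\<^sup>2 - 1) / 2\<bar> \<le> M" "0 \<le> M"
      unfolding M by blast+
    have "(d + 1)\<^sup>2 \<le> M" "(d - 1)\<^sup>2 \<le> M" unfolding M_def by (intro power2_le_iff_abs_le[THEN iffD2]; linarith)+
    then have b2: "\<bar>(d + 1)\<^sup>2 / 2\<bar> \<le> M" "\<bar>(d - 1)\<^sup>2 / 2\<bar> \<le> M" using b(4) by simp_all
    have "i = 0 \<or> i = 1 \<or> i = 2 \<or> i = 3 \<or> i = 4" using that by linarith
    then show ?thesis unfolding base_x_def base_y_def minus_divide_left[symmetric]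
      by (elim disjE) (use b b2 in simp_all)
  qed
  then have cb: "coeff_bound M ?\<alpha>" "coeff_bound M ?\<beta>" unfolding coeff_bound_def using s(2) by (simp_all add: abs_mult)
  have ang: "2 * m \<le> cos t * ang1 ?\<beta> t - sin t * ang1 ?\<alpha> t" for t
  proof -
    have "cos t * ang1 ?\<beta> t - sin t * ang1 ?\<alpha> t = s * (cos t * ang1 (base_y d) t - sin t * ang1 (base_x d) t)"
      unfolding ang1_def by (simp add: algebra_simps)
    also have "\<dots> = (s * d - s) * (cos t)\<^sup>2 + (s * d + s) * (sin t)\<^sup>2"
      unfolding base_angular_speed by (simp add: algebra_simps)
    finally have e: "cos t * ang1 ?\<beta> t - sin t * ang1 ?\<alpha> t = (\<bar>d\<bar> - s) * (cos t)\<^sup>2 + (\<bar>d\<bar> + s) * (sin t)\<^sup>2" unfolding s .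
    have "2 * m = (\<bar>d\<bar> - 1) * (cos t)\<^sup>2 + (\<bar>d\<bar> - 1) * (sin t)\<^sup>2"
      unfolding m_def distrib_left[symmetric] by simp
    also have "\<dots> \<le> (\<bar>d\<bar> - s) * (cos t)\<^sup>2 + (\<bar>d\<bar> + s) * (sin t)\<^sup>2"
      using s(2) by (intro add_mono mult_right_mono) (simp_all add: abs_if split: if_splits)
    finally show ?thesis unfolding e .
  qed
  have "0 < (a - 1) / 2 \<and> (a - 1) / 2 \<le> x + 2 * a + 1" if "1 < a" "0 \<le> x" for a x :: real
    using that by simp
  from this[OF d zero_le_power2[of d]] have m: "0 < m" "m \<le> M" unfolding m_def M by blast+
  interpret pf: polar_field "\<lambda>t z. z * radial_part ?\<alpha> ?\<beta> t z / angular_part ?\<alpha> ?\<beta> t z"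
      "m / (22 * M)" "3 * (26 * M)\<^sup>2 / m\<^sup>2" "quad_field ?\<alpha> ?\<beta>" "(1, 1)" "radial_part ?\<alpha> ?\<beta>" "angular_part ?\<alpha> ?\<beta>" m "26 * M"
    by (rule quad_field_polar_field[OF cb m ang])
  let ?L = "3 * (26 * M)\<^sup>2 / m\<^sup>2"
  \<comment> \<open>Within this radius |X| and |Y| are at most 1/2, so that |X^2 - Y^2| \<le> 1/4 <
    |d| and the hyperbola is not reached.\<close>
  have rsmall: "m / (22 * M) \<le> 1 / (\<bar>d\<bar> + 1)"
  proof -
    have "m * (\<bar>d\<bar> + 1) \<le> (22 * (\<bar>d\<bar> + 1)) * (\<bar>d\<bar> + 1)" unfolding m_def using d by (intro mult_right_mono) simp_all
    also have "\<dots> = 22 * M" unfolding M_def by (simp add: power2_eq_square)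
    finally show ?thesis using m d by (simp add: field_simps)
  qed
  have region: "0 < 1 + fst w \<and> 0 < 1 + snd w \<and> \<bar>hX d (fst w)\<bar> \<le> 1/2 \<and> 0 < s * hyperbola d w"
    if w: "norm w \<le> m / (22 * M)" for w
  proof -
    have "norm w \<le> 1 / (\<bar>d\<bar> + 1)" using w rsmall by (rule order_trans)
    then have w': "(\<bar>d\<bar> + 1) * norm w \<le> 1" using d by (simp add: field_simps)
    have a: "\<bar>fst w\<bar> \<le> norm w" "\<bar>snd w\<bar> \<le> norm w"
      using norm_fst_le[of "fst w" "snd w"] norm_snd_le[of "snd w" "fst w"] by simp_all
    have "2 * norm w \<le> (\<bar>d\<bar> + 1) * norm w" using d by (intro mult_right_mono) simp_all
    then have "norm w \<le> 1/2" using w' by linarith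
    then have p: "0 < 1 + fst w" "0 < 1 + snd w" using a unfolding abs_le_iff by linarith+
    have "\<bar>(d - 1) * fst w\<bar> \<le> (\<bar>d\<bar> + 1) * norm w" "\<bar>(d + 1) * snd w\<bar> \<le> (\<bar>d\<bar> + 1) * norm w"
      unfolding abs_mult using a by (intro mult_mono; linarith)+
    then have h: "\<bar>hX d (fst w)\<bar> \<le> 1/2" "\<bar>hY d (snd w)\<bar> \<le> 1/2" unfolding hX_def hY_def using w' by simp_all
    have "(hX d (fst w))\<^sup>2 \<le> (1/2)\<^sup>2" "(hY d (snd w))\<^sup>2 \<le> (1/2)\<^sup>2"
      unfolding power2_le_iff_abs_le[of "1/2 :: real", simplified] using h by (simp_all add: abs_le_square_iff[symmetric])
    moreover have "\<bar>A - B\<bar> \<le> 1/4" if "A \<le> (1/2)\<^sup>2" "B \<le> (1/2)\<^sup>2" "0 \<le> A" "0 \<le> B" for A B :: real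
      using that by (auto simp: abs_if power2_eq_square)
    ultimately have q: "\<bar>(hX d (fst w))\<^sup>2 - (hY d (snd w))\<^sup>2\<bar> \<le> 1/4" using zero_le_power2 by blast
    have "\<bar>s * ((hX d (fst w))\<^sup>2 - (hY d (snd w))\<^sup>2)\<bar> \<le> 1/4" unfolding abs_mult using q s(2) by simp
    then have "0 < s * ((hX d (fst w))\<^sup>2 - (hY d (snd w))\<^sup>2) + s * d" unfolding s(1) using d unfolding abs_le_iff by linarith
    then have "0 < s * hyperbola d w" unfolding hyperbola_def by (simp add: algebra_simps)
    with p h show ?thesis by blast
  qed
  define W1 where "W1 w = 2 * weight1 d w / ((1 + fst w) * hyperbola d w)" for w
  define W2 where "W2 w = 2 * weight2 d w / ((1 + snd w) * hyperbola d w)" for w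
  let ?V = "\<lambda>q. integral_fun d (q - (1, 1))"
  let ?V' = "\<lambda>q h. W1 (q - (1, 1)) * fst h + W2 (q - (1, 1)) * snd h"
  have V': "(?V has_derivative ?V' q) (at q)" if q: "norm (q - (1, 1)) \<le> m / (22 * M)" for q
  proof -
    have nz: "hyperbola d (q - (1, 1)) \<noteq> 0" using region[OF q] by auto
    have sh: "((\<lambda>q. q - (1, 1)) has_derivative (\<lambda>h. h)) (at q)"
      using has_derivative_diff[OF has_derivative_ident has_derivative_const] by fastforce
    have "(integral_fun d has_derivative (\<lambda>h. W1 (q - (1, 1)) * fst h + W2 (q - (1, 1)) * snd h)) (at (q - (1, 1)))"
      unfolding W1_def W2_def by (rule integral_fun_has_derivative[OF _ _ nz]) (use region[OF q] in blast)+
    from has_derivative_compose[OF sh this] show ?thesis .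
  qed
  have "pf.v x (2 * pi) = x" if x: "0 < x" "x < pf.r1" for x
  proof -
    have up: "x * exp (?L * (2 * pi)) \<le> m / (22 * M)"
    proof -
      have "x * exp (?L * (2 * pi)) \<le> m / (22 * M) * exp (- (?L * (2 * pi))) * exp (?L * (2 * pi))"
        using x(2) unfolding pf.r1_def by (intro mult_right_mono) simp_all
      also have "\<dots> = m / (22 * M)" unfolding mult.assoc exp_add[symmetric] by simp
      finally show ?thesis .
    qed
    show ?thesis
    proof (rule pf.return_sign(2)[OF x, where V = ?V and V' = ?V'])
      fix q :: "real \<times> real" assume q: "x * exp (- (?L * (2 * pi))) \<le> dist q (1, 1)" "dist q (1, 1) \<le> x * exp (?L * (2 * pi))"
      have w: "norm (q - (1, 1)) \<le> m / (22 * M)" using order_trans[OF q(2) up] unfolding dist_norm .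
      show "(?V has_derivative ?V' q) (at q)" by (rule V'[OF w])
      let ?w = "q - (1, 1)"
      have nz: "hyperbola d ?w \<noteq> 0" "1 + fst ?w \<noteq> 0" "1 + snd ?w \<noteq> 0" using region[OF w] by auto
      have F: "quad_field ?\<alpha> ?\<beta> q = ((1 + fst ?w) * (s * quadp (base_x d) ?w), (1 + snd ?w) * (s * quadp (base_y d) ?w))"
        unfolding quad_field_scale quad_field_def by (simp add: case_prod_unfold)
      have e: "2 * W / (X * H) * (X * (s * A)) = 2 * s / H * (W * A)" if "X \<noteq> 0" for W X H A :: real
        using that by (simp add: field_simps)
      have "?V' q (quad_field ?\<alpha> ?\<beta> q) = 2 * s / hyperbola d ?w * (weight1 d ?w * quadp (base_x d) ?w + weight2 d ?w * quadp (base_y d) ?w)"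
        unfolding F fst_conv snd_conv W1_def W2_def e[OF nz(2)] e[OF nz(3)] distrib_left ..
      then show "?V' q (quad_field ?\<alpha> ?\<beta> q) = 0" unfolding weights_orthogonal by simp
    next
      fix \<rho> assume \<rho>: "x * exp (- (?L * (2 * pi))) \<le> \<rho>" "\<rho> \<le> x * exp (?L * (2 * pi))"
      have "0 < x * exp (- (?L * (2 * pi)))" using x by simp
      then have pos: "0 < \<rho>" using \<rho>(1) by linarith
      have "norm (\<rho>, 0::real) \<le> m / (22 * M)" using order_trans[OF \<rho>(2) up] pos by (simp add: norm_Pair)
      note rg = region[OF this]
      have w: "polar (1, 1) \<rho> 0 - (1, 1) = (\<rho>, 0)" by (simp add: polar_def)
      have "0 < s * (d - 1)" using d s by (simp add: s_def sgn_if split: if_splits)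
      then have sx: "0 < s * hX d \<rho>" unfolding hX_def using pos by (simp add: mult.assoc[symmetric])
      have "hX d \<rho> \<noteq> 1" using rg by (auto simp: abs_le_iff)
      then have "0 < (hX d \<rho> - 1)\<^sup>2" by simp
      with sx have "0 < s * hX d \<rho> * (hX d \<rho> - 1)\<^sup>2" by (rule mult_pos_pos)
      moreover have w1: "weight1 d (\<rho>, 0) = - (hX d \<rho> * (hX d \<rho> - 1)\<^sup>2)" unfolding weight1_def hY_def by simp
      ultimately have sw: "s * weight1 d (\<rho>, 0) < 0" by simp
      have "W1 (\<rho>, 0) = (2 * (s * weight1 d (\<rho>, 0))) / ((1 + \<rho>) * (s * hyperbola d (\<rho>, 0)))"
        unfolding W1_def using s(3) by simp
      also have "\<dots> < 0" by (rule divide_neg_pos[OF _ mult_pos_pos]) (use sw rg in simp_all)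
      finally show "?V' (polar (1, 1) \<rho> 0) (1, 0) < 0" unfolding w by simp
    qed
  qed
  then have "center (quad_field ?\<alpha> ?\<beta>) (1, 1)" by (rule pf.center_from_return_identity)
  then show ?thesis unfolding quad_field_scale center_scaleR_iff[OF s(3)] .
qed

lemma center_cubic_family:
  assumes nz: "a * b \<noteq> 0" and ne: "a\<^sup>2 \<noteq> b\<^sup>2"
  shows "center (kolmogorov_field (cubic_family a b)) (1, 1)"
proof -
  let ?d = "(a\<^sup>2 + b\<^sup>2) / (a\<^sup>2 - b\<^sup>2)" and ?c = "- (a\<^sup>2 - b\<^sup>2) / (2 * (a * b))"
  have c: "?c \<noteq> 0" using nz ne by simp
  have "0 < a\<^sup>2" "0 < b\<^sup>2" using nz by simp_all
  then have "\<bar>a\<^sup>2 - b\<^sup>2\<bar> < \<bar>a\<^sup>2 + b\<^sup>2\<bar>" by linarith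
  then have d: "1 < \<bar>?d\<bar>" using ne by (simp add: abs_divide less_divide_eq)
  show ?thesis
    unfolding cubic_family_quad_poly[OF nz ne] kolmogorov_field_quad_poly center_scaleR_iff[OF c]
    by (rule center_base[OF d])
qed

lemma base_tendsto:
  assumes "i < 5"
  shows "((\<lambda>d. base_x d i) \<longlongrightarrow> base_x a i) (at a within S)" "((\<lambda>d. base_y d i) \<longlongrightarrow> base_y a i) (at a within S)"
proof -
  have i: "i = 0 \<or> i = 1 \<or> i = 2 \<or> i = 3 \<or> i = 4" using assms by linarith
  show "((\<lambda>d. base_x d i) \<longlongrightarrow> base_x a i) (at a within S)" "((\<lambda>d. base_y d i) \<longlongrightarrow> base_y a i) (at a within S)"
    using i unfolding base_x_def base_y_def
    by (elim disjE; simp; intro tendsto_intros)+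
qed

text \<open>The perturbation has two parts: d is moved below \<delta>0 while the scale c of the
  original system is kept, and e times the perturbation found for this d is added. Each part changes
  the coefficients at (1, 1) by less than \<epsilon> / 12, and expansion at the origin accounts for
  the remaining factor 6.\<close>

lemma six_limit_cycles_bifurcate:
  "small_limit_cycles_bifurcate 3 6 (cubic_family (sqrt (\<delta>0 + 1)) (sqrt (\<delta>0 - 1))) (1, 1)"
proof -
  let ?a = "sqrt (\<delta>0 + 1)" and ?b = "sqrt (\<delta>0 - 1)"
  have ab: "?a\<^sup>2 = \<delta>0 + 1" "?b\<^sup>2 = \<delta>0 - 1" using \<delta>0(1) by simp_all
  have nz: "?a * ?b \<noteq> 0" and ne: "?a\<^sup>2 \<noteq> ?b\<^sup>2" using \<delta>0(1) unfolding ab by simp_all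
  define c where "c = - (?a\<^sup>2 - ?b\<^sup>2) / (2 * (?a * ?b))"
  have c: "c \<noteq> 0" unfolding c_def using nz ne by simp
  have "(?a\<^sup>2 + ?b\<^sup>2) / (?a\<^sup>2 - ?b\<^sup>2) = \<delta>0" unfolding ab by simp
  then have fam: "cubic_family ?a ?b = (quad_poly (\<lambda>i. c * base_x \<delta>0 i), quad_poly (\<lambda>i. c * base_y \<delta>0 i))"
    using cubic_family_quad_poly[OF nz ne] unfolding c_def by simp
  have eq: "equilibrium (kolmogorov_field (quad_poly (\<lambda>i. c * \<alpha> i), quad_poly (\<lambda>i. c * \<beta> i))) (1, 1)" for \<alpha> \<beta>
    unfolding equilibrium_def kolmogorov_field_quad_poly quad_field_def quad_def by (simp add: zero_prod_def)
  show ?thesis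
    unfolding small_limit_cycles_bifurcate_def
  proof (intro conjI allI impI)
    show "kolmogorov_degree_le 3 (cubic_family ?a ?b)" by (rule kolmogorov_degree_le_cubic_family)
    show "equilibrium (kolmogorov_field (cubic_family ?a ?b)) (1, 1)" unfolding fam by (rule eq)
    fix U :: "(real \<times> real) set" and \<epsilon> :: real
    assume U: "open U \<and> (1, 1) \<in> U \<and> 0 < \<epsilon>"
    then obtain r where r: "0 < r" "cball (1, 1) r \<subseteq> U" by (meson open_contains_cball)
    have \<epsilon>: "0 < \<epsilon> / 12" using U by simp
    \<comment> \<open>Radii below b have a defined return map, their annuli stay in the region of
      radius 1/4 where the estimates hold, and the cycles stay in the ball of radius r inside
      U.\<close>
    define b where "b = min ret_radius (min (1/4) r / spread)"
    have s: "0 < spread" using constants_pos by simp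
    have b: "0 < b" unfolding b_def using constants_pos r by simp
    have zb: "z < ret_radius \<and> z * spread < 1/4 \<and> z * spread < r" if "z < b" for z
    proof -
      have "z < ret_radius" "z < min (1/4) r / spread" using that unfolding b_def min_less_iff_conj by blast+
      then show ?thesis using s by (simp add: pos_less_divide_eq)
    qed
    have cl: "eventually (\<lambda>d. \<forall>i\<in>{..<5}. \<bar>c * base_x d i - c * base_x \<delta>0 i\<bar> < \<epsilon> / 12 \<and> \<bar>c * base_y d i - c * base_y \<delta>0 i\<bar> < \<epsilon> / 12) (at_left \<delta>0)"
    proof (rule eventually_ball_finite, simp, intro ballI)
      fix i :: nat assume "i \<in> {..<5}"
      then have i: "i < 5" by simp
      show "eventually (\<lambda>d. \<bar>c * base_x d i - c * base_x \<delta>0 i\<bar> < \<epsilon> / 12 \<and> \<bar>c * base_y d i - c * base_y \<delta>0 i\<bar> < \<epsilon> / 12) (at_left \<delta>0)"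
        using tendstoD[OF tendsto_mult_left[OF base_tendsto(1)[OF i]] \<epsilon>] tendstoD[OF tendsto_mult_left[OF base_tendsto(2)[OF i]] \<epsilon>]
        unfolding dist_real_def by (rule eventually_conj)
    qed
    have rng: "eventually (\<lambda>d. d \<in> {11/10<..<\<delta>0}) (at_left \<delta>0)" by (rule eventually_at_leftI[OF _ \<delta>0(1)]) simp
    obtain d where st: "staged d 2 6 b"
      and dcl: "\<forall>i\<in>{..<5}. \<bar>c * base_x d i - c * base_x \<delta>0 i\<bar> < \<epsilon> / 12 \<and> \<bar>c * base_y d i - c * base_y \<delta>0 i\<bar> < \<epsilon> / 12"
      and dr: "d \<in> {11/10<..<\<delta>0}"
      using eventually_happens'[OF _ eventually_conj[OF eventually_staged[OF b] eventually_conj[OF cl rng]]] by auto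
    have d: "11/10 < d" "d < 6/5" using dr \<delta>0(2) by auto
    obtain \<alpha> \<beta> R z where cert: "certificate d \<alpha> \<beta> R" and cR: "continuous_on UNIV R" and an: "annuli 6 R b z"
      using st unfolding staged_def by blast
    have z: "0 < z i" "z i < b" if "i \<le> 6" for i using an that unfolding annuli_def by blast+
    obtain e0 where e0: "0 < e0" "\<And>e. \<lbrakk>0 < e; e < e0\<rbrakk> \<Longrightarrow> \<exists>C. finite C \<and> card C = 6 \<and>
      (\<forall>\<gamma>\<in>C. limit_cycle (quad_field (\<lambda>i. base_x d i + e * \<alpha> i) (\<lambda>i. base_y d i + e * \<beta> i)) \<gamma>
         \<and> \<gamma> \<subseteq> cball (1, 1) (z 0 * spread) \<and> (1, 1) \<in> inside \<gamma>)"
    proof (rule perturbed_cycles[OF d cert cR, of 6 z])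
      show "z (Suc i) < z i" if "i < 6" for i using an that unfolding annuli_def by blast
      show "(-1) ^ i * R q < 0" if "i \<le> 6" "z i / spread \<le> norm q" "norm q \<le> z i * spread" for i q
        using an that unfolding annuli_def by blast
    qed (use z zb in blast)+
    \<comment> \<open>The summands with factor 0 are the values of the limits at e = 0, left
      unsimplified to match the form of the convergence statement.\<close>
    have ev: "eventually (\<lambda>e. \<forall>i\<in>{..<5}. \<bar>c * (base_x d i + e * \<alpha> i) - c * (base_x d i + 0 * \<alpha> i)\<bar> < \<epsilon> / 12
        \<and> \<bar>c * (base_y d i + e * \<beta> i) - c * (base_y d i + 0 * \<beta> i)\<bar> < \<epsilon> / 12) (at_right 0)"
    proof (rule eventually_ball_finite, simp, intro ballI)
      fix i :: nat
      have t: "((\<lambda>e. c * (k + e * w)) \<longlongrightarrow> c * (k + 0 * w)) (at_right 0)" for k w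
        by (intro tendsto_mult_left tendsto_add tendsto_const tendsto_mult_right tendsto_ident_at)
      show "eventually (\<lambda>e. \<bar>c * (base_x d i + e * \<alpha> i) - c * (base_x d i + 0 * \<alpha> i)\<bar> < \<epsilon> / 12
        \<and> \<bar>c * (base_y d i + e * \<beta> i) - c * (base_y d i + 0 * \<beta> i)\<bar> < \<epsilon> / 12) (at_right 0)"
        using tendstoD[OF t \<epsilon>] tendstoD[OF t \<epsilon>] unfolding dist_real_def by (rule eventually_conj)
    qed
    have ev0: "eventually (\<lambda>e. e \<in> {0<..<e0}) (at_right 0)" by (rule eventually_at_rightI[OF _ e0(1)]) simp
    obtain e where ee: "(\<forall>i\<in>{..<5}. \<bar>c * (base_x d i + e * \<alpha> i) - c * (base_x d i + 0 * \<alpha> i)\<bar> < \<epsilon> / 12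
        \<and> \<bar>c * (base_y d i + e * \<beta> i) - c * (base_y d i + 0 * \<beta> i)\<bar> < \<epsilon> / 12) \<and> e \<in> {0<..<e0}"
      using eventually_happens'[OF trivial_limit_at_right_real eventually_conj[OF ev ev0]] by (rule exE)
    note ecl = conjunct1[OF ee]
    have e: "0 < e" "e < e0" using conjunct2[OF ee] by simp_all
    let ?\<alpha> = "\<lambda>i. base_x d i + e * \<alpha> i" and ?\<beta> = "\<lambda>i. base_y d i + e * \<beta> i"
    let ?S = "(quad_poly (\<lambda>i. c * ?\<alpha> i), quad_poly (\<lambda>i. c * ?\<beta> i))"
    obtain C where C: "finite C" "card C = 6"
      "\<And>\<gamma>. \<gamma> \<in> C \<Longrightarrow> limit_cycle (quad_field ?\<alpha> ?\<beta>) \<gamma> \<and> \<gamma> \<subseteq> cball (1, 1) (z 0 * spread) \<and> (1, 1) \<in> inside \<gamma>"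
      using e0(2)[OF e] by blast
    have sub: "cball (1, 1) (z 0 * spread) \<subseteq> U"
      using zb[OF z(2)[of 0]] subset_cball[of "z 0 * spread" r "(1, 1)"] r(2) by fastforce
    have close: "\<bar>c * ?\<alpha> i - c * base_x \<delta>0 i\<bar> < \<epsilon> / 6" "\<bar>c * ?\<beta> i - c * base_y \<delta>0 i\<bar> < \<epsilon> / 6" if "i < 5" for i
    proof -
      have "i \<in> {..<5}" using that by simp
      note h = bspec[OF dcl this] bspec[OF ecl this]
      show "\<bar>c * ?\<alpha> i - c * base_x \<delta>0 i\<bar> < \<epsilon> / 6"
        using abs_triangle_ineq[of "c * ?\<alpha> i - c * base_x d i" "c * base_x d i - c * base_x \<delta>0 i"] h by simp
      show "\<bar>c * ?\<beta> i - c * base_y \<delta>0 i\<bar> < \<epsilon> / 6"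
        using abs_triangle_ineq[of "c * ?\<beta> i - c * base_y d i" "c * base_y d i - c * base_y \<delta>0 i"] h by simp
    qed
    show "\<exists>S'. kolmogorov_degree_le 3 S' \<and> kolmogorov_close \<epsilon> S' (cubic_family ?a ?b) \<and>
       (\<exists>q C. equilibrium (kolmogorov_field S') q \<and> finite C \<and> card C = 6 \<and>
          (\<forall>\<gamma>\<in>C. limit_cycle (kolmogorov_field S') \<gamma> \<and> \<gamma> \<subseteq> U \<and> q \<in> inside \<gamma>))"
    proof (intro exI[of _ ?S] conjI exI[of _ "(1, 1)"] exI[of _ C] ballI)
      show "kolmogorov_degree_le 3 ?S" unfolding kolmogorov_degree_le_def by (simp add: total_degree_quad_poly)
      show "kolmogorov_close \<epsilon> ?S (cubic_family ?a ?b)"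
        unfolding kolmogorov_close_def fam fst_conv snd_conv using close U by (intro conjI quad_poly_close) simp_all
      show "equilibrium (kolmogorov_field ?S) (1, 1)" by (rule eq)
      fix \<gamma> assume \<gamma>: "\<gamma> \<in> C"
      show "limit_cycle (kolmogorov_field ?S) \<gamma>"
        unfolding kolmogorov_field_quad_poly limit_cycle_scaleR_iff[OF c] using C(3)[OF \<gamma>] by blast
      show "\<gamma> \<subseteq> U" "(1, 1) \<in> inside \<gamma>" using C(3)[OF \<gamma>] sub by blast+
    qed (rule C)+
  qed
qed

theorem proposition4p1:
  shows "(\<forall>a3 b2 :: real. a3 * b2 \<noteq> 0 \<and> a3\<^sup>2 \<noteq> b2\<^sup>2 \<longrightarrow>
            center (kolmogorov_field (cubic_family a3 b2)) (1, 1)) \<and>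
         (\<exists>a3 b2 :: real. a3 * b2 \<noteq> 0 \<and> a3\<^sup>2 \<noteq> b2\<^sup>2 \<and>
            small_limit_cycles_bifurcate 3 6 (cubic_family a3 b2) (1, 1))"
proof (rule conjI)
  show "\<forall>a3 b2 :: real. a3 * b2 \<noteq> 0 \<and> a3\<^sup>2 \<noteq> b2\<^sup>2 \<longrightarrow> center (kolmogorov_field (cubic_family a3 b2)) (1, 1)"
    using center_cubic_family by blast
  let ?a = "sqrt (\<delta>0 + 1)" and ?b = "sqrt (\<delta>0 - 1)"
  have "?a * ?b \<noteq> 0" "?a\<^sup>2 \<noteq> ?b\<^sup>2" using \<delta>0(1) by simp_all
  then show "\<exists>a3 b2 :: real. a3 * b2 \<noteq> 0 \<and> a3\<^sup>2 \<noteq> b2\<^sup>2 \<and> small_limit_cycles_bifurcate 3 6 (cubic_family a3 b2) (1, 1)"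
    using six_limit_cycles_bifurcate by blast
qed

end
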